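(* Let $H$ be $d^4/dx^4$ in $L_2(\mathbb{R}_+)$ with boundary conditions $u''(0)=\alpha u(0)+\alpha_1u'(0)$, $u'''(0)=-\alpha_2u(0)-\bar\alpha u'(0)$ ($\alpha\in\mathbb{C}$, $\alpha_1,\alpha_2\in\mathbb{R}$). Let $\psi_-(x,\lambda)=\psi(x,\lambda)$ and $\psi_+(x,\lambda)=\overline{s(\lambda)}\psi_-(x,\lambda)$, and define on $L_1(\mathbb{R}_+)\cap L_2(\mathbb{R}_+)$ $$(\mathcal{F}_\pm f)(\lambda)=(2\pi)^{-1/2}\lambda^{-3/8}\int_0^\infty\overline{\psi_\pm(x,\lambda)}f(x)\,dx.$$ These mappings extend to bounded operators $\mathcal{F}_\pm:L_2(\mathbb{R}_+)\to L_2(\mathbb{R}_+)$ satisfying $\mathcal{F}_\pm\mathcal{F}_\pm^*=I$, $\mathcal{F}_\pm^*\mathcal{F}_\pm=P^{(c)}$ and $\mathcal{F}_\pm H=A\mathcal{F}_\pm$.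
   Context: $\alpha_0=\alpha_1\alpha_2-|\alpha|^2$, $\Omega(\zeta)=\alpha_0+(1-i)\alpha_2\zeta+2i\operatorname{Re}\alpha\,\zeta^2-(1+i)\alpha_1\zeta^3-\zeta^4$. For $\lambda=k^4>0$ not an eigenvalue of $H$ (all but at most one $\lambda>0$): $s(\lambda)=\overline{\Omega(k)}/\Omega(k)$, $b(\lambda)=(\alpha_0+2i\operatorname{Im}\alpha\,k^2+k^4)/\Omega(k)$, $\psi(x,\lambda)=2^{-1}(s(\lambda)e^{ikx+\pi i/4}+e^{-ikx-\pi i/4})-2^{-1/2}b(\lambda)e^{-kx}$. $H$ acts as $u\mapsto u^{(4)}$ on $u\in\mathsf{H}^4(\mathbb{R}_+)$ satisfying the boundary conditions. $P^{(c)}$ is the orthogonal projection onto the absolutely continuous subspace of $H$; $A$ is multiplication by $\lambda$ in $L_2(\mathbb{R}_+)$. *)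

theory Defs
  imports "HOL-Analysis.Analysis"
begin

definition L2 :: "(real \<Rightarrow> complex) set" where
  "L2 = {f. set_borel_measurable lborel {0<..} f \<and>
            set_integrable lborel {0<..} (\<lambda>x. (cmod (f x))\<^sup>2)}"

definition L1 :: "(real \<Rightarrow> complex) set" where
  "L1 = {f. set_integrable lborel {0<..} f}"

definition ip :: "(real \<Rightarrow> complex) \<Rightarrow> (real \<Rightarrow> complex) \<Rightarrow> complex" where
  "ip f g = (LINT x:{0<..}|lborel. f x * cnj (g x))"

definition nrm :: "(real \<Rightarrow> complex) \<Rightarrow> real" where
  "nrm f = sqrt (LINT x:{0<..}|lborel. (cmod (f x))\<^sup>2)"

definition aeq :: "(real \<Rightarrow> complex) \<Rightarrow> (real \<Rightarrow> complex) \<Rightarrow> bool" where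
  "aeq f g \<longleftrightarrow> (AE x in lborel. x > 0 \<longrightarrow> f x = g x)"

section \<open>The operator H (graph relation): u in dom H = H^4(R+) with boundary conditions, H u = w\<close>

text \<open>v k is the (absolutely continuous) representative of the k-th derivative of u, k=0..3,
  v 4 is the fourth derivative; all lie in L2.\<close>
definition Hgraph :: "complex \<Rightarrow> real \<Rightarrow> real \<Rightarrow> (real \<Rightarrow> complex) \<Rightarrow> (real \<Rightarrow> complex) \<Rightarrow> bool" where
  "Hgraph \<alpha> \<alpha>1 \<alpha>2 u w \<longleftrightarrow> u \<in> L2 \<and> w \<in> L2 \<and>
     (\<exists>v :: nat \<Rightarrow> real \<Rightarrow> complex.
        (\<forall>k\<le>4. v k \<in> L2) \<and> aeq (v 0) u \<and> aeq (v 4) w \<and>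
        (\<forall>k<4. \<forall>x\<ge>0. set_integrable lborel {0..x} (v (Suc k)) \<and>
                        v k x = v k 0 + (LINT t:{0..x}|lborel. v (Suc k) t)) \<and>
        v 2 0 = \<alpha> * v 0 0 + of_real \<alpha>1 * v 1 0 \<and>
        v 3 0 = - of_real \<alpha>2 * v 0 0 - cnj \<alpha> * v 1 0)"

text \<open>f lies in the absolutely continuous subspace iff its spectral measure mu_f is absolutely
  continuous, i.e. has a density rho; mu_f is characterised by its Borel transform
  <(H - z)^-1 f, f> = int d mu_f(t) / (t - z) for non-real z.\<close>
definition Hac :: "complex \<Rightarrow> real \<Rightarrow> real \<Rightarrow> (real \<Rightarrow> complex) set" where
  "Hac \<alpha> \<alpha>1 \<alpha>2 = {f \<in> L2. \<exists>\<rho> :: real \<Rightarrow> real. (\<forall>t. \<rho> t \<ge> 0) \<and> integrable lborel \<rho> \<and>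
      (\<forall>z u w. Im z \<noteq> 0 \<longrightarrow> Hgraph \<alpha> \<alpha>1 \<alpha>2 u w \<longrightarrow> aeq (\<lambda>x. w x - z * u x) f \<longrightarrow>
          ip u f = (LINT t|lborel. complex_of_real (\<rho> t) / (complex_of_real t - z)))}"

definition alpha0 :: "complex \<Rightarrow> real \<Rightarrow> real \<Rightarrow> complex" where
  "alpha0 \<alpha> \<alpha>1 \<alpha>2 = of_real (\<alpha>1 * \<alpha>2 - (cmod \<alpha>)\<^sup>2)"

definition Omega :: "complex \<Rightarrow> real \<Rightarrow> real \<Rightarrow> complex \<Rightarrow> complex" where
  "Omega \<alpha> \<alpha>1 \<alpha>2 \<zeta> = alpha0 \<alpha> \<alpha>1 \<alpha>2 + (1 - \<i>) * of_real \<alpha>2 * \<zeta>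
      + 2 * \<i> * of_real (Re \<alpha>) * \<zeta>\<^sup>2 - (1 + \<i>) * of_real \<alpha>1 * \<zeta>^3 - \<zeta>^4"

definition kk :: "real \<Rightarrow> real" where "kk lam = lam powr (1/4)"

definition sfun :: "complex \<Rightarrow> real \<Rightarrow> real \<Rightarrow> real \<Rightarrow> complex" where
  "sfun \<alpha> \<alpha>1 \<alpha>2 lam = cnj (Omega \<alpha> \<alpha>1 \<alpha>2 (of_real (kk lam))) / Omega \<alpha> \<alpha>1 \<alpha>2 (of_real (kk lam))"

definition bfun :: "complex \<Rightarrow> real \<Rightarrow> real \<Rightarrow> real \<Rightarrow> complex" where
  "bfun \<alpha> \<alpha>1 \<alpha>2 lam = (alpha0 \<alpha> \<alpha>1 \<alpha>2 + 2 * \<i> * of_real (Im \<alpha>) * of_real ((kk lam)\<^sup>2)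
      + of_real ((kk lam)^4)) / Omega \<alpha> \<alpha>1 \<alpha>2 (of_real (kk lam))"

definition psi :: "complex \<Rightarrow> real \<Rightarrow> real \<Rightarrow> real \<Rightarrow> real \<Rightarrow> complex" where
  "psi \<alpha> \<alpha>1 \<alpha>2 x lam =
     (1/2) * (sfun \<alpha> \<alpha>1 \<alpha>2 lam * exp (\<i> * of_real (kk lam * x) + of_real pi * \<i> / 4)
              + exp (- \<i> * of_real (kk lam * x) - of_real pi * \<i> / 4))
     - of_real (2 powr (-1/2)) * bfun \<alpha> \<alpha>1 \<alpha>2 lam * of_real (exp (- kk lam * x))"

definition psi_pm :: "bool \<Rightarrow> complex \<Rightarrow> real \<Rightarrow> real \<Rightarrow> real \<Rightarrow> real \<Rightarrow> complex" where
  "psi_pm pl \<alpha> \<alpha>1 \<alpha>2 x lam =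
     (if pl then cnj (sfun \<alpha> \<alpha>1 \<alpha>2 lam) * psi \<alpha> \<alpha>1 \<alpha>2 x lam else psi \<alpha> \<alpha>1 \<alpha>2 x lam)"

definition Fformula :: "bool \<Rightarrow> complex \<Rightarrow> real \<Rightarrow> real \<Rightarrow> (real \<Rightarrow> complex) \<Rightarrow> real \<Rightarrow> complex" where
  "Fformula pl \<alpha> \<alpha>1 \<alpha>2 f lam = of_real ((2 * pi) powr (-1/2) * lam powr (-3/8)) *
     (LINT x:{0<..}|lborel. cnj (psi_pm pl \<alpha> \<alpha>1 \<alpha>2 x lam) * f x)"

end

theory Submission
  imports Defs "HOL-Real_Asymp.Real_Asymp" "HOL-Complex_Analysis.Complex_Analysis"
begin

text \<open>With \<open>\<lambda> = k\<^sup>4\<close> the functions \<open>\<psi>(\<cdot>,\<lambda>)\<close> are bounded solutions of \<open>u\<^sup>(\<^sup>4\<^sup>) = \<lambda> u\<close> satisfying the boundary conditions, so an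
  integration by parts gives \<open>F H = A F\<close>. Isometry of \<open>F\<^sup>*\<close> is checked on wave packets, with the damping factor
  \<open>exp (- \<epsilon> x)\<close> in their inner product: the resulting kernel is a Poisson kernel, which tends to the identity, plus a remainder
  whose limit is the boundary form at \<open>0\<close> of two functions satisfying the boundary conditions, hence zero. This yields
  \<open>F F\<^sup>* = I\<close>, and the range of \<open>F\<^sup>* F\<close> is absolutely continuous because the spectral measure of \<open>F\<^sup>* F f\<close> is
  \<open>\<bar>F f\<bar>\<^sup>2 d\<lambda>\<close>.

  Conversely put \<open>P = I - F\<^sup>* F\<close>. If \<open>f\<close> is a finite sum of decaying exponentials, then the resolvent \<open>R(z) f\<close> is
  explicit, and a Wronskian at infinity shows that \<open>Im (R(z) f, f)\<close> has the boundary value \<open>\<pi> \<bar>F f\<bar>\<^sup>2\<close> off a closed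
  countable set; thus \<open>Im (R(z) P f, P f)\<close> has boundary value zero there. Such \<open>f\<close> are dense, and the bound
  \<open>\<integral> Im (R(t + i\<epsilon>) g, g) dt \<le> 4 \<pi> \<parallel>g\<parallel>\<^sup>2\<close> carries this over to every \<open>h\<close> with absolutely continuous spectral measure:
  the spectral measure of \<open>P h\<close> has a density, and by Stieltjes inversion this density vanishes, so \<open>P h = 0\<close>.\<close>

section \<open>Square-integrable functions on the half-line\<close>

text \<open>The functions \<open>psi\<close> are not square integrable and have poles at the zeros
  of \<open>Omega\<close>. Damping meets the first difficulty, multiplication by
  \<open>Omega\<close> the second; the zeros return only as a finite, hence null, set.
  \<open>Omega\<close> is itself the boundary determinant of the two nongrowing exponentials
  (\<open>dt_Omega\<close>). The symmetry of the boundary conditions enters as the vanishing at 0 of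
  one sesquilinear form (\<open>wronskian_bc\<close>), which yields in turn the intertwining with
  \<open>H\<close>, the off-diagonal cancellation and the jump of the resolvent. Absolute continuity
  is expressed by Borel transforms, so that the range of the projection contains the whole subspace
  must come from boundary values of resolvents. The exceptional set is where these may fail for
  exponential sums: 0, the fourth powers of zeros of \<open>Omega\<close> (where eigenvalues can
  sit) and the fourth powers of positive integers, at which some \<open>exp (- n x)\<close> is
  resonant. A closed countable set carries no absolutely continuous mass, so it can be discarded.
  The transforms are first built in the variable \<open>k\<close>, where all kernels are
  exponentials; the unitary substitution is applied afterwards.\<close>

abbreviation hl :: "real measure" where "hl \<equiv> restrict_space lborel {0<..}"

lemma space_hl [simp]: "space hl = {0<..}"
  by (simp add: space_restrict_space)

lemma sigma_finite_hl: "sigma_finite_measure hl"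
  by (rule sigma_finite_measure_restrict_space) (auto intro: lborel.sigma_finite_measure_axioms)

interpretation hl: sigma_finite_measure hl by (rule sigma_finite_hl)

lemma borel_measurable_hl: "f \<in> borel_measurable borel \<Longrightarrow> f \<in> borel_measurable hl"
  by (rule measurable_restrict_space1) simp

lemma integrable_hl_iff:
  fixes f :: "real \<Rightarrow> 'a::{banach, second_countable_topology}"
  shows "integrable hl f \<longleftrightarrow> set_integrable lborel {0<..} f"
  by (simp add: integrable_restrict_space set_integrable_def)

lemma integral_hl:
  fixes f :: "real \<Rightarrow> 'a::{banach, second_countable_topology}"
  shows "(LINT x:{0<..}|lborel. f x) = (\<integral>x. f x \<partial>hl)"
  by (simp add: integral_restrict_space set_lebesgue_integral_def)

lemma L1_iff: "f \<in> L1 \<longleftrightarrow> integrable hl f"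
  by (simp add: L1_def integrable_hl_iff)

lemma L2_iff: "f \<in> L2 \<longleftrightarrow> f \<in> borel_measurable hl \<and> integrable hl (\<lambda>x. (cmod (f x))\<^sup>2)"
  unfolding L2_def integrable_hl_iff
  by (auto simp: set_borel_measurable_def borel_measurable_restrict_space_iff)

lemma L2_meas: "f \<in> L2 \<Longrightarrow> f \<in> borel_measurable hl"
  by (simp add: L2_iff)

lemma L2_sq: "f \<in> L2 \<Longrightarrow> integrable hl (\<lambda>x. (cmod (f x))\<^sup>2)"
  by (simp add: L2_iff)

lemma aeq_iff: "aeq f g \<longleftrightarrow> (AE x in hl. f x = g x)"
  by (simp add: aeq_def AE_restrict_space_iff)

lemma ip_hl: "ip f g = (\<integral>x. f x * cnj (g x) \<partial>hl)"
  by (simp add: ip_def integral_hl)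

lemma nrm_hl: "nrm f = sqrt (\<integral>x. (cmod (f x))\<^sup>2 \<partial>hl)"
  by (simp add: nrm_def integral_hl)

lemma nrm_nonneg [simp]: "0 \<le> nrm f"
  by (simp add: nrm_hl)

lemma nrm_sq: "(nrm f)\<^sup>2 = (\<integral>x. (cmod (f x))\<^sup>2 \<partial>hl)"
  by (simp add: nrm_hl)

lemma aeq_refl [simp]: "aeq f f"
  by (simp add: aeq_def)

lemma aeq_sym: "aeq f g \<Longrightarrow> aeq g f"
  unfolding aeq_def by (auto elim: eventually_mono)

lemma aeq_trans: "aeq f g \<Longrightarrow> aeq g h \<Longrightarrow> aeq f h"
  unfolding aeq_def by (rule AE_mp, assumption, rule AE_mp, assumption, rule AE_I2) auto

lemma aeqI: "(\<And>x. x > 0 \<Longrightarrow> f x = g x) \<Longrightarrow> aeq f g"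
  by (simp add: aeq_def)

lemma borel_measurable_cnj [measurable]:
  "f \<in> borel_measurable M \<Longrightarrow> (\<lambda>x. cnj (f x)) \<in> borel_measurable M"
  by (rule borel_measurable_continuous_on[where f=cnj]) (auto intro: continuous_intros)

lemma ip_cong: "f \<in> borel_measurable hl \<Longrightarrow> f' \<in> borel_measurable hl \<Longrightarrow> g \<in> borel_measurable hl
   \<Longrightarrow> g' \<in> borel_measurable hl \<Longrightarrow> aeq f f' \<Longrightarrow> aeq g g' \<Longrightarrow> ip f g = ip f' g'"
  unfolding ip_hl aeq_iff
  apply (rule integral_cong_AE)
    apply measurable
  by (auto elim: AE_mp)

lemma nrm_cong: "f \<in> borel_measurable hl \<Longrightarrow> g \<in> borel_measurable hl \<Longrightarrow> aeq f g \<Longrightarrow> nrm f = nrm g"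
  unfolding nrm_hl aeq_iff
  by (rule arg_cong[where f=sqrt], rule integral_cong_AE) (measurable, auto)

lemma sq_sum_le: "(cmod (a + b))\<^sup>2 \<le> 2 * (cmod a)\<^sup>2 + 2 * (cmod b)\<^sup>2"
proof -
  have "(cmod (a + b))\<^sup>2 \<le> (cmod a + cmod b)\<^sup>2"
    by (intro power_mono norm_triangle_ineq) auto
  also have "\<dots> \<le> 2 * (cmod a)\<^sup>2 + 2 * (cmod b)\<^sup>2"
    using sum_squares_bound[of "cmod a" "cmod b"] by (simp add: power2_sum)
  finally show ?thesis .
qed

lemma L2_bound:
  assumes "f \<in> borel_measurable hl" "integrable hl g" "\<And>x. x > 0 \<Longrightarrow> (cmod (f x))\<^sup>2 \<le> g x"
  shows "f \<in> L2"
  unfolding L2_iff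
proof
  show "integrable hl (\<lambda>x. (cmod (f x))\<^sup>2)"
  proof (rule Bochner_Integration.integrable_bound[OF assms(2)])
    show "AE x in hl. norm ((cmod (f x))\<^sup>2) \<le> norm (g x)"
      using assms(3) by (intro AE_I2) force
  qed (use assms in measurable)
qed fact

lemma L2_zero [simp]: "(\<lambda>x. 0) \<in> L2"
  by (simp add: L2_iff)

lemma L2_add: assumes "f \<in> L2" "g \<in> L2" shows "(\<lambda>x. f x + g x) \<in> L2"
proof (rule L2_bound)
  show "integrable hl (\<lambda>x. 2 * (cmod (f x))\<^sup>2 + 2 * (cmod (g x))\<^sup>2)"
    using assms by (auto simp: L2_iff)
  show "(\<lambda>x. f x + g x) \<in> borel_measurable hl"
    using assms by (auto simp: L2_iff)
qed (use sq_sum_le in auto)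

lemma L2_mult_bounded:
  assumes "f \<in> L2" "g \<in> borel_measurable hl" "\<And>x. x > 0 \<Longrightarrow> cmod (g x) \<le> B"
  shows "(\<lambda>x. g x * f x) \<in> L2"
proof (rule L2_bound)
  show "integrable hl (\<lambda>x. B\<^sup>2 * (cmod (f x))\<^sup>2)" using assms by (auto simp: L2_iff)
  show "(\<lambda>x. g x * f x) \<in> borel_measurable hl" using assms by (auto simp: L2_iff)
  show "(cmod (g x * f x))\<^sup>2 \<le> B\<^sup>2 * (cmod (f x))\<^sup>2" if "x > 0" for x
    unfolding norm_mult power_mult_distrib
    using assms(3)[OF that] by (intro mult_right_mono power_mono) auto
qed

lemma L2_cmult: "f \<in> L2 \<Longrightarrow> (\<lambda>x. c * f x) \<in> L2"
  by (rule L2_mult_bounded[where B="cmod c"]) auto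

lemma L2_uminus: "f \<in> L2 \<Longrightarrow> (\<lambda>x. - f x) \<in> L2"
  using L2_cmult[of f "-1"] by simp

lemma L2_diff: "f \<in> L2 \<Longrightarrow> g \<in> L2 \<Longrightarrow> (\<lambda>x. f x - g x) \<in> L2"
  using L2_add[of f "\<lambda>x. - g x"] L2_uminus[of g] by simp

lemma L2_sum: "(\<And>i. i \<in> I \<Longrightarrow> f i \<in> L2) \<Longrightarrow> (\<lambda>x. \<Sum>i\<in>I. f i x) \<in> L2"
  by (induction I rule: infinite_finite_induct) (auto intro: L2_add)

lemma L2_cnj: "f \<in> L2 \<Longrightarrow> (\<lambda>x. cnj (f x)) \<in> L2"
  by (auto simp: L2_iff)

lemma L2_aeq: assumes "f \<in> L2" "g \<in> borel_measurable hl" "aeq f g" shows "g \<in> L2"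
proof -
  have "integrable hl (\<lambda>x. (cmod (f x))\<^sup>2) = integrable hl (\<lambda>x. (cmod (g x))\<^sup>2)"
    using assms by (intro integrable_cong_AE) (auto simp: L2_iff aeq_iff elim: eventually_mono)
  then show ?thesis using assms by (auto simp: L2_iff)
qed

lemma cmod_prod_le: "cmod (a * b) \<le> (cmod a)\<^sup>2 + (cmod b)\<^sup>2"
proof -
  have "2 * cmod a * cmod b \<le> (cmod a)\<^sup>2 + (cmod b)\<^sup>2" by (rule sum_squares_bound)
  moreover have "0 \<le> cmod a * cmod b" by simp
  ultimately show ?thesis unfolding norm_mult by linarith
qed

lemma L2_prod_integrable:
  assumes "f \<in> L2" "g \<in> L2" shows "integrable hl (\<lambda>x. f x * g x)"
proof (rule Bochner_Integration.integrable_bound)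
  show "integrable hl (\<lambda>x. (cmod (f x))\<^sup>2 + (cmod (g x))\<^sup>2)" using assms by (auto simp: L2_iff)
  show "AE x in hl. norm (f x * g x) \<le> norm ((cmod (f x))\<^sup>2 + (cmod (g x))\<^sup>2)"
    using cmod_prod_le by (intro AE_I2) (auto intro: order_trans)
qed (use assms in \<open>auto simp: L2_iff\<close>)

lemma ip_integrable: "f \<in> L2 \<Longrightarrow> g \<in> L2 \<Longrightarrow> integrable hl (\<lambda>x. f x * cnj (g x))"
  by (intro L2_prod_integrable L2_cnj)

text \<open>The quadratic \<open>t -> || t |f| - |g| ||^2\<close> is nonnegative, and its value at
  the minimiser \<open>I / (nrm f)^2\<close> is the bound. The moduli stay inside the integral
  because the same estimate later controls weighted L1 distances as well as inner products.\<close>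

lemma Cauchy_Schwarz_norm:
  assumes f: "f \<in> L2" and g: "g \<in> L2"
  shows "(\<integral>x. cmod (f x) * cmod (g x) \<partial>hl) \<le> nrm f * nrm g"
proof -
  define I where "I = (\<integral>x. cmod (f x) * cmod (g x) \<partial>hl)"
  have int: "integrable hl (\<lambda>x. cmod (f x) * cmod (g x))"
    using integrable_norm[OF L2_prod_integrable[OF f g]] by (simp add: norm_mult)
  have I0: "0 \<le> I" unfolding I_def by simp
  have quad: "0 \<le> t\<^sup>2 * (nrm f)\<^sup>2 - 2 * t * I + (nrm g)\<^sup>2" for t
  proof -
    have "0 \<le> (\<integral>x. (t * cmod (f x) - cmod (g x))\<^sup>2 \<partial>hl)" by simp
    also have "(\<lambda>x. (t * cmod (f x) - cmod (g x))\<^sup>2) =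
      (\<lambda>x. t\<^sup>2 * (cmod (f x))\<^sup>2 - 2 * t * (cmod (f x) * cmod (g x)) + (cmod (g x))\<^sup>2)"
      by (auto simp: power2_diff power_mult_distrib)
    also have "(\<integral>x. t\<^sup>2 * (cmod (f x))\<^sup>2 - 2 * t * (cmod (f x) * cmod (g x)) + (cmod (g x))\<^sup>2 \<partial>hl)
      = t\<^sup>2 * (nrm f)\<^sup>2 - 2 * t * I + (nrm g)\<^sup>2"
      unfolding nrm_sq I_def using int f g by (simp add: L2_sq)
    finally show ?thesis .
  qed
  have "I\<^sup>2 \<le> (nrm f)\<^sup>2 * (nrm g)\<^sup>2"
  proof (cases "nrm f = 0")
    case True
    have "I = 0"
    proof (rule ccontr)
      assume "I \<noteq> 0"
      \<comment> \<open>With \<open>nrm f = 0\<close> the quadratic degenerates to a line of slope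
        \<open>- 2 I\<close>, and this value of \<open>t\<close> pushes it below zero.\<close>
      then have "2 * (((nrm g)\<^sup>2 + 1) / I) * I = 2 * ((nrm g)\<^sup>2 + 1)" by simp
      then have "0 \<le> - (2 * ((nrm g)\<^sup>2 + 1)) + (nrm g)\<^sup>2"
        using quad[of "((nrm g)\<^sup>2 + 1) / I"] True by simp
      moreover have "0 \<le> (nrm g)\<^sup>2" by simp
      ultimately show False by (simp add: distrib_left)
    qed
    then show ?thesis by simp
  next
    case False
    then have "0 < (nrm f)\<^sup>2" by simp
    have "0 \<le> (I / (nrm f)\<^sup>2)\<^sup>2 * (nrm f)\<^sup>2 - 2 * (I / (nrm f)\<^sup>2) * I + (nrm g)\<^sup>2" by (rule quad)
    also have "\<dots> = (nrm g)\<^sup>2 - I\<^sup>2 / (nrm f)\<^sup>2"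
      using \<open>0 < (nrm f)\<^sup>2\<close> by (simp add: field_simps power2_eq_square)
    finally show ?thesis using \<open>0 < (nrm f)\<^sup>2\<close> by (simp add: field_simps)
  qed
  then have "I\<^sup>2 \<le> (nrm f * nrm g)\<^sup>2" by (simp add: power_mult_distrib)
  then show ?thesis unfolding I_def[symmetric] by (rule power2_le_imp_le) simp
qed

lemma Cauchy_Schwarz_ip:
  assumes "f \<in> L2" "g \<in> L2" shows "cmod (ip f g) \<le> nrm f * nrm g"
proof -
  have "cmod (ip f g) \<le> (\<integral>x. cmod (f x * cnj (g x)) \<partial>hl)"
    unfolding ip_hl by (rule integral_norm_bound)
  also have "\<dots> = (\<integral>x. cmod (f x) * cmod (g x) \<partial>hl)" by (simp add: norm_mult)
  also have "\<dots> \<le> nrm f * nrm g" by (rule Cauchy_Schwarz_norm[OF assms])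
  finally show ?thesis .
qed

lemma nrm_triangle:
  assumes "f \<in> L2" "g \<in> L2" shows "nrm (\<lambda>x. f x + g x) \<le> nrm f + nrm g"
proof (rule power2_le_imp_le)
  have int: "integrable hl (\<lambda>x. cmod (f x) * cmod (g x))"
    using integrable_norm[OF L2_prod_integrable[OF assms]] by (simp add: norm_mult)
  have "(nrm (\<lambda>x. f x + g x))\<^sup>2
    \<le> (\<integral>x. (cmod (f x))\<^sup>2 + 2 * (cmod (f x) * cmod (g x)) + (cmod (g x))\<^sup>2 \<partial>hl)"
    unfolding nrm_sq
  proof (rule integral_mono)
    fix x
    have "(cmod (f x + g x))\<^sup>2 \<le> (cmod (f x) + cmod (g x))\<^sup>2"
      by (intro power_mono norm_triangle_ineq) auto
    then show "(cmod (f x + g x))\<^sup>2 \<le> (cmod (f x))\<^sup>2 + 2 * (cmod (f x) * cmod (g x)) + (cmod (g x))\<^sup>2"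
      by (simp add: power2_sum)
  qed (use assms int L2_add[OF assms] in \<open>auto simp: L2_iff\<close>)
  also have "\<dots> = (nrm f)\<^sup>2 + 2 * (\<integral>x. cmod (f x) * cmod (g x) \<partial>hl) + (nrm g)\<^sup>2"
    unfolding nrm_sq using assms int by (simp add: L2_sq)
  also have "\<dots> \<le> (nrm f + nrm g)\<^sup>2"
    using Cauchy_Schwarz_norm[OF assms] by (simp add: power2_sum)
  finally show "(nrm (\<lambda>x. f x + g x))\<^sup>2 \<le> (nrm f + nrm g)\<^sup>2" .
qed simp

lemma nrm_cmult: "nrm (\<lambda>x. c * f x) = cmod c * nrm f"
  by (simp add: nrm_hl norm_mult power_mult_distrib real_sqrt_mult)

lemma nrm_uminus [simp]: "nrm (\<lambda>x. - f x) = nrm f"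
  by (simp add: nrm_hl)

lemma nrm_minus_commute: "nrm (\<lambda>x. f x - g x) = nrm (\<lambda>x. g x - f x)"
  by (simp add: nrm_hl norm_minus_commute)

lemma nrm_triangle_diff:
  assumes "f \<in> L2" "g \<in> L2" shows "nrm (\<lambda>x. f x - g x) \<le> nrm f + nrm g"
  using nrm_triangle[of f "\<lambda>x. - g x"] assms by (simp add: L2_uminus)

lemma nrm_triangle3:
  assumes "f \<in> L2" "g \<in> L2" "h \<in> L2"
  shows "nrm (\<lambda>x. f x - g x) \<le> nrm (\<lambda>x. f x - h x) + nrm (\<lambda>x. h x - g x)"
  using nrm_triangle[of "\<lambda>x. f x - h x" "\<lambda>x. h x - g x"] assms by (simp add: L2_diff)

lemma nrm_eq_0_iff: assumes "f \<in> L2" shows "nrm f = 0 \<longleftrightarrow> aeq f (\<lambda>x. 0)"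
proof -
  have "nrm f = 0 \<longleftrightarrow> (\<integral>x. (cmod (f x))\<^sup>2 \<partial>hl) = 0" by (simp add: nrm_hl)
  also have "\<dots> \<longleftrightarrow> (AE x in hl. (cmod (f x))\<^sup>2 = 0)"
    using assms by (intro integral_nonneg_eq_0_iff_AE) (auto simp: L2_iff)
  finally show ?thesis by (simp add: aeq_iff)
qed

lemma nrm_diff_0D: "f \<in> L2 \<Longrightarrow> g \<in> L2 \<Longrightarrow> nrm (\<lambda>x. f x - g x) = 0 \<Longrightarrow> aeq f g"
  by (auto simp: nrm_eq_0_iff L2_diff aeq_def elim: eventually_mono)

lemma ip_add_left: "f \<in> L2 \<Longrightarrow> g \<in> L2 \<Longrightarrow> h \<in> L2 \<Longrightarrow> ip (\<lambda>x. f x + g x) h = ip f h + ip g h"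
  unfolding ip_hl using ip_integrable[of f h] ip_integrable[of g h] by (simp add: distrib_right)

lemma ip_diff_left: "f \<in> L2 \<Longrightarrow> g \<in> L2 \<Longrightarrow> h \<in> L2 \<Longrightarrow> ip (\<lambda>x. f x - g x) h = ip f h - ip g h"
  unfolding ip_hl using ip_integrable[of f h] ip_integrable[of g h] by (simp add: left_diff_distrib)

lemma ip_cmult_left: "ip (\<lambda>x. c * f x) h = c * ip f h"
  unfolding ip_hl by (simp add: mult.assoc)

lemma cnj_ip: "cnj (ip f g) = ip g f"
  using Bochner_Integration.integral_cnj[of hl "\<lambda>x. f x * cnj (g x)"] by (simp add: ip_hl mult.commute)

lemma ip_add_right: "f \<in> L2 \<Longrightarrow> g \<in> L2 \<Longrightarrow> h \<in> L2 \<Longrightarrow> ip h (\<lambda>x. f x + g x) = ip h f + ip h g"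
  using ip_add_left[of f g h] by (metis cnj_ip complex_cnj_add)

lemma ip_diff_right: "f \<in> L2 \<Longrightarrow> g \<in> L2 \<Longrightarrow> h \<in> L2 \<Longrightarrow> ip h (\<lambda>x. f x - g x) = ip h f - ip h g"
  using ip_diff_left[of f g h] by (metis cnj_ip complex_cnj_diff)

lemma ip_cmult_right: "ip h (\<lambda>x. c * f x) = cnj c * ip h f"
  using ip_cmult_left[of c f h] by (metis cnj_ip complex_cnj_mult)

lemma ip_self: "ip f f = of_real ((nrm f)\<^sup>2)"
proof -
  have "ip f f = (\<integral>x. complex_of_real ((cmod (f x))\<^sup>2) \<partial>hl)"
    unfolding ip_hl by (simp only: complex_norm_square)
  then show ?thesis unfolding nrm_sq by (simp only: integral_complex_of_real)
qed

text \<open>A bounded interval has finite measure, so its indicator is itself in \<open>L2\<close>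
  and the product is integrable. Truncations of this kind are the functions on which the integral
  formula of the transform makes sense.\<close>

lemma L1_L2_bounded_support:
  assumes "f \<in> L2" shows "(\<lambda>x. indicator {0<..<r} x * f x) \<in> L1 \<inter> L2"
proof
  have 1: "(\<lambda>x. indicator {0<..<r} x) \<in> L2"
  proof (rule L2_bound)
    show "integrable hl (indicator {0<..<r} :: real \<Rightarrow> real)"
      unfolding integrable_hl_iff set_integrable_def
    proof (rule Bochner_Integration.integrable_bound)
      show "integrable lborel (indicator {0<..<max r 1} :: real \<Rightarrow> real)"
        by (rule integrable_real_indicator) auto
    qed (auto simp: indicator_def)
  qed (auto simp: indicator_def intro!: borel_measurable_hl borel_measurable_indicator)
  show "(\<lambda>x. indicator {0<..<r} x * f x) \<in> L1"
    unfolding L1_iff by (rule L2_prod_integrable[OF 1 assms])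
  show "(\<lambda>x. indicator {0<..<r} x * f x) \<in> L2"
    by (rule L2_mult_bounded[OF assms, where B=1]) (auto simp: indicator_def intro!: borel_measurable_hl)
qed

section \<open>Convergence in norm, exponentials and completeness\<close>

definition L2_lim :: "(nat \<Rightarrow> real \<Rightarrow> complex) \<Rightarrow> (real \<Rightarrow> complex) \<Rightarrow> bool" where
  "L2_lim f g \<longleftrightarrow> (\<lambda>n. nrm (\<lambda>x. f n x - g x)) \<longlonglongrightarrow> 0"

text \<open>Norm convergence is L1 convergence of the squared distances. The pointwise version
  serves to compare a transform obtained as a limit in norm with boundary terms that are only known
  to vanish for each fixed \<open>k\<close>.\<close>

lemma L2_lim_AE_subseq:
  assumes "\<And>n. f n \<in> L2" "g \<in> L2" "L2_lim f g"
  shows "\<exists>r::nat\<Rightarrow>nat. strict_mono r \<and> (AE x in hl. (\<lambda>n. f (r n) x) \<longlonglongrightarrow> g x)"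
proof -
  have d: "(\<lambda>x. f n x - g x) \<in> L2" for n by (intro L2_diff assms)
  have "(\<lambda>n. (nrm (\<lambda>x. f n x - g x))\<^sup>2) \<longlonglongrightarrow> 0"
    using tendsto_power[OF assms(3)[unfolded L2_lim_def], of 2] by simp
  then have "(\<lambda>n. \<integral>x. norm ((cmod (f n x - g x))\<^sup>2) \<partial>hl) \<longlonglongrightarrow> 0" by (simp add: nrm_sq)
  from tendsto_L1_AE_subseq[OF L2_sq[OF d] this]
  obtain r :: "nat \<Rightarrow> nat" where r: "strict_mono r" "AE x in hl. (\<lambda>n. (cmod (f (r n) x - g x))\<^sup>2) \<longlonglongrightarrow> 0"
    by blast
  have "AE x in hl. (\<lambda>n. f (r n) x) \<longlonglongrightarrow> g x"
    using r(2)
  proof eventually_elim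
    case (elim x)
    have "(\<lambda>n. cmod (f (r n) x - g x)) \<longlonglongrightarrow> 0"
      using tendsto_real_sqrt[OF elim] by simp
    then show ?case by (simp add: LIM_zero_iff tendsto_norm_zero_iff)
  qed
  with r(1) show ?thesis by blast
qed

lemma L2_lim_unique:
  assumes "\<And>n. f n \<in> L2" "g \<in> L2" "h \<in> L2" "L2_lim f g" "L2_lim f h"
  shows "aeq g h"
proof -
  have le: "nrm (\<lambda>x. g x - h x) \<le> nrm (\<lambda>x. f n x - g x) + nrm (\<lambda>x. f n x - h x)" for n
    using nrm_triangle3[of g h "f n"] assms by (simp add: nrm_minus_commute[of g])
  have "(\<lambda>n. nrm (\<lambda>x. f n x - g x) + nrm (\<lambda>x. f n x - h x)) \<longlonglongrightarrow> 0 + 0"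
    using assms(4,5) unfolding L2_lim_def by (rule tendsto_add)
  then have "nrm (\<lambda>x. g x - h x) \<le> 0"
    by (intro LIMSEQ_le_const[where X="\<lambda>n. nrm (\<lambda>x. f n x - g x) + nrm (\<lambda>x. f n x - h x)"])
      (use le in auto)
  then have "nrm (\<lambda>x. g x - h x) = 0" using nrm_nonneg[of "\<lambda>x. g x - h x"] by linarith
  then show ?thesis using assms by (intro nrm_diff_0D)
qed

lemma L2_lim_ip:
  assumes "\<And>n. f n \<in> L2" "g \<in> L2" "h \<in> L2" "L2_lim f g"
  shows "(\<lambda>n. ip (f n) h) \<longlonglongrightarrow> ip g h"
proof -
  have "(\<lambda>n. ip (f n) h - ip g h) \<longlonglongrightarrow> 0"
  proof (rule Lim_null_comparison)
    show "\<forall>\<^sub>F n in sequentially. norm (ip (f n) h - ip g h) \<le> nrm (\<lambda>x. f n x - g x) * nrm h"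
      using Cauchy_Schwarz_ip[OF L2_diff[OF assms(1,2)] assms(3)] assms
      by (simp add: ip_diff_left)
    show "(\<lambda>n. nrm (\<lambda>x. f n x - g x) * nrm h) \<longlonglongrightarrow> 0"
      using tendsto_mult_right[OF assms(4)[unfolded L2_lim_def], of "nrm h"] by simp
  qed
  then show ?thesis by (simp add: LIM_zero_iff)
qed

lemma L2_lim_nrm_le:
  assumes "\<And>n. f n \<in> L2" "g \<in> L2" "L2_lim f g" "\<And>n. nrm (f n) \<le> C"
  shows "nrm g \<le> C"
proof -
  have "nrm g \<le> C + nrm (\<lambda>x. f n x - g x)" for n
    using nrm_triangle_diff[OF assms(1)[of n] L2_diff[OF assms(1)[of n] assms(2)]] assms(4)[of n]
    by simp
  moreover have "(\<lambda>n. C + nrm (\<lambda>x. f n x - g x)) \<longlonglongrightarrow> C + 0"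
    using assms(3) unfolding L2_lim_def by (intro tendsto_intros)
  ultimately show ?thesis
    using LIMSEQ_le_const[of "\<lambda>n. C + nrm (\<lambda>x. f n x - g x)" "C + 0" "nrm g"] by simp
qed

lemma L2_lim_add:
  assumes "\<And>n. f n \<in> L2" "g \<in> L2" "\<And>n. f' n \<in> L2" "g' \<in> L2" "L2_lim f g" "L2_lim f' g'"
  shows "L2_lim (\<lambda>n x. f n x + c * f' n x) (\<lambda>x. g x + c * g' x)"
  unfolding L2_lim_def
proof (rule tendsto_sandwich[OF _ _ tendsto_const])
  show "\<forall>\<^sub>F n in sequentially. nrm (\<lambda>x. f n x + c * f' n x - (g x + c * g' x))
     \<le> nrm (\<lambda>x. f n x - g x) + cmod c * nrm (\<lambda>x. f' n x - g' x)"
  proof (intro always_eventually allI)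
    fix n
    have "nrm (\<lambda>x. f n x + c * f' n x - (g x + c * g' x))
       = nrm (\<lambda>x. (f n x - g x) + c * (f' n x - g' x))" by (simp add: algebra_simps)
    also have "\<dots> \<le> nrm (\<lambda>x. f n x - g x) + nrm (\<lambda>x. c * (f' n x - g' x))"
      by (intro nrm_triangle L2_cmult L2_diff assms)
    finally show "nrm (\<lambda>x. f n x + c * f' n x - (g x + c * g' x))
       \<le> nrm (\<lambda>x. f n x - g x) + cmod c * nrm (\<lambda>x. f' n x - g' x)" by (simp add: nrm_cmult)
  qed
  have "(\<lambda>n. nrm (\<lambda>x. f n x - g x) + cmod c * nrm (\<lambda>x. f' n x - g' x)) \<longlonglongrightarrow> 0 + cmod c * 0"
    using assms(5,6) unfolding L2_lim_def by (intro tendsto_intros)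
  then show "(\<lambda>n. nrm (\<lambda>x. f n x - g x) + cmod c * nrm (\<lambda>x. f' n x - g' x)) \<longlonglongrightarrow> 0" by simp
qed simp

lemma L2_lim_dominated_AE:
  assumes "\<And>n. f n \<in> L2" "g \<in> L2" "h \<in> L2"
    and lim: "AE x in hl. (\<lambda>n. f n x) \<longlonglongrightarrow> g x" and bound: "\<And>n x. x > 0 \<Longrightarrow> cmod (f n x) \<le> cmod (h x)"
  shows "L2_lim f g"
proof -
  have "(\<lambda>n. \<integral>x. (cmod (f n x - g x))\<^sup>2 \<partial>hl) \<longlonglongrightarrow> (\<integral>x. 0 \<partial>hl)"
  proof (rule integral_dominated_convergence)
    show "integrable hl (\<lambda>x. 4 * (cmod (h x))\<^sup>2)" using assms(3) by (auto simp: L2_iff)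
    show "AE x in hl. (\<lambda>n. (cmod (f n x - g x))\<^sup>2) \<longlonglongrightarrow> 0"
      using lim
    proof eventually_elim
      case (elim x)
      then have "(\<lambda>n. (cmod (f n x - g x))\<^sup>2) \<longlonglongrightarrow> (cmod (g x - g x))\<^sup>2"
        by (intro tendsto_intros)
      then show "(\<lambda>n. (cmod (f n x - g x))\<^sup>2) \<longlonglongrightarrow> 0" by simp
    qed
    \<comment> \<open>The limit inherits the bound \<open>|h|\<close>, so the distance is at most
      \<open>2 |h|\<close>.\<close>
    show "AE x in hl. norm ((cmod (f n x - g x))\<^sup>2) \<le> 4 * (cmod (h x))\<^sup>2" for n
      using lim AE_space[of hl]
    proof eventually_elim
      case (elim x)
      then have x: "x > 0" by simp
      have "cmod (g x) \<le> cmod (h x)"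
        using bound[OF x] by (intro LIMSEQ_le_const2[OF tendsto_norm[OF elim(1)]]) auto
      then have "cmod (f n x - g x) \<le> 2 * cmod (h x)"
        using bound[OF x, of n] norm_triangle_ineq4[of "f n x" "g x"] by auto
      then have "(cmod (f n x - g x))\<^sup>2 \<le> (2 * cmod (h x))\<^sup>2" by (intro power_mono) auto
      then show "norm ((cmod (f n x - g x))\<^sup>2) \<le> 4 * (cmod (h x))\<^sup>2" by (simp add: power_mult_distrib)
    qed
    have [measurable]: "f n \<in> borel_measurable hl" "g \<in> borel_measurable hl" for n
      using assms L2_meas by auto
    show "(\<lambda>x. (cmod (f n x - g x))\<^sup>2) \<in> borel_measurable hl" for n by measurable
    show "(\<lambda>x. 0::real) \<in> borel_measurable hl" by simp
  qed
  then have "(\<lambda>n. sqrt (\<integral>x. (cmod (f n x - g x))\<^sup>2 \<partial>hl)) \<longlonglongrightarrow> sqrt 0"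
    by (intro tendsto_real_sqrt) simp
  then show ?thesis by (simp add: L2_lim_def nrm_hl)
qed

lemma L2_lim_dominated:
  assumes "\<And>n. f n \<in> L2" "g \<in> L2" "h \<in> L2"
    and "\<And>x. x > 0 \<Longrightarrow> (\<lambda>n. f n x) \<longlonglongrightarrow> g x" "\<And>n x. x > 0 \<Longrightarrow> cmod (f n x) \<le> cmod (h x)"
  shows "L2_lim f g"
  by (rule L2_lim_dominated_AE[OF assms(1-3) AE_I2 assms(5)]) (simp_all add: assms(4))

lemma has_bochner_exp:
  fixes p :: complex assumes p: "Re p > 0"
  shows integrable_exp: "integrable hl (\<lambda>x. exp (- (p * of_real x)))"
    and integral_exp: "(\<integral>x. exp (- (p * of_real x)) \<partial>hl) = 1 / p"
proof -
  have ei: "einterval 0 \<infinity> = {0::real<..}" by (auto simp: einterval_def zero_ereal_def)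
  have "p \<noteq> 0" using p by auto
  have lim0: "((\<lambda>x::real. exp (- (Re p * x))) \<longlongrightarrow> 0) at_top"
    using p by real_asymp
  have "set_integrable lborel (einterval 0 \<infinity>) (\<lambda>x::real. exp (- (Re p * x)))"
  proof (rule interval_integral_FTC_nonneg(1))
    show "((\<lambda>x. - (exp (- (Re p * x)) / Re p)) has_real_derivative exp (- (Re p * x))) (at x)" for x
      using p by (auto intro!: derivative_eq_intros)
    have "((\<lambda>x. - (exp (- (Re p * x)) / Re p)) \<longlongrightarrow> - (exp (- (Re p * 0)) / Re p)) (at_right 0)"
      using p by (intro tendsto_intros) auto
    then show "(((\<lambda>x. - (exp (- (Re p * x)) / Re p)) \<circ> real_of_ereal) \<longlongrightarrow> - (1 / Re p)) (at_right 0)"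
      by (simp add: zero_ereal_def ereal_tendsto_simps)
    have "((\<lambda>x. - (exp (- (Re p * x)) / Re p)) \<longlongrightarrow> - (0 / Re p)) at_top"
      using p by (intro tendsto_intros lim0) auto
    then show "(((\<lambda>x. - (exp (- (Re p * x)) / Re p)) \<circ> real_of_ereal) \<longlongrightarrow> 0) (at_left \<infinity>)"
      by (simp add: ereal_tendsto_simps)
  qed (auto intro!: continuous_intros)
  then have r: "integrable hl (\<lambda>x::real. exp (- (Re p * x)))" by (simp add: ei integrable_hl_iff)
  show i: "integrable hl (\<lambda>x. exp (- (p * of_real x)))"
    by (rule Bochner_Integration.integrable_bound[OF r])
      (auto intro!: borel_measurable_hl borel_measurable_continuous_onI continuous_intros)
  have "(LBINT x=0..\<infinity>. exp (- (p * of_real x))) = 0 - (- (1 / p))"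
  proof (rule interval_integral_FTC_integrable)
    show "((\<lambda>x. - (exp (- (p * of_real x)) / p)) has_vector_derivative exp (- (p * of_real x))) (at x)"
      for x :: real
      using \<open>p \<noteq> 0\<close> by (auto intro!: derivative_eq_intros has_vector_derivative_real_field)
    show "set_integrable lborel (einterval 0 \<infinity>) (\<lambda>x::real. exp (- (p * of_real x)))"
      using i by (simp add: ei integrable_hl_iff)
    have "((\<lambda>x::real. - (exp (- (p * of_real x)) / p)) \<longlongrightarrow> - (exp (- (p * of_real 0)) / p)) (at_right 0)"
      using \<open>p \<noteq> 0\<close> by (intro tendsto_intros) auto
    then show "(((\<lambda>x::real. - (exp (- (p * of_real x)) / p)) \<circ> real_of_ereal) \<longlongrightarrow> - (1 / p)) (at_right 0)"
      by (simp add: zero_ereal_def ereal_tendsto_simps)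
    have "((\<lambda>x::real. exp (- (p * of_real x))) \<longlongrightarrow> 0) at_top"
      by (rule tendsto_norm_zero_cancel) (simp add: lim0)
    then have "((\<lambda>x::real. - (exp (- (p * of_real x)) / p)) \<longlongrightarrow> - (0 / p)) at_top"
      using \<open>p \<noteq> 0\<close> by (intro tendsto_intros) auto
    then show "(((\<lambda>x::real. - (exp (- (p * of_real x)) / p)) \<circ> real_of_ereal) \<longlongrightarrow> 0) (at_left \<infinity>)"
      by (simp add: ereal_tendsto_simps)
  qed (auto intro!: continuous_intros)
  then show "(\<integral>x. exp (- (p * of_real x)) \<partial>hl) = 1 / p"
    by (simp add: interval_lebesgue_integral_def ei integral_hl)
qed

lemma L2_exp: assumes "Re a > 0" shows "(\<lambda>x. exp (- (a * of_real x))) \<in> L2"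
proof (rule L2_bound)
  have "integrable hl (\<lambda>x. norm (exp (- ((2 * a) * of_real x))))"
    using assms by (intro integrable_norm integrable_exp) auto
  then show "integrable hl (\<lambda>x::real. exp (- (2 * Re a * x)))" by simp
  show "(cmod (exp (- (a * of_real x))))\<^sup>2 \<le> exp (- (2 * Re a * x))" for x
    by (simp add: power2_eq_square exp_add[symmetric] algebra_simps)
qed (auto intro!: borel_measurable_hl borel_measurable_continuous_onI continuous_intros)

text \<open>The weight \<open>exp (-x)\<close> turns an \<open>L2\<close>-Cauchy sequence into an \<open>L1\<close>-Cauchy one,
  for which an almost everywhere convergent subsequence is available.\<close>

theorem L2_complete:
  assumes f: "\<And>n. f n \<in> L2"
    and cauchy: "\<And>e. e > 0 \<Longrightarrow> \<exists>N. \<forall>m\<ge>N. \<forall>n\<ge>N. nrm (\<lambda>x. f m x - f n x) < e"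
  shows "\<exists>g\<in>L2. L2_lim f g"
proof -
  define w :: "real \<Rightarrow> complex" where "w x = exp (- (1 * of_real x))" for x
  have w: "w \<in> L2" unfolding w_def by (rule L2_exp) simp
  have w0: "w x \<noteq> 0" for x by (simp add: w_def)
  define s where "s n x = w x * f n x" for n x
  have "\<exists>r. strict_mono r \<and> (AE x in hl. Cauchy (\<lambda>i. s (r i) x))"
  proof (rule cauchy_L1_AE_cauchy_subseq)
    show "integrable hl (s n)" for n unfolding s_def by (rule L2_prod_integrable[OF w f])
    fix e :: real assume "e > 0"
    have np: "nrm w + 1 > 0" using nrm_nonneg[of w] by linarith
    then obtain N where N: "\<forall>m\<ge>N. \<forall>n\<ge>N. nrm (\<lambda>x. f m x - f n x) < e / (nrm w + 1)"
      using cauchy[of "e / (nrm w + 1)"] \<open>e > 0\<close> by auto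
    show "\<exists>N. \<forall>i\<ge>N. \<forall>j\<ge>N. (\<integral>x. norm (s i x - s j x) \<partial>hl) < e"
    proof (intro exI allI impI)
      fix i j assume ij: "i \<ge> N" "j \<ge> N"
      have "(\<integral>x. norm (s i x - s j x) \<partial>hl) = (\<integral>x. cmod (w x) * cmod (f i x - f j x) \<partial>hl)"
        by (simp add: s_def norm_mult right_diff_distrib[symmetric])
      also have "\<dots> \<le> nrm w * nrm (\<lambda>x. f i x - f j x)"
        by (intro Cauchy_Schwarz_norm w L2_diff f)
      also have "\<dots> \<le> (nrm w + 1) * nrm (\<lambda>x. f i x - f j x)"
        by (intro mult_right_mono) auto
      also have "\<dots> < (nrm w + 1) * (e / (nrm w + 1))"
        using N ij np by (intro mult_strict_left_mono) auto
      finally show "(\<integral>x. norm (s i x - s j x) \<partial>hl) < e" using np by simp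
    qed
  qed blast
  then obtain r :: "nat \<Rightarrow> nat" where r: "strict_mono r" "AE x in hl. Cauchy (\<lambda>i. s (r i) x)" by auto
  define g where "g x = lim (\<lambda>i. f (r i) x)" for x
  have conv: "AE x in hl. (\<lambda>i. f (r i) x) \<longlonglongrightarrow> g x"
    using r(2)
  proof eventually_elim
    case (elim x)
    then obtain l where "(\<lambda>i. s (r i) x) \<longlonglongrightarrow> l" by (auto simp: Cauchy_convergent_iff convergent_def)
    then have "(\<lambda>i. s (r i) x / w x) \<longlonglongrightarrow> l / w x" by (intro tendsto_intros) (auto simp: w0)
    then have "(\<lambda>i. f (r i) x) \<longlonglongrightarrow> l / w x" by (simp add: s_def w0)
    then show ?case unfolding g_def by (simp add: limI)
  qed
  have fm [measurable]: "f n \<in> borel_measurable hl" for n using f L2_meas by auto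
  have gm [measurable]: "g \<in> borel_measurable hl" unfolding g_def by measurable
  \<comment> \<open>Fatou along the subsequence gives square integrability of the difference
    together with its size; \<open>g\<close> itself is then recovered as
    \<open>f N - (f N - g)\<close>.\<close>
  have key: "(\<lambda>x. f n x - g x) \<in> L2 \<and> nrm (\<lambda>x. f n x - g x) \<le> e"
    if e: "e > 0" and N: "\<forall>m\<ge>N. \<forall>n\<ge>N. nrm (\<lambda>x. f m x - f n x) < e" and n: "n \<ge> N" for e N n
  proof -
    have "(\<integral>\<^sup>+x. ennreal ((cmod (f n x - g x))\<^sup>2) \<partial>hl)
       = (\<integral>\<^sup>+x. liminf (\<lambda>i. ennreal ((cmod (f n x - f (r i) x))\<^sup>2)) \<partial>hl)"
    proof (rule nn_integral_cong_AE, use conv in eventually_elim)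
      case (elim x)
      have "(\<lambda>i. ennreal ((cmod (f n x - f (r i) x))\<^sup>2)) \<longlonglongrightarrow> ennreal ((cmod (f n x - g x))\<^sup>2)"
        by (intro tendsto_intros elim) 
      from lim_imp_Liminf[OF sequentially_bot this] show ?case by simp
    qed
    also have "\<dots> \<le> liminf (\<lambda>i. \<integral>\<^sup>+x. ennreal ((cmod (f n x - f (r i) x))\<^sup>2) \<partial>hl)"
      by (rule nn_integral_liminf) measurable
    also have "\<dots> = liminf (\<lambda>i. ennreal ((nrm (\<lambda>x. f n x - f (r i) x))\<^sup>2))"
      using L2_sq[OF L2_diff[OF f f]] by (simp add: nrm_sq nn_integral_eq_integral)
    also have "\<dots> \<le> liminf (\<lambda>i. ennreal (e\<^sup>2))"
    proof (rule Liminf_mono, rule eventually_sequentiallyI)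
      fix i assume "i \<ge> N"
      then have "r i \<ge> N" using seq_suble[OF r(1), of i] by linarith
      then have "nrm (\<lambda>x. f n x - f (r i) x) \<le> e" using N n by (auto intro: less_imp_le)
      then show "ennreal ((nrm (\<lambda>x. f n x - f (r i) x))\<^sup>2) \<le> ennreal (e\<^sup>2)"
        by (intro ennreal_leI power_mono) auto
    qed
    finally have le: "(\<integral>\<^sup>+x. ennreal ((cmod (f n x - g x))\<^sup>2) \<partial>hl) \<le> ennreal (e\<^sup>2)"
      by (simp add: Liminf_const)
    have "integrable hl (\<lambda>x. (cmod (f n x - g x))\<^sup>2)"
    proof (rule integrableI_bounded)
      show "(\<lambda>x. (cmod (f n x - g x))\<^sup>2) \<in> borel_measurable hl" by measurable
      show "(\<integral>\<^sup>+x. ennreal (norm ((cmod (f n x - g x))\<^sup>2)) \<partial>hl) < \<infinity>"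
        using le_less_trans[OF le ennreal_less_top] by simp
    qed
    then have L: "(\<lambda>x. f n x - g x) \<in> L2" by (simp add: L2_iff)
    have "ennreal ((nrm (\<lambda>x. f n x - g x))\<^sup>2) \<le> ennreal (e\<^sup>2)"
      using le L2_sq[OF L] by (simp add: nrm_sq nn_integral_eq_integral)
    then have "(nrm (\<lambda>x. f n x - g x))\<^sup>2 \<le> e\<^sup>2" by (subst (asm) ennreal_le_iff) auto
    then have "nrm (\<lambda>x. f n x - g x) \<le> e" by (rule power2_le_imp_le) (use e in simp)
    with L show ?thesis by blast
  qed
  have "g \<in> L2"
  proof -
    obtain N where "\<forall>m\<ge>N. \<forall>n\<ge>N. nrm (\<lambda>x. f m x - f n x) < 1" using cauchy[of 1] by auto
    then have "(\<lambda>x. f N x - g x) \<in> L2" using key[of 1 N N] by simp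
    from L2_diff[OF f[of N] this] show ?thesis by simp
  qed
  moreover have "L2_lim f g"
    unfolding L2_lim_def
  proof (rule LIMSEQ_I)
    fix e :: real assume "e > 0"
    then obtain N where "\<forall>m\<ge>N. \<forall>n\<ge>N. nrm (\<lambda>x. f m x - f n x) < e / 2" using cauchy[of "e/2"] by auto
    then have "nrm (\<lambda>x. f n x - g x) \<le> e / 2" if "n \<ge> N" for n
      using key[of "e/2" N n] \<open>e > 0\<close> that by simp
    then show "\<exists>N. \<forall>n\<ge>N. norm (nrm (\<lambda>x. f n x - g x) - 0) < e"
      using \<open>e > 0\<close> by (intro exI[of _ N]) fastforce
  qed
  ultimately show ?thesis by blast
qed

text \<open>\<open>T\<close> is controlled only on functions cut off to some \<open>E n\<close>. The
  cutoffs converge in norm, so contractivity on them makes the images Cauchy. It serves twice: for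
  the transform, cut off in \<open>x\<close>, and for its formal adjoint, cut off in
  \<open>k\<close>. The limit is chosen separately for each \<open>f\<close>, which is why linearity
  comes back only up to \<open>aeq\<close>.\<close>

lemma L2_extension:
  fixes T :: "(real \<Rightarrow> complex) \<Rightarrow> real \<Rightarrow> complex" and E :: "nat \<Rightarrow> real set"
  defines "P \<equiv> \<lambda>n (f :: real \<Rightarrow> complex) x. indicator (E n) x * f x"
  assumes E: "\<And>n. E n \<in> sets borel" "\<And>x. x > 0 \<Longrightarrow> \<forall>\<^sub>F n in sequentially. x \<in> E n" "incseq E"
    and lin: "\<And>n f g c. f \<in> L2 \<Longrightarrow> g \<in> L2 \<Longrightarrow>
       aeq (T (P n (\<lambda>x. f x + c * g x))) (\<lambda>y. T (P n f) y + c * T (P n g) y)"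
    and bd: "\<And>n f. f \<in> L2 \<Longrightarrow> T (P n f) \<in> L2 \<and> nrm (T (P n f)) \<le> nrm (P n f)"
  shows "\<exists>S. (\<forall>f\<in>L2. S f \<in> L2 \<and> nrm (S f) \<le> nrm f \<and> L2_lim (\<lambda>n. T (P n f)) (S f)) \<and>
     (\<forall>f\<in>L2. \<forall>g\<in>L2. \<forall>c. aeq (S (\<lambda>x. f x + c * g x)) (\<lambda>y. S f y + c * S g y))"
proof -
  have PL: "P n f \<in> L2" if "f \<in> L2" for n f unfolding P_def
    by (rule L2_mult_bounded[OF that, where B=1])
      (auto simp: intro!: borel_measurable_hl borel_measurable_indicator[OF E(1)]
        split: split_indicator)
  have Plim: "L2_lim (\<lambda>n. P n f) f" if "f \<in> L2" for f
  proof (rule L2_lim_dominated[where h=f])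
    fix x :: real assume "x > 0"
    show "(\<lambda>n. P n f x) \<longlonglongrightarrow> f x"
      by (rule tendsto_eventually, rule eventually_mono[OF E(2)[OF \<open>x > 0\<close>]]) (simp add: P_def)
  qed (use that PL in \<open>auto simp: P_def indicator_def\<close>)
  have nP: "nrm (P n f) \<le> nrm f" if "f \<in> L2" for n f
  proof -
    have "(nrm (P n f))\<^sup>2 \<le> (nrm f)\<^sup>2" unfolding nrm_sq
      by (rule integral_mono) (use L2_sq[OF PL[OF that]] L2_sq[OF that] in \<open>auto simp: P_def indicator_def\<close>)
    then show ?thesis by (rule power2_le_imp_le) simp
  qed
  have TL: "T (P n f) \<in> L2" if "f \<in> L2" for n f using bd that by blast
  have diff: "nrm (\<lambda>y. T (P n f) y - T (P m f) y) \<le> nrm (\<lambda>x. P n f x - P m f x)" if "f \<in> L2" for m n f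
  proof -
    have *: "nrm (\<lambda>y. T (P n f) y - T (P m f) y) \<le> nrm (\<lambda>x. P n f x - P m f x)" if "m \<le> n" for m n
    proof -
      \<comment> \<open>Since \<open>E m\<close> lies in \<open>E n\<close>, both cutoffs and their
        difference are unchanged by the larger cutoff, so the hypotheses for the single index
        \<open>n\<close> apply to the difference.\<close>
      have PP: "P n (P m f) = P m f" "P n (P n f) = P n f"
        using that E(3) by (auto simp: P_def fun_eq_iff indicator_def incseq_def)
      have Pd: "P n (\<lambda>x. P n f x + (-1) * P m f x) = (\<lambda>x. P n f x + (-1) * P m f x)"
        using that E(3) by (auto simp: P_def fun_eq_iff indicator_def incseq_def)
      have "aeq (T (P n (\<lambda>x. P n f x + (-1) * P m f x))) (\<lambda>y. T (P n (P n f)) y + (-1) * T (P n (P m f)) y)"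
        by (intro lin PL \<open>f \<in> L2\<close>)
      then have "nrm (\<lambda>y. T (P n f) y + (-1) * T (P m f) y) = nrm (T (P n (\<lambda>x. P n f x + (-1) * P m f x)))"
        unfolding PP by (intro nrm_cong L2_meas L2_add L2_cmult TL PL \<open>f \<in> L2\<close>) (auto intro: aeq_sym)
      also have "\<dots> \<le> nrm (P n (\<lambda>x. P n f x + (-1) * P m f x))"
        by (intro bd[THEN conjunct2] L2_add L2_cmult PL \<open>f \<in> L2\<close>)
      finally show ?thesis unfolding Pd by simp
    qed
    show ?thesis
    proof (cases "m \<le> n")
      case False
      then have "nrm (\<lambda>y. T (P m f) y - T (P n f) y) \<le> nrm (\<lambda>x. P m f x - P n f x)" using *[of n m] by simp
      then show ?thesis
        using nrm_minus_commute[of "T (P m f)" "T (P n f)"] nrm_minus_commute[of "P m f" "P n f"] by simp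
    qed (rule *)
  qed
  have ex: "\<exists>g\<in>L2. L2_lim (\<lambda>n. T (P n f)) g" if f: "f \<in> L2" for f
  proof (rule L2_complete[OF TL[OF f]])
    fix e :: real assume "e > 0"
    then obtain N where N: "\<And>n. n \<ge> N \<Longrightarrow> nrm (\<lambda>x. P n f x - f x) < e / 2"
      using LIMSEQ_D[OF Plim[OF f, unfolded L2_lim_def], of "e/2"] by auto
    show "\<exists>N. \<forall>m\<ge>N. \<forall>n\<ge>N. nrm (\<lambda>x. T (P m f) x - T (P n f) x) < e"
    proof (intro exI allI impI)
      fix m n assume mn: "m \<ge> N" "n \<ge> N"
      have "nrm (\<lambda>x. T (P m f) x - T (P n f) x) \<le> nrm (\<lambda>x. P m f x - P n f x)"
        by (rule diff[OF f])
      also have "\<dots> \<le> nrm (\<lambda>x. P m f x - f x) + nrm (\<lambda>x. f x - P n f x)"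
        by (intro nrm_triangle3 PL f)
      also have "\<dots> < e / 2 + e / 2"
        using N[OF mn(1)] N[OF mn(2)] nrm_minus_commute[of f "P n f"] by simp
      finally show "nrm (\<lambda>x. T (P m f) x - T (P n f) x) < e" by simp
    qed
  qed
  define S where "S f = (SOME g. g \<in> L2 \<and> L2_lim (\<lambda>n. T (P n f)) g)" for f
  have S: "S f \<in> L2" "L2_lim (\<lambda>n. T (P n f)) (S f)" if "f \<in> L2" for f
    using someI_ex[of "\<lambda>g. g \<in> L2 \<and> L2_lim (\<lambda>n. T (P n f)) g"] ex[OF that] unfolding S_def by blast+
  have "nrm (S f) \<le> nrm f" if f: "f \<in> L2" for f
    by (rule L2_lim_nrm_le[OF TL[OF f] S[OF f]]) (use bd[OF f] nP[OF f] order_trans in blast)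
  moreover have "aeq (S (\<lambda>x. f x + c * g x)) (\<lambda>y. S f y + c * S g y)" if f: "f \<in> L2" and g: "g \<in> L2" for f g c
  proof (rule L2_lim_unique)
    have fg: "(\<lambda>x. f x + c * g x) \<in> L2" by (intro L2_add L2_cmult f g)
    show "L2_lim (\<lambda>n. T (P n (\<lambda>x. f x + c * g x))) (S (\<lambda>x. f x + c * g x))" by (rule S[OF fg])
    have "L2_lim (\<lambda>n y. T (P n f) y + c * T (P n g) y) (\<lambda>y. S f y + c * S g y)"
      by (intro L2_lim_add S TL f g)
    moreover have "nrm (\<lambda>y. T (P n f) y + c * T (P n g) y - (S f y + c * S g y))
       = nrm (\<lambda>y. T (P n (\<lambda>x. f x + c * g x)) y - (S f y + c * S g y))" for n
      by (rule nrm_cong) (use lin[OF f g, of n c] in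
        \<open>auto intro!: L2_meas L2_diff L2_add L2_cmult TL S f g simp: aeq_def elim: eventually_mono\<close>)
    ultimately show "L2_lim (\<lambda>n. T (P n (\<lambda>x. f x + c * g x))) (\<lambda>y. S f y + c * S g y)"
      by (simp add: L2_lim_def)
    show "T (P n (\<lambda>x. f x + c * g x)) \<in> L2" for n by (rule TL[OF fg])
  qed (intro S L2_add L2_cmult f g)+
  ultimately show ?thesis using S by blast
qed

section \<open>Absolutely continuous primitives\<close>

text \<open>Domination by the product, which Fubini integrates. Exchanges of integration order below
  rest on this form, with indicators put into the kernel where it is bounded only on a part of the
  plane.\<close>

lemma integrable_product_kernel:
  fixes A :: "'a \<Rightarrow> complex" and B :: "'b \<Rightarrow> complex"
  assumes "pair_sigma_finite M1 M2" "integrable M1 A" "integrable M2 B"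
    and K: "K \<in> borel_measurable (M1 \<Otimes>\<^sub>M M2)" "\<And>p. p \<in> space (M1 \<Otimes>\<^sub>M M2) \<Longrightarrow> cmod (K p) \<le> c"
  shows "integrable (M1 \<Otimes>\<^sub>M M2) (\<lambda>p. K p * (A (fst p) * B (snd p)))"
proof -
  interpret pair_sigma_finite M1 M2 by fact
  have [measurable]: "A \<in> borel_measurable M1" "B \<in> borel_measurable M2"
    using assms(2,3) by auto
  note K(1) [measurable]
  have "integrable (M1 \<Otimes>\<^sub>M M2) (\<lambda>p. A (fst p) * B (snd p))"
  proof (rule Fubini_integrable)
    show "(\<lambda>p. A (fst p) * B (snd p)) \<in> borel_measurable (M1 \<Otimes>\<^sub>M M2)" by measurable
    show "integrable M1 (\<lambda>x. \<integral>y. norm (A (fst (x, y)) * B (snd (x, y))) \<partial>M2)"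
      using assms(2,3) by (simp add: norm_mult)
    show "AE x in M1. integrable M2 (\<lambda>y. A (fst (x, y)) * B (snd (x, y)))"
      using assms(3) by simp
  qed
  then have i: "integrable (M1 \<Otimes>\<^sub>M M2) (\<lambda>p. c * norm (A (fst p) * B (snd p)))"
    by (intro integrable_mult_right integrable_norm)
  show ?thesis
  proof (rule Bochner_Integration.integrable_bound[OF i])
    show "AE p in M1 \<Otimes>\<^sub>M M2. norm (K p * (A (fst p) * B (snd p))) \<le> norm (c * norm (A (fst p) * B (snd p)))"
    proof (rule AE_I2)
      fix p assume "p \<in> space (M1 \<Otimes>\<^sub>M M2)"
      from K(2)[OF this] have "cmod (K p) \<le> \<bar>c\<bar>" by simp
      then show "norm (K p * (A (fst p) * B (snd p))) \<le> norm (c * norm (A (fst p) * B (snd p)))"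
        by (simp add: norm_mult mult_right_mono abs_mult)
    qed
  qed measurable
qed

text \<open>\<open>acp v w\<close>: on \<open>[0,\<infinity>)\<close> the function \<open>v\<close> is a locally absolutely continuous primitive of \<open>w\<close>.\<close>

definition acp :: "(real \<Rightarrow> complex) \<Rightarrow> (real \<Rightarrow> complex) \<Rightarrow> bool" where
  "acp v w \<longleftrightarrow> (\<forall>x\<ge>0. set_integrable lborel {0..x} w \<and> v x = v 0 + (LINT t:{0..x}|lborel. w t))"

lemma acpD: assumes "acp v w" "x \<ge> 0"
  shows "set_integrable lborel {0..x} w" "v x = v 0 + (LINT t:{0..x}|lborel. w t)"
  using assms unfolding acp_def by blast+

lemma acpI:
  assumes "\<And>x. x \<ge> 0 \<Longrightarrow> set_integrable lborel {0..x} w"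
    "\<And>x. x \<ge> 0 \<Longrightarrow> v x = v 0 + (LINT t:{0..x}|lborel. w t)"
  shows "acp v w"
  using assms unfolding acp_def by blast

lemma acp_add: assumes v: "acp v w" and v': "acp v' w'" shows "acp (\<lambda>x. v x + v' x) (\<lambda>x. w x + w' x)"
proof (rule acpI)
  fix x :: real assume x: "x \<ge> 0"
  note i = acpD(1)[OF v x] acpD(1)[OF v' x]
  show "set_integrable lborel {0..x} (\<lambda>x. w x + w' x)" by (rule set_integral_add(1)[OF i])
  have "(LINT t:{0..x}|lborel. w t + w' t) = (v x - v 0) + (v' x - v' 0)"
    unfolding set_integral_add(2)[OF i] acpD(2)[OF v x] acpD(2)[OF v' x] by simp
  then show "v x + v' x = v 0 + v' 0 + (LINT t:{0..x}|lborel. w t + w' t)" by simp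
qed

lemma acp_cmult: assumes v: "acp v w" shows "acp (\<lambda>x. c * v x) (\<lambda>x. c * w x)"
proof (rule acpI)
  fix x :: real assume x: "x \<ge> 0"
  show "set_integrable lborel {0..x} (\<lambda>x. c * w x)"
    by (rule set_integrable_mult_right) (rule acpD(1)[OF v x])
  have "(LINT t:{0..x}|lborel. c * w t) = c * (v x - v 0)"
    unfolding acpD(2)[OF v x] by (simp add: set_integral_mult_right)
  then show "c * v x = c * v 0 + (LINT t:{0..x}|lborel. c * w t)" by (simp add: algebra_simps)
qed

lemma acp_cnj: "acp v w \<Longrightarrow> acp (\<lambda>x. cnj (v x)) (\<lambda>x. cnj (w x))"
proof -
  assume a: "acp v w"
  have *: "(\<lambda>t. indicat_real {0..x} t *\<^sub>R cnj (w t)) = (\<lambda>t. cnj (indicat_real {0..x} t *\<^sub>R w t))" for x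
    by (simp add: fun_eq_iff)
  show ?thesis unfolding acp_def
  proof (intro allI impI conjI)
    fix x :: real assume x: "x \<ge> 0"
    show "set_integrable lborel {0..x} (\<lambda>x. cnj (w x))"
      using acpD(1)[OF a x] unfolding set_integrable_def * by (rule integrable_cnj)
    have "(LINT t:{0..x}|lborel. cnj (w t)) = cnj (LINT t:{0..x}|lborel. w t)"
      unfolding set_lebesgue_integral_def * by (rule Bochner_Integration.integral_cnj)
    then show "cnj (v x) = cnj (v 0) + (LINT t:{0..x}|lborel. cnj (w t))"
      using acpD(2)[OF a x] by (metis complex_cnj_add)
  qed
qed

lemma acp_uminus: "acp v w \<Longrightarrow> acp (\<lambda>x. - v x) (\<lambda>x. - w x)"
  using acp_cmult[of v w "-1"] by simp

lemma acp_diff: "acp v w \<Longrightarrow> acp v' w' \<Longrightarrow> acp (\<lambda>x. v x - v' x) (\<lambda>x. w x - w' x)"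
  using acp_add[of v w "\<lambda>x. - v' x" "\<lambda>x. - w' x"] acp_uminus[of v' w'] by simp

lemma acp_const: "acp (\<lambda>x. c) (\<lambda>x. 0)"
  by (simp add: acp_def set_lebesgue_integral_def set_integrable_def)

lemma acp_sum: "(\<And>i. i \<in> I \<Longrightarrow> acp (v i) (w i)) \<Longrightarrow> acp (\<lambda>x. \<Sum>i\<in>I. v i x) (\<lambda>x. \<Sum>i\<in>I. w i x)"
proof (induction I rule: infinite_finite_induct)
  case (insert i I)
  then have "acp (\<lambda>x. v i x + (\<Sum>i\<in>I. v i x)) (\<lambda>x. w i x + (\<Sum>i\<in>I. w i x))" by (intro acp_add) auto
  then show ?case using insert by simp
qed (simp_all add: acp_const)

lemma acp_continuous: assumes "acp v w" shows "continuous_on {0..} v"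
proof -
  have X: "continuous_on {0..X} v" if "X \<ge> 0" for X
  proof -
    have "w integrable_on {0..X}" by (rule set_borel_integral_eq_integral(1)[OF acpD(1)[OF assms that]])
    then have "continuous_on {0..X} (\<lambda>x. v 0 + integral {0..x} w)"
      by (intro continuous_intros indefinite_integral_continuous_1)
    then show ?thesis
    proof (rule continuous_on_eq)
      fix x assume "x \<in> {0..X}"
      then have "x \<ge> 0" by simp
      from acpD[OF assms this] set_borel_integral_eq_integral(2)[OF acpD(1)[OF assms this]]
      show "v 0 + integral {0..x} w = v x" by simp
    qed
  qed
  show ?thesis
    unfolding continuous_on_eq_continuous_within
  proof
    fix x :: real assume "x \<in> {0..}"
    then have "continuous (at x within {0..x+1}) v"
      using X[of "x+1"] by (simp add: continuous_on_eq_continuous_within)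
    moreover have "at x within {0..x+1} = at x within {0..}"
      by (rule at_within_nhd[of x "{..<x+1}"]) auto
    ultimately show "continuous (at x within {0..}) v" by simp
  qed
qed

lemma continuous_on_measurable_hl: "continuous_on {0<..} f \<Longrightarrow> f \<in> borel_measurable hl"
  using borel_measurable_continuous_on_restrict[of "{0<..}" f]
  by (simp cong: measurable_cong_sets add: sets_restrict_space)

lemma acp_meas: "acp v w \<Longrightarrow> v \<in> borel_measurable hl"
  by (intro continuous_on_measurable_hl) (rule continuous_on_subset[OF acp_continuous], auto)

lemma set_integral_half_open:
  fixes a :: "real \<Rightarrow> complex"
  assumes "set_integrable lborel {0..t} a"
  shows "(LINT s:{0..<t}|lborel. a s) = (LINT s:{0..t}|lborel. a s)"
proof (rule set_integral_cong_set)
  show "AE x in lborel. (x \<in> {0..t}) = (x \<in> {0..<t})"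
    using AE_lborel_singleton[of t] by eventually_elim auto
  have "set_integrable lborel {0..<t} a" by (rule set_integrable_subset[OF assms]) auto
  then show "set_borel_measurable lborel {0..<t} a" "set_borel_measurable lborel {0..t} a"
    using assms by (auto simp: set_borel_measurable_def set_integrable_def)
qed

text \<open>The product of the integrals of \<open>a\<close> and \<open>b\<close> is a double
  integral over the square \<open>[0,x]^2\<close>; splitting the square along its diagonal and
  integrating over each triangle by Fubini gives the product rule.\<close>

lemma acp_mult:
  assumes v: "acp v a" and w: "acp w b"
  shows "acp (\<lambda>x. v x * w x) (\<lambda>x. a x * w x + v x * b x)"
  unfolding acp_def
proof (intro allI impI conjI)
  fix x :: real assume x: "x \<ge> 0"
  define A where "A s = indicator {0..x} s *\<^sub>R a s" for s
  define B where "B s = indicator {0..x} s *\<^sub>R b s" for s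
  have A: "integrable lborel A" and B: "integrable lborel B"
    using acpD(1)[OF v x] acpD(1)[OF w x] by (simp_all add: A_def[abs_def] B_def[abs_def] set_integrable_def)
  note [measurable] = borel_measurable_integrable[OF A] borel_measurable_integrable[OF B]
  have cutv: "integrable lborel (\<lambda>s. indicator {0..x} s *\<^sub>R (u s * f s))"
    if u: "continuous_on {0..x} u" and f: "integrable lborel (\<lambda>s. indicator {0..x} s *\<^sub>R f s)"
    for u f :: "real \<Rightarrow> complex"
  proof -
    have "compact (u ` {0..x})" by (rule compact_continuous_image[OF u]) simp
    then obtain c where c: "\<And>s. s \<in> {0..x} \<Longrightarrow> cmod (u s) \<le> c"
      by (meson compact_imp_bounded bounded_iff imageI)
    have um: "(\<lambda>s. indicator {0..x} s *\<^sub>R u s) \<in> borel_measurable borel"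
      by (rule borel_measurable_continuous_on_indicator) (use u in auto)
    have fm: "(\<lambda>s. indicator {0..x} s *\<^sub>R f s) \<in> borel_measurable borel" using f by auto
    have "integrable lborel (\<lambda>s. c * norm (indicator {0..x} s *\<^sub>R f s))"
      by (intro integrable_mult_right integrable_norm f)
    then show ?thesis
    proof (rule Bochner_Integration.integrable_bound)
      have "(\<lambda>s. (indicator {0..x} s *\<^sub>R u s) * (indicator {0..x} s *\<^sub>R f s)) \<in> borel_measurable borel"
        by (intro borel_measurable_times um fm)
      also have "(\<lambda>s. (indicator {0..x} s *\<^sub>R u s) * (indicator {0..x} s *\<^sub>R f s))
        = (\<lambda>s. indicator {0..x} s *\<^sub>R (u s * f s))" by (auto simp: indicator_def)
      finally show "(\<lambda>s. indicator {0..x} s *\<^sub>R (u s * f s)) \<in> borel_measurable lborel" by simp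
      show "AE s in lborel. norm (indicator {0..x} s *\<^sub>R (u s * f s)) \<le> norm (c * norm (indicator {0..x} s *\<^sub>R f s))"
      proof (rule AE_I2)
        fix s :: real
        show "norm (indicator {0..x} s *\<^sub>R (u s * f s)) \<le> norm (c * norm (indicator {0..x} s *\<^sub>R f s))"
        proof (cases "s \<in> {0..x}")
          case True
          then have "cmod (u s) \<le> \<bar>c\<bar>" using c[OF True] by simp
          then show ?thesis using True by (simp add: norm_mult mult_right_mono abs_mult)
        qed simp
      qed
    qed
  qed
  have cv: "continuous_on {0..x} v" and cw: "continuous_on {0..x} w"
    using acp_continuous[OF v] acp_continuous[OF w] by (auto intro: continuous_on_subset)
  have i1: "integrable lborel (\<lambda>s. w s * A s)" and i2: "integrable lborel (\<lambda>s. v s * B s)"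
    using cutv[OF cw, of a] cutv[OF cv, of b] A B by (simp_all add: A_def[abs_def] B_def[abs_def])
  show "set_integrable lborel {0..x} (\<lambda>x. a x * w x + v x * b x)"
    unfolding set_integrable_def scaleR_add_right
    using i1 i2 by (intro Bochner_Integration.integrable_add) (simp_all add: A_def[abs_def] B_def[abs_def] mult.commute)
  \<comment> \<open>The closed lower and the open upper triangle partition the plane exactly; the
    half-open integral produced by the open one is matched with the closed one by
    \<open>set_integral_half_open\<close>.\<close>
  define T :: "(real \<times> real) \<Rightarrow> complex" where "T p = (if snd p \<le> fst p then 1 else 0)" for p
  define T' :: "(real \<times> real) \<Rightarrow> complex" where "T' p = (if fst p < snd p then 1 else 0)" for p
  have iT: "integrable (lborel \<Otimes>\<^sub>M lborel) (\<lambda>p. T p * (A (fst p) * B (snd p)))"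
    by (rule integrable_product_kernel[OF _ A B, where c=1]) (unfold_locales, auto simp: T_def)
  have iT': "integrable (lborel \<Otimes>\<^sub>M lborel) (\<lambda>p. T' p * (A (fst p) * B (snd p)))"
    by (rule integrable_product_kernel[OF _ A B, where c=1]) (unfold_locales, auto simp: T'_def)
  have iAB: "integrable (lborel \<Otimes>\<^sub>M lborel) (\<lambda>p. 1 * (A (fst p) * B (snd p)))"
    by (rule integrable_product_kernel[OF _ A B, where c=1]) (unfold_locales, auto)
  have 1: "(\<integral>p. T p * (A (fst p) * B (snd p)) \<partial>(lborel \<Otimes>\<^sub>M lborel)) = (\<integral>s. A s * (w s - w 0) \<partial>lborel)"
  proof -
    have "(\<integral>p. T p * (A (fst p) * B (snd p)) \<partial>(lborel \<Otimes>\<^sub>M lborel))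
      = (\<integral>s. (\<integral>t. T (s,t) * (A s * B t) \<partial>lborel) \<partial>lborel)"
      using lborel_pair.integral_fst'[OF iT] by simp
    also have "\<dots> = (\<integral>s. A s * (w s - w 0) \<partial>lborel)"
    proof (rule Bochner_Integration.integral_cong[OF refl])
      fix s :: real
      show "(\<integral>t. T (s,t) * (A s * B t) \<partial>lborel) = A s * (w s - w 0)"
      proof (cases "s \<in> {0..x}")
        case True
        have "(\<integral>t. T (s,t) * (A s * B t) \<partial>lborel) = (\<integral>t. A s * (indicator {0..s} t *\<^sub>R b t) \<partial>lborel)"
          using True by (intro Bochner_Integration.integral_cong) (auto simp: T_def B_def indicator_def)
        also have "\<dots> = A s * (LINT t:{0..s}|lborel. b t)"
          unfolding set_lebesgue_integral_def by (rule integral_mult_right_zero)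
        also have "\<dots> = A s * (w s - w 0)"
          using trans[OF acpD(2)[OF w, of s] add.commute] True by simp
        finally show ?thesis .
      qed (simp add: A_def)
    qed
    finally show ?thesis .
  qed
  have 2: "(\<integral>p. T' p * (A (fst p) * B (snd p)) \<partial>(lborel \<Otimes>\<^sub>M lborel)) = (\<integral>t. B t * (v t - v 0) \<partial>lborel)"
  proof -
    have "(\<integral>p. T' p * (A (fst p) * B (snd p)) \<partial>(lborel \<Otimes>\<^sub>M lborel))
      = (\<integral>t. (\<integral>s. T' (s,t) * (A s * B t) \<partial>lborel) \<partial>lborel)"
      using lborel_pair.integral_snd[of "\<lambda>s t. T' (s,t) * (A s * B t)"] iT'
      by (simp add: case_prod_beta')
    also have "\<dots> = (\<integral>t. B t * (v t - v 0) \<partial>lborel)"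
    proof (rule Bochner_Integration.integral_cong[OF refl])
      fix t :: real
      show "(\<integral>s. T' (s,t) * (A s * B t) \<partial>lborel) = B t * (v t - v 0)"
      proof (cases "t \<in> {0..x}")
        case True
        have "(\<integral>s. T' (s,t) * (A s * B t) \<partial>lborel) = (\<integral>s. B t * (indicator {0..<t} s *\<^sub>R a s) \<partial>lborel)"
          using True by (intro Bochner_Integration.integral_cong) (auto simp: T'_def A_def indicator_def)
        also have "\<dots> = B t * (LINT s:{0..<t}|lborel. a s)"
          unfolding set_lebesgue_integral_def by (rule integral_mult_right_zero)
        also have "\<dots> = B t * (LINT s:{0..t}|lborel. a s)"
          using set_integral_half_open[OF acpD(1)[OF v, of t]] True by simp
        also have "\<dots> = B t * (v t - v 0)"
          using trans[OF acpD(2)[OF v, of t] add.commute] True by simp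
        finally show ?thesis .
      qed (simp add: B_def)
    qed
    finally show ?thesis .
  qed
  have "(\<integral>s. A s \<partial>lborel) * (\<integral>t. B t \<partial>lborel)
    = (\<integral>p. A (fst p) * B (snd p) \<partial>(lborel \<Otimes>\<^sub>M lborel))"
    using lborel_pair.integral_fst'[OF iAB] by simp
  also have "\<dots> = (\<integral>p. T p * (A (fst p) * B (snd p)) + T' p * (A (fst p) * B (snd p)) \<partial>(lborel \<Otimes>\<^sub>M lborel))"
    by (intro Bochner_Integration.integral_cong) (auto simp: T_def T'_def)
  also have "\<dots> = (\<integral>s. A s * (w s - w 0) \<partial>lborel) + (\<integral>t. B t * (v t - v 0) \<partial>lborel)"
    using iT iT' 1 2 by simp
  also have "\<dots> = (\<integral>s. w s * A s \<partial>lborel) - w 0 * (\<integral>s. A s \<partial>lborel)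
      + ((\<integral>s. v s * B s \<partial>lborel) - v 0 * (\<integral>s. B s \<partial>lborel))"
    using i1 i2 A B by (simp add: algebra_simps)
  finally have eq: "(\<integral>s. w s * A s \<partial>lborel) + (\<integral>s. v s * B s \<partial>lborel)
     = (\<integral>s. A s \<partial>lborel) * (\<integral>t. B t \<partial>lborel) + w 0 * (\<integral>s. A s \<partial>lborel) + v 0 * (\<integral>s. B s \<partial>lborel)"
    by (simp add: algebra_simps)
  have "(LINT s:{0..x}|lborel. a s * w s + v s * b s) = (\<integral>s. w s * A s + v s * B s \<partial>lborel)"
    unfolding set_lebesgue_integral_def
    by (intro Bochner_Integration.integral_cong) (auto simp: A_def B_def indicator_def)
  also have "\<dots> = (\<integral>s. w s * A s \<partial>lborel) + (\<integral>s. v s * B s \<partial>lborel)" using i1 i2 by simp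
  finally have L: "(LINT s:{0..x}|lborel. a s * w s + v s * b s)
     = (\<integral>s. A s \<partial>lborel) * (\<integral>t. B t \<partial>lborel) + w 0 * (\<integral>s. A s \<partial>lborel) + v 0 * (\<integral>s. B s \<partial>lborel)"
    using eq by simp
  have "v x = v 0 + (\<integral>s. A s \<partial>lborel)" "w x = w 0 + (\<integral>s. B s \<partial>lborel)"
    using acpD(2)[OF v x] acpD(2)[OF w x] by (simp_all add: set_lebesgue_integral_def A_def B_def)
  then show "v x * w x = v 0 * w 0 + (LINT s:{0..x}|lborel. a s * w s + v s * b s)"
    unfolding L by (simp add: algebra_simps)
qed

lemma acp_deriv:
  assumes "\<And>x. (v has_vector_derivative w x) (at x)" "continuous_on UNIV w"
  shows "acp v w"
  unfolding acp_def
proof (intro allI impI conjI)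
  fix x :: real assume x: "x \<ge> 0"
  have c: "continuous_on {0..x} w" using assms(2) by (rule continuous_on_subset) simp
  show i: "set_integrable lborel {0..x} w"
    unfolding set_integrable_def by (rule borel_integrable_compact) (use c in auto)
  have "(w has_integral (v x - v 0)) {0..x}"
    using x assms(1) by (intro fundamental_theorem_of_calculus) (auto intro: has_vector_derivative_at_within)
  then show "v x = v 0 + (LINT t:{0..x}|lborel. w t)"
    by (simp add: set_borel_integral_eq_integral(2)[OF i] integral_unique)
qed

lemma acp_exp: "acp (\<lambda>x. exp (p * of_real x)) (\<lambda>x. p * exp (p * of_real x))"
proof (rule acp_deriv)
  show "((\<lambda>x. exp (p * of_real x)) has_vector_derivative p * exp (p * of_real x)) (at x)" for x :: real
    by (auto intro!: derivative_eq_intros has_vector_derivative_real_field)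
qed (intro continuous_intros)

text \<open>Applied to a \<open>wronskian\<close>, this turns Lagrange's identity into boundary
  terms at 0 and at infinity. The point 0, present in \<open>acp\<close> but absent from
  \<open>hl\<close>, is null.\<close>

lemma acp_tendsto:
  assumes v: "acp v w" and w: "integrable hl w"
  shows "(v \<longlongrightarrow> v 0 + (\<integral>x. w x \<partial>hl)) at_top"
proof -
  have ae: "AE x in lborel. x \<in> {0..} \<longleftrightarrow> x \<in> {0::real<..}"
    using AE_lborel_singleton[of 0] by eventually_elim auto
  have w': "set_integrable lborel {0<..} w" using w by (simp add: integrable_hl_iff)
  have m: "(\<lambda>x. indicator {0..} x *\<^sub>R w x) \<in> borel_measurable lborel"
  proof -
    have "(\<lambda>x. indicator {0<..} x *\<^sub>R w x + indicator {0} x *\<^sub>R w 0) \<in> borel_measurable lborel"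
      using w' unfolding set_integrable_def by (intro borel_measurable_add) auto
    also have "(\<lambda>x. indicator {0<..} x *\<^sub>R w x + indicator {0} x *\<^sub>R w 0) = (\<lambda>x. indicator {0..} x *\<^sub>R w x)"
      by (auto simp: indicator_def)
    finally show ?thesis .
  qed
  have i: "set_integrable lborel {0..} w"
  proof -
    have "integrable lborel (\<lambda>x. indicator {0..} x *\<^sub>R w x) = integrable lborel (\<lambda>x. indicator {0<..} x *\<^sub>R w x)"
      using m w' ae by (intro integrable_cong_AE) (auto simp: set_integrable_def indicator_def elim!: eventually_mono)
    then show ?thesis using w' by (simp add: set_integrable_def)
  qed
  have e: "(LINT x:{0..}|lborel. w x) = (\<integral>x. w x \<partial>hl)"
    unfolding integral_hl[symmetric] 
    by (rule set_integral_cong_set) (use m w' ae in \<open>auto simp: set_borel_measurable_def set_integrable_def\<close>)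
  have "((\<lambda>x. v 0 + (LINT t:{0..x}|lborel. w t)) \<longlongrightarrow> v 0 + (LINT x:{0..}|lborel. w x)) at_top"
    by (intro tendsto_intros tendsto_set_lebesgue_integral_at_top[OF _ i]) auto
  then show ?thesis unfolding e
  proof (rule Lim_transform_eventually)
    show "\<forall>\<^sub>F x in at_top. v 0 + (LINT t:{0..x}|lborel. w t) = v x"
      using eventually_ge_at_top[of 0] by eventually_elim (rule acpD(2)[OF v, symmetric])
  qed
qed

text \<open>A nonzero limit would keep the modulus above a positive constant on a half-line, which
  has infinite measure.\<close>

lemma integrable_tendsto_zero:
  fixes f :: "real \<Rightarrow> complex"
  assumes i: "integrable hl f" and l: "(f \<longlongrightarrow> l) at_top"
  shows "l = 0"
proof (rule ccontr)
  assume "l \<noteq> 0"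
  have "((\<lambda>x. cmod (f x)) \<longlongrightarrow> cmod l) at_top" by (intro tendsto_intros l)
  then have "\<forall>\<^sub>F x in at_top. cmod l / 2 < cmod (f x)"
    by (rule order_tendstoD) (use \<open>l \<noteq> 0\<close> in simp)
  then obtain X where X: "\<And>x. x \<ge> X \<Longrightarrow> cmod l / 2 < cmod (f x)"
    by (auto simp: eventually_at_top_linorder)
  define Y where "Y = max X 1"
  have "integrable hl (\<lambda>x. 2 / cmod l * norm (f x))" by (intro integrable_mult_right integrable_norm i)
  then have "integrable hl (indicator {Y..} :: real \<Rightarrow> real)"
  proof (rule Bochner_Integration.integrable_bound)
    show "AE x in hl. norm (indicator {Y..} x :: real) \<le> norm (2 / cmod l * norm (f x))"
    proof (rule AE_I2)
      fix x
      show "norm (indicator {Y..} x :: real) \<le> norm (2 / cmod l * norm (f x))"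
        using X[of x] \<open>l \<noteq> 0\<close> by (auto simp: indicator_def Y_def field_simps)
    qed
  qed (rule borel_measurable_hl, simp)
  then have "integrable lborel (\<lambda>x. indicator {0<..} x *\<^sub>R (indicator {Y..} x :: real))"
    by (simp add: integrable_hl_iff set_integrable_def)
  also have "(\<lambda>x. indicator {0<..} x *\<^sub>R (indicator {Y..} x :: real)) = indicator {Y..}"
    by (auto simp: indicator_def Y_def)
  finally have "emeasure lborel {Y..} < \<infinity>" by (simp add: integrable_indicator_iff)
  moreover have "ennreal n \<le> emeasure lborel {Y..}" for n :: nat
    using emeasure_mono[of "{Y..Y + n}" "{Y..}" lborel] by (simp add: ennreal_of_nat_eq_real_of_nat)
  ultimately show False
    by (metis ennreal_of_nat_eq_real_of_nat infinity_ennreal_def linorder_not_less of_nat_less_top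
        ennreal_SUP_of_nat_eq_top SUP_least top.extremum_unique order_less_imp_not_eq)
qed

text \<open>\<open>|v|^2\<close> has the integrable derivative \<open>2 Re (w cnj v)\<close>, hence
  a limit at infinity, and being integrable itself it can only tend to 0.\<close>

lemma acp_decay:
  assumes v: "acp v w" and "v \<in> L2" "w \<in> L2"
  shows "(v \<longlongrightarrow> 0) at_top"
proof -
  have p: "acp (\<lambda>x. v x * cnj (v x)) (\<lambda>x. w x * cnj (v x) + v x * cnj (w x))"
    by (rule acp_mult[OF v acp_cnj[OF v]])
  have "integrable hl (\<lambda>x. w x * cnj (v x) + v x * cnj (w x))"
    by (intro Bochner_Integration.integrable_add ip_integrable assms)
  from acp_tendsto[OF p this] obtain l where l: "((\<lambda>x. v x * cnj (v x)) \<longlongrightarrow> l) at_top" by blast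
  have "l = 0" by (rule integrable_tendsto_zero[OF ip_integrable[OF assms(2,2)] l])
  with l have "((\<lambda>x. cmod (v x * cnj (v x))) \<longlongrightarrow> 0) at_top"
    using tendsto_norm by fastforce
  then have "((\<lambda>x. sqrt ((cmod (v x))\<^sup>2)) \<longlongrightarrow> sqrt 0) at_top"
    by (intro tendsto_real_sqrt) (simp add: norm_mult power2_eq_square)
  then show ?thesis by (simp add: tendsto_norm_zero_iff)
qed

text \<open>Closed rays are an intersection-stable generator of the Borel sets, and the sets over
  which the integral vanishes are stable under complements, where the total integral enters, and
  under disjoint unions.\<close>

lemma AE_zero_if_initial_integrals_zero:
  fixes f :: "real \<Rightarrow> 'a::{second_countable_topology, banach}"
  assumes f: "integrable lborel f" and 0: "(\<integral>x. f x \<partial>lborel) = 0"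
    and z: "\<And>b. (LINT x:{..b}|lborel. f x) = 0"
  shows "AE x in lborel. f x = 0"
proof (rule sigma_finite_measure.density_zero[OF lborel.sigma_finite_measure_axioms f])
  have si: "set_integrable lborel A f" if "A \<in> sets borel" for A
    using f that unfolding set_integrable_def by (intro integrable_mult_indicator) auto
  fix A :: "real set" assume "A \<in> sets lborel"
  then have "A \<in> sigma_sets UNIV (range atMost)"
    by (simp add: borel_eq_atMost)
  have "Int_stable (range (atMost :: real \<Rightarrow> real set))"
    by (auto simp: Int_stable_def)
  moreover have "range (atMost :: real \<Rightarrow> real set) \<subseteq> Pow UNIV" by simp
  ultimately show "(LINT x:A|lborel. f x) = 0"
    using \<open>A \<in> sigma_sets UNIV (range atMost)\<close>
  proof (induction A rule: sigma_sets_induct_disjoint)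
    case (basic A) then show ?case using z by auto
  next
    case empty then show ?case by (simp add: set_lebesgue_integral_def)
  next
    case (compl A)
    then have A: "A \<in> sets borel" by (simp add: borel_eq_atMost)
    have "(LINT x:A \<union> (UNIV - A)|lborel. f x) = (LINT x:A|lborel. f x) + (LINT x:UNIV - A|lborel. f x)"
      by (rule set_integral_Un) (use A in \<open>auto intro!: si\<close>)
    then show ?case using compl 0 by (simp add: set_lebesgue_integral_def)
  next
    case (union A)
    then have A: "A i \<in> sets borel" for i by (auto simp: borel_eq_atMost)
    have "(LINT x:(\<Union>i. A i)|lborel. f x) = (\<Sum>i. (LINT x:(A i)|lborel. f x))"
      by (rule lebesgue_integral_countable_add)
        (use A union in \<open>auto intro!: si simp: disjoint_family_on_def\<close>)
    then show ?case using union by simp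
  qed
qed

lemma AE_zero_if_primitive_zero:
  assumes "\<And>x. x \<ge> 0 \<Longrightarrow> set_integrable lborel {0..x} w" "\<And>x. x \<ge> 0 \<Longrightarrow> (LINT t:{0..x}|lborel. w t) = (0::complex)"
  shows "aeq w (\<lambda>x. 0)"
proof -
  have "AE x in lborel. indicator {0..real n} x *\<^sub>R w x = 0" for n
  proof (rule AE_zero_if_initial_integrals_zero)
    show "integrable lborel (\<lambda>x. indicator {0..real n} x *\<^sub>R w x)"
      using assms(1)[of n] by (simp add: set_integrable_def)
    show "(\<integral>x. indicator {0..real n} x *\<^sub>R w x \<partial>lborel) = 0"
      using assms(2)[of n] by (simp add: set_lebesgue_integral_def)
    fix b :: real
    have "(LINT x:{..b}|lborel. indicator {0..real n} x *\<^sub>R w x) = (LINT x:{0..min (real n) b}|lborel. w x)"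
      unfolding set_lebesgue_integral_def
      by (intro Bochner_Integration.integral_cong) (auto simp: indicator_def)
    also have "\<dots> = 0"
      using assms(2)[of "min (real n) b"] by (cases "b \<ge> 0") (auto simp: set_lebesgue_integral_def)
    finally show "(LINT x:{..b}|lborel. indicator {0..real n} x *\<^sub>R w x) = 0" .
  qed
  then have "AE x in lborel. \<forall>n. indicator {0..real n} x *\<^sub>R w x = 0" by (subst AE_all_countable) simp
  then show ?thesis unfolding aeq_def
  proof (rule AE_mp, intro AE_I2 impI)
    fix x :: real assume "\<forall>n. indicator {0..real n} x *\<^sub>R w x = 0" "0 < x"
    moreover obtain n where "x \<le> real n" using real_arch_simple by blast
    ultimately show "w x = 0" by (metis atLeastAtMost_iff indicator_simps(1) less_imp_le scaleR_one)
  qed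
qed

text \<open>A continuous function vanishing almost everywhere on the half-line vanishes everywhere
  there, and at 0 by continuity, so all increments of the primitive are 0. In this way a null class
  passes from a function to its derivatives.\<close>

lemma acp_aeq_zero:
  assumes v: "acp v w" and z: "aeq v (\<lambda>x. 0)"
  shows "aeq w (\<lambda>x. 0)"
proof -
  have "v x = 0" if "x > 0" for x
  proof (rule ccontr)
    assume "v x \<noteq> 0"
    have "continuous_on {0<..} v" by (rule continuous_on_subset[OF acp_continuous[OF v]]) auto
    then have "open ({0<..} \<inter> v -` (- {0}))" by (intro continuous_open_preimage) auto
    moreover have "x \<in> {0<..} \<inter> v -` (- {0})" using that \<open>v x \<noteq> 0\<close> by auto
    moreover have "AE x in lborel. x \<notin> {0<..} \<inter> v -` (- {0})"
      using z unfolding aeq_def by (auto elim: eventually_mono)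
    then have "{0<..} \<inter> v -` (- {0}) \<in> null_sets lborel"
      using \<open>open ({0<..} \<inter> v -` (- {0}))\<close> by (subst AE_iff_null_sets) auto
    then have "negligible ({0<..} \<inter> v -` (- {0}))"
      unfolding negligible_iff_null_sets by (rule null_sets_completionI)
    ultimately show False using open_not_negligible by blast
  qed
  then have eq: "v x = 0" if "x > 0" for x using that by blast
  have "(v \<longlongrightarrow> v 0) (at_right 0)"
  proof (rule tendsto_within_subset)
    show "(v \<longlongrightarrow> v 0) (at 0 within {0..})" using acp_continuous[OF v] by (simp add: continuous_on)
  qed auto
  moreover have "(v \<longlongrightarrow> 0) (at_right 0)"
    by (rule tendsto_eventually) (auto simp: eventually_at_right_field eq intro!: exI[of _ 1])
  ultimately have "v 0 = 0" by (metis tendsto_unique trivial_limit_at_right_real)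
  then have "(LINT t:{0..x}|lborel. w t) = 0" if "x \<ge> 0" for x
  proof -
    have "v x = 0" using eq[of x] \<open>v 0 = 0\<close> that by (cases "x = 0") auto
    then show ?thesis using acpD(2)[OF v that] \<open>v 0 = 0\<close> by simp
  qed
  then show ?thesis by (intro AE_zero_if_primitive_zero acpD(1)[OF v])
qed

section \<open>First-order equations on the half-line\<close>

lemma set_integrable_Icc_iff:
  fixes f :: "real \<Rightarrow> complex"
  assumes "set_integrable lborel {0<..x} f" shows "set_integrable lborel {0..x} f"
proof (cases "x \<ge> 0")
  case True
  have "integrable lborel (\<lambda>t. indicator {0<..x} t *\<^sub>R f t + indicator {0} t *\<^sub>R f 0)"
    using assms unfolding set_integrable_def
    by (intro Bochner_Integration.integrable_add integrable_scaleR_left) auto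
  also have "(\<lambda>t. indicator {0<..x} t *\<^sub>R f t + indicator {0} t *\<^sub>R f 0) = (\<lambda>t. indicator {0..x} t *\<^sub>R f t)"
    using True by (auto simp: indicator_def)
  finally show ?thesis by (simp add: set_integrable_def)
qed (simp add: set_integrable_def)

lemma integrable_hl_Icc:
  fixes f :: "real \<Rightarrow> complex"
  assumes "integrable hl f" shows "set_integrable lborel {0..x} f"
  by (rule set_integrable_Icc_iff, rule set_integrable_subset[where A="{0<..}"])
    (use assms in \<open>auto simp: integrable_hl_iff\<close>)

lemma L2_Icc:
  assumes "f \<in> L2" shows "set_integrable lborel {0..x} f"
proof -
  have "set_integrable lborel {0..x} (\<lambda>t. indicator {0<..<x+1} t * f t)"
    by (rule integrable_hl_Icc) (use L1_L2_bounded_support[OF assms] in \<open>auto simp: L1_iff\<close>)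
  then have "set_integrable lborel {0<..x} (\<lambda>t. indicator {0<..<x+1} t * f t)"
    by (rule set_integrable_subset) auto
  also have "set_integrable lborel {0<..x} (\<lambda>t. indicator {0<..<x+1} t * f t) = set_integrable lborel {0<..x} f"
    by (rule set_integrable_cong) auto
  finally show ?thesis by (rule set_integrable_Icc_iff)
qed

lemma set_integrable_continuous_mult:
  fixes f :: "real \<Rightarrow> complex"
  assumes f: "set_integrable lborel {0..x} f" and g: "continuous_on {0..x} g"
  shows "set_integrable lborel {0..x} (\<lambda>t. g t * f t)"
proof -
  have "compact (g ` {0..x})" by (rule compact_continuous_image[OF g]) simp
  then obtain c where c: "\<And>s. s \<in> {0..x} \<Longrightarrow> cmod (g s) \<le> c"
    by (meson compact_imp_bounded bounded_iff imageI)
  have gm: "(\<lambda>s. indicator {0..x} s *\<^sub>R g s) \<in> borel_measurable borel"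
    by (rule borel_measurable_continuous_on_indicator) (use g in auto)
  have fm: "(\<lambda>s. indicator {0..x} s *\<^sub>R f s) \<in> borel_measurable borel"
    using f by (auto simp: set_integrable_def)
  have "integrable lborel (\<lambda>s. c * norm (indicator {0..x} s *\<^sub>R f s))"
    using f by (intro integrable_mult_right integrable_norm) (simp add: set_integrable_def)
  then show ?thesis unfolding set_integrable_def
  proof (rule Bochner_Integration.integrable_bound)
    have "(\<lambda>s. (indicator {0..x} s *\<^sub>R g s) * (indicator {0..x} s *\<^sub>R f s)) \<in> borel_measurable borel"
      by (intro borel_measurable_times gm fm)
    also have "(\<lambda>s. (indicator {0..x} s *\<^sub>R g s) * (indicator {0..x} s *\<^sub>R f s))
      = (\<lambda>s. indicator {0..x} s *\<^sub>R (g s * f s))" by (auto simp: indicator_def)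
    finally show "(\<lambda>s. indicator {0..x} s *\<^sub>R (g s * f s)) \<in> borel_measurable lborel" by simp
    show "AE s in lborel. norm (indicator {0..x} s *\<^sub>R (g s * f s)) \<le> norm (c * norm (indicator {0..x} s *\<^sub>R f s))"
    proof (rule AE_I2)
      fix s :: real
      show "norm (indicator {0..x} s *\<^sub>R (g s * f s)) \<le> norm (c * norm (indicator {0..x} s *\<^sub>R f s))"
      proof (cases "s \<in> {0..x}")
        case True
        then have "cmod (g s) \<le> \<bar>c\<bar>" using c[OF True] by simp
        then show ?thesis using True by (simp add: norm_mult mult_right_mono abs_mult)
      qed simp
    qed
  qed
qed

lemma Icc_integral_hl:
  fixes f :: "real \<Rightarrow> complex"
  assumes "x \<ge> 0" "set_integrable lborel {0..x} f"
  shows "(LINT t:{0..x}|lborel. f t) = (\<integral>t. indicator {0<..x} t * f t \<partial>hl)"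
proof -
  have "(LINT t:{0..x}|lborel. f t) = (LINT t:{0<..x}|lborel. f t)"
  proof (rule set_integral_cong_set)
    show "AE t in lborel. (t \<in> {0<..x}) = (t \<in> {0..x})"
      using AE_lborel_singleton[of 0] by eventually_elim auto
    have "set_integrable lborel {0<..x} f" by (rule set_integrable_subset[OF assms(2)]) auto
    then show "set_borel_measurable lborel {0<..x} f" "set_borel_measurable lborel {0..x} f"
      using assms by (auto simp: set_borel_measurable_def set_integrable_def)
  qed
  also have "\<dots> = (\<integral>t. indicator {0<..x} t * f t \<partial>hl)"
    unfolding integral_hl[symmetric] set_lebesgue_integral_def
    by (intro Bochner_Integration.integral_cong) (auto simp: indicator_def)
  finally show ?thesis .
qed

lemma tail_integral_hl:
  fixes f :: "real \<Rightarrow> complex"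
  assumes "x \<ge> 0" "integrable hl f"
  shows "(\<integral>t. indicator {x<..} t * f t \<partial>hl) = (\<integral>t. f t \<partial>hl) - (LINT t:{0..x}|lborel. f t)"
proof -
  have m: "indicator A \<in> borel_measurable hl" if "A \<in> sets borel" for A :: "real set"
    by (rule borel_measurable_hl) (use that in simp)
  have i: "integrable hl (\<lambda>t. indicator A t * f t)" if "A \<in> sets borel" for A
  proof (rule Bochner_Integration.integrable_bound[OF assms(2)])
    show "(\<lambda>t. indicator A t * f t) \<in> borel_measurable hl"
      using m[OF that] assms(2) by (intro borel_measurable_times) (auto intro!: borel_measurable_hl that)
  qed (auto simp: indicator_def)
  have "(\<integral>t. f t \<partial>hl) = (\<integral>t. indicator {x<..} t * f t + indicator {0<..x} t * f t \<partial>hl)"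
    using assms(1) by (intro Bochner_Integration.integral_cong) (auto simp: indicator_def)
  also have "\<dots> = (\<integral>t. indicator {x<..} t * f t \<partial>hl) + (\<integral>t. indicator {0<..x} t * f t \<partial>hl)"
    by (intro Bochner_Integration.integral_add i) auto
  finally show ?thesis
    using Icc_integral_hl[OF assms(1) integrable_hl_Icc[OF assms(2)]] by simp
qed

text \<open>Monotone convergence over the intervals from 0 to \<open>n\<close>; continuity of
  \<open>y\<close> makes each of these integrals finite.\<close>

lemma L2I_bounded_integrals:
  assumes y: "continuous_on {0..} y"
    and bd: "\<And>X. X \<ge> 0 \<Longrightarrow> (LINT t:{0..X}|lborel. (cmod (y t))\<^sup>2) \<le> C"
  shows "y \<in> L2"
proof -
  have ym [measurable]: "y \<in> borel_measurable hl"
    by (intro continuous_on_measurable_hl continuous_on_subset[OF y]) auto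
  let ?g = "\<lambda>n t. indicator {0..real n} t * (cmod (y t))\<^sup>2"
  have i: "set_integrable lborel {0..X} (\<lambda>t. (cmod (y t))\<^sup>2)" for X
    unfolding set_integrable_def
    by (rule borel_integrable_compact) (auto intro!: continuous_intros continuous_on_subset[OF y])
  have gm [measurable]: "indicator {0..real n} \<in> borel_measurable hl" for n
    by (rule borel_measurable_hl) simp
  have "(\<integral>\<^sup>+t. ennreal (?g n t) \<partial>hl) \<le> ennreal C" for n
  proof -
    have "integrable lborel (\<lambda>t. indicator {0<..} t *\<^sub>R (?g n t))"
    proof (rule Bochner_Integration.integrable_bound[OF i[unfolded set_integrable_def, of "real n"]])
      have "(\<lambda>t. indicator {0..real n} t *\<^sub>R (cmod (y t))\<^sup>2) \<in> borel_measurable lborel"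
        using i[of "real n"] by (simp add: set_integrable_def)
      then have "(\<lambda>t. indicator {0<..} t *\<^sub>R (indicator {0..real n} t *\<^sub>R (cmod (y t))\<^sup>2)) \<in> borel_measurable lborel"
        by (rule borel_measurable_scaleR[rotated]) simp
      then show "(\<lambda>t. indicator {0<..} t *\<^sub>R (?g n t)) \<in> borel_measurable lborel"
        by (simp only: real_scaleR_def)
    qed (auto simp: indicator_def)
    then have ih: "integrable hl (?g n)" by (simp add: integrable_hl_iff set_integrable_def)
    have "(\<integral>t. ?g n t \<partial>hl) = (\<integral>t. indicator {0<..} t *\<^sub>R (?g n t) \<partial>lborel)"
      unfolding integral_hl[symmetric] set_lebesgue_integral_def ..
    also have "\<dots> \<le> (LINT t:{0..real n}|lborel. (cmod (y t))\<^sup>2)"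
      unfolding set_lebesgue_integral_def
      by (rule integral_mono[OF \<open>integrable lborel (\<lambda>t. indicator {0<..} t *\<^sub>R (?g n t))\<close>])
        (use i in \<open>auto simp: set_integrable_def indicator_def\<close>)
    also have "\<dots> \<le> C" by (rule bd) simp
    finally show ?thesis
      by (subst nn_integral_eq_integral[OF ih]) (auto intro!: ennreal_leI)
  qed
  moreover have "(\<integral>\<^sup>+t. ennreal ((cmod (y t))\<^sup>2) \<partial>hl) = (SUP n. \<integral>\<^sup>+t. ennreal (?g n t) \<partial>hl)"
  proof (subst nn_integral_monotone_convergence_SUP[symmetric])
    show "incseq (\<lambda>n t. ennreal (?g n t))"
      by (auto simp: incseq_def le_fun_def indicator_def intro!: ennreal_leI)
    show "(\<integral>\<^sup>+t. ennreal ((cmod (y t))\<^sup>2) \<partial>hl) = (\<integral>\<^sup>+t. (SUP n. ennreal (?g n t)) \<partial>hl)"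
    proof (rule nn_integral_cong)
      fix t assume "t \<in> space hl"
      then have t: "t > 0" by simp
      obtain n where n: "t \<le> real n" using real_arch_simple by blast
      show "ennreal ((cmod (y t))\<^sup>2) = (SUP n. ennreal (?g n t))"
      proof (rule antisym)
        show "ennreal ((cmod (y t))\<^sup>2) \<le> (SUP n. ennreal (?g n t))"
          by (rule SUP_upper2[of n]) (use n t in auto)
        show "(SUP n. ennreal (?g n t)) \<le> ennreal ((cmod (y t))\<^sup>2)"
          by (rule SUP_least) (auto simp: indicator_def)
      qed
    qed
  qed measurable
  ultimately have "(\<integral>\<^sup>+t. ennreal ((cmod (y t))\<^sup>2) \<partial>hl) \<le> ennreal C" by (simp add: SUP_least)
  then have "integrable hl (\<lambda>t. (cmod (y t))\<^sup>2)"
    by (intro integrableI_bounded) (auto simp: le_less_trans[OF _ ennreal_less_top])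
  then show ?thesis by (simp add: L2_iff ym)
qed

text \<open>Integrating the derivative of \<open>\<bar>y\<bar>\<^sup>2\<close> gives square integrability without any kernel estimate.\<close>

lemma energy_L2:
  assumes y: "acp y y'" and f: "f \<in> L2" and a: "a > 0"
    and le: "\<And>x. x \<ge> 0 \<Longrightarrow> a * (cmod (y x))\<^sup>2 \<le> s * (2 * Re (y' x * cnj (y x))) + (cmod (f x))\<^sup>2 / a"
    and C: "\<And>X. X \<ge> 0 \<Longrightarrow> s * ((cmod (y X))\<^sup>2 - (cmod (y 0))\<^sup>2) \<le> C"
  shows "y \<in> L2"
proof (rule L2I_bounded_integrals[OF acp_continuous[OF y]])
  fix X :: real assume X: "X \<ge> 0"
  have p: "acp (\<lambda>x. y x * cnj (y x)) (\<lambda>x. y' x * cnj (y x) + y x * cnj (y' x))"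
    by (rule acp_mult[OF y acp_cnj[OF y]])
  have re: "Re (y' x * cnj (y x) + y x * cnj (y' x)) = 2 * Re (y' x * cnj (y x))" for x
    by (simp add: algebra_simps)
  have iD: "set_integrable lborel {0..X} (\<lambda>x. 2 * Re (y' x * cnj (y x)))"
    and D: "(LINT x:{0..X}|lborel. 2 * Re (y' x * cnj (y x))) = (cmod (y X))\<^sup>2 - (cmod (y 0))\<^sup>2"
  proof -
    have ci: "integrable lborel (\<lambda>x. indicator {0..X} x *\<^sub>R (y' x * cnj (y x) + y x * cnj (y' x)))"
      using acpD(1)[OF p X] by (simp add: set_integrable_def)
    have eq: "(\<lambda>x. Re (indicator {0..X} x *\<^sub>R (y' x * cnj (y x) + y x * cnj (y' x))))
       = (\<lambda>x. indicator {0..X} x *\<^sub>R (2 * Re (y' x * cnj (y x))))"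
      unfolding scaleR_complex.sel re by simp
    show "set_integrable lborel {0..X} (\<lambda>x. 2 * Re (y' x * cnj (y x)))"
      using integrable_Re[OF ci] unfolding eq by (simp add: set_integrable_def)
    have "(LINT x:{0..X}|lborel. 2 * Re (y' x * cnj (y x)))
       = Re (LINT x:{0..X}|lborel. y' x * cnj (y x) + y x * cnj (y' x))"
      unfolding set_lebesgue_integral_def integral_Re[OF ci, symmetric] eq ..
    also have "\<dots> = Re (y X * cnj (y X)) - Re (y 0 * cnj (y 0))"
      using arg_cong[OF acpD(2)[OF p X], of Re] by simp
    finally show "(LINT x:{0..X}|lborel. 2 * Re (y' x * cnj (y x))) = (cmod (y X))\<^sup>2 - (cmod (y 0))\<^sup>2"
      by (simp only: complex_norm_square[symmetric] Re_complex_of_real)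
  qed
  have iy: "set_integrable lborel {0..X} (\<lambda>t. (cmod (y t))\<^sup>2)"
    unfolding set_integrable_def
    by (rule borel_integrable_compact) (auto intro!: continuous_intros continuous_on_subset[OF acp_continuous[OF y]])
  have cf: "integrable hl (\<lambda>t. complex_of_real ((cmod (f t))\<^sup>2))"
    by (rule integrable_of_real[OF L2_sq[OF f]])
  have if': "set_integrable lborel {0..X} (\<lambda>t. complex_of_real ((cmod (f t))\<^sup>2))"
    by (rule integrable_hl_Icc[OF cf])
  have iF: "set_integrable lborel {0..X} (\<lambda>t. (cmod (f t))\<^sup>2)"
    using integrable_Re[OF if'[unfolded set_integrable_def]] by (simp add: set_integrable_def)
  have Fle: "(LINT t:{0..X}|lborel. (cmod (f t))\<^sup>2) \<le> (nrm f)\<^sup>2"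
  proof -
    have "complex_of_real (LINT t:{0..X}|lborel. (cmod (f t))\<^sup>2) = (LINT t:{0..X}|lborel. complex_of_real ((cmod (f t))\<^sup>2))"
      by (rule set_integral_complex_of_real[symmetric])
    also have "\<dots> = (\<integral>t. complex_of_real (indicator {0<..X} t * (cmod (f t))\<^sup>2) \<partial>hl)"
      unfolding Icc_integral_hl[OF X if']
      by (intro Bochner_Integration.integral_cong) (auto simp: indicator_def)
    also have "\<dots> = complex_of_real (\<integral>t. indicator {0<..X} t * (cmod (f t))\<^sup>2 \<partial>hl)" by (rule integral_complex_of_real)
    finally have "(LINT t:{0..X}|lborel. (cmod (f t))\<^sup>2) = (\<integral>t. indicator {0<..X} t * (cmod (f t))\<^sup>2 \<partial>hl)"
      by (simp only: of_real_eq_iff)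
    also have "\<dots> \<le> (nrm f)\<^sup>2" unfolding nrm_sq
    proof (rule integral_mono)
      have m: "indicator {0<..X} \<in> borel_measurable hl" by (rule borel_measurable_hl) simp
      show "integrable hl (\<lambda>t. indicator {0<..X} t * (cmod (f t))\<^sup>2)"
      proof (rule Bochner_Integration.integrable_bound[OF L2_sq[OF f]])
        show "(\<lambda>t. indicator {0<..X} t * (cmod (f t))\<^sup>2) \<in> borel_measurable hl"
          using f by (intro borel_measurable_times m) (auto simp: L2_iff)
      qed (auto simp: indicator_def)
    qed (use f in \<open>auto simp: L2_iff indicator_def\<close>)
    finally show ?thesis .
  qed
  have "a * (LINT t:{0..X}|lborel. (cmod (y t))\<^sup>2) = (LINT t:{0..X}|lborel. a * (cmod (y t))\<^sup>2)"
    by simp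
  also have "\<dots> \<le> (LINT t:{0..X}|lborel. s * (2 * Re (y' t * cnj (y t))) + (cmod (f t))\<^sup>2 / a)"
    by (rule set_integral_mono) (use iy iD iF le in \<open>auto intro!: set_integral_add(1) set_integrable_mult_right set_integrable_divide\<close>)
  also have "\<dots> = s * ((cmod (y X))\<^sup>2 - (cmod (y 0))\<^sup>2) + (LINT t:{0..X}|lborel. (cmod (f t))\<^sup>2) / a"
    using iD iF D by (subst set_integral_add(2)) (auto intro!: set_integrable_mult_right set_integrable_divide)
  also have "\<dots> \<le> C + (nrm f)\<^sup>2 / a"
    using C[OF X] Fle a by (intro add_mono divide_right_mono) auto
  finally show "(LINT t:{0..X}|lborel. (cmod (y t))\<^sup>2) \<le> (C + (nrm f)\<^sup>2 / a) / a"
    using a by (simp add: field_simps)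
qed

lemma acp_primitive:
  assumes "\<And>x. x \<ge> 0 \<Longrightarrow> set_integrable lborel {0..x} g"
  shows "acp (\<lambda>x. c + (LINT t:{0..x}|lborel. g t)) g"
proof (rule acpI)
  have "(LINT t:{0..0}|lborel. g t) = 0"
    unfolding set_lebesgue_integral_def
    by (rule integral_eq_zero_AE) (use AE_lborel_singleton[of 0] in \<open>eventually_elim, auto simp: indicator_def\<close>)
  then show "c + (LINT t:{0..x}|lborel. g t) = c + (LINT t:{0..0}|lborel. g t) + (LINT t:{0..x}|lborel. g t)" for x
    by simp
qed (rule assms)

text \<open>The square of the modulus of \<open>a y - f\<close>, expanded and divided by
  \<open>a\<close>.\<close>

lemma energy_ineq:
  assumes "a > 0" shows "0 \<le> a * (cmod y)\<^sup>2 - 2 * Re (f * cnj y) + (cmod f)\<^sup>2 / a"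
proof -
  have "0 \<le> (cmod (of_real a * y - f))\<^sup>2 / a" using assms by simp
  also have "(cmod (of_real a * y - f))\<^sup>2 = a\<^sup>2 * (cmod y)\<^sup>2 - 2 * a * Re (f * cnj y) + (cmod f)\<^sup>2"
    unfolding cmod_power2 by (simp add: power2_eq_square algebra_simps)
  finally show ?thesis using assms by (simp add: field_simps power2_eq_square)
qed

text \<open>Variation of constants with initial value 0. Square integrability comes from the sign of
  the real part of \<open>r\<close> through the energy estimate.\<close>

lemma solve_first_order_decay:
  assumes r: "Re r > 0" and f: "f \<in> L2"
  shows "\<exists>y\<in>L2. acp y (\<lambda>x. f x - r * y x)"
proof -
  define I where "I x = 0 + (LINT t:{0..x}|lborel. exp (r * of_real t) * f t)" for x
  define y where "y x = exp (- r * of_real x) * I x" for x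
  have I: "acp I (\<lambda>t. exp (r * of_real t) * f t)" unfolding I_def
    by (intro acp_primitive set_integrable_continuous_mult L2_Icc f continuous_intros)
  have "acp y (\<lambda>x. - r * exp (- r * of_real x) * I x + exp (- r * of_real x) * (exp (r * of_real x) * f x))"
    unfolding y_def by (intro acp_mult acp_exp I)
  also have "(\<lambda>x. - r * exp (- r * of_real x) * I x + exp (- r * of_real x) * (exp (r * of_real x) * f x))
    = (\<lambda>x. f x - r * y x)"
    by (simp add: fun_eq_iff y_def mult.assoc[symmetric] exp_add[symmetric])
  finally have y: "acp y (\<lambda>x. f x - r * y x)" .
  have "y \<in> L2"
  \<comment> \<open>With \<open>s = -1\<close> the contribution of \<open>|y X|^2\<close> has the
    favourable sign, and only the initial value remains as a bound.\<close>
  proof (rule energy_L2[OF y f r, where s="-1" and C="(cmod (y 0))\<^sup>2"])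
    fix x :: real
    show "Re r * (cmod (y x))\<^sup>2 \<le> - 1 * (2 * Re ((f x - r * y x) * cnj (y x))) + (cmod (f x))\<^sup>2 / Re r"
      using energy_ineq[OF r, of "y x" "f x"] unfolding cmod_power2
      by (simp add: algebra_simps power2_eq_square)
  qed simp
  with y show ?thesis by blast
qed

text \<open>The homogeneous solution grows, so the constant of integration must cancel the full
  integral: then \<open>y X\<close> is a tail integral. Cauchy-Schwarz on the tail bounds
  \<open>y\<close> uniformly, which is what the energy estimate asks for at the far end.\<close>

lemma solve_first_order_growth:
  assumes r: "Re r > 0" and f: "f \<in> L2"
  shows "\<exists>y\<in>L2. acp y (\<lambda>x. r * y x - f x)"
proof -
  define e where "e x = exp (- (r * of_real x))" for x :: real
  have e: "e \<in> L2" unfolding e_def by (rule L2_exp[OF r])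
  define c where "c = (\<integral>t. e t * f t \<partial>hl)"
  define I where "I x = c + (LINT t:{0..x}|lborel. - e t * f t)" for x
  define y where "y x = exp (r * of_real x) * I x" for x
  have ief: "integrable hl (\<lambda>t. e t * f t)" by (rule L2_prod_integrable[OF e f])
  have I: "acp I (\<lambda>t. - e t * f t)" unfolding I_def e_def
    by (intro acp_primitive set_integrable_continuous_mult L2_Icc f continuous_intros)
  have "acp y (\<lambda>x. r * exp (r * of_real x) * I x + exp (r * of_real x) * (- e x * f x))"
    unfolding y_def by (intro acp_mult acp_exp I)
  also have "(\<lambda>x. r * exp (r * of_real x) * I x + exp (r * of_real x) * (- e x * f x))
    = (\<lambda>x. r * y x - f x)"
    by (simp add: fun_eq_iff y_def e_def mult.assoc[symmetric] exp_add[symmetric])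
  finally have y: "acp y (\<lambda>x. r * y x - f x)" .
  have bd: "cmod (y X) \<le> sqrt (1 / (2 * Re r)) * nrm f" if X: "X \<ge> 0" for X
  proof -
    define t where "t s = indicator {X<..} s * exp (r * of_real X) * e s" for s
    have tm: "(\<lambda>s. indicator {X<..} s * exp (r * of_real X)) \<in> borel_measurable hl"
      by (rule borel_measurable_hl) simp
    have tL: "t \<in> L2" unfolding t_def
      by (rule L2_mult_bounded[OF e tm, where B="cmod (exp (r * of_real X))"]) (auto simp: indicator_def)
    have "(LINT t:{0..X}|lborel. - e t * f t) = - (LINT t:{0..X}|lborel. e t * f t)"
      unfolding set_lebesgue_integral_def by simp
    then have "I X = (\<integral>s. indicator {X<..} s * (e s * f s) \<partial>hl)"
      unfolding I_def c_def tail_integral_hl[OF X ief] by simp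
    then have "y X = (\<integral>s. exp (r * of_real X) * (indicator {X<..} s * (e s * f s)) \<partial>hl)"
      unfolding y_def by (simp only: integral_mult_right_zero)
    also have "\<dots> = (\<integral>s. t s * cnj (cnj (f s)) \<partial>hl)"
      by (intro Bochner_Integration.integral_cong) (auto simp: t_def)
    finally have "y X = ip t (\<lambda>s. cnj (f s))" by (simp add: ip_hl)
    then have "cmod (y X) \<le> nrm t * nrm (\<lambda>s. cnj (f s))"
      using Cauchy_Schwarz_ip[OF tL L2_cnj[OF f]] by simp
    also have "nrm (\<lambda>s. cnj (f s)) = nrm f" by (simp add: nrm_hl)
    \<comment> \<open>The factor \<open>exp (r X)\<close> undoes exactly the decay of the tail of
      \<open>e\<close>, so this norm does not depend on \<open>X\<close>.\<close>
    also have "nrm t = sqrt (1 / (2 * Re r))"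
    proof -
      define g where "g s = exp (- (of_real (2 * Re r) * of_real s) :: complex)" for s
      have gi: "integrable hl g" and gI: "(\<integral>s. g s \<partial>hl) = 1 / of_real (2 * Re r)"
        unfolding g_def using r by (auto intro!: integrable_exp integral_exp)
      have "acp (\<lambda>s. (- 1 / of_real (2 * Re r)) * exp (- of_real (2 * Re r) * of_real s))
          (\<lambda>s. (- 1 / of_real (2 * Re r)) * (- of_real (2 * Re r) * exp (- of_real (2 * Re r) * of_real s)))"
        by (intro acp_cmult acp_exp)
      also have "(\<lambda>s. (- 1 / of_real (2 * Re r)) * (- of_real (2 * Re r) * exp (- of_real (2 * Re r) * of_real s))) = g"
        using r by (auto simp: g_def fun_eq_iff)
      finally have p: "acp (\<lambda>s. (- 1 / of_real (2 * Re r)) * exp (- of_real (2 * Re r) * of_real s)) g" .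
      have gX: "(LINT s:{0..X}|lborel. g s) = 1 / of_real (2 * Re r) - g X / of_real (2 * Re r)"
        using trans[OF acpD(2)[OF p X] add.commute] by (simp add: g_def algebra_simps)
      have "complex_of_real ((nrm t)\<^sup>2) = ip t t" by (simp add: ip_self)
      also have "\<dots> = (\<integral>s. of_real (exp (2 * Re r * X)) * (indicator {X<..} s * g s) \<partial>hl)"
        unfolding ip_hl
      proof (intro Bochner_Integration.integral_cong refl)
        fix s :: real
        have "cmod (exp (r * of_real X) * e s)^2 = exp (2 * Re r * X) * exp (- (2 * Re r * s))"
          by (simp add: e_def norm_mult power_mult_distrib power2_eq_square exp_add[symmetric] algebra_simps)
        then have "complex_of_real (cmod (exp (r * of_real X) * e s)^2) = of_real (exp (2 * Re r * X)) * g s"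
          by (simp add: g_def exp_of_real[symmetric])
        then show "t s * cnj (t s) = of_real (exp (2 * Re r * X)) * (indicator {X<..} s * g s)"
          unfolding complex_norm_square[symmetric] t_def by (cases "s > X") simp_all
      qed
      also have "\<dots> = of_real (exp (2 * Re r * X)) * (g X / of_real (2 * Re r))"
        unfolding integral_mult_right_zero tail_integral_hl[OF X gi] gI gX by simp
      also have "\<dots> = complex_of_real (1 / (2 * Re r))"
        unfolding g_def by (simp add: exp_of_real[symmetric] mult.assoc[symmetric] exp_add[symmetric])
      finally have "(nrm t)\<^sup>2 = 1 / (2 * Re r)" by (simp only: of_real_eq_iff)
      then show ?thesis by (metis nrm_nonneg real_sqrt_unique)
    qed
    finally show ?thesis .
  qed
  have "y \<in> L2"
  proof (rule energy_L2[OF y f r, where s=1 and C="(sqrt (1 / (2 * Re r)) * nrm f)\<^sup>2"])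
    fix x :: real assume "x \<ge> 0"
    show "Re r * (cmod (y x))\<^sup>2 \<le> 1 * (2 * Re ((r * y x - f x) * cnj (y x))) + (cmod (f x))\<^sup>2 / Re r"
      using energy_ineq[OF r, of "y x" "f x"] unfolding cmod_power2
      by (simp add: algebra_simps power2_eq_square)
    have "(cmod (y x))\<^sup>2 \<le> (sqrt (1 / (2 * Re r)) * nrm f)\<^sup>2"
      using bd[OF \<open>x \<ge> 0\<close>] by (intro power_mono) auto
    moreover have "1 * ((cmod (y x))\<^sup>2 - (cmod (y 0))\<^sup>2) \<le> (cmod (y x))\<^sup>2" by simp
    ultimately show "1 * ((cmod (y x))\<^sup>2 - (cmod (y 0))\<^sup>2) \<le> (sqrt (1 / (2 * Re r)) * nrm f)\<^sup>2" by (rule order_trans[rotated])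
  qed
  with y show ?thesis by blast
qed

lemma solve_first_order:
  assumes p: "Re p \<noteq> 0" and f: "f \<in> L2"
  shows "\<exists>y\<in>L2. acp y (\<lambda>x. p * y x + f x)"
proof (cases "Re p < 0")
  case True
  then obtain y where "y \<in> L2" "acp y (\<lambda>x. f x - (- p) * y x)"
    using solve_first_order_decay[of "- p" f] f by auto
  then show ?thesis by (intro bexI[of _ y]) (simp_all add: add.commute)
next
  case False
  then obtain y where "y \<in> L2" "acp y (\<lambda>x. p * y x - (- f x))"
    using solve_first_order_growth[of p "\<lambda>x. - f x"] p L2_uminus[OF f] by auto
  then show ?thesis by auto
qed

section \<open>The operator and its resolvent\<close>

definition chain :: "(nat \<Rightarrow> real \<Rightarrow> complex) \<Rightarrow> bool" where
  "chain v \<longleftrightarrow> (\<forall>k<4. acp (v k) (v (Suc k)))"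

text \<open>The Lagrange bracket of the fourth derivative rather than a determinant: in its
  derivative the intermediate products cancel and \<open>v 4 * w 0 - v 0 * w 4\<close> remains. With
  \<open>cnjs\<close> in the second slot it is the boundary form of \<open>H\<close>.\<close>

definition wronskian :: "(nat \<Rightarrow> real \<Rightarrow> complex) \<Rightarrow> (nat \<Rightarrow> real \<Rightarrow> complex) \<Rightarrow> real \<Rightarrow> complex" where
  "wronskian v w x = v 3 x * w 0 x - v 2 x * w 1 x + v 1 x * w 2 x - v 0 x * w 3 x"

abbreviation cnjs :: "(nat \<Rightarrow> real \<Rightarrow> complex) \<Rightarrow> nat \<Rightarrow> real \<Rightarrow> complex" where
  "cnjs v \<equiv> (\<lambda>k x. cnj (v k x))"

lemma chainD:
  assumes "chain v"
  shows "acp (v 0) (v 1)" "acp (v 1) (v 2)" "acp (v 2) (v 3)" "acp (v 3) (v 4)"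
  using assms[unfolded chain_def, rule_format, of 0] assms[unfolded chain_def, rule_format, of 1]
    assms[unfolded chain_def, rule_format, of 2] assms[unfolded chain_def, rule_format, of 3]
  by (simp_all add: numeral_eq_Suc)

lemma chainI:
  assumes "acp (v 0) (v 1)" "acp (v 1) (v 2)" "acp (v 2) (v 3)" "acp (v 3) (v 4)"
  shows "chain v"
proof -
  have "k = 0 \<or> k = 1 \<or> k = 2 \<or> k = 3" if "k < 4" for k :: nat using that by linarith
  moreover have "Suc 1 = 2" "Suc 2 = 3" "Suc 3 = 4" by simp_all
  ultimately show ?thesis using assms unfolding chain_def by (metis One_nat_def)
qed

lemma chain_add: "chain v \<Longrightarrow> chain w \<Longrightarrow> chain (\<lambda>k x. v k x + w k x)"
  unfolding chain_def by (intro allI impI acp_add) blast+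

lemma chain_diff: "chain v \<Longrightarrow> chain w \<Longrightarrow> chain (\<lambda>k x. v k x - w k x)"
  unfolding chain_def by (intro allI impI acp_diff) blast+

lemma chain_cmult: "chain v \<Longrightarrow> chain (\<lambda>k x. c * v k x)"
  unfolding chain_def by (intro allI impI acp_cmult) blast

lemma chain_sum: "(\<And>i. i \<in> I \<Longrightarrow> chain (v i)) \<Longrightarrow> chain (\<lambda>k x. \<Sum>i\<in>I. v i k x)"
  unfolding chain_def by (intro allI impI acp_sum) blast

lemma chain_cnjs: "chain v \<Longrightarrow> chain (cnjs v)"
  unfolding chain_def by (intro allI impI acp_cnj) blast

lemma chain_exp: "chain (\<lambda>k x. p ^ k * exp (p * of_real x))"
proof -
  have "acp (\<lambda>x. p ^ k * exp (p * of_real x)) (\<lambda>x. p ^ Suc k * exp (p * of_real x))" for k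
    using acp_cmult[OF acp_exp[of p], of "p ^ k"] by (simp add: ac_simps)
  then show ?thesis by (simp add: chain_def)
qed

lemma acp_wronskian:
  assumes v: "chain v" and w: "chain w"
  shows "acp (wronskian v w) (\<lambda>x. v 4 x * w 0 x - v 0 x * w 4 x)"
proof -
  note p = chainD[OF v] chainD[OF w]
  have "acp (\<lambda>x. v 3 x * w 0 x - v 2 x * w 1 x + v 1 x * w 2 x - v 0 x * w 3 x)
    (\<lambda>x. (v 4 x * w 0 x + v 3 x * w 1 x) - (v 3 x * w 1 x + v 2 x * w 2 x)
      + (v 2 x * w 2 x + v 1 x * w 3 x) - (v 1 x * w 3 x + v 0 x * w 4 x))"
    by (intro acp_diff acp_add acp_mult p)
  then show ?thesis unfolding wronskian_def[abs_def] by simp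
qed

lemma wronskian_tendsto_zero:
  assumes "chain v" "chain w" and "\<And>k. k \<le> 4 \<Longrightarrow> v k \<in> L2" "\<And>k. k \<le> 4 \<Longrightarrow> w k \<in> L2"
  shows "(wronskian v w \<longlongrightarrow> 0) at_top"
proof -
  have v: "(v k \<longlongrightarrow> 0) at_top" and w: "(w k \<longlongrightarrow> 0) at_top" if "k < 4" for k
    using assms that by (auto intro!: acp_decay[of "_ k" "_ (Suc k)"] simp: chain_def)
  have "((\<lambda>x. v 3 x * w 0 x - v 2 x * w 1 x + v 1 x * w 2 x - v 0 x * w 3 x) \<longlongrightarrow> 0 * 0 - 0 * 0 + 0 * 0 - 0 * 0) at_top"
    by (intro tendsto_intros v w) auto
  then show ?thesis by (simp add: wronskian_def[abs_def])
qed

lemma aeq_exists: assumes "aeq f g" shows "\<exists>x>0. f x = g x"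
proof (rule ccontr)
  assume "\<not> ?thesis"
  then have "AE x in lborel. x \<notin> {0<..<1::real}"
    using assms unfolding aeq_def by (auto elim!: eventually_mono)
  then have "{0<..<1::real} \<in> null_sets lborel" by (subst AE_iff_null_sets) auto
  then show False by (simp add: null_sets_def)
qed

text \<open>A fourth root \<open>q\<close> of a non-real number is neither real nor imaginary, so
  exactly two of \<open>q\<close>, \<open>-q\<close>, \<open>i q\<close>, \<open>-i q\<close> lie in
  the right half-plane. They differ by a factor \<open>i\<close> or \<open>-i\<close>, whence the
  relation between their squares.\<close>

lemma fourth_roots_exist:
  assumes "Im z \<noteq> 0"
  shows "\<exists>r1 r2. Re r1 > 0 \<and> Re r2 > 0 \<and> r1 ^ 4 = z \<and> r2\<^sup>2 = - r1\<^sup>2"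
proof -
  define q where "q = csqrt (csqrt z)"
  have q4: "q ^ 4 = z"
    using power_mult[of q 2 2] by (simp add: q_def)
  have "Re q \<noteq> 0"
  proof
    assume "Re q = 0"
    then have "q = \<i> * of_real (Im q)" by (simp add: complex_eq_iff)
    then have "z = of_real (Im q ^ 4)" by (metis q4 power_mult_distrib i_even_power of_real_power power_mult mult_1 numeral_Bit0 mult_2 power_add i_squared mult_minus1 minus_minus power2_minus one_power2)
    then show False using assms by simp
  qed
  moreover have "Im q \<noteq> 0"
  proof
    assume "Im q = 0"
    then have "q = of_real (Re q)" by (simp add: complex_eq_iff)
    then have "z = of_real (Re q ^ 4)" by (metis q4 of_real_power)
    then show False using assms by simp
  qed
  moreover define r1 where "r1 = (if Re q > 0 then q else - q)"
  moreover define r2 where "r2 = (if Im q < 0 then \<i> * q else - \<i> * q)"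
  ultimately have "Re r1 > 0" "Re r2 > 0" "r1 ^ 4 = z" "r2\<^sup>2 = - r1\<^sup>2"
    using q4 by (auto simp: power_mult_distrib)
  then show ?thesis by blast
qed

lemma linear_2x2_kernel:
  fixes a b c d :: complex
  assumes "a * d - b * c = 0"
  shows "\<exists>x y. (x \<noteq> 0 \<or> y \<noteq> 0) \<and> a * x + b * y = 0 \<and> c * x + d * y = 0"
proof (cases "a = 0 \<and> b = 0")
  case True
  show ?thesis
  proof (cases "c = 0 \<and> d = 0")
    case False
    then show ?thesis using True by (intro exI[of _ d] exI[of _ "- c"]) auto
  qed (use True in \<open>auto intro!: exI[of _ 1]\<close>)
next
  case False
  then show ?thesis using assms
    by (intro exI[of _ b] exI[of _ "- a"]) (auto simp: algebra_simps)
qed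

lemma linear_2x2_solve:
  fixes a b c d :: complex
  assumes "a * d - b * c \<noteq> 0"
  shows "\<exists>x y. a * x + b * y = e \<and> c * x + d * y = f"
proof (intro exI conjI)
  let ?D = "a * d - b * c"
  have "a * ((e * d - b * f) / ?D) + b * ((a * f - e * c) / ?D) = (a * (e * d - b * f) + b * (a * f - e * c)) / ?D"
    by (simp add: add_divide_distrib)
  also have "a * (e * d - b * f) + b * (a * f - e * c) = e * ?D" by (simp add: algebra_simps)
  finally show "a * ((e * d - b * f) / ?D) + b * ((a * f - e * c) / ?D) = e" using assms by simp
  have "c * ((e * d - b * f) / ?D) + d * ((a * f - e * c) / ?D) = (c * (e * d - b * f) + d * (a * f - e * c)) / ?D"
    by (simp add: add_divide_distrib)
  also have "c * (e * d - b * f) + d * (a * f - e * c) = f * ?D" by (simp add: algebra_simps)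
  finally show "c * ((e * d - b * f) / ?D) + d * ((a * f - e * c) / ?D) = f" using assms by simp
qed

text \<open>Partial fractions: \<open>1 / (D^4 - z)\<close> is a quarter of the sum of
  \<open>p^-3 / (D - p)\<close> over the four roots \<open>p\<close> of \<open>z\<close>, and each
  first-order equation is solvable in \<open>L2\<close> because no root is imaginary.\<close>

lemma particular_solution:
  assumes r: "Re r1 > 0" "Re r2 > 0" "r1 ^ 4 = z" "r2\<^sup>2 = - r1\<^sup>2" and f: "f \<in> L2"
  shows "\<exists>v. chain v \<and> (\<forall>k\<le>4. v k \<in> L2) \<and> v 4 = (\<lambda>x. z * v 0 x + f x)"
proof -
  define P where "P = {r1, - r1, r2, - r2}"
  have nz: "r1 \<noteq> 0" "r2 \<noteq> 0" using r by auto
  have "r2 \<noteq> r1"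
  proof
    assume "r2 = r1"
    then have "r1\<^sup>2 = - (r1\<^sup>2)" using r(4) by simp
    then show False using nz by (simp add: equal_neg_zero)
  qed
  moreover have "r1 \<noteq> - r1" "r2 \<noteq> - r2" using nz by (simp_all add: equal_neg_zero)
  moreover have "r2 \<noteq> - r1" using r(1,2) by auto
  ultimately have sumP: "(\<Sum>p\<in>P. h p) = h r1 + h (- r1) + h r2 + h (- r2)" for h :: "complex \<Rightarrow> complex"
    unfolding P_def by (subst sum.insert; auto)+
  have r24: "r2 ^ 4 = z"
    using r(3,4) power_mult[of r1 2 2] power_mult[of r2 2 2] by simp
  have P: "Re p \<noteq> 0" "p \<noteq> 0" "p ^ 4 = z" if "p \<in> P" for p
    using that r nz r24 by (auto simp: P_def)
  have "\<forall>p\<in>P. \<exists>y. y \<in> L2 \<and> acp y (\<lambda>x. p * y x + f x)"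
    using solve_first_order[OF P(1) f] by blast
  then obtain y where y: "\<And>p. p \<in> P \<Longrightarrow> y p \<in> L2" "\<And>p. p \<in> P \<Longrightarrow> acp (y p) (\<lambda>x. p * y p x + f x)"
    by metis
  define V where "V k x = (1 / 4) * (\<Sum>p\<in>P. p ^ k / p ^ 3 * y p x)" for k :: nat and x
  have VL: "V k \<in> L2" for k unfolding V_def by (intro L2_cmult L2_sum y)
  have dV: "acp (V k) (\<lambda>x. V (Suc k) x + (1 / 4) * (\<Sum>p\<in>P. p ^ k / p ^ 3) * f x)" for k
  proof -
    have "acp (V k) (\<lambda>x. (1 / 4) * (\<Sum>p\<in>P. p ^ k / p ^ 3 * (p * y p x + f x)))"
      unfolding V_def by (intro acp_cmult acp_sum y)
    also have "(\<lambda>x. (1 / 4) * (\<Sum>p\<in>P. p ^ k / p ^ 3 * (p * y p x + f x)))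
      = (\<lambda>x. (1 / 4) * (\<Sum>p\<in>P. p ^ Suc k / p ^ 3 * y p x + p ^ k / p ^ 3 * f x))"
      by (intro ext arg_cong[where f="\<lambda>u. (1 / 4) * u"] sum.cong refl) (simp add: distrib_left add_divide_distrib ac_simps)
    also have "\<dots> = (\<lambda>x. V (Suc k) x + (1 / 4) * (\<Sum>p\<in>P. p ^ k / p ^ 3) * f x)"
      by (simp add: V_def sum.distrib distrib_left sum_distrib_right)
    finally show ?thesis .
  qed
  have s0: "(\<Sum>p\<in>P. p ^ 0 / p ^ 3) = 0" "(\<Sum>p\<in>P. p ^ 2 / p ^ 3) = 0" "(\<Sum>p\<in>P. p ^ 3 / p ^ 3) = 4"
    using nz by (simp_all add: sumP)
  have "(\<Sum>p\<in>P. p ^ 1 / p ^ 3) = (\<Sum>p\<in>P. 1 / p\<^sup>2)"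
    by (intro sum.cong refl) (use P(2) in \<open>auto simp: power2_eq_square power3_eq_cube\<close>)
  also have "\<dots> = 0" using r(4) by (simp add: sumP)
  finally have s1: "(\<Sum>p\<in>P. p ^ 1 / p ^ 3) = 0" .
  have V4: "V 4 x = z * V 0 x" for x
    unfolding V_def by (simp add: sum_distrib_left P(3))
  \<comment> \<open>Only the top entry is changed, since \<open>V 4\<close> lacks the
    inhomogeneity.\<close>
  define v where "v k = (if k = 4 then (\<lambda>x. z * V 0 x + f x) else V k)" for k :: nat
  have e: "Suc 0 = 1" "Suc 1 = 2" "Suc 2 = 3" "Suc 3 = 4" by simp_all
  have "chain v"
  proof (rule chainI)
    show "acp (v 0) (v 1)" using dV[of 0] unfolding s0 e by (simp add: v_def)
    show "acp (v 1) (v 2)" using dV[of 1] unfolding s1 e by (simp add: v_def)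
    show "acp (v 2) (v 3)" using dV[of 2] unfolding s0 e by (simp add: v_def)
    show "acp (v 3) (v 4)" using dV[of 3] unfolding s0 e V4 by (simp add: v_def)
  qed
  moreover have "v k \<in> L2" for k unfolding v_def using VL f by (auto intro!: L2_add L2_cmult)
  ultimately show ?thesis by (intro exI[of _ v]) (simp add: v_def)
qed

locale biharmonic =
  fixes \<alpha> :: complex and \<alpha>1 \<alpha>2 :: real
begin

abbreviation H :: "(real \<Rightarrow> complex) \<Rightarrow> (real \<Rightarrow> complex) \<Rightarrow> bool" where
  "H \<equiv> Hgraph \<alpha> \<alpha>1 \<alpha>2"

text \<open>The boundary conditions are kept as linear functionals of the chain of derivatives, so
  that a solution can be corrected by linear algebra.\<close>

definition bc1 :: "(nat \<Rightarrow> real \<Rightarrow> complex) \<Rightarrow> complex" where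
  "bc1 v = v 2 0 - \<alpha> * v 0 0 - of_real \<alpha>1 * v 1 0"

definition bc2 :: "(nat \<Rightarrow> real \<Rightarrow> complex) \<Rightarrow> complex" where
  "bc2 v = v 3 0 + of_real \<alpha>2 * v 0 0 + cnj \<alpha> * v 1 0"

lemma H_iff:
  "H u w \<longleftrightarrow> u \<in> L2 \<and> w \<in> L2 \<and> (\<exists>v. (\<forall>k\<le>4. v k \<in> L2) \<and> aeq (v 0) u \<and> aeq (v 4) w
     \<and> chain v \<and> bc1 v = 0 \<and> bc2 v = 0)"
proof -
  have 1: "v 2 0 = \<alpha> * v 0 0 + of_real \<alpha>1 * v 1 0 \<longleftrightarrow> bc1 v = 0"
    "v 3 0 = - of_real \<alpha>2 * v 0 0 - cnj \<alpha> * v 1 0 \<longleftrightarrow> bc2 v = 0" for v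
    unfolding bc1_def bc2_def by (auto simp: algebra_simps eq_neg_iff_add_eq_0)
  show ?thesis unfolding Hgraph_def chain_def acp_def 1 by (rule refl)
qed

lemma H_E:
  assumes "H u w"
  obtains v where "\<And>k. k \<le> 4 \<Longrightarrow> v k \<in> L2" "aeq (v 0) u" "aeq (v 4) w" "chain v" "bc1 v = 0" "bc2 v = 0"
  using assms unfolding H_iff by blast

lemma H_L2: "H u w \<Longrightarrow> u \<in> L2" "H u w \<Longrightarrow> w \<in> L2"
  by (auto simp: H_iff)

lemma HI:
  assumes "\<And>k. k \<le> 4 \<Longrightarrow> v k \<in> L2" "chain v" "bc1 v = 0" "bc2 v = 0"
  shows "H (v 0) (v 4)"
  unfolding H_iff using assms by (intro conjI exI[of _ v]) auto

lemma H_add: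
  assumes "H u w" "H u' w'" shows "H (\<lambda>x. u x + c * u' x) (\<lambda>x. w x + c * w' x)"
proof -
  obtain v where v: "\<And>k. k \<le> 4 \<Longrightarrow> v k \<in> L2" "aeq (v 0) u" "aeq (v 4) w" "chain v" "bc1 v = 0" "bc2 v = 0"
    using H_E[OF assms(1)] by blast
  obtain v' where v': "\<And>k. k \<le> 4 \<Longrightarrow> v' k \<in> L2" "aeq (v' 0) u'" "aeq (v' 4) w'" "chain v'" "bc1 v' = 0" "bc2 v' = 0"
    using H_E[OF assms(2)] by blast
  let ?v = "\<lambda>k x. v k x + c * v' k x"
  have ae: "aeq (\<lambda>x. f x + c * g x) (\<lambda>x. f' x + c * g' x)" if "aeq f f'" "aeq g g'" for f f' g g'
    using that unfolding aeq_iff by (auto elim: AE_mp)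
  have "bc1 ?v = bc1 v + c * bc1 v'" "bc2 ?v = bc2 v + c * bc2 v'"
    by (simp_all add: bc1_def bc2_def algebra_simps)
  then show ?thesis unfolding H_iff
    using v v' H_L2[OF assms(1)] H_L2[OF assms(2)]
    by (intro conjI exI[of _ ?v] L2_add L2_cmult ae chain_add chain_cmult allI impI) auto
qed

text \<open>After elimination of the second and third derivatives the terms cancel in pairs: those
  with \<alpha>1 and \<alpha>2 because these are real, the mixed ones because \<alpha> in the first
  condition meets its conjugate in the second.\<close>

lemma wronskian_bc:
  assumes "bc1 v = 0" "bc2 v = 0" "bc1 w = 0" "bc2 w = 0"
  shows "wronskian v (cnjs w) 0 = 0"
proof -
  have e: "v 2 0 = \<alpha> * v 0 0 + of_real \<alpha>1 * v 1 0" "v 3 0 = - of_real \<alpha>2 * v 0 0 - cnj \<alpha> * v 1 0"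
    "w 2 0 = \<alpha> * w 0 0 + of_real \<alpha>1 * w 1 0" "w 3 0 = - of_real \<alpha>2 * w 0 0 - cnj \<alpha> * w 1 0"
    using assms unfolding bc1_def bc2_def by (auto simp: algebra_simps eq_neg_iff_add_eq_0)
  show ?thesis unfolding wronskian_def e by (simp add: algebra_simps)
qed

text \<open>Lagrange's identity on the half-line: the bracket vanishes at 0 by the boundary
  conditions and at infinity by decay.\<close>

lemma H_symmetric:
  assumes "H u w" "H u' w'" shows "ip w u' = ip u w'"
proof -
  obtain v where v: "\<And>k. k \<le> 4 \<Longrightarrow> v k \<in> L2" "aeq (v 0) u" "aeq (v 4) w" "chain v" "bc1 v = 0" "bc2 v = 0"
    using H_E[OF assms(1)] by blast
  obtain v' where v': "\<And>k. k \<le> 4 \<Longrightarrow> v' k \<in> L2" "aeq (v' 0) u'" "aeq (v' 4) w'" "chain v'" "bc1 v' = 0" "bc2 v' = 0"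
    using H_E[OF assms(2)] by blast
  have i: "integrable hl (\<lambda>x. v 4 x * cnj (v' 0 x))" "integrable hl (\<lambda>x. v 0 x * cnj (v' 4 x))"
    by (intro ip_integrable v v'; simp)+
  have "(wronskian v (cnjs v') \<longlongrightarrow> wronskian v (cnjs v') 0 + (\<integral>x. v 4 x * cnj (v' 0 x) - v 0 x * cnj (v' 4 x) \<partial>hl)) at_top"
    by (intro acp_tendsto acp_wronskian chain_cnjs v v' Bochner_Integration.integrable_diff i)
  moreover have "(wronskian v (cnjs v') \<longlongrightarrow> 0) at_top"
    by (intro wronskian_tendsto_zero chain_cnjs L2_cnj v v')
  ultimately have "wronskian v (cnjs v') 0 + (\<integral>x. v 4 x * cnj (v' 0 x) - v 0 x * cnj (v' 4 x) \<partial>hl) = 0"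
    by (rule tendsto_unique[OF trivial_limit_at_top_linorder])
  then have "ip (v 4) (v' 0) = ip (v 0) (v' 4)"
    using wronskian_bc[of v v'] v v' i by (simp add: ip_hl)
  moreover have "ip (v 4) (v' 0) = ip w u'" "ip (v 0) (v' 4) = ip u w'"
    by (intro ip_cong L2_meas v v' H_L2[OF assms(1)] H_L2[OF assms(2)]; simp)+
  ultimately show ?thesis by simp
qed

text \<open>Pair \<open>(H - z) u = f\<close> with \<open>u\<close>; the term \<open>ip w u\<close>
  is real by symmetry. The identity makes the imaginary part of the resolvent form a multiple of a
  squared norm.\<close>

lemma resolvent_im:
  assumes H: "H u w" and f: "f \<in> L2" "aeq (\<lambda>x. w x - z * u x) f"
  shows "Im z * (nrm u)\<^sup>2 = Im (ip u f)"
proof -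
  note L = H_L2[OF H]
  have "ip f u = ip (\<lambda>x. w x - z * u x) u"
    by (rule ip_cong) (use L f in \<open>auto intro!: L2_meas L2_diff L2_cmult aeq_sym[OF f(2)]\<close>)
  also have "\<dots> = ip w u - z * ip u u"
    using L by (simp add: ip_diff_left L2_cmult ip_cmult_left)
  finally have "Im (ip f u) = Im (ip w u) - Im z * (nrm u)\<^sup>2" by (simp add: ip_self)
  moreover have "Im (ip w u) = 0"
    using H_symmetric[OF H H] cnj_ip[of w u] by (metis complex_cnj_cancel_iff Reals_cnj_iff complex_is_Real_iff)
  moreover have "Im (ip u f) = - Im (ip f u)" using arg_cong[OF cnj_ip[of f u], of Im] by simp
  ultimately show ?thesis by simp
qed

lemma resolvent_bound:
  assumes H: "H u w" and f: "f \<in> L2" "aeq (\<lambda>x. w x - z * u x) f"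
  shows "\<bar>Im z\<bar> * nrm u \<le> nrm f"
proof (cases "nrm u = 0")
  case False
  have "\<bar>Im z\<bar> * (nrm u)\<^sup>2 = \<bar>Im (ip u f)\<bar>"
    using resolvent_im[OF assms] by (simp add: abs_mult flip: resolvent_im[OF assms])
  also have "\<dots> \<le> cmod (ip u f)" by (rule abs_Im_le_cmod)
  also have "\<dots> \<le> nrm u * nrm f" by (intro Cauchy_Schwarz_ip H_L2[OF H] f)
  finally have "nrm u * (\<bar>Im z\<bar> * nrm u) \<le> nrm u * nrm f" by (simp add: power2_eq_square ac_simps)
  then show ?thesis using False nrm_nonneg[of u] by (simp add: mult_le_cancel_left)
qed simp

lemma resolvent_unique:
  assumes "Im z \<noteq> 0" "H u w" "H u' w'" "aeq (\<lambda>x. w x - z * u x) f" "aeq (\<lambda>x. w' x - z * u' x) f"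
  shows "aeq u u'"
proof -
  have "H (\<lambda>x. u x + (-1) * u' x) (\<lambda>x. w x + (-1) * w' x)" by (intro H_add assms)
  moreover have "aeq (\<lambda>x. (w x + (-1) * w' x) - z * (u x + (-1) * u' x)) (\<lambda>x. 0)"
    using assms(4,5) unfolding aeq_iff
  proof eventually_elim
    case (elim x) then show ?case by (auto simp: algebra_simps)
  qed
  ultimately have "\<bar>Im z\<bar> * nrm (\<lambda>x. u x + (-1) * u' x) \<le> nrm (\<lambda>x. 0)"
    by (intro resolvent_bound) auto
  also have "nrm (\<lambda>x. 0) = 0" by (simp add: nrm_hl)
  finally have "nrm (\<lambda>x. u x - u' x) = 0"
    using assms(1) nrm_nonneg[of "\<lambda>x. u x - u' x"] by (simp add: mult_le_0_iff)
  then show ?thesis using assms by (intro nrm_diff_0D H_L2) auto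
qed

lemma bc_exp:
  "bc1 (\<lambda>k x. p ^ k * exp (p * of_real x)) = p\<^sup>2 - \<alpha> - of_real \<alpha>1 * p"
  "bc2 (\<lambda>k x. p ^ k * exp (p * of_real x)) = p ^ 3 + of_real \<alpha>2 + cnj \<alpha> * p"
  by (simp_all add: bc1_def bc2_def)

lemma exp_chain_L2: "Re p < 0 \<Longrightarrow> (\<lambda>x. p ^ k * exp (p * of_real x)) \<in> L2"
  using L2_cmult[OF L2_exp[of "- p"], of "p ^ k"] by simp

lemma bc_comb:
  "bc1 (\<lambda>k x. c * v k x + d * w k x) = bc1 v * c + bc1 w * d"
  "bc2 (\<lambda>k x. c * v k x + d * w k x) = bc2 v * c + bc2 w * d"
  by (simp_all add: bc1_def bc2_def algebra_simps)

lemma bc_add: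
  "bc1 (\<lambda>k x. v k x + w k x) = bc1 v + bc1 w"
  "bc2 (\<lambda>k x. v k x + w k x) = bc2 v + bc2 w"
  by (simp_all add: bc1_def bc2_def algebra_simps)

text \<open>A vanishing determinant would give a decaying combination of exponentials satisfying
  both boundary conditions, hence an element of the domain with \<open>H v = z v\<close> for a
  non-real \<open>z\<close>. Symmetry makes it 0, and two distinct exponentials are
  independent.\<close>

lemma decaying_bc_det_nonzero:
  assumes r: "Re r1 < 0" "Re r2 < 0" "r1 ^ 4 = z" "r2 ^ 4 = z" "r1 \<noteq> r2" and z: "Im z \<noteq> 0"
  defines "E \<equiv> \<lambda>p k (x::real). p ^ k * exp (p * of_real x :: complex)"
  shows "bc1 (E r1) * bc2 (E r2) - bc1 (E r2) * bc2 (E r1) \<noteq> 0"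
proof
  assume "bc1 (E r1) * bc2 (E r2) - bc1 (E r2) * bc2 (E r1) = 0"
  from linear_2x2_kernel[OF this] obtain c d where cd: "c \<noteq> 0 \<or> d \<noteq> 0"
    "bc1 (E r1) * c + bc1 (E r2) * d = 0" "bc2 (E r1) * c + bc2 (E r2) * d = 0" by blast
  define v where "v k x = c * E r1 k x + d * E r2 k x" for k x
  have EL: "E r1 k \<in> L2" "E r2 k \<in> L2" for k
    unfolding E_def by (intro exp_chain_L2 r)+
  have ch: "chain v" unfolding v_def E_def by (intro chain_add chain_cmult chain_exp)
  have H: "H (v 0) (v 4)"
  proof (rule HI[OF _ ch])
    show "v k \<in> L2" for k unfolding v_def by (intro L2_add L2_cmult EL)
    show "bc1 v = 0" "bc2 v = 0" unfolding v_def bc_comb using cd by simp_all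
  qed
  have "v 4 = (\<lambda>x. z * v 0 x)" by (simp add: v_def E_def r fun_eq_iff algebra_simps)
  then have "\<bar>Im z\<bar> * nrm (v 0) \<le> nrm (\<lambda>x. 0)" by (intro resolvent_bound[OF H]) auto
  also have "nrm (\<lambda>x. 0) = 0" by (simp add: nrm_hl)
  finally have "nrm (v 0) = 0" using z nrm_nonneg[of "v 0"] by (simp add: mult_le_0_iff)
  then have a0: "aeq (v 0) (\<lambda>x. 0)" using H_L2[OF H] by (simp add: nrm_eq_0_iff)
  have a1: "aeq (v 1) (\<lambda>x. 0)" by (rule acp_aeq_zero[OF chainD(1)[OF ch] a0])
  \<comment> \<open>Joining function and derivative in one null condition yields a single point
    where both vanish; there the Vandermonde system for the two summands is regular.\<close>
  have "aeq (\<lambda>x. cmod (v 0 x) + cmod (v 1 x)) (\<lambda>x. 0 :: complex)"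
    using a0 a1 unfolding aeq_iff by eventually_elim simp
  from aeq_exists[OF this] obtain x where x: "cmod (v 0 x) + cmod (v 1 x) = 0"
    by (metis of_real_eq_0_iff of_real_add)
  then have "v 0 x = 0" "v 1 x = 0" by (auto simp: add_nonneg_eq_0_iff)
  then have e: "c * exp (r1 * of_real x) + d * exp (r2 * of_real x) = 0"
    "r1 * (c * exp (r1 * of_real x)) + r2 * (d * exp (r2 * of_real x)) = 0"
    by (simp_all add: v_def E_def algebra_simps)
  have "(r1 - r2) * (c * exp (r1 * of_real x)) = 0"
  proof -
    have "(r1 - r2) * (c * exp (r1 * of_real x))
       = (r1 * (c * exp (r1 * of_real x)) + r2 * (d * exp (r2 * of_real x)))
         - r2 * (c * exp (r1 * of_real x) + d * exp (r2 * of_real x))" by (simp add: algebra_simps)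
    then show ?thesis using e by simp
  qed
  then have "c = 0" using r(5) by simp
  with e(1) have "d = 0" by simp
  with \<open>c = 0\<close> cd show False by simp
qed

text \<open>The particular solution is square integrable but has arbitrary boundary data; two
  decaying exponentials correct it, their boundary determinant being nonzero. Surjectivity of
  \<open>H - z\<close> for non-real \<open>z\<close> together with symmetry is the self-adjointness
  of \<open>H\<close>.\<close>

theorem resolvent_exists:
  assumes z: "Im z \<noteq> 0" and f: "f \<in> L2"
  shows "\<exists>u w. H u w \<and> w = (\<lambda>x. z * u x + f x)"
proof -
  obtain r1 r2 where r: "Re r1 > 0" "Re r2 > 0" "r1 ^ 4 = z" "r2\<^sup>2 = - r1\<^sup>2"
    using fourth_roots_exist[OF z] by blast
  from particular_solution[OF r f] obtain v where v: "chain v" "\<And>k. k \<le> 4 \<Longrightarrow> v k \<in> L2"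
    "v 4 = (\<lambda>x. z * v 0 x + f x)" by blast
  define E where "E p k x = p ^ k * exp (p * of_real x)" for p :: complex and k :: nat and x :: real
  have r24: "r2 ^ 4 = z" using r(3,4) power_mult[of r1 2 2] power_mult[of r2 2 2] by simp
  have "r1 \<noteq> r2"
  proof
    assume "r1 = r2"
    then have "r1\<^sup>2 = - (r1\<^sup>2)" using r(4) by simp
    then show False using r(1) by (auto simp: equal_neg_zero)
  qed
  then have "bc1 (E (- r1)) * bc2 (E (- r2)) - bc1 (E (- r2)) * bc2 (E (- r1)) \<noteq> 0"
    unfolding E_def[abs_def] by (intro decaying_bc_det_nonzero[OF _ _ _ _ _ z]) (use r r24 in auto)
  from linear_2x2_solve[OF this, of "- bc1 v" "- bc2 v"] obtain c d where cd:
    "bc1 (E (- r1)) * c + bc1 (E (- r2)) * d = - bc1 v" "bc2 (E (- r1)) * c + bc2 (E (- r2)) * d = - bc2 v"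
    by blast
  define V where "V k x = v k x + (c * E (- r1) k x + d * E (- r2) k x)" for k x
  have EL: "E (- r1) k \<in> L2" "E (- r2) k \<in> L2" for k
    unfolding E_def[abs_def] using r by (intro exp_chain_L2; simp)+
  have "H (V 0) (V 4)"
  proof (rule HI)
    show "chain V" unfolding V_def E_def by (intro chain_add chain_cmult chain_exp v)
    show "V k \<in> L2" if "k \<le> 4" for k unfolding V_def by (intro L2_add L2_cmult EL v that)
    have "bc1 V = bc1 v + bc1 (\<lambda>k x. c * E (- r1) k x + d * E (- r2) k x)"
      "bc2 V = bc2 v + bc2 (\<lambda>k x. c * E (- r1) k x + d * E (- r2) k x)"
      unfolding V_def by (rule bc_add)+
    then show "bc1 V = 0" "bc2 V = 0" unfolding bc_comb using cd by simp_all
  qed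
  moreover have "V 4 = (\<lambda>x. z * V 0 x + f x)"
    by (simp add: V_def v(3) E_def r r24 fun_eq_iff algebra_simps)
  ultimately show ?thesis by blast
qed

end

section \<open>Generalized eigenfunctions\<close>

lemma integral_Cauchy_kernel:
  shows integrable_Cauchy_kernel: "integrable lborel (\<lambda>t::real. 1 / (1 + t\<^sup>2))"
    and "(\<integral>t. 1 / (1 + t\<^sup>2) \<partial>lborel) = pi"
proof -
  have ei: "einterval (-\<infinity>) \<infinity> = (UNIV :: real set)" by (auto simp: einterval_def)
  have d: "(arctan has_real_derivative 1 / (1 + x\<^sup>2)) (at x)" for x
    by (rule DERIV_cong[OF DERIV_arctan]) (simp add: field_simps)
  have c: "isCont (\<lambda>x::real. 1 / (1 + x\<^sup>2)) x" for x
    by (intro continuous_intros) (simp add: add_nonneg_eq_0_iff)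
  have l: "((arctan \<circ> real_of_ereal) \<longlongrightarrow> - (pi / 2)) (at_right (- \<infinity>))"
    "((arctan \<circ> real_of_ereal) \<longlongrightarrow> pi / 2) (at_left \<infinity>)"
    unfolding ereal_tendsto_simps by (simp_all add: tendsto_arctan_at_top tendsto_arctan_at_bot)
  have p: "0 \<le> 1 / (1 + x\<^sup>2)" for x :: real by simp
  note F = interval_integral_FTC_nonneg[where F=arctan and f="\<lambda>t. 1 / (1 + t\<^sup>2)" and a="-\<infinity>" and b="\<infinity>", OF _ d c _ l]
  have "set_integrable lborel (einterval (-\<infinity>) \<infinity>) (\<lambda>t::real. 1 / (1 + t\<^sup>2))"
    by (rule F(1)) (simp_all add: p)
  then show "integrable lborel (\<lambda>t::real. 1 / (1 + t\<^sup>2))" by (simp add: ei set_integrable_def)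
  have "(LBINT t=-\<infinity>..\<infinity>. 1 / (1 + t\<^sup>2)) = pi / 2 - (- (pi / 2))"
    by (rule F(2)) (simp_all add: p)
  then show "(\<integral>t. 1 / (1 + t\<^sup>2) \<partial>lborel) = pi"
    by (simp add: interval_lebesgue_integral_def ei set_lebesgue_integral_def)
qed

text \<open>Densities of wave packets. Support away from 0 and infinity keeps the coefficients
  bounded and the denominators off 0; continuity only almost everywhere admits indicators of
  intervals and is all that a limit of Poisson averages uses.\<close>

definition testfn :: "(real \<Rightarrow> complex) \<Rightarrow> bool" where
  "testfn h \<longleftrightarrow> h \<in> borel_measurable borel \<and> (\<exists>M. \<forall>k. cmod (h k) \<le> M) \<and>
     (\<exists>a b. 0 < a \<and> (\<forall>k. k \<notin> {a..b} \<longrightarrow> h k = 0)) \<and> (AE k in lborel. isCont h k)"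

lemma compact_support_integrable:
  fixes f :: "real \<Rightarrow> complex"
  assumes "f \<in> borel_measurable borel" "\<And>k. cmod (f k) \<le> M" "\<And>k. k \<notin> {a..b} \<Longrightarrow> f k = 0"
  shows "integrable lborel f"
proof (rule integrableI_bounded_set[where A="{a..b}" and B=M])
  show "emeasure lborel {a..b} < \<infinity>" by (cases "a \<le> b") auto
qed (use assms in auto)

text \<open>The substitution \<open>l = k + e t\<close> moves the width of the kernel into the
  argument of \<open>b2\<close> and leaves the fixed weight \<open>2 / (1 + t^2)\<close> of mass
  \<open>2 pi\<close>; dominated convergence then applies in \<open>t\<close> and again in
  \<open>k\<close>.\<close>

lemma Poisson_limit:
  fixes b1 b2 :: "real \<Rightarrow> complex"
  assumes b1: "integrable lborel b1"
    and b2: "b2 \<in> borel_measurable borel" "\<And>k. cmod (b2 k) \<le> M" "AE k in lborel. isCont b2 k"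
    and e: "\<And>n. e n > 0" "e \<longlonglongrightarrow> 0"
  shows "(\<lambda>n. \<integral>k. b1 k * (\<integral>l. cnj (b2 l) * of_real (2 * e n / ((e n)\<^sup>2 + (k - l)\<^sup>2)) \<partial>lborel) \<partial>lborel)
    \<longlonglongrightarrow> 2 * of_real pi * (\<integral>k. b1 k * cnj (b2 k) \<partial>lborel)"
proof -
  note b2(1)[measurable]
  define I where "I n k = (\<integral>t. cnj (b2 (k + e n * t)) * of_real (2 / (1 + t\<^sup>2)) \<partial>lborel)" for n k
  have int2: "integrable lborel (\<lambda>t::real. M * (2 / (1 + t\<^sup>2)))"
    using integrable_mult_right[OF integrable_Cauchy_kernel, of "M * 2"] by simp
  have M0: "0 \<le> M" using b2(2)[of 0] norm_ge_zero order_trans by blast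
  have bnd: "norm (cnj (b2 (k + e n * t)) * complex_of_real (2 / (1 + t\<^sup>2))) \<le> M * (2 / (1 + t\<^sup>2))" for n k t
    unfolding norm_mult using b2(2)[of "k + e n * t"]
    by (intro mult_mono) (auto simp: M0 norm_divide norm_of_real abs_of_nonneg add_nonneg_pos simp del: of_real_add of_real_divide)
  have Ieq: "(\<integral>l. cnj (b2 l) * of_real (2 * e n / ((e n)\<^sup>2 + (k - l)\<^sup>2)) \<partial>lborel) = I n k" for n k
  proof -
    have "(\<integral>l. cnj (b2 l) * of_real (2 * e n / ((e n)\<^sup>2 + (k - l)\<^sup>2)) \<partial>lborel)
      = \<bar>e n\<bar> *\<^sub>R (\<integral>t. cnj (b2 (k + e n * t)) * of_real (2 * e n / ((e n)\<^sup>2 + (k - (k + e n * t))\<^sup>2)) \<partial>lborel)"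
      by (rule lborel_integral_real_affine) (use e(1)[of n] in simp)
    also have "\<dots> = (\<integral>t. \<bar>e n\<bar> *\<^sub>R (cnj (b2 (k + e n * t)) * of_real (2 * e n / ((e n)\<^sup>2 + (k - (k + e n * t))\<^sup>2))) \<partial>lborel)"
      by simp
    also have "\<dots> = I n k" unfolding I_def
    proof (intro Bochner_Integration.integral_cong refl)
      fix t :: real
      have "1 + t\<^sup>2 > 0" by (rule add_pos_nonneg) auto
      have "(e n)\<^sup>2 + (k - (k + e n * t))\<^sup>2 = (e n * e n) * (1 + t\<^sup>2)"
        by (simp add: power2_eq_square algebra_simps)
      then have "e n * (2 * e n / ((e n)\<^sup>2 + (k - (k + e n * t))\<^sup>2)) = 2 / (1 + t\<^sup>2)"
        using e(1)[of n] by simp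
      moreover have "\<bar>e n\<bar> *\<^sub>R (cnj (b2 (k + e n * t)) * complex_of_real (2 * e n / ((e n)\<^sup>2 + (k - (k + e n * t))\<^sup>2)))
         = cnj (b2 (k + e n * t)) * complex_of_real (e n * (2 * e n / ((e n)\<^sup>2 + (k - (k + e n * t))\<^sup>2)))"
        using e(1)[of n] by (simp add: scaleR_conv_of_real)
      ultimately show "\<bar>e n\<bar> *\<^sub>R (cnj (b2 (k + e n * t)) * complex_of_real (2 * e n / ((e n)\<^sup>2 + (k - (k + e n * t))\<^sup>2)))
         = cnj (b2 (k + e n * t)) * complex_of_real (2 / (1 + t\<^sup>2))" by simp
    qed
    finally show ?thesis .
  qed
  have Ilim: "(\<lambda>n. I n k) \<longlonglongrightarrow> 2 * of_real pi * cnj (b2 k)" if k: "isCont b2 k" for k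
  proof -
    have "(\<lambda>n. I n k) \<longlonglongrightarrow> (\<integral>t. cnj (b2 k) * of_real (2 / (1 + t\<^sup>2)) \<partial>lborel)"
      unfolding I_def
    proof (rule integral_dominated_convergence[OF _ _ int2])
      show "AE t in lborel. (\<lambda>n. cnj (b2 (k + e n * t)) * complex_of_real (2 / (1 + t\<^sup>2)))
          \<longlonglongrightarrow> cnj (b2 k) * complex_of_real (2 / (1 + t\<^sup>2))"
      proof (rule AE_I2)
        fix t :: real
        have "(\<lambda>n. k + e n * t) \<longlonglongrightarrow> k + 0 * t" by (intro tendsto_intros e)
        then have "(\<lambda>n. b2 (k + e n * t)) \<longlonglongrightarrow> b2 k" by (intro isCont_tendsto_compose[OF k]) simp
        then show "(\<lambda>n. cnj (b2 (k + e n * t)) * complex_of_real (2 / (1 + t\<^sup>2)))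
          \<longlonglongrightarrow> cnj (b2 k) * complex_of_real (2 / (1 + t\<^sup>2))" by (intro tendsto_intros)
      qed
    qed (use bnd in auto)
    also have "(\<integral>t. cnj (b2 k) * of_real (2 / (1 + t\<^sup>2)) \<partial>lborel) = cnj (b2 k) * of_real (\<integral>t. 2 / (1 + t\<^sup>2) \<partial>lborel)"
      unfolding integral_mult_right_zero integral_complex_of_real ..
    also have "(\<integral>t. 2 / (1 + t\<^sup>2) \<partial>lborel) = (\<integral>t. (2::real) * (1 / (1 + t\<^sup>2)) \<partial>lborel)"
      by simp
    also have "\<dots> = 2 * pi"
      unfolding integral_mult_right_zero integral_Cauchy_kernel ..
    finally show ?thesis by (simp add: ac_simps)
  qed
  have Ib: "cmod (I n k) \<le> M * (2 * pi)" for n k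
  proof -
    have "cmod (I n k) \<le> (\<integral>t. norm (cnj (b2 (k + e n * t)) * complex_of_real (2 / (1 + t\<^sup>2))) \<partial>lborel)"
      unfolding I_def by (rule integral_norm_bound)
    also have "\<dots> \<le> (\<integral>t. M * (2 / (1 + t\<^sup>2)) \<partial>lborel)"
    proof (rule integral_mono[OF _ int2 bnd])
      show "integrable lborel (\<lambda>t. norm (cnj (b2 (k + e n * t)) * complex_of_real (2 / (1 + t\<^sup>2))))"
        by (rule Bochner_Integration.integrable_bound[OF int2]) (use bnd M0 in \<open>auto intro!: AE_I2 order_trans[OF bnd abs_ge_self]\<close>)
    qed
    also have "(\<lambda>t. M * (2 / (1 + t\<^sup>2))) = (\<lambda>t. (M * 2) * (1 / (1 + t\<^sup>2)))" by simp
    also have "(\<integral>t. (M * 2) * (1 / (1 + t\<^sup>2)) \<partial>lborel) = M * (2 * pi)"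
      unfolding integral_mult_right_zero integral_Cauchy_kernel by simp
    finally show ?thesis .
  qed
  have Im [measurable]: "I n \<in> borel_measurable borel" for n
    unfolding I_def by measurable
  have "(\<lambda>n. \<integral>k. b1 k * I n k \<partial>lborel) \<longlonglongrightarrow> (\<integral>k. b1 k * (2 * of_real pi * cnj (b2 k)) \<partial>lborel)"
  proof (rule integral_dominated_convergence)
    show "integrable lborel (\<lambda>k. norm (b1 k) * (M * (2 * pi)))"
      by (intro integrable_mult_left integrable_norm b1)
    show "AE k in lborel. (\<lambda>n. b1 k * I n k) \<longlonglongrightarrow> b1 k * (2 * of_real pi * cnj (b2 k))"
      using b2(3) by eventually_elim (intro tendsto_intros Ilim)
    show "AE k in lborel. norm (b1 k * I n k) \<le> norm (b1 k) * (M * (2 * pi))" for n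
      unfolding norm_mult by (intro AE_I2 mult_left_mono Ib) auto
  qed (use b1 in auto)
  also have "(\<integral>k. b1 k * (2 * of_real pi * cnj (b2 k)) \<partial>lborel) = (\<integral>k. (2 * of_real pi) * (b1 k * cnj (b2 k)) \<partial>lborel)"
    by (simp add: ac_simps)
  finally show ?thesis unfolding Ieq integral_mult_right_zero .
qed

context biharmonic
begin

definition a0 :: real where "a0 = \<alpha>1 * \<alpha>2 - (cmod \<alpha>)\<^sup>2"

definition Om :: "real \<Rightarrow> complex" where "Om k = Omega \<alpha> \<alpha>1 \<alpha>2 (of_real k)"

definition Nm :: "real \<Rightarrow> complex" where
  "Nm k = alpha0 \<alpha> \<alpha>1 \<alpha>2 + 2 * \<i> * of_real (Im \<alpha>) * of_real (k\<^sup>2) + of_real (k ^ 4)"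

lemma Om_Complex: "Om k = Complex (a0 + \<alpha>2 * k - \<alpha>1 * k ^ 3 - k ^ 4) (- \<alpha>2 * k + 2 * Re \<alpha> * k\<^sup>2 - \<alpha>1 * k ^ 3)"
proof -
  have "complex_of_real k ^ 4 = of_real (k ^ 4)" "complex_of_real k ^ 3 = of_real (k ^ 3)"
    "(complex_of_real k)\<^sup>2 = of_real (k\<^sup>2)" by simp_all
  then show ?thesis
    unfolding Om_def Omega_def alpha0_def a0_def
    by (simp only:) (simp add: complex_eq_iff del: of_real_power)
qed

lemma Nm_Complex: "Nm k = Complex (a0 + k ^ 4) (2 * Im \<alpha> * k\<^sup>2)"
  unfolding Nm_def alpha0_def a0_def by (simp add: complex_eq_iff del: of_real_power)

definition ex :: "real \<Rightarrow> nat \<Rightarrow> complex" where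
  "ex k i = (if i = 0 then \<i> * of_real k else if i = 1 then - \<i> * of_real k else - of_real k)"

text \<open>Clearing the denominator \<open>Omega\<close> in \<open>psi\<close> and using that
  \<open>exp\<close> of plus or minus \<open>i pi / 4\<close> is \<open>(1 + i) / sqrt 2\<close> or
  \<open>(1 - i) / sqrt 2\<close> gives the common denominator \<open>2 sqrt 2\<close>. Indices 0
  and 1 are the two waves; every other index stands for the decaying
  \<open>exp (- k x)\<close>.\<close>

definition co :: "real \<Rightarrow> nat \<Rightarrow> complex" where
  "co k i = (if i = 0 then cnj (Om k) * (1 + \<i>) else if i = 1 then Om k * (1 - \<i>) else - 2 * Nm k) / of_real (2 * sqrt 2)"

text \<open>\<open>PS k j\<close> is the \<open>j\<close>-th derivative of \<open>\<Omega>(k) \<psi>(\<cdot>,k\<^sup>4)\<close>; multiplying by \<open>\<Omega>\<close> removes the poles of the coefficients.\<close>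

definition PS :: "real \<Rightarrow> nat \<Rightarrow> real \<Rightarrow> complex" where
  "PS k j x = (\<Sum>i<3. co k i * (ex k i ^ j * exp (ex k i * of_real x)))"

lemma sum3: "(\<Sum>i<3. f i) = f 0 + f 1 + f (2::nat)" for f :: "nat \<Rightarrow> 'b::comm_monoid_add"
  by (simp add: numeral_eq_Suc lessThan_Suc ac_simps)

lemma ex_pow4: "i < 3 \<Longrightarrow> ex k i ^ 4 = of_real (k ^ 4)"
  by (auto simp: ex_def power_mult_distrib)

lemma chain_PS: "chain (PS k)"
  unfolding PS_def[abs_def] by (intro chain_sum chain_cmult chain_exp)

lemma PS_4: "PS k 4 x = of_real (k ^ 4) * PS k 0 x"
  unfolding PS_def sum_distrib_left by (intro sum.cong refl) (simp add: ex_pow4)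

lemma Re_ex: "k > 0 \<Longrightarrow> i < 3 \<Longrightarrow> Re (ex k i) \<le> 0"
  by (auto simp: ex_def)

text \<open>\<open>Om\<close> and \<open>Nm\<close> are built for this: once they are split into
  real and imaginary parts and \<open>|\<alpha>|^2\<close> is expanded, each condition is a
  polynomial identity in \<open>k\<close>.\<close>

lemma bc_PS: "bc1 (PS k) = 0" "bc2 (PS k) = 0"
proof -
  have p3: "\<i> ^ 3 = - \<i>" by (simp add: power3_eq_cube)
  have v: "PS k 0 0 = (cnj (Om k) * (1 + \<i>) + Om k * (1 - \<i>) - 2 * Nm k) / of_real (2 * sqrt 2)"
    "PS k 1 0 = of_real k * (cnj (Om k) * (1 + \<i>) * \<i> - Om k * (1 - \<i>) * \<i> + 2 * Nm k) / of_real (2 * sqrt 2)"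
    "PS k 2 0 = of_real (k ^ 2) * (- (cnj (Om k) * (1 + \<i>)) - Om k * (1 - \<i>) - 2 * Nm k) / of_real (2 * sqrt 2)"
    "PS k 3 0 = of_real (k ^ 3) * (- (cnj (Om k) * (1 + \<i>) * \<i>) + Om k * (1 - \<i>) * \<i> + 2 * Nm k) / of_real (2 * sqrt 2)"
    by (simp_all add: PS_def sum3 ex_def co_def power_mult_distrib p3 algebra_simps diff_divide_distrib add_divide_distrib)
  have a2: "(cmod \<alpha>)\<^sup>2 = Re \<alpha> * Re \<alpha> + Im \<alpha> * Im \<alpha>" unfolding cmod_power2 by (simp add: power2_eq_square)
  have pw: "k ^ 4 = k * k * k * k" "k ^ 3 = k * k * k" "k ^ 2 = k * k"
    by (simp_all add: power4_eq_xxxx power3_eq_cube power2_eq_square)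
  have "of_real (k ^ 2) * (- (cnj (Om k) * (1 + \<i>)) - Om k * (1 - \<i>) - 2 * Nm k)
    - \<alpha> * (cnj (Om k) * (1 + \<i>) + Om k * (1 - \<i>) - 2 * Nm k)
    - of_real \<alpha>1 * (of_real k * (cnj (Om k) * (1 + \<i>) * \<i> - Om k * (1 - \<i>) * \<i> + 2 * Nm k)) = 0"
    unfolding Om_Complex Nm_Complex a0_def a2 pw by (simp add: complex_eq_iff algebra_simps)
  then show "bc1 (PS k) = 0" unfolding bc1_def v
    by (simp add: diff_divide_distrib[symmetric] times_divide_eq_right)
  have "of_real (k ^ 3) * (- (cnj (Om k) * (1 + \<i>) * \<i>) + Om k * (1 - \<i>) * \<i> + 2 * Nm k)
    + of_real \<alpha>2 * (cnj (Om k) * (1 + \<i>) + Om k * (1 - \<i>) - 2 * Nm k)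
    + cnj \<alpha> * (of_real k * (cnj (Om k) * (1 + \<i>) * \<i> - Om k * (1 - \<i>) * \<i> + 2 * Nm k)) = 0"
    unfolding Om_Complex Nm_Complex a0_def a2 pw by (simp add: complex_eq_iff algebra_simps)
  then show "bc2 (PS k) = 0" unfolding bc2_def v
    by (simp add: add_divide_distrib[symmetric] times_divide_eq_right)
qed

lemma psi_PS:
  assumes lam: "lam > 0" and Om: "Om (kk lam) \<noteq> 0"
  shows "Om (kk lam) * psi \<alpha> \<alpha>1 \<alpha>2 x lam = PS (kk lam) 0 x"
proof -
  define k where "k = kk lam"
  have s2: "complex_of_real (sqrt 2) * complex_of_real (sqrt 2) = 2"
    by (metis of_real_mult of_real_numeral real_sqrt_mult_self abs_numeral)
  have r2: "sqrt 2 / 2 = 1 / sqrt 2" by (simp add: field_simps)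
  have e1: "exp (of_real pi * \<i> / 4) = (1 + \<i>) / of_real (sqrt 2)"
  proof -
    have "exp (of_real pi * \<i> / 4) = cis (pi / 4)" by (simp add: cis_conv_exp ac_simps)
    then show ?thesis by (rule trans) (simp add: complex_eq_iff cos_45 sin_45 r2)
  qed
  have e2: "exp (- (of_real pi * \<i> / 4)) = (1 - \<i>) / of_real (sqrt 2)"
  proof -
    have "exp (- (of_real pi * \<i> / 4)) = cis (- (pi / 4))" by (simp add: cis_conv_exp ac_simps)
    then show ?thesis by (rule trans) (simp add: complex_eq_iff cos_45 sin_45 r2)
  qed
  have p2: "(2::real) powr (- 1 / 2) = 1 / sqrt 2"
    by (simp add: powr_minus powr_half_sqrt field_simps)
  have s: "Om k * sfun \<alpha> \<alpha>1 \<alpha>2 lam = cnj (Om k)" and b: "Om k * bfun \<alpha> \<alpha>1 \<alpha>2 lam = Nm k"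
    using Om unfolding sfun_def bfun_def Om_def[symmetric] k_def Nm_def by auto
  have "Om k * psi \<alpha> \<alpha>1 \<alpha>2 x lam =
     (1/2) * ((Om k * sfun \<alpha> \<alpha>1 \<alpha>2 lam) * (exp (\<i> * of_real (k * x)) * exp (of_real pi * \<i> / 4))
              + Om k * (exp (- \<i> * of_real (k * x)) * exp (- (of_real pi * \<i> / 4))))
     - of_real (2 powr (-1/2)) * (Om k * bfun \<alpha> \<alpha>1 \<alpha>2 lam) * of_real (exp (- k * x))"
    unfolding psi_def k_def[symmetric] exp_add[symmetric] by (simp add: algebra_simps)
  also have "\<dots> = PS k 0 x"
    unfolding s b e1 e2 p2 PS_def sum3 co_def ex_def
    by (simp add: exp_of_real[symmetric] field_simps)
  finally show ?thesis unfolding k_def .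
qed

end

section \<open>Wave packets\<close>

lemma testfnE:
  assumes "testfn h"
  obtains a b M where "0 < a" "\<And>k. k \<notin> {a..b} \<Longrightarrow> h k = 0" "\<And>k. cmod (h k) \<le> M"
    "h \<in> borel_measurable borel" "AE k in lborel. isCont h k"
  using assms unfolding testfn_def by blast

lemma testfn_integrable: "testfn h \<Longrightarrow> integrable lborel h"
  by (elim testfnE) (rule compact_support_integrable)

lemma testfn_nonpos: "testfn h \<Longrightarrow> k \<le> 0 \<Longrightarrow> h k = 0"
  by (elim testfnE) auto

lemma testfn_mult:
  assumes "testfn h" "continuous_on UNIV g" shows "testfn (\<lambda>k. h k * g k)"
proof -
  from assms(1) obtain a b M where h: "0 < a" "\<And>k. k \<notin> {a..b} \<Longrightarrow> h k = 0" "\<And>k. cmod (h k) \<le> M"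
    "h \<in> borel_measurable borel" "AE k in lborel. isCont h k" by (rule testfnE) blast
  have "compact (g ` {a..b})"
    by (intro compact_continuous_image continuous_on_subset[OF assms(2)]) auto
  then obtain C where C: "\<And>k. k \<in> {a..b} \<Longrightarrow> cmod (g k) \<le> C"
    by (meson compact_imp_bounded bounded_iff imageI)
  have "cmod (h k * g k) \<le> \<bar>M\<bar> * \<bar>C\<bar>" for k
  proof (cases "k \<in> {a..b}")
    case True
    have "cmod (h k) * cmod (g k) \<le> \<bar>M\<bar> * \<bar>C\<bar>"
      using h(3)[of k] C[OF True] by (intro mult_mono) auto
    then show ?thesis by (simp add: norm_mult)
  qed (simp add: h(2))
  moreover have "AE k in lborel. isCont (\<lambda>k. h k * g k) k"
    using h(5) by eventually_elim (use assms(2) in \<open>auto intro!: continuous_intros simp: continuous_on_eq_continuous_at\<close>)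
  moreover have "(\<lambda>k. h k * g k) \<in> borel_measurable borel"
    using h(4) borel_measurable_continuous_onI[OF assms(2)] by (intro borel_measurable_times)
  ultimately show ?thesis
    unfolding testfn_def using h(1,2) by (metis mult_zero_left)
qed

lemma lborel_integral_product:
  fixes F G :: "real \<Rightarrow> complex"
  assumes "integrable lborel F" "integrable lborel G"
  shows "(\<integral>p. F (fst p) * G (snd p) \<partial>(lborel \<Otimes>\<^sub>M lborel)) = (\<integral>k. F k \<partial>lborel) * (\<integral>l. G l \<partial>lborel)"
proof -
  have "integrable (lborel \<Otimes>\<^sub>M lborel) (\<lambda>p. 1 * (F (fst p) * G (snd p)))"
    by (rule integrable_product_kernel[OF _ assms, where c=1]) (unfold_locales, auto)
  from lborel_pair.integral_fst'[OF this] show ?thesis by simp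
qed

lemma AE_off_diagonal: "AE p in (lborel \<Otimes>\<^sub>M lborel). fst p \<noteq> (snd p :: real)"
proof (rule lborel_pair.AE_pair_measure)
  show "AE x in lborel. AE y in lborel. fst (x, y) \<noteq> (snd (x, y) :: real)"
  proof (rule AE_I2)
    fix x :: real
    show "AE y in lborel. fst (x, y) \<noteq> snd (x, y)"
      using AE_lborel_singleton[of x] by eventually_elim auto
  qed
qed measurable

text \<open>The second factor is the \<open>wronskian\<close> at 0 of \<open>exp (p x)\<close> and
  \<open>exp (q x)\<close>, so this is Lagrange's identity for exponentials.\<close>

lemma sum_pow4:
  fixes p q :: complex
  shows "(p + q) * (p ^ 3 - p\<^sup>2 * q + p * q\<^sup>2 - q ^ 3) = p ^ 4 - q ^ 4"
  by (simp add: algebra_simps power2_eq_square power3_eq_cube power4_eq_xxxx)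

context biharmonic
begin

lemma continuous_Om [continuous_intros]: "continuous_on S Om"
  unfolding Om_def[abs_def] Omega_def by (intro continuous_intros)

lemma continuous_Nm [continuous_intros]: "continuous_on S Nm"
  unfolding Nm_def[abs_def] by (intro continuous_intros)

lemma continuous_co: "continuous_on S (\<lambda>k. co k i)"
  unfolding co_def by (cases "i = 0"; cases "i = 1") (auto intro!: continuous_intros)

lemma continuous_ex: "continuous_on S (\<lambda>k. ex k i)"
  unfolding ex_def by (cases "i = 0"; cases "i = 1") (auto intro!: continuous_intros)

lemma co_measurable [measurable]: "(\<lambda>k. co k i) \<in> borel_measurable borel"
  by (rule borel_measurable_continuous_onI[OF continuous_co])

lemma ex_measurable [measurable]: "(\<lambda>k. ex k i) \<in> borel_measurable borel"
  by (rule borel_measurable_continuous_onI[OF continuous_ex])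

lemma co_bounded: "\<exists>C\<ge>0. \<forall>k\<in>{a..b}. \<forall>i. cmod (co k i) \<le> C"
proof -
  have "\<exists>C. \<forall>k\<in>{a..b}. cmod (co k i) \<le> C" for i
  proof -
    have "compact ((\<lambda>k. co k i) ` {a..b})"
      by (intro compact_continuous_image continuous_co) auto
    then show ?thesis by (meson compact_imp_bounded bounded_iff imageI)
  qed
  then obtain C where C: "\<And>i k. k \<in> {a..b} \<Longrightarrow> cmod (co k i) \<le> C i" by metis
  have "cmod (co k i) \<le> \<bar>C 0\<bar> + \<bar>C 1\<bar> + \<bar>C 2\<bar>" if "k \<in> {a..b}" for k i
  proof -
    have "co k i \<in> {co k 0, co k 1, co k 2}" by (auto simp: co_def)
    then show ?thesis using C[OF that, of 0] C[OF that, of 1] C[OF that, of 2] by auto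
  qed
  then show ?thesis by (intro exI[of _ "\<bar>C 0\<bar> + \<bar>C 1\<bar> + \<bar>C 2\<bar>"]) auto
qed

lemma exp_ex_bound: "k > 0 \<Longrightarrow> x \<ge> 0 \<Longrightarrow> cmod (exp (ex k i * of_real x)) \<le> 1"
  by (auto simp: ex_def)

lemma PS_bound:
  assumes "0 < a" shows "\<exists>C\<ge>0. \<forall>k\<in>{a..b}. \<forall>x\<ge>0. cmod (PS k 0 x) \<le> C"
proof -
  obtain C where C: "C \<ge> 0" "\<And>k i. k \<in> {a..b} \<Longrightarrow> cmod (co k i) \<le> C" using co_bounded by blast
  have "cmod (PS k 0 x) \<le> (\<Sum>i<3::nat. C)" if k: "k \<in> {a..b}" and x: "x \<ge> 0" for k x
    unfolding PS_def
  proof (rule order_trans[OF norm_sum], rule sum_mono)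
    fix i :: nat
    have "cmod (co k i) * cmod (exp (ex k i * of_real x)) \<le> C * 1"
      using C k x assms by (intro mult_mono C exp_ex_bound) auto
    then show "cmod (co k i * (ex k i ^ 0 * exp (ex k i * of_real x))) \<le> C" by (simp add: norm_mult)
  qed
  then show ?thesis using C(1) by (intro exI[of _ "3 * C"]) auto
qed

lemma PS_meas1: "(\<lambda>k. PS k 0 x) \<in> borel_measurable borel"
  unfolding PS_def by measurable

text \<open>The superposition of generalized eigenfunctions with density \<open>h\<close>: up to the
  factor \<open>Om\<close> and a constant, the adjoint of the transform applied to
  \<open>h\<close>.\<close>

definition TP :: "(real \<Rightarrow> complex) \<Rightarrow> real \<Rightarrow> complex" where
  "TP h x = (\<integral>k. h k * PS k 0 x \<partial>lborel)"

text \<open>The damped inner product of two generalized eigenfunctions in closed form: all exponents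
  have nonpositive real part, and \<open>e > 0\<close> makes each product of exponentials
  integrable.\<close>

definition KK :: "real \<Rightarrow> real \<Rightarrow> real \<Rightarrow> complex" where
  "KK e k l = (\<Sum>i<3. \<Sum>j<3. co k i * cnj (co l j) / (of_real e - ex k i - cnj (ex l j)))"

lemma KK_integral:
  assumes "k > 0" "l > 0" "e > 0"
  shows "(\<integral>x. exp (- (of_real e * of_real x)) * (PS k 0 x * cnj (PS l 0 x)) \<partial>hl) = KK e k l"
proof -
  have re: "Re (of_real e - ex k i - cnj (ex l j)) > 0" if "i < 3" "j < 3" for i j
    using Re_ex[OF assms(1) that(1)] Re_ex[OF assms(2) that(2)] assms(3) by simp
  have "(\<integral>x. exp (- (of_real e * of_real x)) * (PS k 0 x * cnj (PS l 0 x)) \<partial>hl)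
    = (\<integral>x. (\<Sum>i<3. \<Sum>j<3. (co k i * cnj (co l j)) * exp (- ((of_real e - ex k i - cnj (ex l j)) * of_real x))) \<partial>hl)"
  proof (rule Bochner_Integration.integral_cong[OF refl])
    fix x :: real
    have PP: "PS k 0 x * cnj (PS l 0 x)
      = (\<Sum>i<3. \<Sum>j<3. (co k i * exp (ex k i * of_real x)) * (cnj (co l j) * exp (cnj (ex l j) * of_real x)))"
      unfolding PS_def cnj_sum sum_product by (intro sum.cong refl) (simp add: exp_cnj)
    have "exp (- (of_real e * of_real x)) * (PS k 0 x * cnj (PS l 0 x))
      = (\<Sum>i<3. \<Sum>j<3. exp (- (of_real e * of_real x)) * ((co k i * exp (ex k i * of_real x)) * (cnj (co l j) * exp (cnj (ex l j) * of_real x))))"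
      unfolding PP sum_distrib_left ..
    also have "\<dots> = (\<Sum>i<3. \<Sum>j<3. (co k i * cnj (co l j)) * exp (- ((of_real e - ex k i - cnj (ex l j)) * of_real x)))"
      by (intro sum.cong refl) (simp add: algebra_simps exp_add exp_diff exp_minus field_simps)
    finally show "exp (- (of_real e * of_real x)) * (PS k 0 x * cnj (PS l 0 x)) = \<dots>" .
  qed
  also have "\<dots> = (\<Sum>i<3. \<Sum>j<3. (co k i * cnj (co l j)) * (1 / (of_real e - ex k i - cnj (ex l j))))"
  proof -
    have i: "integrable hl (\<lambda>x. (co k i * cnj (co l j)) * exp (- ((of_real e - ex k i - cnj (ex l j)) * of_real x)))"
      if "i < 3" "j < 3" for i j by (intro integrable_mult_right integrable_exp re that)
    show ?thesis
      by (subst Bochner_Integration.integral_sum, (intro Bochner_Integration.integrable_sum i; simp),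
          intro sum.cong refl, subst Bochner_Integration.integral_sum, (intro i; simp), intro sum.cong refl)
        (simp add: integral_exp[OF re])
  qed
  finally show ?thesis by (simp add: KK_def)
qed

text \<open>Damping makes the triple integral over \<open>x\<close>, \<open>k\<close> and
  \<open>l\<close> absolutely convergent, so that the \<open>x\<close>-integral may be done first;
  it yields \<open>KK\<close>.\<close>

lemma damped_inner_product:
  assumes h1: "testfn h1" and h2: "testfn h2" and e: "e > 0"
  shows "integrable hl (\<lambda>x. exp (- (of_real e * of_real x)) * (TP h1 x * cnj (TP h2 x)))"
    and "(\<integral>x. exp (- (of_real e * of_real x)) * (TP h1 x * cnj (TP h2 x)) \<partial>hl)
      = (\<integral>p. KK e (fst p) (snd p) * (h1 (fst p) * cnj (h2 (snd p))) \<partial>(lborel \<Otimes>\<^sub>M lborel))"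
proof -
  obtain a1 b1 where s1: "0 < a1" "\<And>k. k \<notin> {a1..b1} \<Longrightarrow> h1 k = 0" using testfnE[OF h1] by metis
  obtain a2 b2 where s2: "0 < a2" "\<And>k. k \<notin> {a2..b2} \<Longrightarrow> h2 k = 0" using testfnE[OF h2] by metis
  define a where "a = min a1 a2"
  define b where "b = max b1 b2"
  have a: "0 < a" using s1 s2 by (simp add: a_def)
  have z1: "h1 k = 0" and z2: "h2 k = 0" if "k \<notin> {a..b}" for k
    using s1(2)[of k] s2(2)[of k] that by (auto simp: a_def b_def min_def max_def split: if_splits)
  obtain C where C: "C \<ge> 0" "\<And>k x. k \<in> {a..b} \<Longrightarrow> x \<ge> 0 \<Longrightarrow> cmod (PS k 0 x) \<le> C"
    using PS_bound[OF a] by blast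
  let ?N = "lborel \<Otimes>\<^sub>M lborel :: (real \<times> real) measure"
  interpret N: sigma_finite_measure ?N by (rule lborel_pair.sigma_finite_measure_axioms)
  interpret P: pair_sigma_finite hl ?N by unfold_locales
  define A where "A x = exp (- (of_real e * of_real x) :: complex)" for x :: real
  have A: "integrable hl A" unfolding A_def using e by (intro integrable_exp) simp
  define B where "B p = h1 (fst p) * cnj (h2 (snd p))" for p :: "real \<times> real"
  have i1: "integrable lborel h1" and i2: "integrable lborel (\<lambda>l. cnj (h2 l))"
    using testfn_integrable[OF h1] testfn_integrable[OF h2] by auto
  have "integrable ?N (\<lambda>p. 1 * (h1 (fst p) * cnj (h2 (snd p))))"
    by (rule integrable_product_kernel[OF _ i1 i2, where c=1]) (unfold_locales, auto)
  then have B: "integrable ?N B" by (simp add: B_def[abs_def])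
  define S :: "real set" where "S = {a..b}"
  \<comment> \<open>The indicators repeat the supports of \<open>h1\<close> and \<open>h2\<close>
    inside the kernel, because the bound \<open>C\<close> on \<open>PS\<close> is available only for
    \<open>k\<close> in \<open>{a..b}\<close>.\<close>
  define K where "K q = indicator S (fst (snd q)) * PS (fst (snd q)) 0 (fst q) * (indicator S (snd (snd q)) * cnj (PS (snd (snd q)) 0 (fst q)))"
    for q :: "real \<times> real \<times> real"
  have [measurable]: "(\<lambda>x. x) \<in> hl \<rightarrow>\<^sub>M borel" by (rule borel_measurable_hl) simp
  have [measurable]: "S \<in> sets borel" by (simp add: S_def)
  have Km: "K \<in> borel_measurable (hl \<Otimes>\<^sub>M ?N)"
    unfolding K_def PS_def by measurable
  have Kb: "cmod (K q) \<le> C * C" if "q \<in> space (hl \<Otimes>\<^sub>M ?N)" for q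
  proof -
    have "0 < fst q" using that by (auto simp: space_pair_measure)
    then have "cmod (indicator S k * PS k 0 (fst q)) \<le> C" for k
      using C(1) C(2)[of k "fst q"] by (auto simp: indicator_def S_def)
    from this[of "fst (snd q)"] this[of "snd (snd q)"] show ?thesis
      unfolding K_def norm_mult using C(1) by (intro mult_mono) (auto simp: norm_mult)
  qed
  have i: "integrable (hl \<Otimes>\<^sub>M ?N) (\<lambda>q. K q * (A (fst q) * B (snd q)))"
    by (rule integrable_product_kernel[OF _ A B Km Kb]) unfold_locales
  have hP: "integrable lborel (\<lambda>k. h k * (indicator S k * PS k 0 x))" if "x > 0" "integrable lborel h" for x h
  proof (rule Bochner_Integration.integrable_bound)
    show "integrable lborel (\<lambda>k. C * norm (h k))" by (intro integrable_mult_right integrable_norm that)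
    show "AE k in lborel. norm (h k * (indicator S k * PS k 0 x)) \<le> norm (C * norm (h k))"
    proof (rule AE_I2)
      fix k
      have "cmod (indicator S k * PS k 0 x) \<le> C"
        using C(1) C(2)[of k x] that by (auto simp: indicator_def S_def)
      then have "cmod (h k) * cmod (indicator S k * PS k 0 x) \<le> cmod (h k) * C" by (rule mult_left_mono) simp
      then show "norm (h k * (indicator S k * PS k 0 x)) \<le> norm (C * norm (h k))"
        using C(1) unfolding norm_mult by (simp add: ac_simps)
    qed
    show "(\<lambda>k. h k * (indicator S k * PS k 0 x)) \<in> borel_measurable lborel"
      using borel_measurable_integrable[OF that(2)] PS_meas1 by (intro borel_measurable_times) auto
  qed
  have in1: "(\<integral>p. K (x, p) * (A x * B p) \<partial>?N) = A x * (TP h1 x * cnj (TP h2 x))" if x: "x > 0" for x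
  proof -
    have "(\<integral>p. K (x, p) * (A x * B p) \<partial>?N) = (\<integral>p. A x * ((h1 (fst p) * (indicator S (fst p) * PS (fst p) 0 x))
        * cnj (h2 (snd p) * (indicator S (snd p) * PS (snd p) 0 x))) \<partial>?N)"
      by (intro Bochner_Integration.integral_cong refl) (simp add: K_def B_def indicator_def ac_simps)
    also have "\<dots> = A x * ((\<integral>k. h1 k * (indicator S k * PS k 0 x) \<partial>lborel) * (\<integral>k. cnj (h2 k * (indicator S k * PS k 0 x)) \<partial>lborel))"
      unfolding integral_mult_right_zero
      by (subst lborel_integral_product[OF hP[OF x i1] integrable_cnj[OF hP[OF x testfn_integrable[OF h2]]]]) (rule refl)
    also have "(\<integral>k. h1 k * (indicator S k * PS k 0 x) \<partial>lborel) = TP h1 x"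
      unfolding TP_def by (intro Bochner_Integration.integral_cong refl) (use z1 in \<open>auto simp: S_def indicator_def\<close>)
    also have "(\<integral>k. cnj (h2 k * (indicator S k * PS k 0 x)) \<partial>lborel) = cnj (\<integral>k. h2 k * (indicator S k * PS k 0 x) \<partial>lborel)"
      by (rule Bochner_Integration.integral_cnj)
    also have "(\<integral>k. h2 k * (indicator S k * PS k 0 x) \<partial>lborel) = TP h2 x"
      unfolding TP_def by (intro Bochner_Integration.integral_cong refl) (use z2 in \<open>auto simp: S_def indicator_def\<close>)
    finally show ?thesis .
  qed
  have in2: "(\<integral>x. K (x, p) * (A x * B p) \<partial>hl) = KK e (fst p) (snd p) * B p" for p
  proof (cases "fst p \<in> S \<and> snd p \<in> S")
    case True
    then have "fst p > 0" "snd p > 0" using a by (auto simp: S_def)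
    have "(\<integral>x. K (x, p) * (A x * B p) \<partial>hl) = (\<integral>x. (A x * (PS (fst p) 0 x * cnj (PS (snd p) 0 x))) * B p \<partial>hl)"
      using True by (intro Bochner_Integration.integral_cong refl) (simp add: K_def ac_simps)
    also have "\<dots> = KK e (fst p) (snd p) * B p"
      unfolding integral_mult_left_zero A_def using KK_integral[OF \<open>fst p > 0\<close> \<open>snd p > 0\<close> e] by simp
    finally show ?thesis .
  next
    case False
    then have "B p = 0" using z1 z2 by (auto simp: B_def S_def)
    then show ?thesis by simp
  qed
  have f1: "integrable hl (\<lambda>x. \<integral>p. K (x, p) * (A x * B p) \<partial>?N)"
    using P.integrable_fst'[OF i] by simp
  have eqA: "integrable hl (\<lambda>x. \<integral>p. K (x, p) * (A x * B p) \<partial>?N) = integrable hl (\<lambda>x. A x * (TP h1 x * cnj (TP h2 x)))"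
    by (intro Bochner_Integration.integrable_cong refl) (use in1 in auto)
  show "integrable hl (\<lambda>x. exp (- (of_real e * of_real x)) * (TP h1 x * cnj (TP h2 x)))"
    using f1 unfolding eqA by (simp add: A_def)
  have "(\<integral>x. A x * (TP h1 x * cnj (TP h2 x)) \<partial>hl) = (\<integral>x. (\<integral>p. K (x, p) * (A x * B p) \<partial>?N) \<partial>hl)"
    by (intro Bochner_Integration.integral_cong refl) (use in1 in auto)
  also have "\<dots> = (\<integral>p. (\<integral>x. K (x, p) * (A x * B p) \<partial>hl) \<partial>?N)"
    using P.Fubini_integral[of "\<lambda>x p. K (x, p) * (A x * B p)"] i by (simp add: case_prod_beta')
  also have "\<dots> = (\<integral>p. KK e (fst p) (snd p) * B p \<partial>?N)"
    unfolding in2 ..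
  finally show "(\<integral>x. exp (- (of_real e * of_real x)) * (TP h1 x * cnj (TP h2 x)) \<partial>hl)
      = (\<integral>p. KK e (fst p) (snd p) * (h1 (fst p) * cnj (h2 (snd p))) \<partial>?N)"
    by (simp add: A_def B_def)
qed

text \<open>The limit kernel vanishes off the diagonal: up to the factor \<open>k\<^sup>4 - l\<^sup>4\<close> it is the boundary form at \<open>0\<close> of two functions
  satisfying the boundary conditions.\<close>

lemma KK_zero:
  assumes k: "k > 0" and l: "l > 0" and kl: "k \<noteq> l"
  shows "(\<Sum>i<3. \<Sum>j<3. co k i * cnj (co l j) / (- ex k i - cnj (ex l j))) = 0"
proof -
  define D where "D = complex_of_real (k ^ 4) - complex_of_real (l ^ 4)"
  have "k ^ 4 \<noteq> l ^ 4" using k l kl by (simp add: power_eq_iff_eq_base)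
  then have D: "D \<noteq> 0" unfolding D_def by (metis of_real_eq_iff right_minus_eq)
  \<comment> \<open>Dividing \<open>sum_pow4\<close> by \<open>k^4 - l^4\<close> trades each
    denominator for the four products that make up the bracket. The common factor is the same for
    all \<open>i\<close> and \<open>j\<close>, since every exponent is a fourth root of
    \<open>k^4\<close> or, conjugated, of \<open>l^4\<close>.\<close>
  have t: "co k i * cnj (co l j) / (- ex k i - cnj (ex l j))
    = (- 1 / D) * ((co k i * ex k i ^ 3) * (cnj (co l j) * cnj (ex l j) ^ 0) - (co k i * ex k i ^ 2) * (cnj (co l j) * cnj (ex l j) ^ 1)
      + (co k i * ex k i ^ 1) * (cnj (co l j) * cnj (ex l j) ^ 2) - (co k i * ex k i ^ 0) * (cnj (co l j) * cnj (ex l j) ^ 3))"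
    if ij: "i < 3" "j < 3" for i j
  proof -
    define p where "p = ex k i"
    define q where "q = cnj (ex l j)"
    have "p ^ 4 - q ^ 4 = D" unfolding p_def q_def D_def
      using ex_pow4[OF ij(1)] ex_pow4[OF ij(2), of l] by (metis complex_cnj_complex_of_real complex_cnj_power)
    then have pq: "(p + q) * (p ^ 3 - p\<^sup>2 * q + p * q\<^sup>2 - q ^ 3) = D" using sum_pow4[of p q] by simp
    then have "p + q \<noteq> 0" using D by auto
    then have "1 / (p + q) = (p ^ 3 - p\<^sup>2 * q + p * q\<^sup>2 - q ^ 3) / D"
      using pq D by (simp add: frac_eq_eq mult.commute)
    moreover have "1 / (- p - q) = - (1 / (p + q))"
      by (metis minus_divide_right minus_add_distrib add_uminus_conv_diff)
    ultimately have "1 / (- p - q) = (- 1 / D) * (p ^ 3 - p\<^sup>2 * q + p * q\<^sup>2 - q ^ 3)" by simp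
    then have "co k i * cnj (co l j) * (1 / (- p - q)) = co k i * cnj (co l j) * ((- 1 / D) * (p ^ 3 - p\<^sup>2 * q + p * q\<^sup>2 - q ^ 3))"
      by simp
    then show ?thesis unfolding p_def[symmetric] q_def[symmetric] by (simp add: algebra_simps)
  qed
  have v: "PS k j 0 = (\<Sum>i<3. co k i * ex k i ^ j)" for k j by (simp add: PS_def)
  have W: "wronskian (PS k) (cnjs (PS l)) 0 = (\<Sum>i<3. \<Sum>j<3.
      (co k i * ex k i ^ 3) * (cnj (co l j) * cnj (ex l j) ^ 0) - (co k i * ex k i ^ 2) * (cnj (co l j) * cnj (ex l j) ^ 1)
      + (co k i * ex k i ^ 1) * (cnj (co l j) * cnj (ex l j) ^ 2) - (co k i * ex k i ^ 0) * (cnj (co l j) * cnj (ex l j) ^ 3))"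
    unfolding wronskian_def v cnj_sum complex_cnj_mult complex_cnj_power sum_product
      sum_subtractf sum.distrib ..
  have "(\<Sum>i<3. \<Sum>j<3. co k i * cnj (co l j) / (- ex k i - cnj (ex l j)))
    = (- 1 / D) * wronskian (PS k) (cnjs (PS l)) 0"
    unfolding W sum_distrib_left by (intro sum.cong refl t) auto
  also have "wronskian (PS k) (cnjs (PS l)) 0 = 0" by (rule wronskian_bc) (rule bc_PS)+
  finally show ?thesis by simp
qed

text \<open>Supplies the first-order vanishing at \<open>k = l\<close> that cancels the singularity
  \<open>1 / (k - l)\<close> in the remainder of the kernel.\<close>

lemma Om_Lipschitz: "\<exists>L\<ge>0. \<forall>k\<in>{a..b}. \<forall>l\<in>{a..b}. cmod (Om k - Om l) \<le> L * \<bar>k - l\<bar>"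
proof -
  define f' where "f' z = (1 - \<i>) * of_real \<alpha>2 + 2 * \<i> * of_real (Re \<alpha>) * (2 * z)
     - (1 + \<i>) * of_real \<alpha>1 * (3 * z\<^sup>2) - 4 * z ^ 3" for z
  define r where "r = max \<bar>a\<bar> \<bar>b\<bar>"
  have d: "(Omega \<alpha> \<alpha>1 \<alpha>2 has_field_derivative f' z) (at z within cball 0 r)" for z
    unfolding Omega_def[abs_def] f'_def by (auto intro!: derivative_eq_intros)
  have "compact (f' ` cball 0 r)"
    unfolding f'_def by (intro compact_continuous_image continuous_intros) auto
  then obtain L where "\<And>z. z \<in> cball 0 r \<Longrightarrow> cmod (f' z) \<le> L"
    by (meson compact_imp_bounded bounded_iff imageI)
  then have L: "cmod (f' z) \<le> \<bar>L\<bar>" if "z \<in> cball 0 r" for z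
    using abs_ge_self order_trans that by blast
  have "cmod (Om k - Om l) \<le> \<bar>L\<bar> * \<bar>k - l\<bar>" if "k \<in> {a..b}" "l \<in> {a..b}" for k l
  proof -
    have "cmod (Omega \<alpha> \<alpha>1 \<alpha>2 (of_real k) - Omega \<alpha> \<alpha>1 \<alpha>2 (of_real l)) \<le> \<bar>L\<bar> * cmod (of_real k - of_real l)"
      by (rule field_differentiable_bound[OF convex_cball d])
        (use L that in \<open>auto simp: r_def\<close>)
    then show ?thesis unfolding Om_def of_real_diff[symmetric] norm_of_real .
  qed
  then show ?thesis by (intro exI[of _ "\<bar>L\<bar>"]) auto
qed

end

context biharmonic
begin

text \<open>The terms of \<open>KK\<close> that become singular on the diagonal have indices (0,0)
  and (1,1); their denominators \<open>e - i (k - l)\<close> and \<open>e + i (k - l)\<close> have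
  reciprocals adding up to the Poisson kernel. Their coefficients agree for \<open>k = l\<close>,
  and the second one is used for both.\<close>

definition Pois :: "real \<Rightarrow> real \<Rightarrow> real \<Rightarrow> complex" where
  "Pois e k l = co k 1 * cnj (co l 1) * of_real (2 * e / (e\<^sup>2 + (k - l)\<^sup>2))"

lemma KK_denominator_nonzero:
  assumes "k > 0" "l > 0" "k \<noteq> l" "i < 3" "j < 3"
  shows "- ex k i - cnj (ex l j) \<noteq> 0"
  using assms by (auto simp: ex_def complex_eq_iff)

text \<open>Outside (0,0) and (1,1) nothing is singular: an index 2 puts at least \<open>a\<close>
  into the real part, and a pair of opposite waves puts \<open>k + l\<close> into the imaginary
  part.\<close>

lemma KK_denominator_bound:
  assumes "0 < a" "k \<ge> a" "l \<ge> a" "e > 0" "i < 3" "j < 3" "i = j \<Longrightarrow> i = 2"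
  shows "a \<le> cmod (of_real e - ex k i - cnj (ex l j))"
proof -
  let ?z = "of_real e - ex k i - cnj (ex l j)"
  have "a \<le> \<bar>Re ?z\<bar> \<or> a \<le> \<bar>Im ?z\<bar>"
    using assms by (auto simp: ex_def)
  then show ?thesis using abs_Re_le_cmod[of ?z] abs_Im_le_cmod[of ?z] by linarith
qed

lemma KK_minus_Pois:
  assumes "e > 0"
  shows "KK e k l - Pois e k l =
    (co k 0 * cnj (co l 0) - co k 1 * cnj (co l 1)) / (of_real e - \<i> * of_real (k - l))
    + (\<Sum>(i,j)\<in>{(0,1),(1,0),(0,2),(2,0),(1,2),(2,1),(2,2)}. co k i * cnj (co l j) / (of_real e - ex k i - cnj (ex l j)))"
proof -
  let ?d = "of_real (k - l) :: complex"
  have nz: "of_real e - \<i> * ?d \<noteq> 0" "of_real e + \<i> * ?d \<noteq> 0"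
    using assms by (auto simp: complex_eq_iff)
  have "e\<^sup>2 + (k - l)\<^sup>2 > 0" using assms by (intro add_pos_nonneg) auto
  have "(of_real e - \<i> * ?d) * (of_real e + \<i> * ?d) = of_real (e\<^sup>2 + (k - l)\<^sup>2)"
    by (simp add: complex_eq_iff power2_eq_square algebra_simps)
  then have "complex_of_real (2 * e / (e\<^sup>2 + (k - l)\<^sup>2)) = 2 * of_real e / ((of_real e - \<i> * ?d) * (of_real e + \<i> * ?d))"
    by simp
  also have "\<dots> = 1 / (of_real e - \<i> * ?d) + 1 / (of_real e + \<i> * ?d)"
    using nz by (simp add: add_frac_eq)
  finally have P: "Pois e k l = co k 1 * cnj (co l 1) / (of_real e - \<i> * ?d) + co k 1 * cnj (co l 1) / (of_real e + \<i> * ?d)"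
    unfolding Pois_def by (simp add: distrib_left)
  have e00: "of_real e - ex k 0 - cnj (ex l 0) = of_real e - \<i> * ?d"
    and e11: "of_real e - ex k 1 - cnj (ex l 1) = of_real e + \<i> * ?d"
    by (simp_all add: ex_def algebra_simps)
  show ?thesis
    unfolding P KK_def sum3 e00 e11 by (simp add: diff_divide_distrib)
qed

text \<open>Uniformity in \<open>e\<close> is the point, since the bound has to dominate as
  \<open>e\<close> tends to 0. The singular term has a numerator of order \<open>|k - l|\<close>
  over a denominator of modulus at least \<open>|k - l|\<close>; the seven others are bounded one by
  one.\<close>

lemma Pois_remainder_bound:
  assumes "0 < a"
  shows "\<exists>L\<ge>0. \<forall>k\<in>{a..b}. \<forall>l\<in>{a..b}. \<forall>e>0. cmod (KK e k l - Pois e k l) \<le> L"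
proof -
  obtain C where C: "C \<ge> 0" "\<And>k i. k \<in> {a..b} \<Longrightarrow> cmod (co k i) \<le> C" using co_bounded by blast
  obtain L where L: "L \<ge> 0" "\<And>k l. k \<in> {a..b} \<Longrightarrow> l \<in> {a..b} \<Longrightarrow> cmod (Om k - Om l) \<le> L * \<bar>k - l\<bar>"
    using Om_Lipschitz by blast
  have "compact (Om ` {a..b})" by (intro compact_continuous_image continuous_Om) auto
  then obtain B where B: "\<And>k. k \<in> {a..b} \<Longrightarrow> cmod (Om k) \<le> B"
    by (meson compact_imp_bounded bounded_iff imageI)
  let ?I = "{(0,1),(1,0),(0,2),(2,0),(1,2),(2,1),(2,2)} :: (nat \<times> nat) set"
  have "cmod (KK e k l - Pois e k l) \<le> B * L + 7 * (C * C / a)"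
    if k: "k \<in> {a..b}" and l: "l \<in> {a..b}" and e: "e > 0" for k l e
  proof -
    have B0: "0 \<le> B" using B[OF k] norm_ge_zero order_trans by blast
    have "co k 0 * cnj (co l 0) - co k 1 * cnj (co l 1) = (cnj (Om k) * Om l - Om k * cnj (Om l)) / 4"
    proof -
      have s: "complex_of_real (2 * sqrt 2) * of_real (2 * sqrt 2) = 8"
        unfolding of_real_mult[symmetric] by simp
      have m: "(1 + \<i>) * (1 - \<i>) = 2" by (simp add: algebra_simps)
      have "co k 0 * cnj (co l 0) = cnj (Om k) * Om l * ((1 + \<i>) * (1 - \<i>)) / (of_real (2 * sqrt 2) * of_real (2 * sqrt 2))"
        "co k 1 * cnj (co l 1) = Om k * cnj (Om l) * ((1 + \<i>) * (1 - \<i>)) / (of_real (2 * sqrt 2) * of_real (2 * sqrt 2))"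
        unfolding co_def by simp_all
      then have "co k 0 * cnj (co l 0) = cnj (Om k) * Om l * 2 / 8" "co k 1 * cnj (co l 1) = Om k * cnj (Om l) * 2 / 8"
        unfolding m s by blast+
      then show ?thesis by (simp only:) (simp add: diff_divide_distrib)
    qed
    also have "cnj (Om k) * Om l - Om k * cnj (Om l) = cnj (Om k) * (Om l - Om k) + Om k * (cnj (Om k) - cnj (Om l))"
      by (simp add: algebra_simps)
    finally have E: "co k 0 * cnj (co l 0) - co k 1 * cnj (co l 1)
      = (cnj (Om k) * (Om l - Om k) + Om k * (cnj (Om k) - cnj (Om l))) / 4" .
    have "cmod (co k 0 * cnj (co l 0) - co k 1 * cnj (co l 1))
      = cmod (cnj (Om k) * (Om l - Om k) + Om k * (cnj (Om k) - cnj (Om l))) / 4"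
      unfolding E by (simp add: norm_divide)
    also have "\<dots> \<le> (cmod (cnj (Om k) * (Om l - Om k)) + cmod (Om k * (cnj (Om k) - cnj (Om l)))) / 4"
      by (intro divide_right_mono norm_triangle_ineq) simp
    also have "\<dots> = (cmod (Om k) * cmod (Om k - Om l)) / 2"
      unfolding norm_mult complex_cnj_diff[symmetric] complex_mod_cnj
      by (simp add: norm_minus_commute)
    also have "\<dots> \<le> (B * (L * \<bar>k - l\<bar>)) / 2"
      by (intro divide_right_mono mult_mono B L k l B0) auto
    also have "\<dots> \<le> B * L * \<bar>k - l\<bar>" using B0 L(1) by simp
    finally have n0: "cmod (co k 0 * cnj (co l 0) - co k 1 * cnj (co l 1)) \<le> B * L * \<bar>k - l\<bar>" .
    define w where "w = of_real e - \<i> * complex_of_real (k - l)"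
    have w: "\<bar>k - l\<bar> \<le> cmod w" "w \<noteq> 0"
      using abs_Im_le_cmod[of w] e by (auto simp: w_def complex_eq_iff)
    have "B * L * \<bar>k - l\<bar> \<le> B * L * cmod w" using w(1) B0 L(1) by (intro mult_left_mono) auto
    with n0 have A: "cmod ((co k 0 * cnj (co l 0) - co k 1 * cnj (co l 1)) / w) \<le> B * L"
      using w(2) unfolding norm_divide by (subst pos_divide_le_eq) auto
    have S: "cmod (\<Sum>(i,j)\<in>?I. co k i * cnj (co l j) / (of_real e - ex k i - cnj (ex l j))) \<le> of_nat (card ?I) * (C * C / a)"
    proof (rule sum_norm_bound)
      fix p assume p: "p \<in> ?I"
      obtain i j where ij: "p = (i, j)" by force
      have "a \<le> cmod (of_real e - ex k i - cnj (ex l j))"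
        by (rule KK_denominator_bound) (use p ij k l e assms in auto)
      moreover have "cmod (co k i) * cmod (co l j) \<le> C * C" using C k l by (intro mult_mono) auto
      ultimately show "cmod (case p of (i,j) \<Rightarrow> co k i * cnj (co l j) / (of_real e - ex k i - cnj (ex l j))) \<le> C * C / a"
        unfolding ij using assms C(1) by (auto simp: norm_divide norm_mult intro!: frac_le)
    qed
    have c7: "real (card ?I) = 7" by simp
    show ?thesis
      unfolding KK_minus_Pois[OF e]
      by (rule order_trans[OF norm_triangle_ineq add_mono[OF A[unfolded w_def] S[unfolded c7]]])
  qed
  moreover have "0 \<le> \<bar>B\<bar> * L + 7 * (C * C / a)" using L C assms by simp
  moreover have "B * L + 7 * (C * C / a) \<le> \<bar>B\<bar> * L + 7 * (C * C / a)" using L by (simp add: mult_right_mono)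
  ultimately show ?thesis by (meson order_trans)
qed

text \<open>Off the diagonal, which is null, both \<open>KK\<close> and \<open>Pois\<close> tend to
  0, so the bounded remainder disappears and the Poisson part survives. Its mass \<open>2 pi\<close>
  times \<open>|co k 1|^2 = |Om k|^2 / 4\<close> is the factor \<open>pi / 2\<close>.\<close>

lemma KK_limit:
  assumes h1: "testfn h1" and h2: "testfn h2"
  shows "(\<lambda>n. \<integral>p. KK (inverse (real (Suc n))) (fst p) (snd p) * (h1 (fst p) * cnj (h2 (snd p))) \<partial>(lborel \<Otimes>\<^sub>M lborel))
    \<longlonglongrightarrow> of_real (pi / 2) * (\<integral>k. h1 k * cnj (h2 k) * of_real ((cmod (Om k))\<^sup>2) \<partial>lborel)"
proof -
  define e where "e n = inverse (real (Suc n))" for n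
  have e: "e n > 0" for n by (simp add: e_def)
  have e0: "e \<longlonglongrightarrow> 0" unfolding e_def[abs_def] by (rule LIMSEQ_inverse_real_of_nat)
  obtain a1 b1 where s1: "0 < a1" "\<And>k. k \<notin> {a1..b1} \<Longrightarrow> h1 k = 0" using testfnE[OF h1] by metis
  obtain a2 b2 where s2: "0 < a2" "\<And>k. k \<notin> {a2..b2} \<Longrightarrow> h2 k = 0" using testfnE[OF h2] by metis
  define a where "a = min a1 a2"
  define b where "b = max b1 b2"
  have a: "0 < a" using s1 s2 by (simp add: a_def)
  have z1: "h1 k = 0" and z2: "h2 k = 0" if "k \<notin> {a..b}" for k
    using s1(2)[of k] s2(2)[of k] that by (auto simp: a_def b_def min_def max_def split: if_splits)
  obtain L where L: "L \<ge> 0" "\<And>k l e. k \<in> {a..b} \<Longrightarrow> l \<in> {a..b} \<Longrightarrow> e > 0 \<Longrightarrow> cmod (KK e k l - Pois e k l) \<le> L"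
    using Pois_remainder_bound[OF a] by metis
  let ?N = "lborel \<Otimes>\<^sub>M lborel :: (real \<times> real) measure"
  define S where "S = {a..b}"
  have [measurable]: "S \<in> sets borel" by (simp add: S_def)
  define R where "R n p = indicator S (fst p) * indicator S (snd p) * (KK (e n) (fst p) (snd p) - Pois (e n) (fst p) (snd p))" for n p
  have i1: "integrable lborel h1" and i2: "integrable lborel (\<lambda>l. cnj (h2 l))"
    using testfn_integrable[OF h1] testfn_integrable[OF h2] by auto
  have Rm [measurable]: "R n \<in> borel_measurable ?N" for n
    unfolding R_def KK_def Pois_def by measurable
  have Rb: "cmod (R n p) \<le> L" for n p
    using L(1) L(2)[of "fst p" "snd p" "e n"] e[of n] by (auto simp: R_def S_def indicator_def norm_mult)
  have iR: "integrable ?N (\<lambda>p. R n p * (h1 (fst p) * cnj (h2 (snd p))))" for n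
    by (rule integrable_product_kernel[OF _ i1 i2 Rm Rb]) unfold_locales
  have iC: "integrable ?N (\<lambda>p. norm (complex_of_real L * (h1 (fst p) * cnj (h2 (snd p)))))"
    by (rule integrable_norm, rule integrable_product_kernel[OF _ i1 i2, where c=L]) (unfold_locales, use L in auto)
  have limR: "(\<lambda>n. \<integral>p. R n p * (h1 (fst p) * cnj (h2 (snd p))) \<partial>?N) \<longlonglongrightarrow> (\<integral>p. 0 \<partial>?N)"
  proof (rule integral_dominated_convergence[OF _ _ iC])
    show "AE p in ?N. (\<lambda>n. R n p * (h1 (fst p) * cnj (h2 (snd p)))) \<longlonglongrightarrow> 0"
      using AE_off_diagonal
    proof eventually_elim
      case (elim p)
      show ?case
      proof (cases "fst p \<in> S \<and> snd p \<in> S")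
        case True
        then have pos: "fst p > 0" "snd p > 0" using a by (auto simp: S_def)
        have "(\<lambda>n. KK (e n) (fst p) (snd p)) \<longlonglongrightarrow> (\<Sum>i<3. \<Sum>j<3. co (fst p) i * cnj (co (snd p) j) / (of_real 0 - ex (fst p) i - cnj (ex (snd p) j)))"
          unfolding KK_def
          by (intro tendsto_intros e0) (use KK_denominator_nonzero[OF pos elim] in auto)
        then have K: "(\<lambda>n. KK (e n) (fst p) (snd p)) \<longlonglongrightarrow> 0"
          using KK_zero[OF pos elim] by simp
        have "(\<lambda>n. Pois (e n) (fst p) (snd p)) \<longlonglongrightarrow> co (fst p) 1 * cnj (co (snd p) 1) * of_real (2 * 0 / (0\<^sup>2 + (fst p - snd p)\<^sup>2))"
          unfolding Pois_def by (intro tendsto_intros e0) (use elim in auto)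
        then have P: "(\<lambda>n. Pois (e n) (fst p) (snd p)) \<longlonglongrightarrow> 0" by simp
        have "(\<lambda>n. R n p * (h1 (fst p) * cnj (h2 (snd p)))) \<longlonglongrightarrow> (indicator S (fst p) * indicator S (snd p) * (0 - 0)) * (h1 (fst p) * cnj (h2 (snd p)))"
          unfolding R_def by (intro tendsto_intros K P)
        then show ?thesis by simp
      qed (auto simp: R_def)
    qed
    show "AE p in ?N. norm (R n p * (h1 (fst p) * cnj (h2 (snd p)))) \<le> norm (complex_of_real L * (h1 (fst p) * cnj (h2 (snd p))))" for n
    proof (rule AE_I2)
      fix p
      have "cmod (R n p) \<le> cmod (complex_of_real L)" using Rb[of n p] L(1) by simp
      then show "norm (R n p * (h1 (fst p) * cnj (h2 (snd p)))) \<le> norm (complex_of_real L * (h1 (fst p) * cnj (h2 (snd p))))"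
        unfolding norm_mult by (rule mult_right_mono) simp
    qed
  qed (use iR in \<open>auto simp: borel_measurable_integrable\<close>)
  have t1: "testfn (\<lambda>k. h1 k * co k 1)" and t2: "testfn (\<lambda>k. h2 k * co k 1)"
    by (intro testfn_mult h1 h2 continuous_co)+
  have j1: "integrable lborel (\<lambda>k. h1 k * co k 1)" and j2: "integrable lborel (\<lambda>k. cnj (h2 k * co k 1))"
    using testfn_integrable[OF t1] integrable_cnj[OF testfn_integrable[OF t2]] by auto
  define Q where "Q n p = complex_of_real (2 * e n / ((e n)\<^sup>2 + (fst p - snd p)\<^sup>2))" for n and p :: "real \<times> real"
  have iQ: "integrable ?N (\<lambda>p. Q n p * ((h1 (fst p) * co (fst p) 1) * cnj (h2 (snd p) * co (snd p) 1)))" for n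
  proof (rule integrable_product_kernel[OF _ j1 j2])
    show "Q n \<in> borel_measurable ?N" unfolding Q_def by measurable
    show "cmod (Q n p) \<le> 2 / e n" for p
    proof -
      have "2 * e n / ((e n)\<^sup>2 + (fst p - snd p)\<^sup>2) \<le> 2 * e n / (e n)\<^sup>2"
        using e[of n] by (intro divide_left_mono mult_pos_pos add_pos_nonneg) auto
      also have "\<dots> = 2 / e n" using e[of n] by (simp add: power2_eq_square)
      finally show ?thesis
        unfolding Q_def norm_of_real using e[of n] by (subst abs_of_nonneg) auto
    qed
  qed unfold_locales
  have Qeq: "(\<integral>p. Q n p * ((h1 (fst p) * co (fst p) 1) * cnj (h2 (snd p) * co (snd p) 1)) \<partial>?N)
    = (\<integral>k. h1 k * co k 1 * (\<integral>l. cnj (h2 l * co l 1) * of_real (2 * e n / ((e n)\<^sup>2 + (k - l)\<^sup>2)) \<partial>lborel) \<partial>lborel)" for n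
  proof -
    have "(\<integral>p. Q n p * ((h1 (fst p) * co (fst p) 1) * cnj (h2 (snd p) * co (snd p) 1)) \<partial>?N)
      = (\<integral>k. (\<integral>l. h1 k * co k 1 * (cnj (h2 l * co l 1) * of_real (2 * e n / ((e n)\<^sup>2 + (k - l)\<^sup>2))) \<partial>lborel) \<partial>lborel)"
      using lborel_pair.integral_fst'[OF iQ[of n]] by (simp add: Q_def ac_simps)
    then show ?thesis unfolding integral_mult_right_zero .
  qed
  obtain M where M: "\<And>k. cmod (h2 k * co k 1) \<le> M" using t2 unfolding testfn_def by metis
  have limQ: "(\<lambda>n. \<integral>p. Q n p * ((h1 (fst p) * co (fst p) 1) * cnj (h2 (snd p) * co (snd p) 1)) \<partial>?N)
    \<longlonglongrightarrow> 2 * of_real pi * (\<integral>k. h1 k * co k 1 * cnj (h2 k * co k 1) \<partial>lborel)"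
    unfolding Qeq by (rule Poisson_limit[OF j1 _ M _ e e0]) (use t2 in \<open>auto simp: testfn_def\<close>)
  have split: "(\<integral>p. KK (e n) (fst p) (snd p) * (h1 (fst p) * cnj (h2 (snd p))) \<partial>?N)
    = (\<integral>p. R n p * (h1 (fst p) * cnj (h2 (snd p))) \<partial>?N)
      + (\<integral>p. Q n p * ((h1 (fst p) * co (fst p) 1) * cnj (h2 (snd p) * co (snd p) 1)) \<partial>?N)" for n
  proof (subst Bochner_Integration.integral_add[OF iR iQ, symmetric], intro Bochner_Integration.integral_cong refl)
    fix p
    show "KK (e n) (fst p) (snd p) * (h1 (fst p) * cnj (h2 (snd p))) = R n p * (h1 (fst p) * cnj (h2 (snd p)))
      + Q n p * ((h1 (fst p) * co (fst p) 1) * cnj (h2 (snd p) * co (snd p) 1))"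
      by (cases "fst p \<in> S \<and> snd p \<in> S")
        (use z1[of "fst p"] z2[of "snd p"] in \<open>auto simp: R_def Q_def Pois_def S_def algebra_simps\<close>)
  qed
  have c1: "co k 1 * cnj (co k 1) = of_real ((cmod (Om k))\<^sup>2 / 4)" for k
  proof -
    have "(cmod (co k 1))\<^sup>2 = (cmod (Om k))\<^sup>2 / 4"
      unfolding co_def by (simp add: norm_divide norm_mult power_divide power_mult_distrib cmod_power2[of "1 - \<i>"])
    then show ?thesis by (simp only: complex_norm_square[symmetric])
  qed
  have "2 * of_real pi * (\<integral>k. h1 k * co k 1 * cnj (h2 k * co k 1) \<partial>lborel)
    = 2 * of_real pi * (\<integral>k. (1 / 4) * (h1 k * cnj (h2 k) * of_real ((cmod (Om k))\<^sup>2)) \<partial>lborel)"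
  proof (intro arg_cong[where f="\<lambda>u. 2 * of_real pi * u"] Bochner_Integration.integral_cong refl)
    fix k
    have "h1 k * co k 1 * cnj (h2 k * co k 1) = h1 k * cnj (h2 k) * (co k 1 * cnj (co k 1))" by (simp add: ac_simps)
    then show "h1 k * co k 1 * cnj (h2 k * co k 1) = (1 / 4) * (h1 k * cnj (h2 k) * of_real ((cmod (Om k))\<^sup>2))"
      unfolding c1 by simp
  qed
  also have "\<dots> = of_real (pi / 2) * (\<integral>k. h1 k * cnj (h2 k) * of_real ((cmod (Om k))\<^sup>2) \<partial>lborel)"
    unfolding integral_mult_right_zero by simp
  finally have fin: "2 * of_real pi * (\<integral>k. h1 k * co k 1 * cnj (h2 k * co k 1) \<partial>lborel)
     = of_real (pi / 2) * (\<integral>k. h1 k * cnj (h2 k) * of_real ((cmod (Om k))\<^sup>2) \<partial>lborel)" .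
  show ?thesis
    using tendsto_add[OF limR limQ] unfolding split[symmetric] fin by (simp add: e_def)
qed

lemma TP_measurable: "testfn h \<Longrightarrow> TP h \<in> borel_measurable hl"
proof (rule borel_measurable_hl)
  assume "testfn h"
  then have [measurable]: "h \<in> borel_measurable borel" by (simp add: testfn_def)
  show "TP h \<in> borel_measurable borel" unfolding TP_def PS_def by measurable
qed

text \<open>The damping is removed twice: by monotone convergence for two equal packets, which is
  what proves square integrability, and then by dominated convergence for different ones.\<close>

theorem TP_isometry:
  assumes h1: "testfn h1" and h2: "testfn h2"
  shows "TP h1 \<in> L2"
    and "ip (TP h1) (TP h2) = of_real (pi / 2) * (\<integral>k. h1 k * cnj (h2 k) * of_real ((cmod (Om k))\<^sup>2) \<partial>lborel)"
proof -
  let ?e = "\<lambda>n. inverse (real (Suc n))"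
  have L: "TP h \<in> L2" if h: "testfn h" for h
  proof -
    let ?v = "\<lambda>n x. exp (- (?e n * x)) * (cmod (TP h x))\<^sup>2"
    have eq: "exp (- (complex_of_real (?e n) * of_real x)) * (TP h x * cnj (TP h x)) = of_real (?v n x)" for n x
      unfolding of_real_mult complex_norm_square exp_of_real[symmetric] by simp
    have i: "integrable hl (?v n)" for n
      using damped_inner_product(1)[OF h h, of "?e n"] unfolding eq complex_of_real_integrable_eq by simp
    have "(\<lambda>n. Re (\<integral>x. complex_of_real (?v n x) \<partial>hl)) \<longlonglongrightarrow>
       Re (of_real (pi / 2) * (\<integral>k. h k * cnj (h k) * of_real ((cmod (Om k))\<^sup>2) \<partial>lborel))"
      using tendsto_Re[OF KK_limit[OF h h]]
      unfolding damped_inner_product(2)[OF h h, symmetric, of "?e _", OF inverse_positive_iff_positive[THEN iffD2, OF of_nat_0_less_iff[THEN iffD2, OF zero_less_Suc]]] eq .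
    then have lim: "(\<lambda>n. \<integral>x. ?v n x \<partial>hl) \<longlonglongrightarrow> Re (of_real (pi / 2) * (\<integral>k. h k * cnj (h k) * of_real ((cmod (Om k))\<^sup>2) \<partial>lborel))"
      unfolding integral_complex_of_real Re_complex_of_real .
    have "integrable hl (\<lambda>x. (cmod (TP h x))\<^sup>2)"
    proof (rule integrable_monotone_convergence[OF i _ _ lim])
      show "AE x in hl. mono (\<lambda>n. ?v n x)"
      proof (rule AE_I2)
        fix x assume "x \<in> space hl"
        then have "x > 0" by simp
        then show "mono (\<lambda>n. ?v n x)"
          by (auto simp: mono_def intro!: mult_right_mono simp: divide_simps)
      qed
      show "AE x in hl. (\<lambda>n. ?v n x) \<longlonglongrightarrow> (cmod (TP h x))\<^sup>2"
      proof (rule AE_I2)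
        fix x
        have "(\<lambda>n. ?v n x) \<longlonglongrightarrow> exp (- (0 * x)) * (cmod (TP h x))\<^sup>2"
          by (intro tendsto_intros LIMSEQ_inverse_real_of_nat)
        then show "(\<lambda>n. ?v n x) \<longlonglongrightarrow> (cmod (TP h x))\<^sup>2" by simp
      qed
      show "(\<lambda>x. (cmod (TP h x))\<^sup>2) \<in> borel_measurable hl"
        using TP_measurable[OF h] by measurable
    qed
    then show ?thesis using TP_measurable[OF h] by (simp add: L2_iff)
  qed
  show "TP h1 \<in> L2" by (rule L[OF h1])
  have "(\<lambda>n. \<integral>x. exp (- (complex_of_real (?e n) * of_real x)) * (TP h1 x * cnj (TP h2 x)) \<partial>hl) \<longlonglongrightarrow> (\<integral>x. TP h1 x * cnj (TP h2 x) \<partial>hl)"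
  proof (rule integral_dominated_convergence)
    show "integrable hl (\<lambda>x. norm (TP h1 x * cnj (TP h2 x)))"
      by (intro integrable_norm ip_integrable L h1 h2)
    show "AE x in hl. (\<lambda>n. exp (- (complex_of_real (?e n) * of_real x)) * (TP h1 x * cnj (TP h2 x))) \<longlonglongrightarrow> TP h1 x * cnj (TP h2 x)"
    proof (rule AE_I2)
      fix x
      have "(\<lambda>n. exp (- (complex_of_real (?e n) * of_real x)) * (TP h1 x * cnj (TP h2 x))) \<longlonglongrightarrow> exp (- (complex_of_real 0 * of_real x)) * (TP h1 x * cnj (TP h2 x))"
        by (intro tendsto_intros LIMSEQ_inverse_real_of_nat)
      then show "(\<lambda>n. exp (- (complex_of_real (?e n) * of_real x)) * (TP h1 x * cnj (TP h2 x))) \<longlonglongrightarrow> TP h1 x * cnj (TP h2 x)" by simp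
    qed
    show "AE x in hl. norm (exp (- (complex_of_real (?e n) * of_real x)) * (TP h1 x * cnj (TP h2 x))) \<le> norm (TP h1 x * cnj (TP h2 x))" for n
      by (intro AE_I2) (auto simp: norm_mult intro!: mult_left_le_one_le)
    show "(\<lambda>x. TP h1 x * cnj (TP h2 x)) \<in> borel_measurable hl"
      using TP_measurable[OF h1] TP_measurable[OF h2] by measurable
    show "(\<lambda>x. exp (- (complex_of_real (?e n) * of_real x)) * (TP h1 x * cnj (TP h2 x))) \<in> borel_measurable hl" for n
      using damped_inner_product(1)[OF h1 h2, of "?e n"] by (intro borel_measurable_integrable) simp
  qed
  moreover have "(\<integral>x. exp (- (complex_of_real (?e n) * of_real x)) * (TP h1 x * cnj (TP h2 x)) \<partial>hl)
    = (\<integral>p. KK (?e n) (fst p) (snd p) * (h1 (fst p) * cnj (h2 (snd p))) \<partial>(lborel \<Otimes>\<^sub>M lborel))" for n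
    by (rule damped_inner_product(2)[OF h1 h2]) simp
  ultimately show "ip (TP h1) (TP h2) = of_real (pi / 2) * (\<integral>k. h1 k * cnj (h2 k) * of_real ((cmod (Om k))\<^sup>2) \<partial>lborel)"
    using KK_limit[OF h1 h2] unfolding ip_hl by (simp only: LIMSEQ_unique)
qed

end

section \<open>The transform in the momentum variable\<close>

lemma L2_cut:
  assumes "f \<in> L2" "A \<in> sets borel" shows "(\<lambda>x. indicator A x * f x) \<in> L2"
proof (rule L2_mult_bounded[OF assms(1), where B=1])
  show "indicator A \<in> borel_measurable hl" by (rule borel_measurable_hl) (use assms in simp)
qed (auto simp: indicator_def)

lemma L2_lim_cut:
  assumes "f \<in> L2" "\<And>n. E n \<in> sets borel" "\<And>x. x > 0 \<Longrightarrow> \<forall>\<^sub>F n in sequentially. x \<in> E n"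
  shows "L2_lim (\<lambda>n x. indicator (E n) x * f x) f"
proof (rule L2_lim_dominated[where h=f])
  fix x :: real assume "x > 0"
  show "(\<lambda>n. indicator (E n) x * f x) \<longlonglongrightarrow> f x"
    by (rule tendsto_eventually, rule eventually_mono[OF assms(3)[OF \<open>x > 0\<close>]]) simp
qed (use assms L2_cut in \<open>auto simp: indicator_def\<close>)

lemma L2_lim_ip_right:
  assumes "\<And>n. f n \<in> L2" "g \<in> L2" "h \<in> L2" "L2_lim f g"
  shows "(\<lambda>n. ip h (f n)) \<longlonglongrightarrow> ip h g"
  using tendsto_cnj[OF L2_lim_ip[OF assms]] unfolding cnj_ip .

text \<open>Fatou's lemma for weights tending to 1. It gives membership in \<open>L2\<close> to
  functions of which only weighted square integrals are under control.\<close>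

lemma L2I_weights:
  assumes y: "y \<in> borel_measurable hl"
    and eta: "\<And>n. \<eta> n \<in> borel_measurable hl" "\<And>n x. 0 \<le> \<eta> n x" "AE x in hl. (\<lambda>n. \<eta> n x) \<longlonglongrightarrow> 1"
    and i: "\<And>n. integrable hl (\<lambda>x. \<eta> n x * (cmod (y x))\<^sup>2)"
      "\<And>n. (\<integral>x. \<eta> n x * (cmod (y x))\<^sup>2 \<partial>hl) \<le> C\<^sup>2" and C: "0 \<le> C"
  shows "y \<in> L2" "nrm y \<le> C"
proof -
  note y[measurable] eta(1)[measurable]
  have "(\<integral>\<^sup>+x. ennreal ((cmod (y x))\<^sup>2) \<partial>hl) = (\<integral>\<^sup>+x. liminf (\<lambda>n. ennreal (\<eta> n x * (cmod (y x))\<^sup>2)) \<partial>hl)"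
  proof (rule nn_integral_cong_AE, use eta(3) in eventually_elim)
    case (elim x)
    have "(\<lambda>n. ennreal (\<eta> n x * (cmod (y x))\<^sup>2)) \<longlonglongrightarrow> ennreal (1 * (cmod (y x))\<^sup>2)"
      by (intro tendsto_intros elim)
    from lim_imp_Liminf[OF sequentially_bot this] show ?case by simp
  qed
  also have "\<dots> \<le> liminf (\<lambda>n. \<integral>\<^sup>+x. ennreal (\<eta> n x * (cmod (y x))\<^sup>2) \<partial>hl)"
    by (rule nn_integral_liminf) measurable
  also have "\<dots> \<le> liminf (\<lambda>n::nat. ennreal (C\<^sup>2))"
  proof (rule Liminf_mono, rule always_eventually, rule allI)
    fix n
    show "(\<integral>\<^sup>+x. ennreal (\<eta> n x * (cmod (y x))\<^sup>2) \<partial>hl) \<le> ennreal (C\<^sup>2)"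
      by (subst nn_integral_eq_integral[OF i(1)]) (use eta(2) i(2) in \<open>auto intro!: ennreal_leI AE_I2\<close>)
  qed
  finally have le: "(\<integral>\<^sup>+x. ennreal ((cmod (y x))\<^sup>2) \<partial>hl) \<le> ennreal (C\<^sup>2)"
    by (simp add: Liminf_const)
  have "integrable hl (\<lambda>x. (cmod (y x))\<^sup>2)"
  proof (rule integrableI_bounded)
    show "(\<integral>\<^sup>+x. ennreal (norm ((cmod (y x))\<^sup>2)) \<partial>hl) < \<infinity>"
      using le_less_trans[OF le ennreal_less_top] by simp
  qed measurable
  then show L: "y \<in> L2" using y by (simp add: L2_iff)
  have "ennreal ((nrm y)\<^sup>2) \<le> ennreal (C\<^sup>2)"
    using le L2_sq[OF L] by (simp add: nrm_sq nn_integral_eq_integral)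
  then have "(nrm y)\<^sup>2 \<le> C\<^sup>2" by (subst (asm) ennreal_le_iff) auto
  then show "nrm y \<le> C" by (rule power2_le_imp_le) (rule C)
qed

text \<open>Only the two end points can be discontinuities.\<close>

lemma testfn_indicator:
  assumes c: "0 < c" and g: "continuous_on {0<..} g"
  shows "testfn (\<lambda>k. indicator {c..d} k * g k)"
  unfolding testfn_def
proof (intro conjI)
  have gm: "g \<in> borel_measurable hl" by (rule continuous_on_measurable_hl[OF g])
  have gc: "continuous_on {c..d} g" by (rule continuous_on_subset[OF g]) (use c in auto)
  have "(\<lambda>k. indicator {c..d} k *\<^sub>R g k) \<in> borel_measurable borel"
    by (rule borel_measurable_continuous_on_indicator) (use gc in auto)
  then show "(\<lambda>k. indicator {c..d} k * g k) \<in> borel_measurable borel"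
    by (rule back_subst[where P="\<lambda>f. f \<in> borel_measurable borel"]) (auto simp: indicator_def)
  have "compact (g ` {c..d})" by (intro compact_continuous_image gc) auto
  then obtain C where C: "\<And>k. k \<in> {c..d} \<Longrightarrow> cmod (g k) \<le> C"
    by (meson compact_imp_bounded bounded_iff imageI)
  have "cmod (indicator {c..d} k * g k) \<le> \<bar>C\<bar>" for k
    using C[of k] by (auto simp: indicator_def)
  then show "\<exists>M. \<forall>k. cmod (indicator {c..d} k * g k) \<le> M" by blast
  show "\<exists>a b. 0 < a \<and> (\<forall>k. k \<notin> {a..b} \<longrightarrow> indicator {c..d} k * g k = 0)"
    using c by (intro exI[of _ c] exI[of _ d]) auto
  show "AE k in lborel. isCont (\<lambda>k. indicator {c..d} k * g k) k"
    using AE_lborel_singleton[of c] AE_lborel_singleton[of d]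
  proof eventually_elim
    case (elim k)
    show ?case
    proof (cases "k \<in> {c<..<d}")
      case True
      have "isCont g k" using g True c by (simp add: continuous_on_eq_continuous_at)
      moreover have "\<forall>\<^sub>F x in nhds k. indicator {c..d} x * g x = g x"
        using eventually_nhds_in_open[of "{c<..<d}" k] True by (auto elim!: eventually_mono)
      ultimately show ?thesis by (rule isCont_cong[THEN iffD2, rotated])
    next
      case False
      then have "k \<in> {..<c} \<union> {d<..}" using elim by auto
      then have "\<forall>\<^sub>F x in nhds k. x \<in> {..<c} \<union> {d<..}"
        by (intro eventually_nhds_in_open) auto
      then have "\<forall>\<^sub>F x in nhds k. indicator {c..d} x * g x = 0"
        by (rule eventually_mono) auto
      then show ?thesis by (simp add: isCont_cong[where g="\<lambda>x. 0"])
    qed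
  qed
qed

lemma testfn_L2: assumes "testfn h" shows "h \<in> L2"
proof -
  from assms obtain a b M where h: "0 < a" "\<And>k. k \<notin> {a..b} \<Longrightarrow> h k = 0" "\<And>k. cmod (h k) \<le> M"
    "h \<in> borel_measurable borel" by (rule testfnE) blast
  have "integrable lborel (\<lambda>k. h k * cnj (h k))"
  proof (rule compact_support_integrable)
    show "cmod (h k * cnj (h k)) \<le> M * M" for k
      using h(3)[of k] by (simp add: norm_mult mult_mono')
  qed (use h in auto)
  then have "integrable lborel (\<lambda>k. Re (h k * cnj (h k)))" by (rule integrable_Re)
  then have "integrable lborel (\<lambda>k. (cmod (h k))\<^sup>2)"
    unfolding complex_norm_square[symmetric] Re_complex_of_real .
  then have "integrable hl (\<lambda>k. (cmod (h k))\<^sup>2)"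
    unfolding integrable_hl_iff set_integrable_def by (intro integrable_mult_indicator) auto
  then show ?thesis using borel_measurable_hl[OF h(4)] by (simp add: L2_iff)
qed

lemma testfn_integral_hl:
  assumes "testfn h" shows "(\<integral>k. h k * f k \<partial>lborel) = (\<integral>k. h k * f k \<partial>hl)"
  unfolding integral_hl[symmetric] set_lebesgue_integral_def
  by (intro Bochner_Integration.integral_cong refl) (use testfn_nonpos[OF assms] in \<open>auto simp: indicator_def\<close>)

context biharmonic
begin

text \<open>A polynomial with coefficient \<open>-1\<close> in degree 4, hence nonzero for all
  values of the parameters.\<close>

lemma Omega_zeros_finite: "finite {z. Omega \<alpha> \<alpha>1 \<alpha>2 z = 0}"
proof -
  let ?p = "[:alpha0 \<alpha> \<alpha>1 \<alpha>2, (1 - \<i>) * of_real \<alpha>2, 2 * \<i> * of_real (Re \<alpha>), - (1 + \<i>) * of_real \<alpha>1, -1:]"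
  have p: "Omega \<alpha> \<alpha>1 \<alpha>2 z = poly ?p z" for z
    unfolding Omega_def by (simp add: algebra_simps power2_eq_square power3_eq_cube power4_eq_xxxx)
  show ?thesis unfolding p by (rule poly_roots_finite) simp
qed

lemma Om_zeros_finite: "finite {k. Om k = 0}"
proof -
  have "finite (complex_of_real -` {z. Omega \<alpha> \<alpha>1 \<alpha>2 z = 0})"
    by (rule finite_vimageI[OF Omega_zeros_finite]) (simp add: inj_on_def)
  then show ?thesis by (simp add: Om_def vimage_def)
qed

lemma AE_Om: "AE k in hl. Om k \<noteq> 0"
proof -
  have "AE k in lborel. k \<notin> {k. Om k = 0}"
    by (rule AE_not_in) (intro finite_imp_null_set_lborel Om_zeros_finite)
  then show ?thesis by (simp add: AE_restrict_space_iff eventually_mono)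
qed

lemma PS_bound0: "\<exists>C\<ge>0. \<forall>k\<in>{0<..b}. \<forall>x\<ge>0. cmod (PS k 0 x) \<le> C"
proof -
  obtain C where C: "C \<ge> 0" "\<And>k i. k \<in> {0..b} \<Longrightarrow> cmod (co k i) \<le> C" using co_bounded by blast
  have "cmod (PS k 0 x) \<le> (\<Sum>i<3::nat. C)" if k: "k \<in> {0<..b}" and x: "x \<ge> 0" for k x
    unfolding PS_def
  proof (rule order_trans[OF norm_sum], rule sum_mono)
    fix i :: nat
    have "cmod (co k i) * cmod (exp (ex k i * of_real x)) \<le> C * 1"
      using C k x by (intro mult_mono C exp_ex_bound) auto
    then show "cmod (co k i * (ex k i ^ 0 * exp (ex k i * of_real x))) \<le> C" by (simp add: norm_mult)
  qed
  then show ?thesis using C(1) by (intro exI[of _ "3 * C"]) auto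
qed

definition hat :: "(real \<Rightarrow> complex) \<Rightarrow> real \<Rightarrow> complex" where
  "hat f k = (\<integral>x. cnj (PS k 0 x) * f x \<partial>hl)"

text \<open>Division by \<open>cnj Om\<close> restores \<open>cnj psi\<close> from the pole-free
  \<open>PS\<close>, and \<open>sqrt (2 / pi)\<close> compensates the \<open>pi / 2\<close> in the
  isometry of wave packets. At a zero of \<open>Om\<close> the value is 0 by the convention on
  division.\<close>

definition F0 :: "(real \<Rightarrow> complex) \<Rightarrow> real \<Rightarrow> complex" where
  "F0 f k = of_real (sqrt (2 / pi)) * hat f k / cnj (Om k)"

text \<open>The expected transform of the wave packet \<open>TP h\<close>; with this weight the
  isometry of packets has constant 1.\<close>

definition Phi :: "(real \<Rightarrow> complex) \<Rightarrow> real \<Rightarrow> complex" where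
  "Phi h k = of_real (sqrt (pi / 2)) * Om k * h k"

lemma PS_meas_x: "(\<lambda>x. PS k 0 x) \<in> borel_measurable hl"
  by (rule borel_measurable_hl) (simp add: PS_def)

lemma PS_mult_integrable:
  assumes "integrable hl f" "k > 0" shows "integrable hl (\<lambda>x. cnj (PS k 0 x) * f x)"
proof -
  obtain C where C: "C \<ge> 0" "\<And>x. x \<ge> 0 \<Longrightarrow> cmod (PS k 0 x) \<le> C" using PS_bound0[of k] assms(2) by auto
  have "integrable hl (\<lambda>x. C * norm (f x))" using assms by (intro integrable_mult_right integrable_norm)
  then show ?thesis
  proof (rule Bochner_Integration.integrable_bound)
    show "(\<lambda>x. cnj (PS k 0 x) * f x) \<in> borel_measurable hl"
      using PS_meas_x assms by (intro borel_measurable_times borel_measurable_cnj) auto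
    show "AE x in hl. norm (cnj (PS k 0 x) * f x) \<le> norm (C * norm (f x))"
      using C by (intro AE_I2) (auto simp: norm_mult abs_mult intro!: mult_right_mono)
  qed
qed

text \<open>Continuity makes truncations of \<open>hat f\<close> to compact intervals admissible as
  densities of wave packets.\<close>

lemma hat_continuous:
  assumes f: "integrable hl f" shows "continuous_on {0<..} (hat f)"
proof (rule continuous_on_sequentiallyI)
  fix u :: "nat \<Rightarrow> real" and a :: real
  assume u: "\<forall>n. u n \<in> {0<..}" and a: "a \<in> {0<..}" and lim: "u \<longlonglongrightarrow> a"
  obtain b where b: "\<And>n. \<bar>u n\<bar> \<le> b" using convergent_imp_Bseq[OF convergentI[OF lim]] by (auto simp: Bseq_def)
  obtain C where C: "C \<ge> 0" "\<And>k x. k \<in> {0<..b} \<Longrightarrow> x \<ge> 0 \<Longrightarrow> cmod (PS k 0 x) \<le> C" using PS_bound0 by blast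
  show "(\<lambda>n. hat f (u n)) \<longlonglongrightarrow> hat f a"
    unfolding hat_def
  proof (rule integral_dominated_convergence)
    show "integrable hl (\<lambda>x. C * norm (f x))" using f by (intro integrable_mult_right integrable_norm)
    show "AE x in hl. (\<lambda>n. cnj (PS (u n) 0 x) * f x) \<longlonglongrightarrow> cnj (PS a 0 x) * f x"
    proof (rule AE_I2)
      fix x
      have "isCont (\<lambda>k. PS k 0 x) a"
      proof -
        have "continuous_on UNIV (\<lambda>k. PS k 0 x)"
          unfolding PS_def by (intro continuous_intros continuous_co continuous_ex)
        then show ?thesis by (simp add: continuous_on_eq_continuous_at)
      qed
      then show "(\<lambda>n. cnj (PS (u n) 0 x) * f x) \<longlonglongrightarrow> cnj (PS a 0 x) * f x"
        by (intro tendsto_intros isCont_tendsto_compose[OF _ lim])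
    qed
    show "AE x in hl. norm (cnj (PS (u n) 0 x) * f x) \<le> C * norm (f x)" for n
    proof (rule AE_I2)
      fix x assume "x \<in> space hl"
      moreover have "u n \<in> {0<..b}" using u b[of n] by auto
      ultimately show "norm (cnj (PS (u n) 0 x) * f x) \<le> C * norm (f x)"
        using C(2)[of "u n" x] by (auto simp: norm_mult intro!: mult_right_mono)
    qed
  qed (use PS_mult_integrable[OF f] a u in auto)
qed

lemma F0_meas: assumes "integrable hl f" shows "F0 f \<in> borel_measurable hl"
proof -
  have [measurable]: "hat f \<in> borel_measurable hl" by (rule continuous_on_measurable_hl[OF hat_continuous[OF assms]])
  have [measurable]: "Om \<in> borel_measurable hl" by (intro continuous_on_measurable_hl continuous_Om)
  show ?thesis unfolding F0_def[abs_def] by measurable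
qed

lemma Fubini_hat:
  assumes f: "integrable hl f" and B: "integrable hl B" "\<And>k. k > b \<Longrightarrow> B k = 0"
  shows "(\<integral>k. hat f k * B k \<partial>hl) = (\<integral>x. f x * (\<integral>k. cnj (PS k 0 x) * B k \<partial>hl) \<partial>hl)"
proof -
  obtain C where C: "C \<ge> 0" "\<And>k x. k \<in> {0<..b} \<Longrightarrow> x \<ge> 0 \<Longrightarrow> cmod (PS k 0 x) \<le> C" using PS_bound0 by blast
  interpret P: pair_sigma_finite hl hl by unfold_locales
  define S :: "real set" where "S = {..b}"
  define K where "K q = indicator S (snd q) * cnj (PS (snd q) 0 (fst q))" for q :: "real \<times> real"
  have [measurable]: "S \<in> sets borel" by (simp add: S_def)
  have [measurable]: "(\<lambda>x. x) \<in> hl \<rightarrow>\<^sub>M borel" by (rule borel_measurable_hl) simp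
  have Km: "K \<in> borel_measurable (hl \<Otimes>\<^sub>M hl)" unfolding K_def PS_def by measurable
  have Kb: "cmod (K q) \<le> C" if "q \<in> space (hl \<Otimes>\<^sub>M hl)" for q
    using that C(1) C(2)[of "snd q" "fst q"] by (auto simp: space_pair_measure K_def S_def indicator_def)
  have i: "integrable (hl \<Otimes>\<^sub>M hl) (\<lambda>q. K q * (f (fst q) * B (snd q)))"
    by (rule integrable_product_kernel[OF _ f B(1) Km Kb]) unfold_locales
  have KB: "K (x, k) * (f x * B k) = f x * (cnj (PS k 0 x) * B k)" for x k
    using B(2)[of k] by (auto simp: K_def S_def indicator_def)
  have "(\<integral>k. hat f k * B k \<partial>hl) = (\<integral>k. (\<integral>x. f x * (cnj (PS k 0 x) * B k) \<partial>hl) \<partial>hl)"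
    unfolding hat_def integral_mult_left_zero[symmetric] by (simp only: ac_simps)
  also have "\<dots> = (\<integral>x. (\<integral>k. f x * (cnj (PS k 0 x) * B k) \<partial>hl) \<partial>hl)"
    using P.Fubini_integral[of "\<lambda>x k. f x * (cnj (PS k 0 x) * B k)"] i
    by (simp add: case_prod_beta' KB[symmetric])
  finally show ?thesis unfolding integral_mult_right_zero .
qed

lemma testfn_hl_integrable: "testfn h \<Longrightarrow> integrable hl h"
  unfolding integrable_hl_iff set_integrable_def
  by (intro integrable_mult_indicator testfn_integrable) auto

text \<open>The factors \<open>Om\<close> and \<open>sqrt (pi / 2)\<close> in \<open>Phi\<close>
  cancel those in \<open>F0\<close>, and Fubini moves the \<open>k\<close>-integral onto the
  eigenfunctions. Combined with the isometry of packets, this weak identity gives the norm bound on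
  \<open>F0\<close>.\<close>

lemma F0_Phi:
  assumes f: "integrable hl f" and h: "testfn h"
  shows "ip (F0 f) (Phi h) = ip f (TP h)"
proof -
  obtain b where b: "\<And>k. k > b \<Longrightarrow> h k = 0" using testfnE[OF h] by (metis atLeastAtMost_iff not_less)
  have s: "complex_of_real (sqrt (2 / pi)) * complex_of_real (sqrt (pi / 2)) = 1"
    unfolding of_real_mult[symmetric] real_sqrt_mult[symmetric] by simp
  have fm [measurable]: "F0 f \<in> borel_measurable hl" by (rule F0_meas[OF f])
  have hm [measurable]: "h \<in> borel_measurable hl" using h by (intro borel_measurable_hl) (simp add: testfn_def)
  have [measurable]: "hat f \<in> borel_measurable hl" by (rule continuous_on_measurable_hl[OF hat_continuous[OF f]])
  have [measurable]: "Om \<in> borel_measurable hl" by (intro continuous_on_measurable_hl continuous_Om)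
  have "ip (F0 f) (Phi h) = (\<integral>k. hat f k * cnj (h k) \<partial>hl)"
    unfolding ip_hl
  proof (rule integral_cong_AE)
    show "AE k in hl. F0 f k * cnj (Phi h k) = hat f k * cnj (h k)"
      using AE_Om
    proof eventually_elim
      case (elim k)
      have "F0 f k * cnj (Phi h k) = (complex_of_real (sqrt (2 / pi)) * complex_of_real (sqrt (pi / 2))) * (hat f k * cnj (h k))"
        using elim by (simp add: F0_def Phi_def)
      then show ?case unfolding s by simp
    qed
  qed (simp_all add: Phi_def)
  also have "\<dots> = (\<integral>x. f x * (\<integral>k. cnj (PS k 0 x) * cnj (h k) \<partial>hl) \<partial>hl)"
    by (rule Fubini_hat[OF f, where b=b]) (use testfn_hl_integrable[OF h] b in auto)
  also have "(\<lambda>x. \<integral>k. cnj (PS k 0 x) * cnj (h k) \<partial>hl) = (\<lambda>x. cnj (TP h x))"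
  proof
    fix x
    have "TP h x = (\<integral>k. h k * PS k 0 x \<partial>hl)" unfolding TP_def by (rule testfn_integral_hl[OF h])
    then have "cnj (TP h x) = (\<integral>k. cnj (h k * PS k 0 x) \<partial>hl)"
      by (simp only: Bochner_Integration.integral_cnj)
    then show "(\<integral>k. cnj (PS k 0 x) * cnj (h k) \<partial>hl) = cnj (TP h x)" by (simp add: mult.commute)
  qed
  finally show ?thesis by (simp add: ip_hl)
qed

lemma Phi_testfn: "testfn h \<Longrightarrow> testfn (Phi h)"
  using testfn_mult[of h "\<lambda>k. of_real (sqrt (pi / 2)) * Om k"]
  by (simp add: Phi_def[abs_def] mult.commute continuous_intros)

lemma Phi_L2: "testfn h \<Longrightarrow> Phi h \<in> L2"
  by (intro testfn_L2 Phi_testfn)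

lemma ip_TP: assumes "testfn h1" "testfn h2" shows "ip (TP h1) (TP h2) = ip (Phi h1) (Phi h2)"
proof -
  have s: "complex_of_real (sqrt (pi / 2)) * complex_of_real (sqrt (pi / 2)) = of_real (pi / 2)"
    unfolding of_real_mult[symmetric] by simp
  have "ip (Phi h1) (Phi h2) = (\<integral>k. of_real (pi / 2) * (h1 k * (cnj (h2 k) * of_real ((cmod (Om k))\<^sup>2))) \<partial>hl)"
    unfolding ip_hl
  proof (intro Bochner_Integration.integral_cong refl)
    fix k
    have "Phi h1 k * cnj (Phi h2 k) = (complex_of_real (sqrt (pi / 2)) * complex_of_real (sqrt (pi / 2))) * (h1 k * (cnj (h2 k) * (Om k * cnj (Om k))))"
      by (simp add: Phi_def)
    then show "Phi h1 k * cnj (Phi h2 k) = of_real (pi / 2) * (h1 k * (cnj (h2 k) * of_real ((cmod (Om k))\<^sup>2)))"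
      unfolding s complex_norm_square[symmetric] .
  qed
  also have "\<dots> = ip (TP h1) (TP h2)"
    unfolding TP_isometry(2)[OF assms] integral_mult_right_zero testfn_integral_hl[OF assms(1), symmetric]
    by (simp only: mult.assoc)
  finally show ?thesis ..
qed

lemma nrm_TP: "testfn h \<Longrightarrow> nrm (TP h) = nrm (Phi h)"
proof -
  assume h: "testfn h"
  have "complex_of_real ((nrm (TP h))\<^sup>2) = of_real ((nrm (Phi h))\<^sup>2)"
    using ip_TP[OF h h] by (simp only: ip_self)
  then have "(nrm (TP h))\<^sup>2 = (nrm (Phi h))\<^sup>2" by (simp only: of_real_eq_iff)
  then show ?thesis by (metis nrm_nonneg power2_eq_iff_nonneg)
qed

text \<open>Duality: the density \<open>h n\<close> is chosen so that \<open>Phi (h n)\<close> is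
  \<open>F0 f\<close> times a weight with values in [0,1]. Pairing and the isometry of packets bound
  the weighted square integral \<open>J\<close> by \<open>nrm f * sqrt J\<close>, and the weights
  tend to 1.\<close>

lemma F0_contraction:
  assumes "f \<in> L1 \<inter> L2" shows "F0 f \<in> L2" "nrm (F0 f) \<le> nrm f"
proof -
  have f: "integrable hl f" and f2: "f \<in> L2" using assms by (auto simp: L1_iff)
  define e where "e n = inverse (real (Suc n))" for n
  have e: "e n > 0" for n by (simp add: e_def)
  \<comment> \<open>A regularised \<open>|Om|^2\<close>: dividing by it keeps \<open>h n\<close>
    continuous across zeros of \<open>Om\<close>, while the quotient of \<open>|Om|^2\<close> by it
    stays in [0,1] and tends to 1 elsewhere.\<close>
  define Q where "Q n k = (cmod (Om k))\<^sup>2 + e n" for n k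
  have Q: "Q n k > 0" for n k unfolding Q_def using e[of n] by (intro add_nonneg_pos) auto
  define I where "I n = {e n..real (Suc n)}" for n
  define \<eta> where "\<eta> n k = indicator (I n) k * ((cmod (Om k))\<^sup>2 / Q n k)" for n k
  define h where "h n k = indicator (I n) k * (of_real (2 / pi / Q n k) * hat f k)" for n k
  have hc: "continuous_on {0<..} (\<lambda>k. complex_of_real (2 / pi / Q n k) * hat f k)" for n
    using Q[of n] unfolding Q_def
    by (intro continuous_intros hat_continuous f) (auto simp: less_le)
  have h: "testfn (h n)" for n
    unfolding h_def[abs_def] I_def by (rule testfn_indicator[OF e hc])
  have hh: "testfn (\<lambda>k. indicator (I n) k * (of_real (2 / pi / Q n k) * hat f k * cnj (hat f k)))" for n
    unfolding I_def by (rule testfn_indicator[OF e]) (intro continuous_intros hc hat_continuous f)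
  have s1: "complex_of_real (sqrt (2 / pi)) * of_real (sqrt (2 / pi)) = of_real (2 / pi)"
    unfolding of_real_mult[symmetric] by simp
  have s2: "complex_of_real (sqrt (pi / 2)) * of_real (2 / pi) = of_real (sqrt (2 / pi))"
    unfolding of_real_mult[symmetric] of_real_eq_iff by (simp add: real_sqrt_divide field_simps)
  have Phi_h: "Phi (h n) k = of_real (\<eta> n k) * F0 f k" for n k
  proof (cases "Om k = 0")
    case False
    have "of_real ((cmod (Om k))\<^sup>2) / cnj (Om k) = Om k"
      using False unfolding complex_norm_square by simp
    have "of_real (\<eta> n k) * F0 f k = indicator (I n) k * of_real (sqrt (2 / pi)) * hat f k / of_real (Q n k) * (of_real ((cmod (Om k))\<^sup>2) / cnj (Om k))"
      unfolding \<eta>_def F0_def by (simp add: indicator_def del: of_real_power)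
    also have "\<dots> = Phi (h n) k"
      unfolding \<open>of_real ((cmod (Om k))\<^sup>2) / cnj (Om k) = Om k\<close> Phi_def h_def s2[symmetric]
      by (simp add: indicator_def)
    finally show ?thesis ..
  qed (simp add: Phi_def F0_def)
  have eta01: "0 \<le> \<eta> n k" "\<eta> n k \<le> 1" for n k
    using Q[of n k] e[of n] by (auto simp: \<eta>_def indicator_def Q_def)
  have Fm [measurable]: "F0 f \<in> borel_measurable hl" by (rule F0_meas[OF f])
  have [measurable]: "Om \<in> borel_measurable hl" by (intro continuous_on_measurable_hl continuous_Om)
  have em [measurable]: "\<eta> n \<in> borel_measurable hl" for n
  proof -
    have "indicator (I n) \<in> borel_measurable hl" by (rule borel_measurable_hl) (simp add: I_def)
    then show ?thesis unfolding \<eta>_def[abs_def] Q_def by measurable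
  qed
  have i: "integrable hl (\<lambda>k. complex_of_real (\<eta> n k * (cmod (F0 f k))\<^sup>2))" for n
  proof -
    have "AE k in hl. indicator (I n) k * (of_real (2 / pi / Q n k) * hat f k * cnj (hat f k)) = complex_of_real (\<eta> n k * (cmod (F0 f k))\<^sup>2)"
      using AE_Om
    proof eventually_elim
      case (elim k)
      have "complex_of_real (\<eta> n k * (cmod (F0 f k))\<^sup>2) = Phi (h n) k * cnj (F0 f k)"
        unfolding Phi_h of_real_mult complex_norm_square by (simp only: ac_simps)
      also have "\<dots> = (of_real (sqrt (pi / 2)) * of_real (sqrt (2 / pi))) * (indicator (I n) k * (of_real (2 / pi / Q n k) * hat f k * cnj (hat f k)))"
        using elim by (simp add: Phi_def h_def F0_def)
      also have "complex_of_real (sqrt (pi / 2)) * of_real (sqrt (2 / pi)) = 1"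
        unfolding of_real_mult[symmetric] real_sqrt_mult[symmetric] by simp
      finally show ?case by simp
    qed
    moreover have "(\<lambda>k. complex_of_real (\<eta> n k * (cmod (F0 f k))\<^sup>2)) \<in> borel_measurable hl" by measurable
    ultimately show ?thesis
      by (intro integrable_cong_AE_imp[OF testfn_hl_integrable[OF hh[of n]]]) auto
  qed
  then have ir: "integrable hl (\<lambda>k. \<eta> n k * (cmod (F0 f k))\<^sup>2)" for n
    using complex_of_real_integrable_eq by blast
  have bd: "(\<integral>k. \<eta> n k * (cmod (F0 f k))\<^sup>2 \<partial>hl) \<le> (nrm f)\<^sup>2" for n
  proof -
    define J where "J = (\<integral>k. \<eta> n k * (cmod (F0 f k))\<^sup>2 \<partial>hl)"
    have J0: "0 \<le> J" unfolding J_def using eta01 by simp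
    have "complex_of_real J = (\<integral>k. complex_of_real (\<eta> n k * (cmod (F0 f k))\<^sup>2) \<partial>hl)"
      unfolding J_def by (rule integral_complex_of_real[symmetric])
    also have "\<dots> = ip (F0 f) (Phi (h n))"
      unfolding ip_hl Phi_h of_real_mult complex_norm_square
      by (intro Bochner_Integration.integral_cong refl) simp
    also have "\<dots> = ip f (TP (h n))" by (rule F0_Phi[OF f h])
    finally have "J = cmod (ip f (TP (h n)))" using J0 by (metis abs_of_nonneg norm_of_real)
    also have "\<dots> \<le> nrm f * nrm (Phi (h n))"
      using Cauchy_Schwarz_ip[OF f2 TP_isometry(1)[OF h h]] by (simp add: nrm_TP[OF h])
    also have "nrm (Phi (h n)) \<le> sqrt J"
    proof -
      have "(nrm (Phi (h n)))\<^sup>2 \<le> J" unfolding nrm_sq J_def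
      proof (rule integral_mono[OF L2_sq[OF Phi_L2[OF h]] ir])
        fix k
        have "\<eta> n k * \<eta> n k * (cmod (F0 f k))\<^sup>2 \<le> \<eta> n k * (cmod (F0 f k))\<^sup>2"
          using eta01[of n k] by (intro mult_right_mono mult_left_le) auto
        then show "(cmod (Phi (h n) k))\<^sup>2 \<le> \<eta> n k * (cmod (F0 f k))\<^sup>2"
          unfolding Phi_h norm_mult by (simp add: power2_eq_square ac_simps)
      qed
      then show ?thesis by (rule real_le_rsqrt)
    qed
    finally have "J \<le> nrm f * sqrt J" by (simp add: mult_left_mono)
    then have "sqrt J * sqrt J \<le> nrm f * sqrt J" using J0 by simp
    then have "sqrt J \<le> nrm f"
      using J0 mult_right_le_imp_le[of "sqrt J" "sqrt J" "nrm f"] by (cases "J = 0") auto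
    then have "(sqrt J)\<^sup>2 \<le> (nrm f)\<^sup>2" using J0 by (intro power_mono) auto
    then show ?thesis using J0 by (simp add: J_def)
  qed
  have lim: "AE k in hl. (\<lambda>n. \<eta> n k) \<longlonglongrightarrow> 1"
    using AE_Om AE_space[of hl]
  proof eventually_elim
    case (elim k)
    then have k: "k > 0" by simp
    have e0: "e \<longlonglongrightarrow> 0" unfolding e_def[abs_def] by (rule LIMSEQ_inverse_real_of_nat)
    have "\<forall>\<^sub>F n in sequentially. e n < k" using order_tendstoD(2)[OF e0 k] .
    moreover have "\<forall>\<^sub>F n in sequentially. k \<le> real (Suc n)"
      using real_arch_simple[of k] by (auto simp: eventually_sequentially) (metis of_nat_Suc le_SucI of_nat_mono order_trans of_nat_le_iff)
    ultimately have ev: "\<forall>\<^sub>F n in sequentially. (cmod (Om k))\<^sup>2 / Q n k = \<eta> n k"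
      by eventually_elim (simp add: \<eta>_def I_def)
    have "(\<lambda>n. (cmod (Om k))\<^sup>2 / Q n k) \<longlonglongrightarrow> (cmod (Om k))\<^sup>2 / ((cmod (Om k))\<^sup>2 + 0)"
      unfolding Q_def by (intro tendsto_intros e0) (use elim in auto)
    then show ?case using elim by (intro Lim_transform_eventually[OF _ ev]) simp
  qed
  show "F0 f \<in> L2" "nrm (F0 f) \<le> nrm f"
    by (rule L2I_weights[OF Fm em eta01(1) lim ir bd nrm_nonneg])+
qed

end

section \<open>Extension of the transform and its adjoint to all of L2\<close>

definition extends_contraction ::
  "((real \<Rightarrow> complex) \<Rightarrow> real \<Rightarrow> complex) \<Rightarrow> (nat \<Rightarrow> real set) \<Rightarrow> ((real \<Rightarrow> complex) \<Rightarrow> real \<Rightarrow> complex) \<Rightarrow> bool" where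
  "extends_contraction T E S \<longleftrightarrow>
     (\<forall>f\<in>L2. S f \<in> L2 \<and> nrm (S f) \<le> nrm f \<and> L2_lim (\<lambda>n. T (\<lambda>x. indicator (E n) x * f x)) (S f)) \<and>
     (\<forall>f\<in>L2. \<forall>g\<in>L2. \<forall>c. aeq (S (\<lambda>x. f x + c * g x)) (\<lambda>y. S f y + c * S g y))"

context biharmonic
begin

lemma hat_linear:
  assumes "integrable hl f" "integrable hl g" "k > 0"
  shows "hat (\<lambda>x. f x + c * g x) k = hat f k + c * hat g k"
proof -
  have "hat (\<lambda>x. f x + c * g x) k = (\<integral>x. cnj (PS k 0 x) * f x + c * (cnj (PS k 0 x) * g x) \<partial>hl)"
    unfolding hat_def by (simp add: algebra_simps)
  also have "\<dots> = hat f k + c * hat g k"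
    unfolding hat_def using PS_mult_integrable[OF assms(1,3)] PS_mult_integrable[OF assms(2,3)] by simp
  finally show ?thesis .
qed

lemma F0_linear:
  assumes "integrable hl f" "integrable hl g"
  shows "aeq (F0 (\<lambda>x. f x + c * g x)) (\<lambda>k. F0 f k + c * F0 g k)"
  by (rule aeqI) (simp add: F0_def hat_linear[OF assms] add_divide_distrib distrib_left)

definition cutF :: "nat \<Rightarrow> real set" where "cutF n = {0<..<real n}"

text \<open>On this set the quotient by \<open>Om\<close> and the functions \<open>PS\<close> are
  bounded. Zeros of \<open>Om\<close> are kept so that every \<open>k > 0\<close> is eventually
  included; the quotient by \<open>Om\<close> is 0 there.\<close>

definition cutG :: "nat \<Rightarrow> real set" where
  "cutG n = {inverse (real (Suc n))..real (Suc n)} \<inter> {k. inverse (real (Suc n)) \<le> cmod (Om k) \<or> Om k = 0}"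

lemma cutF: "cutF n \<in> sets borel" "x > 0 \<Longrightarrow> \<forall>\<^sub>F n in sequentially. x \<in> cutF n" "incseq cutF"
proof -
  show "cutF n \<in> sets borel" by (simp add: cutF_def)
  show "x > 0 \<Longrightarrow> \<forall>\<^sub>F n in sequentially. x \<in> cutF n"
    using reals_Archimedean2[of x]
    by (auto simp: cutF_def eventually_sequentially) (metis less_le_trans of_nat_mono)
  show "incseq cutF" by (auto simp: incseq_def cutF_def) 
qed

lemma cutG: "cutG n \<in> sets borel" "x > 0 \<Longrightarrow> \<forall>\<^sub>F n in sequentially. x \<in> cutG n" "incseq cutG"
proof -
  have [measurable]: "Om \<in> borel_measurable borel" by (intro borel_measurable_continuous_onI continuous_Om)
  have "{k \<in> space borel. inverse (real (Suc n)) \<le> cmod (Om k) \<or> Om k = 0} \<in> sets borel" by measurable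
  then show "cutG n \<in> sets borel" unfolding cutG_def by (intro sets.Int) auto
  have e0: "(\<lambda>n. inverse (real (Suc n))) \<longlonglongrightarrow> 0" by (rule LIMSEQ_inverse_real_of_nat)
  show "\<forall>\<^sub>F n in sequentially. x \<in> cutG n" if "x > 0"
  proof -
    have 1: "\<forall>\<^sub>F n in sequentially. inverse (real (Suc n)) < x" using order_tendstoD(2)[OF e0 that] .
    have 2: "\<forall>\<^sub>F n in sequentially. inverse (real (Suc n)) < cmod (Om x) \<or> Om x = 0"
      using order_tendstoD(2)[OF e0, of "cmod (Om x)"] by (cases "Om x = 0") auto
    obtain N where N: "x \<le> real N" using real_arch_simple by blast
    have 3: "\<forall>\<^sub>F n in sequentially. x \<le> real (Suc n)"
      using eventually_ge_at_top[of N] by eventually_elim (use N in linarith)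
    show ?thesis using 1 2 3 by eventually_elim (auto simp: cutG_def)
  qed
  show "incseq cutG"
  proof (rule incseq_SucI, rule subsetI)
    fix n x assume x: "x \<in> cutG n"
    have le: "inverse (real (Suc (Suc n))) \<le> inverse (real (Suc n))" by (rule le_imp_inverse_le) auto
    have "real (Suc n) \<le> real (Suc (Suc n))" by simp
    with x le show "x \<in> cutG (Suc n)" unfolding cutG_def
      by (auto simp del: of_nat_Suc intro: order_trans[OF le])
  qed
qed

lemma cutF_L1: "f \<in> L2 \<Longrightarrow> (\<lambda>x. indicator (cutF n) x * f x) \<in> L1 \<inter> L2"
  unfolding cutF_def by (rule L1_L2_bounded_support)

lemma Fk_exists: "\<exists>S. extends_contraction F0 cutF S"
  unfolding extends_contraction_def
proof (rule L2_extension)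
  fix n c and f g :: "real \<Rightarrow> complex" assume f: "f \<in> L2" and g: "g \<in> L2"
  have "aeq (F0 (\<lambda>x. indicator (cutF n) x * f x + c * (indicator (cutF n) x * g x)))
     (\<lambda>y. F0 (\<lambda>x. indicator (cutF n) x * f x) y + c * F0 (\<lambda>x. indicator (cutF n) x * g x) y)"
    by (rule F0_linear) (use cutF_L1[OF f] cutF_L1[OF g] in \<open>auto simp: L1_iff\<close>)
  then show "aeq (F0 (\<lambda>x. indicator (cutF n) x * (f x + c * g x)))
     (\<lambda>y. F0 (\<lambda>x. indicator (cutF n) x * f x) y + c * F0 (\<lambda>x. indicator (cutF n) x * g x) y)"
    by (simp add: algebra_simps)
next
  fix n and f :: "real \<Rightarrow> complex" assume "f \<in> L2"
  then show "F0 (\<lambda>x. indicator (cutF n) x * f x) \<in> L2 \<and>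
    nrm (F0 (\<lambda>x. indicator (cutF n) x * f x)) \<le> nrm (\<lambda>x. indicator (cutF n) x * f x)"
    using F0_contraction[OF cutF_L1] by blast
qed (use cutF in auto)

definition Fk :: "(real \<Rightarrow> complex) \<Rightarrow> real \<Rightarrow> complex" where
  "Fk = (SOME S. extends_contraction F0 cutF S)"

lemma Fk_extends: "extends_contraction F0 cutF Fk"
  unfolding Fk_def by (rule someI_ex[OF Fk_exists])

lemma Fk: "f \<in> L2 \<Longrightarrow> Fk f \<in> L2" "f \<in> L2 \<Longrightarrow> nrm (Fk f) \<le> nrm f"
  "f \<in> L2 \<Longrightarrow> L2_lim (\<lambda>n. F0 (\<lambda>x. indicator (cutF n) x * f x)) (Fk f)"
  "f \<in> L2 \<Longrightarrow> g \<in> L2 \<Longrightarrow> aeq (Fk (\<lambda>x. f x + c * g x)) (\<lambda>y. Fk f y + c * Fk g y)"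
  using Fk_extends unfolding extends_contraction_def by blast+

lemma Fk_F0:
  assumes f: "f \<in> L1 \<inter> L2" shows "aeq (Fk f) (F0 f)"
proof -
  have f1: "integrable hl f" and f2: "f \<in> L2" using f by (auto simp: L1_iff)
  let ?c = "\<lambda>n x. indicator (cutF n) x * f x"
  have c: "?c n \<in> L1 \<inter> L2" for n by (rule cutF_L1[OF f2])
  show ?thesis
  proof (rule L2_lim_unique[OF _ Fk(1)[OF f2] _ Fk(3)[OF f2]])
    show "F0 (?c n) \<in> L2" for n by (rule F0_contraction(1)[OF c])
    show "F0 f \<in> L2" by (rule F0_contraction(1)[OF f])
    show "L2_lim (\<lambda>n. F0 (?c n)) (F0 f)"
      unfolding L2_lim_def
    proof (rule tendsto_sandwich[OF _ _ tendsto_const])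
      show "(\<lambda>n. nrm (\<lambda>x. ?c n x - f x)) \<longlonglongrightarrow> 0"
        using L2_lim_cut[OF f2 cutF(1) cutF(2)] unfolding L2_lim_def by simp
      show "\<forall>\<^sub>F n in sequentially. nrm (\<lambda>k. F0 (?c n) k - F0 f k) \<le> nrm (\<lambda>x. ?c n x - f x)"
      proof (rule always_eventually, rule allI)
        fix n
        have d: "(\<lambda>x. ?c n x + (-1) * f x) \<in> L1 \<inter> L2"
        proof
          show "(\<lambda>x. ?c n x + (-1) * f x) \<in> L1" unfolding L1_iff
            by (intro Bochner_Integration.integrable_add integrable_mult_right f1) (use c in \<open>auto simp: L1_iff\<close>)
          show "(\<lambda>x. ?c n x + (-1) * f x) \<in> L2" using c f2 by (intro L2_add L2_cmult) auto
        qed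
        have "nrm (\<lambda>k. F0 (?c n) k + (-1) * F0 f k) = nrm (F0 (\<lambda>x. ?c n x + (-1) * f x))"
        proof (rule nrm_cong)
          show "aeq (\<lambda>k. F0 (?c n) k + (-1) * F0 f k) (F0 (\<lambda>x. ?c n x + (-1) * f x))"
            by (rule aeq_sym, rule F0_linear) (use c f1 in \<open>auto simp: L1_iff\<close>)
        qed (intro L2_meas L2_add L2_cmult F0_contraction(1) c f d)+
        also have "\<dots> \<le> nrm (\<lambda>x. ?c n x + (-1) * f x)" by (rule F0_contraction(2)[OF d])
        finally show "nrm (\<lambda>k. F0 (?c n) k - F0 f k) \<le> nrm (\<lambda>x. ?c n x - f x)" by simp
      qed
    qed simp
  qed
qed

text \<open>The formal adjoint of \<open>F0\<close>, used on functions cut off to some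
  \<open>cutG n\<close>.\<close>

definition G0 :: "(real \<Rightarrow> complex) \<Rightarrow> real \<Rightarrow> complex" where
  "G0 g x = of_real (sqrt (2 / pi)) * (\<integral>k. (g k / Om k) * PS k 0 x \<partial>hl)"

lemma cutG_quotient:
  assumes g: "g \<in> L2"
  shows "integrable hl (\<lambda>k. indicator (cutG n) k * g k / Om k)"
    "k > real (Suc n) \<Longrightarrow> indicator (cutG n) k * g k / Om k = 0"
proof -
  have [measurable]: "Om \<in> borel_measurable hl" by (intro continuous_on_measurable_hl continuous_Om)
  have [measurable]: "indicator (cutG n) \<in> borel_measurable hl" by (rule borel_measurable_hl) (use cutG(1) in simp)
  have [measurable]: "g \<in> borel_measurable hl" using g by (rule L2_meas)
  let ?r = "real (Suc n) + 1"
  have "integrable hl (\<lambda>k. indicator {0<..<?r} k * g k)"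
    using L1_L2_bounded_support[OF g] by (simp add: L1_iff)
  then have "integrable hl (\<lambda>k. real (Suc n) * norm (indicator {0<..<?r} k * g k))"
    by (intro integrable_mult_right integrable_norm)
  then show "integrable hl (\<lambda>k. indicator (cutG n) k * g k / Om k)"
  proof (rule Bochner_Integration.integrable_bound)
    show "AE k in hl. norm (indicator (cutG n) k * g k / Om k) \<le> norm (real (Suc n) * norm (indicator {0<..<?r} k * g k))"
    proof (rule AE_I2)
      fix k assume "k \<in> space hl"
      show "norm (indicator (cutG n) k * g k / Om k) \<le> norm (real (Suc n) * norm (indicator {0<..<?r} k * g k))"
      proof (cases "k \<in> cutG n \<and> Om k \<noteq> 0")
        case True
        then have k: "k \<in> {0<..<?r}" "inverse (real (Suc n)) \<le> cmod (Om k)"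
          using \<open>k \<in> space hl\<close> by (auto simp: cutG_def)
        have "inverse (cmod (Om k)) \<le> real (Suc n)"
          using le_imp_inverse_le[OF k(2)] by simp
        then have "cmod (g k) * inverse (cmod (Om k)) \<le> cmod (g k) * real (Suc n)" by (intro mult_left_mono) auto
        then show ?thesis using True k(1) by (simp add: norm_divide divide_inverse norm_inverse norm_mult abs_mult ac_simps)
      qed auto
    qed
  qed measurable
  show "k > real (Suc n) \<Longrightarrow> indicator (cutG n) k * g k / Om k = 0"
    by (auto simp: cutG_def indicator_def)
qed

lemma F0_G0:
  assumes f: "integrable hl f" and g: "g \<in> L2"
  shows "ip (F0 f) (\<lambda>k. indicator (cutG n) k * g k) = ip f (G0 (\<lambda>k. indicator (cutG n) k * g k))"
proof -
  let ?B = "\<lambda>k. indicator (cutG n) k * g k / Om k"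
  have "ip (F0 f) (\<lambda>k. indicator (cutG n) k * g k) = (\<integral>k. of_real (sqrt (2 / pi)) * (hat f k * cnj (?B k)) \<partial>hl)"
    unfolding ip_hl F0_def by (intro Bochner_Integration.integral_cong refl) (simp add: indicator_def)
  also have "\<dots> = of_real (sqrt (2 / pi)) * (\<integral>x. f x * (\<integral>k. cnj (PS k 0 x) * cnj (?B k) \<partial>hl) \<partial>hl)"
    unfolding integral_mult_right_zero
    by (subst Fubini_hat[OF f, where b="real (Suc n)"])
      (use integrable_cnj[OF cutG_quotient(1)[OF g, of n]] cutG_quotient(2)[OF g] in auto)
  also have "\<dots> = (\<integral>x. f x * (of_real (sqrt (2 / pi)) * (\<integral>k. cnj (?B k * PS k 0 x) \<partial>hl)) \<partial>hl)"
    unfolding integral_mult_right_zero[symmetric] by (simp add: ac_simps)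
  also have "\<dots> = ip f (G0 (\<lambda>k. indicator (cutG n) k * g k))"
    unfolding ip_hl G0_def Bochner_Integration.integral_cnj by simp
  finally show ?thesis .
qed

text \<open>A priori \<open>y\<close> is only bounded. The squared norm of its truncation to an
  interval is the inner product of the transform of that truncation with the cut-off
  \<open>g\<close>, hence at most the product of their norms; then the truncation is
  removed.\<close>

lemma G0_contraction:
  fixes n :: nat
  assumes g: "g \<in> L2"
  defines "y \<equiv> G0 (\<lambda>k. indicator (cutG n) k * g k)"
  shows "y \<in> L2" "nrm y \<le> nrm (\<lambda>k. indicator (cutG n) k * g k)"
proof -
  let ?B = "\<lambda>k. indicator (cutG n) k * g k / Om k"
  note B = cutG_quotient[OF g]
  have gL: "(\<lambda>k. indicator (cutG n) k * g k) \<in> L2" by (rule L2_cut[OF g cutG(1)])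
  have Bm [measurable]: "?B \<in> borel_measurable hl" using B(1) by (rule borel_measurable_integrable)
  have ym: "y \<in> borel_measurable hl"
  proof (rule borel_measurable_hl)
    have [measurable]: "(\<lambda>x. x) \<in> hl \<rightarrow>\<^sub>M borel" by (rule borel_measurable_hl) simp
    show "y \<in> borel_measurable borel" unfolding y_def G0_def PS_def by measurable
  qed
  obtain C where C: "C \<ge> 0" "\<And>k x. k \<in> {0<..real (Suc n)} \<Longrightarrow> x \<ge> 0 \<Longrightarrow> cmod (PS k 0 x) \<le> C" using PS_bound0 by blast
  define D where "D = sqrt (2 / pi) * (\<integral>k. C * norm (?B k) \<partial>hl)"
  have iB: "integrable hl (\<lambda>k. C * norm (?B k))" by (intro integrable_mult_right integrable_norm B)
  have yb: "cmod (y x) \<le> D" if "x > 0" for x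
  proof -
    have le: "norm (?B k * PS k 0 x) \<le> C * norm (?B k)" if "k > 0" for k
    proof (cases "k \<le> real (Suc n)")
      case True
      then have "cmod (PS k 0 x) \<le> C" using C(2)[of k x] that \<open>x > 0\<close> by auto
      then show ?thesis unfolding norm_mult by (subst mult.commute) (intro mult_right_mono, auto)
    qed (use B(2)[of n k] C in auto)
    have "integrable hl (\<lambda>k. ?B k * PS k 0 x)"
    proof (rule Bochner_Integration.integrable_bound[OF iB])
      have "(\<lambda>k. PS k 0 x) \<in> borel_measurable hl" by (rule borel_measurable_hl[OF PS_meas1])
      then show "(\<lambda>k. ?B k * PS k 0 x) \<in> borel_measurable hl" by (intro borel_measurable_times Bm)
      show "AE k in hl. norm (?B k * PS k 0 x) \<le> norm (C * norm (?B k))"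
      proof (rule AE_I2)
        fix k assume "k \<in> space hl"
        then have "norm (?B k * PS k 0 x) \<le> C * norm (?B k)" by (intro le) simp
        then show "norm (?B k * PS k 0 x) \<le> norm (C * norm (?B k))" unfolding real_norm_def by linarith
      qed
    qed
    then have "norm (\<integral>k. ?B k * PS k 0 x \<partial>hl) \<le> (\<integral>k. C * norm (?B k) \<partial>hl)"
      by (intro Bochner_Integration.integral_norm_bound_integral[OF _ iB]) (use le in auto)
    then show ?thesis unfolding y_def G0_def D_def norm_mult
      by (intro mult_mono) auto
  qed
  have yc: "(\<lambda>x. indicator (cutF m) x * y x) \<in> L1 \<inter> L2" for m
  proof -
    have "(\<lambda>x. indicator (cutF m) x * (exp (- (1 * of_real x)) :: complex)) \<in> L2"
      by (intro L2_cut L2_exp cutF) simp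
    \<comment> \<open>The factors \<open>exp x\<close> and \<open>exp (- x)\<close> cancel; they
      present a bounded function on a bounded interval as a bounded multiple of an \<open>L2\<close>
      function.\<close>
    then have "(\<lambda>x. indicator (cutF m) x * (exp (of_real x) * y x) * (indicator (cutF m) x * (exp (- (1 * of_real x)) :: complex))) \<in> L2"
    proof (rule L2_mult_bounded[where B="exp (real m) * D"])
      have "indicator (cutF m) \<in> borel_measurable hl" "(\<lambda>x. exp (complex_of_real x)) \<in> borel_measurable hl"
        by (rule borel_measurable_hl, use cutF(1) in simp)+
      then show "(\<lambda>x. indicator (cutF m) x * (exp (of_real x) * y x)) \<in> borel_measurable hl"
        by (intro borel_measurable_times ym)
      fix x :: real assume "x > 0"
      have "0 \<le> D" using yb[OF \<open>x > 0\<close>] norm_ge_zero order_trans by blast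
      then show "cmod (indicator (cutF m) x * (exp (of_real x) * y x)) \<le> exp (real m) * D"
        using yb[OF \<open>x > 0\<close>] by (auto simp: indicator_def norm_mult cutF_def intro!: mult_mono)
    qed
    also have "(\<lambda>x. indicator (cutF m) x * (exp (of_real x) * y x) * (indicator (cutF m) x * (exp (- (1 * of_real x)) :: complex)))
      = (\<lambda>x. indicator (cutF m) x * y x)"
      by (auto simp: indicator_def exp_minus fun_eq_iff)
    finally have L: "(\<lambda>x. indicator (cutF m) x * y x) \<in> L2" .
    from cutF_L1[OF this, of m] show ?thesis
      by (rule back_subst[where P="\<lambda>f. f \<in> L1 \<inter> L2"]) (auto simp: indicator_def fun_eq_iff)
  qed
  have key: "(\<integral>x. indicator (cutF m) x * (cmod (y x))\<^sup>2 \<partial>hl) = (nrm (\<lambda>x. indicator (cutF m) x * y x))\<^sup>2" for m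
    unfolding nrm_sq by (intro Bochner_Integration.integral_cong refl) (auto simp: indicator_def)
  have nb: "nrm (\<lambda>x. indicator (cutF m) x * y x) \<le> nrm (\<lambda>k. indicator (cutG n) k * g k)" for m
  proof -
    let ?f = "\<lambda>x. indicator (cutF m) x * y x"
    have f: "integrable hl ?f" "?f \<in> L2" using yc[of m] by (auto simp: L1_iff)
    have "complex_of_real ((nrm ?f)\<^sup>2) = ip ?f y"
      unfolding ip_self[symmetric] ip_hl by (intro Bochner_Integration.integral_cong refl) (auto simp: indicator_def)
    also have "\<dots> = ip (F0 ?f) (\<lambda>k. indicator (cutG n) k * g k)"
      unfolding y_def by (rule F0_G0[OF f(1)[unfolded y_def] g, symmetric])
    finally have "(nrm ?f)\<^sup>2 = cmod (ip (F0 ?f) (\<lambda>k. indicator (cutG n) k * g k))"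
      by (metis abs_of_nonneg norm_of_real zero_le_power2)
    also have "\<dots> \<le> nrm (F0 ?f) * nrm (\<lambda>k. indicator (cutG n) k * g k)"
      by (rule Cauchy_Schwarz_ip[OF F0_contraction(1)[OF yc] gL])
    also have "\<dots> \<le> nrm ?f * nrm (\<lambda>k. indicator (cutG n) k * g k)"
      by (intro mult_right_mono F0_contraction(2)[OF yc]) simp
    finally show ?thesis
      using mult_left_le_imp_le[of "nrm ?f" "nrm ?f"] nrm_nonneg[of ?f]
      by (cases "nrm ?f = 0") (auto simp: power2_eq_square)
  qed
  have w: "indicator (cutF m) \<in> borel_measurable hl" for m by (rule borel_measurable_hl) (use cutF(1) in simp)
  have i: "integrable hl (\<lambda>x. indicator (cutF m) x * (cmod (y x))\<^sup>2)" for m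
  proof -
    have "(\<lambda>x. (cmod (indicator (cutF m) x * y x))\<^sup>2) = (\<lambda>x. indicator (cutF m) x * (cmod (y x))\<^sup>2)"
      by (auto simp: indicator_def)
    then show ?thesis using L2_sq[of "\<lambda>x. indicator (cutF m) x * y x"] yc[of m] by simp
  qed
  have lim: "AE x in hl. (\<lambda>m. indicator (cutF m) x :: real) \<longlonglongrightarrow> 1"
  proof (rule AE_I2)
    fix x assume "x \<in> space hl"
    then show "(\<lambda>m. indicator (cutF m) x :: real) \<longlonglongrightarrow> 1"
      using cutF(2)[of x] by (intro tendsto_eventually) (auto elim!: eventually_mono)
  qed
  have bd: "(\<integral>x. indicator (cutF m) x * (cmod (y x))\<^sup>2 \<partial>hl) \<le> (nrm (\<lambda>k. indicator (cutG n) k * g k))\<^sup>2" for m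
    unfolding key by (intro power_mono nb nrm_nonneg)
  show "y \<in> L2" "nrm y \<le> nrm (\<lambda>k. indicator (cutG n) k * g k)"
    by (rule L2I_weights[OF ym w _ lim i bd nrm_nonneg], simp)+
qed

lemma Gk_exists: "\<exists>S. extends_contraction G0 cutG S"
  unfolding extends_contraction_def
proof (rule L2_extension)
  fix n c and f g :: "real \<Rightarrow> complex" assume f: "f \<in> L2" and g: "g \<in> L2"
  show "aeq (G0 (\<lambda>x. indicator (cutG n) x * (f x + c * g x)))
     (\<lambda>y. G0 (\<lambda>x. indicator (cutG n) x * f x) y + c * G0 (\<lambda>x. indicator (cutG n) x * g x) y)"
  proof (rule aeqI)
    fix x :: real assume x: "x > 0"
    have i: "integrable hl (\<lambda>k. indicator (cutG n) k * h k / Om k * PS k 0 x)" if h: "h \<in> L2" for h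
    proof -
      note B = cutG_quotient[OF h, of n]
      obtain C where C: "C \<ge> 0" "\<And>k x. k \<in> {0<..real (Suc n)} \<Longrightarrow> x \<ge> 0 \<Longrightarrow> cmod (PS k 0 x) \<le> C" using PS_bound0 by blast
      have "integrable hl (\<lambda>k. C * norm (indicator (cutG n) k * h k / Om k))"
        by (intro integrable_mult_right integrable_norm B)
      then show ?thesis
      proof (rule Bochner_Integration.integrable_bound)
        have "(\<lambda>k. PS k 0 x) \<in> borel_measurable hl" by (rule borel_measurable_hl[OF PS_meas1])
        then show "(\<lambda>k. indicator (cutG n) k * h k / Om k * PS k 0 x) \<in> borel_measurable hl"
          by (rule borel_measurable_times[OF borel_measurable_integrable[OF B(1)]])
        show "AE k in hl. norm (indicator (cutG n) k * h k / Om k * PS k 0 x) \<le> norm (C * norm (indicator (cutG n) k * h k / Om k))"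
        proof (rule AE_I2)
          fix k assume "k \<in> space hl"
          show "norm (indicator (cutG n) k * h k / Om k * PS k 0 x) \<le> norm (C * norm (indicator (cutG n) k * h k / Om k))"
          proof (cases "k \<le> real (Suc n)")
            case True
            then have "cmod (PS k 0 x) \<le> C" using C(2)[of k x] \<open>k \<in> space hl\<close> x by auto
            then have "cmod (indicator (cutG n) k * h k / Om k) * cmod (PS k 0 x) \<le> cmod (indicator (cutG n) k * h k / Om k) * C"
              by (rule mult_left_mono) simp
            then show ?thesis using C(1) unfolding norm_mult[of "indicator (cutG n) k * h k / Om k"]
              by (simp add: abs_mult mult.commute)
          qed (use B(2)[of k] in auto)
        qed
      qed
    qed
    have "(\<integral>k. indicator (cutG n) k * (f k + c * g k) / Om k * PS k 0 x \<partial>hl)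
      = (\<integral>k. indicator (cutG n) k * f k / Om k * PS k 0 x + c * (indicator (cutG n) k * g k / Om k * PS k 0 x) \<partial>hl)"
      by (intro Bochner_Integration.integral_cong refl) (simp add: add_divide_distrib algebra_simps)
    also have "\<dots> = (\<integral>k. indicator (cutG n) k * f k / Om k * PS k 0 x \<partial>hl) + c * (\<integral>k. indicator (cutG n) k * g k / Om k * PS k 0 x \<partial>hl)"
      by (subst Bochner_Integration.integral_add[OF i[OF f] integrable_mult_right[OF i[OF g]]])
        (simp only: integral_mult_right_zero)
    finally show "G0 (\<lambda>x. indicator (cutG n) x * (f x + c * g x)) x =
      G0 (\<lambda>x. indicator (cutG n) x * f x) x + c * G0 (\<lambda>x. indicator (cutG n) x * g x) x"
      unfolding G0_def by (simp only: distrib_left mult.left_commute)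
  qed
next
  fix n and f :: "real \<Rightarrow> complex" assume "f \<in> L2"
  then show "G0 (\<lambda>x. indicator (cutG n) x * f x) \<in> L2 \<and>
    nrm (G0 (\<lambda>x. indicator (cutG n) x * f x)) \<le> nrm (\<lambda>x. indicator (cutG n) x * f x)"
    using G0_contraction by blast
qed (use cutG in auto)

definition Gk :: "(real \<Rightarrow> complex) \<Rightarrow> real \<Rightarrow> complex" where
  "Gk = (SOME S. extends_contraction G0 cutG S)"

lemma Gk_extends: "extends_contraction G0 cutG Gk"
  unfolding Gk_def by (rule someI_ex[OF Gk_exists])

lemma Gk: "f \<in> L2 \<Longrightarrow> Gk f \<in> L2" "f \<in> L2 \<Longrightarrow> nrm (Gk f) \<le> nrm f"
  "f \<in> L2 \<Longrightarrow> L2_lim (\<lambda>n. G0 (\<lambda>x. indicator (cutG n) x * f x)) (Gk f)"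
  "f \<in> L2 \<Longrightarrow> g \<in> L2 \<Longrightarrow> aeq (Gk (\<lambda>x. f x + c * g x)) (\<lambda>y. Gk f y + c * Gk g y)"
  using Gk_extends unfolding extends_contraction_def by blast+

text \<open>With both cutoffs in place the identity is Fubini; they are removed one after the other,
  first in \<open>x\<close> and then in \<open>k\<close>.\<close>

lemma Fk_Gk_adjoint:
  assumes f: "f \<in> L2" and g: "g \<in> L2" shows "ip (Fk f) g = ip f (Gk g)"
proof -
  let ?f = "\<lambda>m x. indicator (cutF m) x * f x"
  let ?g = "\<lambda>n x. indicator (cutG n) x * g x"
  have gL: "?g n \<in> L2" for n by (rule L2_cut[OF g cutG(1)])
  have 1: "ip (Fk f) (?g n) = ip f (G0 (?g n))" for n
  proof (rule LIMSEQ_unique)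
    show "(\<lambda>m. ip (F0 (?f m)) (?g n)) \<longlonglongrightarrow> ip (Fk f) (?g n)"
      by (intro L2_lim_ip F0_contraction(1) cutF_L1 Fk gL f)
    have "ip (F0 (?f m)) (?g n) = ip (?f m) (G0 (?g n))" for m
      by (rule F0_G0) (use cutF_L1[OF f] g in \<open>auto simp: L1_iff\<close>)
    moreover have "(\<lambda>m. ip (?f m) (G0 (?g n))) \<longlonglongrightarrow> ip f (G0 (?g n))"
      by (intro L2_lim_ip L2_cut cutF G0_contraction f g L2_lim_cut)
    ultimately show "(\<lambda>m. ip (F0 (?f m)) (?g n)) \<longlonglongrightarrow> ip f (G0 (?g n))" by simp
  qed
  show ?thesis
  proof (rule LIMSEQ_unique)
    show "(\<lambda>n. ip (Fk f) (?g n)) \<longlonglongrightarrow> ip (Fk f) g"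
      by (intro L2_lim_ip_right gL g Fk f L2_lim_cut cutG)
    show "(\<lambda>n. ip (Fk f) (?g n)) \<longlonglongrightarrow> ip f (Gk g)"
      unfolding 1 by (intro L2_lim_ip_right G0_contraction Gk f g)
  qed
qed

lemma Fk_Phi:
  assumes f: "f \<in> L2" and h: "testfn h" shows "ip (Fk f) (Phi h) = ip f (TP h)"
proof (rule LIMSEQ_unique)
  let ?f = "\<lambda>m x. indicator (cutF m) x * f x"
  show "(\<lambda>m. ip (F0 (?f m)) (Phi h)) \<longlonglongrightarrow> ip (Fk f) (Phi h)"
    by (intro L2_lim_ip F0_contraction(1) cutF_L1 Fk Phi_L2 h f)
  have "ip (F0 (?f m)) (Phi h) = ip (?f m) (TP h)" for m
    by (rule F0_Phi[OF _ h]) (use cutF_L1[OF f] in \<open>auto simp: L1_iff\<close>)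
  moreover have "(\<lambda>m. ip (?f m) (TP h)) \<longlonglongrightarrow> ip f (TP h)"
    by (intro L2_lim_ip L2_cut cutF f TP_isometry(1)[OF h h] L2_lim_cut)
  ultimately show "(\<lambda>m. ip (F0 (?f m)) (Phi h)) \<longlonglongrightarrow> ip f (TP h)" by simp
qed

text \<open>Indicators of intervals suffice as densities: they force the primitive of
  \<open>cnj Om * u\<close> to be constant on the open half-line, hence 0 by continuity at 0, and
  \<open>Om\<close> is nonzero almost everywhere.\<close>

lemma Phi_separates:
  assumes u: "u \<in> L2" and z: "\<And>h. testfn h \<Longrightarrow> ip u (Phi h) = 0"
  shows "aeq u (\<lambda>x. 0)"
proof -
  define v where "v k = cnj (Om k) * u k" for k
  have vI: "set_integrable lborel {0..x} v" for x
    unfolding v_def by (intro set_integrable_continuous_mult L2_Icc u continuous_intros)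
  define I where "I x = 0 + (LINT t:{0..x}|lborel. v t)" for x
  have aI: "acp I v" unfolding I_def by (intro acp_primitive vI)
  have I0: "I 0 = 0"
    unfolding I_def set_lebesgue_integral_def
    by (simp, rule integral_eq_zero_AE) (use AE_lborel_singleton[of 0] in \<open>eventually_elim, auto simp: indicator_def\<close>)
  have eq: "I x = I s" if "0 < s" "s < x" for s x
  proof -
    define h where "h k = indicator {s..x} k * (1::complex)" for k
    have h: "testfn h" unfolding h_def[abs_def] by (rule testfn_indicator[OF that(1)]) (intro continuous_intros)
    have "0 = (\<integral>k. of_real (sqrt (pi / 2)) * (indicator {s..x} k * v k) \<partial>hl)"
      unfolding z[OF h, symmetric] ip_hl
      by (intro Bochner_Integration.integral_cong refl) (simp add: Phi_def h_def v_def indicator_def)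
    then have "(\<integral>k. indicator {s..x} k * v k \<partial>hl) = 0" unfolding integral_mult_right_zero by simp
    also have "(\<integral>k. indicator {s..x} k * v k \<partial>hl) = (LINT t:{s..x}|lborel. v t)"
      unfolding integral_hl[symmetric] set_lebesgue_integral_def
      by (intro Bochner_Integration.integral_cong refl) (use that in \<open>auto simp: indicator_def\<close>)
    finally have z0: "(LINT t:{s..x}|lborel. v t) = 0" .
    have "(LINT t:{0..<s} \<union> {s..x}|lborel. v t) = (LINT t:{0..<s}|lborel. v t) + (LINT t:{s..x}|lborel. v t)"
      by (rule set_integral_Un) (use that in \<open>auto intro!: set_integrable_subset[OF vI[of x]]\<close>)
    moreover have "{0..<s} \<union> {s..x} = {0..x}" using that by auto
    ultimately show ?thesis
      unfolding I_def by (simp add: z0 set_integral_half_open[OF vI])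
  qed
  have "I x = 0" if x: "x > 0" for x
  proof -
    have "(I \<longlongrightarrow> I 0) (at 0 within {0..})" using acp_continuous[OF aI] by (simp add: continuous_on)
    then have "(I \<longlongrightarrow> I 0) (at_right 0)" by (rule tendsto_within_subset) auto
    moreover have "(I \<longlongrightarrow> I x) (at_right 0)"
      using eq[of _ x] x by (intro tendsto_eventually) (auto simp: eventually_at_right_field intro!: exI[of _ x])
    ultimately show ?thesis using tendsto_unique[OF trivial_limit_at_right_real] I0 by metis
  qed
  then have "(LINT t:{0..x}|lborel. v t) = 0" if "x \<ge> 0" for x
    using I0 that unfolding I_def by (cases "x = 0") auto
  then have "aeq v (\<lambda>x. 0)" by (intro AE_zero_if_primitive_zero vI)
  then show ?thesis unfolding aeq_iff using AE_Om
    by eventually_elim (simp add: v_def)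
qed

text \<open>\<open>Gk (Phi h)\<close> and \<open>TP h\<close> have the same inner product with every
  element of \<open>L2\<close>, in particular with their difference.\<close>

lemma Gk_Phi:
  assumes h: "testfn h" shows "aeq (Gk (Phi h)) (TP h)"
proof (rule nrm_diff_0D)
  note L = Gk(1)[OF Phi_L2[OF h]] TP_isometry(1)[OF h h]
  let ?d = "\<lambda>x. Gk (Phi h) x - TP h x"
  have d: "?d \<in> L2" by (intro L2_diff L)
  have "ip ?d ?d = ip ?d (Gk (Phi h)) - ip ?d (TP h)" by (rule ip_diff_right[OF L d])
  also have "\<dots> = 0" using Fk_Gk_adjoint[OF d Phi_L2[OF h]] Fk_Phi[OF d h] by simp
  finally show "nrm ?d = 0" by (simp add: ip_self)
qed (use Gk(1)[OF Phi_L2[OF h]] TP_isometry(1)[OF h h] in auto)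

lemma Gk_Fk_adjoint: "f \<in> L2 \<Longrightarrow> g \<in> L2 \<Longrightarrow> ip (Gk g) f = ip g (Fk f)"
  using Fk_Gk_adjoint[of f g] by (metis cnj_ip)

text \<open>By the isometry of packets \<open>Fk (Gk (Phi h)) - Phi h\<close> is orthogonal to every
  \<open>Phi h'\<close>, hence null. For general \<open>g\<close> the adjoint moves
  \<open>Fk Gk\<close> onto \<open>Phi h\<close>, and separation is used once more.\<close>

lemma Fk_Gk: assumes g: "g \<in> L2" shows "aeq (Fk (Gk g)) g"
proof -
  have P: "aeq (Fk (Gk (Phi h))) (Phi h)" if h: "testfn h" for h
  proof -
    note L = Phi_L2[OF h] Gk(1)[OF Phi_L2[OF h]] Fk(1)[OF Gk(1)[OF Phi_L2[OF h]]]
    have "aeq (\<lambda>k. Fk (Gk (Phi h)) k - Phi h k) (\<lambda>k. 0)"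
    proof (rule Phi_separates)
      fix h' assume h': "testfn h'"
      note L' = Phi_L2[OF h'] Gk(1)[OF Phi_L2[OF h']]
      have "ip (Fk (Gk (Phi h))) (Phi h') = ip (Gk (Phi h)) (Gk (Phi h'))"
        by (intro Fk_Gk_adjoint L L')
      also have "\<dots> = ip (TP h) (TP h')"
        by (intro ip_cong L2_meas L L' TP_isometry(1)[OF h h] TP_isometry(1)[OF h' h'] Gk_Phi h h')
      also have "\<dots> = ip (Phi h) (Phi h')" by (rule ip_TP[OF h h'])
      finally show "ip (\<lambda>k. Fk (Gk (Phi h)) k - Phi h k) (Phi h') = 0"
        using L L' by (simp add: ip_diff_left)
    qed (intro L2_diff L)
    then show ?thesis unfolding aeq_iff by eventually_elim simp
  qed
  note L = g Gk(1)[OF g] Fk(1)[OF Gk(1)[OF g]]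
  have "aeq (\<lambda>k. Fk (Gk g) k - g k) (\<lambda>k. 0)"
  proof (rule Phi_separates)
    fix h assume h: "testfn h"
    note L' = Phi_L2[OF h] Gk(1)[OF Phi_L2[OF h]] Fk(1)[OF Gk(1)[OF Phi_L2[OF h]]]
    have "ip (Fk (Gk g)) (Phi h) = ip (Gk g) (Gk (Phi h))" by (intro Fk_Gk_adjoint L L')
    also have "\<dots> = ip g (Fk (Gk (Phi h)))" by (intro Gk_Fk_adjoint L L')
    also have "\<dots> = ip g (Phi h)" by (intro ip_cong L2_meas L L' P h aeq_refl)
    finally show "ip (\<lambda>k. Fk (Gk g) k - g k) (Phi h) = 0" using L L' by (simp add: ip_diff_left)
  qed (intro L2_diff L)
  then show ?thesis unfolding aeq_iff by eventually_elim simp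
qed

end

section \<open>The transform in the spectral variable\<close>

lemma L2_lim_subseq: "L2_lim f g \<Longrightarrow> strict_mono r \<Longrightarrow> L2_lim (\<lambda>n. f (r n)) g"
  unfolding L2_lim_def using LIMSEQ_subseq_LIMSEQ[of "\<lambda>n. nrm (\<lambda>x. f n x - g x)" 0 r] by (simp add: o_def)

text \<open>The extended operators act on representatives through a choice; independence of the
  representative follows from linearity and the norm bound applied to a null function.\<close>

lemma extends_contraction_cong:
  assumes S: "extends_contraction T E S" and "f \<in> L2" "g \<in> L2" "aeq f g"
  shows "aeq (S f) (S g)"
proof -
  have L: "(\<lambda>x. f x + (-1) * g x) \<in> L2" by (intro L2_add L2_cmult assms)
  have z: "nrm (\<lambda>x. f x + (-1) * g x) = 0"
    using L assms(4) by (subst nrm_eq_0_iff) (auto simp: aeq_def elim: eventually_mono)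
  have "S (\<lambda>x. f x + (-1) * g x) \<in> L2" "nrm (S (\<lambda>x. f x + (-1) * g x)) \<le> nrm (\<lambda>x. f x + (-1) * g x)"
    using S L unfolding extends_contraction_def by blast+
  note SL = this
  have "nrm (S (\<lambda>x. f x + (-1) * g x)) = 0"
    using SL(2) nrm_nonneg[of "S (\<lambda>x. f x + (-1) * g x)"] unfolding z by linarith
  then have "aeq (S (\<lambda>x. f x + (-1) * g x)) (\<lambda>x. 0)"
    by (subst (asm) nrm_eq_0_iff[OF SL(1)])
  moreover have "aeq (S (\<lambda>x. f x + (-1) * g x)) (\<lambda>y. S f y + (-1) * S g y)"
    using S assms(2,3) unfolding extends_contraction_def by blast
  ultimately show ?thesis unfolding aeq_iff by eventually_elim auto
qed

section \<open>Substitution of the fourth root for the spectral variable\<close>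

lemma kk_pos: "x > 0 \<Longrightarrow> kk x > 0"
  by (simp add: kk_def)

lemma kk_power4: "x > 0 \<Longrightarrow> kk x ^ 4 = x"
  unfolding kk_def by (simp add: powr_power)

lemma kk_of_power4: "k > 0 \<Longrightarrow> kk (k ^ 4) = k"
proof -
  assume k: "k > 0"
  have "(k powr real 4) powr (1/4) = k" unfolding powr_powr using k by simp
  then show "kk (k ^ 4) = k" unfolding kk_def powr_realpow[OF k] .
qed

lemma kk_image: "kk ` {0<..} = {0<..}"
proof
  show "{0<..} \<subseteq> kk ` {0<..}"
  proof
    fix k :: real assume "k \<in> {0<..}"
    then have "k = kk (k ^ 4)" "k ^ 4 \<in> {0<..}" by (simp_all add: kk_of_power4)
    then show "k \<in> kk ` {0<..}" by blast
  qed
qed (auto simp: kk_pos)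

lemma kk_measurable: "kk \<in> hl \<rightarrow>\<^sub>M hl"
proof (rule measurable_restrict_space2)
  show "kk \<in> hl \<rightarrow>\<^sub>M lborel"
    unfolding measurable_lborel1[symmetric]
    by (simp, intro borel_measurable_hl) (simp add: kk_def[abs_def])
qed (auto simp: kk_pos)

lemma integrable_hl_absolutely:
  fixes f :: "real \<Rightarrow> 'a::euclidean_space"
  assumes "f \<in> borel_measurable hl"
  shows "integrable hl f \<longleftrightarrow> f absolutely_integrable_on {0<..}"
    and "integrable hl f \<Longrightarrow> (\<integral>x. f x \<partial>hl) = integral {0<..} f"
proof -
  have m: "(\<lambda>x. indicator {0<..} x *\<^sub>R f x) \<in> borel_measurable lborel"
    using assms by (subst (asm) borel_measurable_restrict_space_iff) auto
  show iff: "integrable hl f \<longleftrightarrow> f absolutely_integrable_on {0<..}"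
    unfolding integrable_hl_iff set_integrable_def integrable_completion[OF m] ..
  assume "integrable hl f"
  then have "f absolutely_integrable_on {0<..}" using iff by simp
  then have "(LINT x:{0<..}|lebesgue. f x) = integral {0<..} f" by (rule set_lebesgue_integral_eq_integral(2))
  then show "(\<integral>x. f x \<partial>hl) = integral {0<..} f"
    unfolding integral_hl[symmetric] set_lebesgue_integral_def integral_completion[OF m] by simp
qed

text \<open>The weight is the derivative of \<open>kk\<close>, an injective map of the open
  half-line onto itself.\<close>

lemma hl_substitution:
  fixes f :: "real \<Rightarrow> 'a::euclidean_space"
  assumes f: "f \<in> borel_measurable hl"
  shows "integrable hl (\<lambda>x. (x powr (-3/4) / 4) *\<^sub>R f (kk x)) \<longleftrightarrow> integrable hl f"
    and "integrable hl f \<Longrightarrow> (\<integral>x. (x powr (-3/4) / 4) *\<^sub>R f (kk x) \<partial>hl) = (\<integral>x. f x \<partial>hl)"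
proof -
  let ?f = "\<lambda>x. (x powr (-3/4) / 4) *\<^sub>R f (kk x)"
  have m: "?f \<in> borel_measurable hl"
  proof (rule borel_measurable_scaleR)
    show "(\<lambda>x. x powr (-3/4) / 4) \<in> borel_measurable hl" by (rule borel_measurable_hl) simp
    show "(\<lambda>x. f (kk x)) \<in> borel_measurable hl" by (rule measurable_compose[OF kk_measurable f])
  qed
  have d: "(kk has_field_derivative x powr (-3/4) / 4) (at x within {0<..})" if "x \<in> {0<..}" for x
  proof -
    have "(kk has_field_derivative (1/4) * x powr (1/4 - 1)) (at x within {0<..})"
      unfolding kk_def[abs_def] using that by (intro has_real_derivative_powr[THEN DERIV_subset]) auto
    then show ?thesis by simp
  qed
  have inj: "inj_on kk {0<..}" by (rule inj_on_inverseI[where g="\<lambda>k. k ^ 4"]) (simp add: kk_power4)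
  have abs: "\<bar>x powr (-3/4) / 4\<bar> = x powr (-3/4) / 4" for x :: real by simp
  note C = has_absolute_integral_change_of_variables_real[of "{0<..}" kk "\<lambda>x. x powr (-3/4) / 4" f, OF _ d inj,
      unfolded kk_image abs]
  show 1: "integrable hl ?f \<longleftrightarrow> integrable hl f"
    unfolding integrable_hl_absolutely(1)[OF m] integrable_hl_absolutely(1)[OF f] using C by auto
  assume i: "integrable hl f"
  show "(\<integral>x. ?f x \<partial>hl) = (\<integral>x. f x \<partial>hl)"
    unfolding integrable_hl_absolutely(2)[OF f i] integrable_hl_absolutely(2)[OF m 1[THEN iffD2, OF i]]
    using C[of "integral {0<..} f"] i unfolding integrable_hl_absolutely(1)[OF f] by auto
qed

text \<open>The unitary change of variable \<open>\<lambda> = k\<^sup>4\<close> and its inverse.\<close>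

definition VV :: "(real \<Rightarrow> complex) \<Rightarrow> real \<Rightarrow> complex" where
  "VV g x = of_real (x powr (-3/8) / 2) * g (kk x)"

definition VI :: "(real \<Rightarrow> complex) \<Rightarrow> real \<Rightarrow> complex" where
  "VI g k = of_real (2 * k powr (3/2)) * g (k ^ 4)"

lemma VV_product:
  "x > 0 \<Longrightarrow> VV f x * cnj (VV g x) = (x powr (-3/4) / 4) *\<^sub>R (f (kk x) * cnj (g (kk x)))"
proof -
  assume "x > 0"
  then have "(x powr (-3/8) / 2) * (x powr (-3/8) / 2) = x powr (-3/4) / 4" by (simp add: powr_add[symmetric])
  then have "complex_of_real (x powr (-3/8) / 2) * of_real (x powr (-3/8) / 2) = of_real (x powr (-3/4) / 4)"
    unfolding of_real_mult[symmetric] by (rule arg_cong)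
  moreover have "VV f x * cnj (VV g x) = (complex_of_real (x powr (-3/8) / 2) * of_real (x powr (-3/8) / 2)) * (f (kk x) * cnj (g (kk x)))"
    by (simp add: VV_def)
  ultimately show ?thesis by (simp only: scaleR_conv_of_real)
qed

lemma VV_meas: "g \<in> borel_measurable hl \<Longrightarrow> VV g \<in> borel_measurable hl"
proof -
  assume g: "g \<in> borel_measurable hl"
  have "(\<lambda>x. complex_of_real (x powr (-3/8) / 2)) \<in> borel_measurable hl" by (rule borel_measurable_hl) simp
  then show ?thesis unfolding VV_def[abs_def]
    by (rule borel_measurable_times) (rule measurable_compose[OF kk_measurable g])
qed

lemma VV_norm_sq: "x > 0 \<Longrightarrow> (cmod (VV g x))\<^sup>2 = (x powr (-3/4) / 4) *\<^sub>R (cmod (g (kk x)))\<^sup>2"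
proof -
  assume x: "x > 0"
  have "complex_of_real ((cmod (VV g x))\<^sup>2) = (x powr (-3/4) / 4) *\<^sub>R complex_of_real ((cmod (g (kk x)))\<^sup>2)"
    unfolding complex_norm_square VV_product[OF x] ..
  then show ?thesis unfolding scaleR_conv_of_real of_real_mult[symmetric] of_real_eq_iff by simp
qed

lemma VV_L2_iff:
  assumes "g \<in> borel_measurable hl" shows "VV g \<in> L2 \<longleftrightarrow> g \<in> L2"
proof -
  have "integrable hl (\<lambda>x. (cmod (VV g x))\<^sup>2) = integrable hl (\<lambda>x. (x powr (-3/4) / 4) *\<^sub>R (cmod (g (kk x)))\<^sup>2)"
    by (intro Bochner_Integration.integrable_cong refl) (simp add: VV_norm_sq)
  also have "\<dots> = integrable hl (\<lambda>x. (cmod (g x))\<^sup>2)"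
    by (rule hl_substitution(1)) (use assms in measurable)
  finally show ?thesis using assms VV_meas[OF assms] by (simp add: L2_iff)
qed

lemma VV_L2: "g \<in> L2 \<Longrightarrow> VV g \<in> L2"
  using VV_L2_iff[OF L2_meas] by blast

lemma ip_VV: assumes "f \<in> L2" "g \<in> L2" shows "ip (VV f) (VV g) = ip f g"
proof -
  have "ip (VV f) (VV g) = (\<integral>x. (x powr (-3/4) / 4) *\<^sub>R (f (kk x) * cnj (g (kk x))) \<partial>hl)"
    unfolding ip_hl by (intro Bochner_Integration.integral_cong refl) (simp add: VV_product)
  also have "\<dots> = ip f g"
    unfolding ip_hl by (rule hl_substitution(2)[OF _ ip_integrable[OF assms]])
      (rule borel_measurable_integrable[OF ip_integrable[OF assms]])
  finally show ?thesis .
qed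

lemma nrm_VV: assumes "f \<in> L2" shows "nrm (VV f) = nrm f"
proof -
  have "complex_of_real ((nrm (VV f))\<^sup>2) = of_real ((nrm f)\<^sup>2)"
    using ip_VV[OF assms assms] by (simp only: ip_self)
  then have "(nrm (VV f))\<^sup>2 = (nrm f)\<^sup>2" by (simp only: of_real_eq_iff)
  then show ?thesis by (metis nrm_nonneg power2_eq_iff_nonneg)
qed

lemma VV_cong: assumes "f \<in> L2" "g \<in> L2" "aeq f g" shows "aeq (VV f) (VV g)"
proof (rule nrm_diff_0D[OF VV_L2[OF assms(1)] VV_L2[OF assms(2)]])
  have "nrm (VV (\<lambda>x. f x - g x)) = nrm (\<lambda>x. f x - g x)" by (intro nrm_VV L2_diff assms)
  also have "\<dots> = 0" using assms by (subst nrm_eq_0_iff[OF L2_diff]) (auto simp: aeq_def elim: eventually_mono)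
  also have "VV (\<lambda>x. f x - g x) = (\<lambda>x. VV f x - VV g x)" by (simp add: VV_def fun_eq_iff right_diff_distrib)
  finally show "nrm (\<lambda>x. VV f x - VV g x) = 0" .
qed

lemma VV_VI: "x > 0 \<Longrightarrow> VV (VI g) x = g x"
proof -
  assume x: "x > 0"
  have "(x powr (-3/8) / 2) * (2 * kk x powr (3/2)) = 1"
    using x by (simp add: kk_def powr_powr powr_add[symmetric])
  then have "complex_of_real (x powr (-3/8) / 2) * of_real (2 * kk x powr (3/2)) = 1"
    unfolding of_real_mult[symmetric] by simp
  moreover have "VV (VI g) x = complex_of_real (x powr (-3/8) / 2) * of_real (2 * kk x powr (3/2)) * g (kk x ^ 4)"
    unfolding VV_def VI_def by (simp only: mult.assoc)
  ultimately show ?thesis by (simp add: kk_power4[OF x])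
qed

lemma VI_L2: assumes "g \<in> L2" shows "VI g \<in> L2"
proof -
  have p: "(\<lambda>k. k ^ 4) \<in> hl \<rightarrow>\<^sub>M hl"
  proof (rule measurable_restrict_space2)
    show "(\<lambda>k. k ^ 4) \<in> hl \<rightarrow>\<^sub>M lborel"
      unfolding measurable_lborel1[symmetric] by (simp, intro borel_measurable_hl) simp
  qed auto
  have "(\<lambda>k. complex_of_real (2 * k powr (3/2))) \<in> borel_measurable hl" by (rule borel_measurable_hl) simp
  then have m: "VI g \<in> borel_measurable hl" unfolding VI_def[abs_def]
    by (rule borel_measurable_times) (rule measurable_compose[OF p L2_meas[OF assms]])
  have "VV (VI g) \<in> L2"
    by (rule L2_aeq[OF assms VV_meas[OF m]]) (rule aeqI, simp add: VV_VI)
  then show ?thesis using VV_L2_iff[OF m] by simp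
qed

context biharmonic
begin

lemma PS_bounded_x:
  assumes "k > 0" shows "\<exists>C. \<forall>x\<ge>0. cmod (PS k j x) \<le> C"
proof -
  have "cmod (PS k j x) \<le> (\<Sum>i<3. cmod (co k i) * cmod (ex k i ^ j))" if x: "x \<ge> 0" for x
    unfolding PS_def
  proof (rule order_trans[OF norm_sum], rule sum_mono)
    fix i :: nat
    have "cmod (co k i) * (cmod (ex k i ^ j) * cmod (exp (ex k i * of_real x))) \<le> cmod (co k i) * (cmod (ex k i ^ j) * 1)"
      by (intro mult_left_mono exp_ex_bound assms x) auto
    then show "cmod (co k i * (ex k i ^ j * exp (ex k i * of_real x))) \<le> cmod (co k i) * cmod (ex k i ^ j)"
      by (simp add: norm_mult)
  qed
  then show ?thesis by blast
qed

lemma wronskian_PS_tendsto_zero: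
  assumes v: "chain v" "\<And>k. k \<le> 4 \<Longrightarrow> v k \<in> L2" and k: "k > 0"
  shows "(wronskian v (cnjs (PS k)) \<longlongrightarrow> 0) at_top"
proof -
  have z: "((\<lambda>x. v i x * cnj (PS k j x)) \<longlongrightarrow> 0) at_top" if "i < 4" for i j
  proof -
    obtain C where C: "\<And>x. x \<ge> 0 \<Longrightarrow> cmod (PS k j x) \<le> C" using PS_bounded_x[OF k] by blast
    have vi: "(v i \<longlongrightarrow> 0) at_top"
      using v that by (intro acp_decay[of "v i" "v (Suc i)"]) (auto simp: chain_def)
    show ?thesis
    proof (rule Lim_null_comparison)
      show "\<forall>\<^sub>F x in at_top. norm (v i x * cnj (PS k j x)) \<le> cmod (v i x) * C"
        using eventually_ge_at_top[of 0] by eventually_elim (use C in \<open>auto simp: norm_mult intro!: mult_left_mono\<close>)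
      have "((\<lambda>x. cmod (v i x) * C) \<longlongrightarrow> cmod 0 * C) at_top" by (intro tendsto_intros vi)
      then show "((\<lambda>x. cmod (v i x) * C) \<longlongrightarrow> 0) at_top" by simp
    qed
  qed
  have "((\<lambda>x. v 3 x * cnj (PS k 0 x) - v 2 x * cnj (PS k 1 x) + v 1 x * cnj (PS k 2 x) - v 0 x * cnj (PS k 3 x)) \<longlongrightarrow> 0 - 0 + 0 - 0) at_top"
    by (intro tendsto_intros z) auto
  then show ?thesis by (simp add: wronskian_def[abs_def])
qed

lemma hat_cut:
  assumes f: "f \<in> L2" and k: "k > 0"
  shows "hat (\<lambda>x. indicator (cutF n) x * f x) k = (LINT x:{0..real n}|lborel. f x * cnj (PS k 0 x))"
proof -
  have pc: "continuous_on S (\<lambda>x. cnj (PS k 0 x))" for S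
    unfolding PS_def by (intro continuous_intros)
  have i: "set_integrable lborel {0..real n} (\<lambda>x. f x * cnj (PS k 0 x))"
    using set_integrable_continuous_mult[OF L2_Icc[OF f, of "real n"] pc] by (simp add: mult.commute)
  have "hat (\<lambda>x. indicator (cutF n) x * f x) k = (\<integral>x. indicator {0<..<real n} x *\<^sub>R (f x * cnj (PS k 0 x)) \<partial>hl)"
    unfolding hat_def cutF_def by (intro Bochner_Integration.integral_cong refl) (auto simp: indicator_def)
  also have "\<dots> = (LINT x:{0<..<real n}|lborel. f x * cnj (PS k 0 x))"
    unfolding integral_hl[symmetric] set_lebesgue_integral_def
    by (intro Bochner_Integration.integral_cong refl) (auto simp: indicator_def)
  also have "\<dots> = (LINT x:{0..real n}|lborel. f x * cnj (PS k 0 x))"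
  proof (rule set_integral_cong_set)
    show "AE x in lborel. (x \<in> {0..real n}) = (x \<in> {0<..<real n})"
      using AE_lborel_singleton[of 0] AE_lborel_singleton[of "real n"] by eventually_elim auto
    have "set_integrable lborel {0<..<real n} (\<lambda>x. f x * cnj (PS k 0 x))"
      by (rule set_integrable_subset[OF i]) auto
    then show "set_borel_measurable lborel {0<..<real n} (\<lambda>x. f x * cnj (PS k 0 x))"
      "set_borel_measurable lborel {0..real n} (\<lambda>x. f x * cnj (PS k 0 x))"
      using i by (auto simp: set_borel_measurable_def set_integrable_def)
  qed
  finally show ?thesis .
qed

text \<open>For truncations at \<open>n\<close>, Lagrange's identity with \<open>PS k\<close> leaves
  the bracket at \<open>x = n\<close>, which tends to 0 for each \<open>k\<close> since the
  derivatives of \<open>v\<close> decay and those of \<open>PS k\<close> are bounded. Limits in norm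
  are compared with this pointwise limit along a common subsequence.\<close>

lemma Fk_H:
  assumes H: "H u w" shows "aeq (Fk w) (\<lambda>k. of_real (k ^ 4) * Fk u k)"
proof -
  obtain v where v: "\<And>k. k \<le> 4 \<Longrightarrow> v k \<in> L2" "aeq (v 0) u" "aeq (v 4) w" "chain v" "bc1 v = 0" "bc2 v = 0"
    using H_E[OF H] by blast
  have vL: "v 0 \<in> L2" "v 4 \<in> L2" using v(1) by auto
  let ?c = "\<lambda>f n x. indicator (cutF n) x * f x"
  have lim: "(\<lambda>n. F0 (?c (v 4) n) k - of_real (k ^ 4) * F0 (?c (v 0) n) k) \<longlonglongrightarrow> 0" if k: "k > 0" for k
  proof -
    have hd: "hat (?c (v 4) n) k - of_real (k ^ 4) * hat (?c (v 0) n) k = wronskian v (cnjs (PS k)) (real n)" for n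
    proof -
      have a: "acp (wronskian v (cnjs (PS k))) (\<lambda>x. v 4 x * cnj (PS k 0 x) - v 0 x * cnj (PS k 4 x))"
        by (intro acp_wronskian chain_cnjs chain_PS v)
      have W0: "wronskian v (cnjs (PS k)) 0 = 0" by (intro wronskian_bc v bc_PS)
      have pc: "continuous_on S (\<lambda>x. cnj (PS k 0 x))" for S
        unfolding PS_def by (intro continuous_intros)
      have i: "set_integrable lborel {0..real n} (\<lambda>x. v j x * cnj (PS k 0 x))" if "j \<le> 4" for j
        using set_integrable_continuous_mult[OF L2_Icc[OF v(1)[OF that], of "real n"] pc] by (simp add: mult.commute)
      have "wronskian v (cnjs (PS k)) (real n) = (LINT x:{0..real n}|lborel. v 4 x * cnj (PS k 0 x) - v 0 x * cnj (PS k 4 x))"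
        using trans[OF acpD(2)[OF a, of "real n"] add.commute] W0 by simp
      also have "(\<lambda>x. v 4 x * cnj (PS k 0 x) - v 0 x * cnj (PS k 4 x))
        = (\<lambda>x. v 4 x * cnj (PS k 0 x) - of_real (k ^ 4) * (v 0 x * cnj (PS k 0 x)))"
        by (simp add: PS_4 ac_simps)
      also have "(LINT x:{0..real n}|lborel. v 4 x * cnj (PS k 0 x) - of_real (k ^ 4) * (v 0 x * cnj (PS k 0 x)))
        = hat (?c (v 4) n) k - of_real (k ^ 4) * hat (?c (v 0) n) k"
        unfolding hat_cut[OF vL(1) k] hat_cut[OF vL(2) k]
        by (subst set_integral_diff(2)[OF i set_integrable_mult_right[OF i]]) (simp_all add: set_integral_mult_right)
      finally show ?thesis ..
    qed
    have "F0 (?c (v 4) n) k - of_real (k ^ 4) * F0 (?c (v 0) n) k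
       = of_real (sqrt (2 / pi)) * wronskian v (cnjs (PS k)) (real n) / cnj (Om k)" for n
      unfolding F0_def hd[symmetric] by (simp add: diff_divide_distrib right_diff_distrib ac_simps)
    moreover have "(\<lambda>n. of_real (sqrt (2 / pi)) * wronskian v (cnjs (PS k)) (real n) * inverse (cnj (Om k))) \<longlonglongrightarrow> of_real (sqrt (2 / pi)) * 0 * inverse (cnj (Om k))"
      by (intro tendsto_intros filterlim_compose[OF wronskian_PS_tendsto_zero[OF v(4) v(1) k] filterlim_real_sequentially])
    ultimately show ?thesis by (simp add: divide_inverse)
  qed
  have c: "?c f n \<in> L1 \<inter> L2" if "f \<in> L2" for f n by (rule cutF_L1[OF that])
  obtain r :: "nat \<Rightarrow> nat" where r: "strict_mono r" "AE k in hl. (\<lambda>n. F0 (?c (v 4) (r n)) k) \<longlonglongrightarrow> Fk (v 4) k"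
    using L2_lim_AE_subseq[OF F0_contraction(1)[OF c[OF vL(2)]] Fk(1)[OF vL(2)] Fk(3)[OF vL(2)]] by blast
  \<comment> \<open>The second subsequence is extracted from the first, so that both transforms
    converge along it.\<close>
  obtain r' :: "nat \<Rightarrow> nat" where r': "strict_mono r'" "AE k in hl. (\<lambda>n. F0 (?c (v 0) (r (r' n))) k) \<longlonglongrightarrow> Fk (v 0) k"
    using L2_lim_AE_subseq[OF F0_contraction(1)[OF c[OF vL(1)]] Fk(1)[OF vL(1)] L2_lim_subseq[OF Fk(3)[OF vL(1)] r(1)]] by blast
  have "AE k in hl. Fk (v 4) k = of_real (k ^ 4) * Fk (v 0) k"
    using r(2) r'(2) AE_space[of hl]
  proof eventually_elim
    case (elim k)
    have "(\<lambda>n. F0 (?c (v 4) (r (r' n))) k) \<longlonglongrightarrow> Fk (v 4) k"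
      using LIMSEQ_subseq_LIMSEQ[OF elim(1) r'(1)] unfolding o_def .
    then have "(\<lambda>n. F0 (?c (v 4) (r (r' n))) k - of_real (k ^ 4) * F0 (?c (v 0) (r (r' n))) k) \<longlonglongrightarrow> Fk (v 4) k - of_real (k ^ 4) * Fk (v 0) k"
      by (intro tendsto_intros elim(2))
    moreover have "(\<lambda>n. F0 (?c (v 4) (r (r' n))) k - of_real (k ^ 4) * F0 (?c (v 0) (r (r' n))) k) \<longlonglongrightarrow> 0"
      using LIMSEQ_subseq_LIMSEQ[OF lim strict_mono_o[OF r(1) r'(1)], of k] elim(3) unfolding o_def space_hl by blast
    ultimately have "Fk (v 4) k - of_real (k ^ 4) * Fk (v 0) k = 0" by (rule LIMSEQ_unique)
    then show ?case by (simp only: right_minus_eq)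
  qed
  moreover have "aeq (Fk (v 4)) (Fk w)" "aeq (Fk (v 0)) (Fk u)"
    by (intro extends_contraction_cong[OF Fk_extends] vL v H_L2[OF H])+
  ultimately show ?thesis unfolding aeq_iff by eventually_elim simp
qed

definition FF :: "(real \<Rightarrow> complex) \<Rightarrow> real \<Rightarrow> complex" where "FF f = VV (Fk f)"

definition GG :: "(real \<Rightarrow> complex) \<Rightarrow> real \<Rightarrow> complex" where "GG g = Gk (VI g)"

lemma FF: assumes "f \<in> L2" shows "FF f \<in> L2" "nrm (FF f) \<le> nrm f"
  using Fk(1,2)[OF assms] by (simp_all add: FF_def VV_L2 nrm_VV)

lemma FF_linear:
  assumes "f \<in> L2" "g \<in> L2" shows "aeq (FF (\<lambda>x. f x + c * g x)) (\<lambda>y. FF f y + c * FF g y)"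
proof -
  have "aeq (VV (Fk (\<lambda>x. f x + c * g x))) (VV (\<lambda>y. Fk f y + c * Fk g y))"
    by (intro VV_cong Fk L2_add L2_cmult assms)
  also have "VV (\<lambda>y. Fk f y + c * Fk g y) = (\<lambda>y. FF f y + c * FF g y)"
    by (simp add: VV_def FF_def fun_eq_iff algebra_simps)
  finally show ?thesis by (simp add: FF_def)
qed

lemma GG: "g \<in> L2 \<Longrightarrow> GG g \<in> L2"
  unfolding GG_def by (intro Gk VI_L2)

lemma FF_GG_adjoint: assumes f: "f \<in> L2" and g: "g \<in> L2" shows "ip (FF f) g = ip f (GG g)"
proof -
  have "ip (FF f) g = ip (VV (Fk f)) (VV (VI g))"
    unfolding FF_def
    by (intro ip_cong aeq_refl L2_meas VV_L2 Fk VI_L2 f g) (rule aeqI, simp add: VV_VI)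
  also have "\<dots> = ip (Fk f) (VI g)" by (intro ip_VV Fk VI_L2 f g)
  also have "\<dots> = ip f (GG g)" unfolding GG_def by (intro Fk_Gk_adjoint VI_L2 f g)
  finally show ?thesis .
qed

lemma FF_GG: assumes g: "g \<in> L2" shows "aeq (FF (GG g)) g"
proof -
  have "aeq (VV (Fk (Gk (VI g)))) (VV (VI g))"
    by (intro VV_cong Fk_Gk Fk Gk VI_L2 g)
  moreover have "aeq (VV (VI g)) g" by (rule aeqI) (rule VV_VI)
  ultimately show ?thesis unfolding FF_def GG_def by (rule aeq_trans)
qed

lemma FF_H: assumes H: "H u w" shows "aeq (FF w) (\<lambda>x. of_real x * FF u x)"
proof -
  note L = H_L2[OF H]
  have m: "(\<lambda>k. of_real (k ^ 4) * Fk u k) \<in> borel_measurable hl"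
    by (rule borel_measurable_times[OF borel_measurable_hl L2_meas[OF Fk(1)[OF L(1)]]]) simp
  have "aeq (VV (Fk w)) (VV (\<lambda>k. of_real (k ^ 4) * Fk u k))"
    by (rule VV_cong[OF Fk(1)[OF L(2)] L2_aeq[OF Fk(1)[OF L(2)] m Fk_H[OF H]] Fk_H[OF H]])
  moreover have "aeq (VV (\<lambda>k. of_real (k ^ 4) * Fk u k)) (\<lambda>x. of_real x * FF u x)"
  proof (rule aeqI)
    fix x :: real assume "x > 0"
    have "VV (\<lambda>k. of_real (k ^ 4) * Fk u k) x = of_real (kk x ^ 4) * VV (Fk u) x"
      unfolding VV_def by (simp only: mult.left_commute)
    then show "VV (\<lambda>k. of_real (k ^ 4) * Fk u k) x = of_real x * FF u x"
      unfolding kk_power4[OF \<open>x > 0\<close>] FF_def .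
  qed
  ultimately show ?thesis unfolding FF_def by (rule aeq_trans)
qed

lemma AE_Om_kk: "AE x in hl. Om (kk x) \<noteq> 0"
proof -
  have "finite ((\<lambda>k. k ^ 4) ` {k. Om k = 0})" by (intro finite_imageI Om_zeros_finite)
  then have "AE x in lborel. x \<notin> (\<lambda>k. k ^ 4) ` {k. Om k = 0}"
    by (intro AE_not_in finite_imp_null_set_lborel)
  then have "AE x in lborel. x > 0 \<longrightarrow> Om (kk x) \<noteq> 0"
  proof (rule eventually_mono, intro impI notI)
    fix x :: real assume x: "x \<notin> (\<lambda>k. k ^ 4) ` {k. Om k = 0}" "0 < x" "Om (kk x) = 0"
    then have "x = kk x ^ 4" by (simp add: kk_power4)
    with x show False by blast
  qed
  then show ?thesis by (simp add: AE_restrict_space_iff)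
qed

text \<open>Half of \<open>sqrt (2 / pi)\<close> is \<open>(2 pi)^(-1/2)\<close>: the Jacobian
  factor and the normalisation of packets combine to the constant of the formula.\<close>

lemma VV_F0:
  assumes x: "x > 0" and Om: "Om (kk x) \<noteq> 0"
  shows "VV (F0 f) x = Fformula False \<alpha> \<alpha>1 \<alpha>2 f x"
proof -
  have c: "x powr (-3/8) / 2 * sqrt (2 / pi) = (2 * pi) powr (-1/2) * x powr (-3/8)"
  proof -
    have "(2 * pi) powr (-1/2) = 1 / sqrt (2 * pi)" by (simp add: powr_minus powr_half_sqrt field_simps)
    also have "\<dots> = sqrt (2 / pi) / 2"
      by (simp add: real_sqrt_mult real_sqrt_divide field_simps)
    finally show ?thesis by simp
  qed
  have "(LINT y:{0<..}|lborel. cnj (psi_pm False \<alpha> \<alpha>1 \<alpha>2 y x) * f y) = (\<integral>y. (1 / cnj (Om (kk x))) * (cnj (PS (kk x) 0 y) * f y) \<partial>hl)"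
    unfolding integral_hl
  proof (intro Bochner_Integration.integral_cong refl)
    fix y
    have "psi \<alpha> \<alpha>1 \<alpha>2 y x = PS (kk x) 0 y / Om (kk x)"
      using psi_PS[OF x Om, of y] Om by (simp add: field_simps)
    then show "cnj (psi_pm False \<alpha> \<alpha>1 \<alpha>2 y x) * f y = (1 / cnj (Om (kk x))) * (cnj (PS (kk x) 0 y) * f y)"
      by (simp add: psi_pm_def)
  qed
  also have "\<dots> = hat f (kk x) / cnj (Om (kk x))"
    unfolding integral_mult_right_zero hat_def by simp
  finally have I: "(LINT y:{0<..}|lborel. cnj (psi_pm False \<alpha> \<alpha>1 \<alpha>2 y x) * f y) = hat f (kk x) / cnj (Om (kk x))" .
  have "VV (F0 f) x = of_real (x powr (-3/8) / 2 * sqrt (2 / pi)) * (hat f (kk x) / cnj (Om (kk x)))"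
    unfolding VV_def F0_def of_real_mult by simp
  then show ?thesis unfolding Fformula_def I c .
qed

lemma FF_formula: assumes f: "f \<in> L1 \<inter> L2" shows "aeq (FF f) (Fformula False \<alpha> \<alpha>1 \<alpha>2 f)"
proof -
  have "aeq (VV (Fk f)) (VV (F0 f))"
    using f by (intro VV_cong Fk_F0 Fk F0_contraction) auto
  moreover have "aeq (VV (F0 f)) (Fformula False \<alpha> \<alpha>1 \<alpha>2 f)"
    unfolding aeq_iff using AE_Om_kk AE_space[of hl] by eventually_elim (simp add: VV_F0)
  ultimately show ?thesis unfolding FF_def by (rule aeq_trans)
qed

end

section \<open>Stieltjes inversion and the resolvent\<close>

text \<open>On the semicircle \<open>\<bar>w\<bar> = T\<close> the weight \<open>1 - w\<^sup>2/T\<^sup>2\<close> has modulus \<open>2 Im w / T\<close>, which compensates the bound \<open>B / Im w\<close>.\<close>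

lemma contour_bound:
  assumes m: "m holomorphic_on {z. Im z > 0}" and B: "\<And>z. Im z > 0 \<Longrightarrow> cmod (m z) \<le> B / Im z"
    and e: "e > 0" and T: "T > 0"
  shows "cmod (integral {-T..T} (\<lambda>t. m (of_real t + \<i> * of_real e) * of_real (1 - t\<^sup>2 / T\<^sup>2))) \<le> 2 * pi * B"
proof -
  define f where "f w = m (w + \<i> * of_real e) * (1 - w\<^sup>2 / of_real (T\<^sup>2))" for w
  define S where "S = {w. Im w > - e}"
  have "convex S" unfolding S_def by (rule convex_halfspace_Im_gt)
  have fS: "f holomorphic_on S"
  proof -
    have "(m \<circ> (\<lambda>w. w + \<i> * of_real e)) holomorphic_on S"
    proof (rule holomorphic_on_compose_gen[OF _ m])
      show "(\<lambda>w. w + \<i> * of_real e) holomorphic_on S" by (intro holomorphic_intros)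
      show "(\<lambda>w. w + \<i> * of_real e) ` S \<subseteq> {z. Im z > 0}" by (auto simp: S_def)
    qed
    then show ?thesis unfolding f_def o_def using T by (intro holomorphic_intros) auto
  qed
  \<comment> \<open>Diameter and upper semicircle form a closed path inside the half-plane where the
    shifted function is holomorphic, so the integral over the diameter is minus that over the
    arc.\<close>
  define g1 where "g1 = linepath (- complex_of_real T) (of_real T)"
  define g2 where "g2 = part_circlepath 0 T 0 pi"
  have arcT: "cmod w = T \<and> 0 \<le> Im w" if "w \<in> path_image g2" for w
    using that T unfolding g2_def
    by (auto simp: path_image_part_circlepath closed_segment_eq_real_ivl norm_mult sin_ge_zero Im_exp)
  have "path_image g1 \<subseteq> S"
  proof
    fix w assume "w \<in> path_image g1"
    then have "w \<in> closed_segment (- complex_of_real T) (of_real T)" by (simp add: g1_def)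
    then have "Im w = 0" by (auto simp: closed_segment_def)
    then show "w \<in> S" using e by (simp add: S_def)
  qed
  moreover have "path_image g2 \<subseteq> S" using arcT e by (fastforce simp: S_def)
  moreover have fin: "pathfinish g1 = pathstart g2" "pathstart g1 = pathfinish g2"
    unfolding g1_def g2_def by (simp_all add: exp_pi_i')
  ultimately have zero: "contour_integral (g1 +++ g2) f = 0"
    by (intro contour_integral_unique Cauchy_theorem_convex_simple[OF fS \<open>convex S\<close>])
      (auto simp: g1_def[symmetric] g2_def[symmetric] path_image_join intro!: valid_path_join, auto simp: g1_def g2_def)
  have ci: "f contour_integrable_on g" if "valid_path g" "path_image g \<subseteq> S" for g
    by (rule contour_integrable_holomorphic_simple[OF fS]) (use that in \<open>auto simp: S_def intro: open_halfspace_Im_gt\<close>)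
  have i1: "f contour_integrable_on g1" and i2: "f contour_integrable_on g2"
    using ci[of g1] ci[of g2] \<open>path_image g1 \<subseteq> S\<close> \<open>path_image g2 \<subseteq> S\<close> by (auto simp: g1_def g2_def)
  have "contour_integral g1 f + contour_integral g2 f = 0"
    using zero fin i1 i2 by (subst (asm) contour_integral_join) (auto simp: g1_def g2_def)
  then have "cmod (contour_integral g1 f) = cmod (contour_integral g2 f)"
    by (metis add_eq_0_iff norm_minus_cancel)
  also have "\<dots> \<le> (2 * B / T) * T * \<bar>pi - 0\<bar>"
    unfolding g2_def
  proof (rule contour_integral_bound_part_circlepath[OF i2[unfolded g2_def]])
    have "cmod (m \<i>) \<le> B / 1" using B[of \<i>] by simp
    then have "0 \<le> B" using norm_ge_zero[of "m \<i>"] by linarith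
    then show "0 \<le> 2 * B / T" using T by simp
    fix w assume "w \<in> path_image (part_circlepath 0 T 0 pi)"
    then have w: "cmod w = T" "0 \<le> Im w" using arcT by (auto simp: g2_def)
    have T2: "T\<^sup>2 = (Re w)\<^sup>2 + (Im w)\<^sup>2" using w(1) by (simp add: cmod_power2[symmetric])
    have "1 - w\<^sup>2 / of_real (T\<^sup>2) = (of_real (T\<^sup>2) - w\<^sup>2) / of_real (T\<^sup>2)"
      using T by (simp add: diff_divide_distrib)
    also have "of_real (T\<^sup>2) - w\<^sup>2 = - (2 * \<i> * of_real (Im w) * w)"
      unfolding T2 by (simp add: complex_eq_iff power2_eq_square algebra_simps)
    finally have "cmod (1 - w\<^sup>2 / of_real (T\<^sup>2)) = 2 * Im w * T / T\<^sup>2"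
      using w T by (simp add: norm_divide norm_mult norm_power)
    also have "\<dots> = 2 * Im w / T" using T by (simp add: power2_eq_square)
    finally have n1: "cmod (1 - w\<^sup>2 / of_real (T\<^sup>2)) = 2 * Im w / T" .
    have n2: "cmod (m (w + \<i> * of_real e)) \<le> B / (Im w + e)"
      using B[of "w + \<i> * of_real e"] w e by simp
    have "cmod (f w) \<le> (B / (Im w + e)) * (2 * Im w / T)"
      unfolding f_def norm_mult n1 using n2 w T by (intro mult_right_mono) auto
    also have "\<dots> = (2 * B / T) * (Im w / (Im w + e))" by (simp add: ac_simps)
    also have "\<dots> \<le> (2 * B / T) * 1"
      using w e T \<open>0 \<le> B\<close> by (intro mult_left_mono) auto
    finally show "cmod (f w) \<le> 2 * B / T" by simp
  qed (use T in auto)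
  finally have "cmod (contour_integral g1 f) \<le> 2 * pi * B" using T by (simp add: ac_simps)
  moreover have "contour_integral g1 f = integral {-T..T} (\<lambda>t. f (of_real t))"
    unfolding g1_def using T by (subst contour_integral_linepath_Reals_eq) auto
  ultimately show ?thesis by (simp add: f_def)
qed

text \<open>The diameter is taken so long that the weight is at least 1/2 on \<open>[a,b]\<close>;
  positivity of the imaginary part allows enlarging the interval to the whole diameter, and
  \<open>2 * 2 pi B\<close> results. The bound depends neither on the interval nor on
  \<open>e\<close>.\<close>

lemma Nevanlinna_interval_bound:
  assumes m: "m holomorphic_on {z. Im z > 0}" and B: "\<And>z. Im z > 0 \<Longrightarrow> cmod (m z) \<le> B / Im z"
    and pos: "\<And>z. Im z > 0 \<Longrightarrow> 0 \<le> Im (m z)" and e: "e > 0"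
  shows "(LINT t:{a..b}|lborel. Im (m (of_real t + \<i> * of_real e))) \<le> 4 * pi * B"
proof -
  define T where "T = 2 * (\<bar>a\<bar> + \<bar>b\<bar> + 1)"
  have T: "T > 0" by (simp add: T_def)
  let ?g = "\<lambda>t. m (of_real t + \<i> * of_real e)"
  have cont: "continuous_on UNIV ?g"
  proof (rule continuous_on_compose2[OF holomorphic_on_imp_continuous_on[OF m]])
    show "continuous_on UNIV (\<lambda>t. complex_of_real t + \<i> * of_real e)" by (intro continuous_intros)
  qed (use e in auto)
  have c: "continuous_on S (\<lambda>t. ?g t * of_real (1 - t\<^sup>2 / T\<^sup>2))" for S
    using T by (intro continuous_intros continuous_on_subset[OF cont]) auto
  have i: "(\<lambda>t. ?g t * of_real (1 - t\<^sup>2 / T\<^sup>2)) integrable_on {-T..T}"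
    by (rule integrable_continuous_interval[OF c])
  have ir: "(\<lambda>t. Im (?g t) * (1 - t\<^sup>2 / T\<^sup>2)) integrable_on S" if "S = {c..d}" for S c d
    unfolding that using T by (intro integrable_continuous_interval continuous_intros continuous_on_subset[OF cont]) auto
  have Img: "(\<lambda>t. Im (?g t)) integrable_on {a..b}"
    by (intro integrable_continuous_interval continuous_intros continuous_on_subset[OF cont]) auto
  have si: "set_integrable lborel {a..b} (\<lambda>t. Im (?g t))"
    unfolding set_integrable_def
    by (rule borel_integrable_compact) (auto intro!: continuous_intros continuous_on_subset[OF cont])
  have w: "0 \<le> 1 - t\<^sup>2 / T\<^sup>2" if "t \<in> {-T..T}" for t
  proof -
    have "t\<^sup>2 \<le> T\<^sup>2" using that T by (intro abs_le_square_iff[THEN iffD1]) auto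
    then show ?thesis using T by simp
  qed
  have w2: "1 / 2 \<le> 1 - t\<^sup>2 / T\<^sup>2" if "t \<in> {a..b}" for t
  proof -
    have "\<bar>2 * t\<bar> \<le> \<bar>T\<bar>" using that by (auto simp: T_def)
    then have "(2 * t)\<^sup>2 \<le> T\<^sup>2" by (rule abs_le_square_iff[THEN iffD1])
    then have "4 * t\<^sup>2 \<le> T\<^sup>2" by (simp add: power_mult_distrib)
    moreover have "2 * t\<^sup>2 \<le> 4 * t\<^sup>2" by simp
    ultimately have "2 * t\<^sup>2 \<le> T\<^sup>2" by (rule order_trans[rotated])
    then show ?thesis using T by (simp add: field_simps)
  qed
  have gp: "0 \<le> Im (?g t)" for t by (rule pos) (use e in simp)
  have "integral {a..b} (\<lambda>t. Im (?g t)) \<le> integral {a..b} (\<lambda>t. 2 * (Im (?g t) * (1 - t\<^sup>2 / T\<^sup>2)))"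
  proof (rule integral_le[OF Img])
    show "(\<lambda>t. 2 * (Im (?g t) * (1 - t\<^sup>2 / T\<^sup>2))) integrable_on {a..b}"
      by (rule integrable_on_mult_right[OF ir[OF refl]])
    show "Im (?g t) \<le> 2 * (Im (?g t) * (1 - t\<^sup>2 / T\<^sup>2))" if "t \<in> {a..b}" for t
      using mult_left_mono[OF w2[OF that] gp[of t]] by (simp add: ac_simps)
  qed
  also have "\<dots> = 2 * integral {a..b} (\<lambda>t. Im (?g t) * (1 - t\<^sup>2 / T\<^sup>2))" by simp
  also have "integral {a..b} (\<lambda>t. Im (?g t) * (1 - t\<^sup>2 / T\<^sup>2)) \<le> integral {-T..T} (\<lambda>t. Im (?g t) * (1 - t\<^sup>2 / T\<^sup>2))"
    by (rule integral_subset_le[OF _ ir[OF refl] ir[OF refl]]) (use w gp in \<open>auto simp: T_def\<close>)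
  also have "\<dots> = Im (integral {-T..T} (\<lambda>t. ?g t * of_real (1 - t\<^sup>2 / T\<^sup>2)))"
    using integral_linear[OF i bounded_linear_Im] by (simp add: o_def)
  also have "\<dots> \<le> 2 * pi * B"
    by (rule order_trans[OF _ contour_bound[OF m B e T]]) (rule order_trans[OF abs_ge_self abs_Im_le_cmod])
  finally show ?thesis
    unfolding set_borel_integral_eq_integral(2)[OF si] by simp
qed

lemma Im_inverse_diff:
  "Im (1 / (of_real t - (of_real l + \<i> * of_real e))) = e / ((l - t)\<^sup>2 + e\<^sup>2)"
  by (simp add: Im_divide power2_commute[of t l])

text \<open>Exchanging the integrals leaves a difference of arctangents, between 0 and
  \<open>pi\<close>, which tends to \<open>pi\<close> inside the interval and to 0 outside. It will
  be applied also to a difference of two spectral densities, whose sign is not known.\<close>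

lemma Stieltjes_inversion:
  fixes \<rho> :: "real \<Rightarrow> real"
  assumes rho: "integrable lborel \<rho>" and ab: "a < b" and e: "\<And>n. e n > 0" "e \<longlonglongrightarrow> 0"
  shows "(\<lambda>n. LINT l:{a..b}|lborel. (\<integral>t. \<rho> t * (e n / ((l - t)\<^sup>2 + (e n)\<^sup>2)) \<partial>lborel))
    \<longlonglongrightarrow> pi * (LINT t:{a..b}|lborel. \<rho> t)"
proof -
  note rho' [measurable] = borel_measurable_integrable[OF rho]
  define A where "A n t = arctan ((b - t) / e n) - arctan ((a - t) / e n)" for n t
  have inner: "(\<integral>l. indicator {a..b} l * (e n / ((l - t)\<^sup>2 + (e n)\<^sup>2)) \<partial>lborel) = A n t" for n t
  proof -
    have pos: "(l - t)\<^sup>2 + (e n)\<^sup>2 > 0" for l using e(1)[of n] by (intro add_nonneg_pos) auto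
    have c: "continuous_on {a..b} (\<lambda>l. e n / ((l - t)\<^sup>2 + (e n)\<^sup>2))"
      using pos by (intro continuous_intros) (auto simp: less_le)
    have si: "set_integrable lborel {a..b} (\<lambda>l. e n / ((l - t)\<^sup>2 + (e n)\<^sup>2))"
      unfolding set_integrable_def by (rule borel_integrable_compact) (use c in auto)
    have "((\<lambda>l. e n / ((l - t)\<^sup>2 + (e n)\<^sup>2)) has_integral (arctan ((b - t) / e n) - arctan ((a - t) / e n))) {a..b}"
    proof (rule fundamental_theorem_of_calculus)
      fix l
      have "1 + ((l - t) / e n)\<^sup>2 = ((l - t)\<^sup>2 + (e n)\<^sup>2) / (e n)\<^sup>2"
        using e(1)[of n] by (simp add: field_simps power_divide)
      then have "(1 / e n) / (1 + ((l - t) / e n)\<^sup>2) = e n / ((l - t)\<^sup>2 + (e n)\<^sup>2)"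
        using e(1)[of n] by (simp add: power2_eq_square)
      moreover have "((\<lambda>l. arctan ((l - t) / e n)) has_real_derivative (1 / e n) / (1 + ((l - t) / e n)\<^sup>2)) (at l within {a..b})"
        using e(1)[of n] by (auto intro!: derivative_eq_intros simp: divide_inverse)
      ultimately show "((\<lambda>l. arctan ((l - t) / e n)) has_vector_derivative e n / ((l - t)\<^sup>2 + (e n)\<^sup>2)) (at l within {a..b})"
        by (simp add: has_real_derivative_iff_has_vector_derivative)
    qed (use ab in simp)
    then show ?thesis
      using set_borel_integral_eq_integral(2)[OF si]
      by (simp add: A_def set_lebesgue_integral_def integral_unique)
  qed
  have A0: "0 \<le> A n t" "A n t \<le> pi" for n t
  proof -
    have "(a - t) / e n \<le> (b - t) / e n" using e(1)[of n] ab by (intro divide_right_mono) auto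
    then show "0 \<le> A n t" by (simp add: A_def arctan_le_iff)
    show "A n t \<le> pi"
      using arctan_ubound[of "(b - t) / e n"] arctan_lbound[of "(a - t) / e n"] by (simp add: A_def)
  qed
  have swap: "(LINT l:{a..b}|lborel. (\<integral>t. \<rho> t * (e n / ((l - t)\<^sup>2 + (e n)\<^sup>2)) \<partial>lborel)) = (\<integral>t. \<rho> t * A n t \<partial>lborel)" for n
  proof -
    let ?f = "\<lambda>l t. indicator {a..b} l * (\<rho> t * (e n / ((l - t)\<^sup>2 + (e n)\<^sup>2)))"
    have "integrable (lborel \<Otimes>\<^sub>M lborel) (\<lambda>p. complex_of_real (e n / ((fst p - snd p)\<^sup>2 + (e n)\<^sup>2)) *
        (complex_of_real (indicator {a..b} (fst p)) * complex_of_real (\<rho> (snd p))))"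
    proof (rule integrable_product_kernel[where c="1 / e n"])
      show "integrable lborel (\<lambda>l. complex_of_real (indicator {a..b} l))"
        using ab by (intro integrable_of_real integrable_real_indicator) auto
      show "integrable lborel (\<lambda>t. complex_of_real (\<rho> t))" using rho by (rule integrable_of_real)
      show "cmod (complex_of_real (e n / ((fst p - snd p)\<^sup>2 + (e n)\<^sup>2))) \<le> 1 / e n" for p
      proof -
        have "e n / ((fst p - snd p)\<^sup>2 + (e n)\<^sup>2) \<le> e n / (e n)\<^sup>2"
          using e(1)[of n] by (intro divide_left_mono mult_pos_pos add_nonneg_pos) auto
        also have "\<dots> = 1 / e n" using e(1)[of n] by (simp add: power2_eq_square)
        finally show ?thesis unfolding norm_of_real using e(1)[of n] by (subst abs_of_nonneg) auto
      qed
    qed (unfold_locales, measurable)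
    from integrable_Re[OF this]
    have i: "integrable (lborel \<Otimes>\<^sub>M lborel) (\<lambda>p. ?f (fst p) (snd p))"
      by (simp add: ac_simps)
    have "(LINT l:{a..b}|lborel. (\<integral>t. \<rho> t * (e n / ((l - t)\<^sup>2 + (e n)\<^sup>2)) \<partial>lborel)) = (\<integral>l. (\<integral>t. ?f l t \<partial>lborel) \<partial>lborel)"
      unfolding set_lebesgue_integral_def real_scaleR_def integral_mult_right_zero ..
    also have "\<dots> = (\<integral>t. (\<integral>l. ?f l t \<partial>lborel) \<partial>lborel)"
      by (rule lborel_pair.Fubini_integral[symmetric]) (use i in \<open>simp add: case_prod_beta'\<close>)
    also have "\<dots> = (\<integral>t. (\<integral>l. \<rho> t * (indicator {a..b} l * (e n / ((l - t)\<^sup>2 + (e n)\<^sup>2))) \<partial>lborel) \<partial>lborel)"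
      by (simp only: ac_simps)
    also have "\<dots> = (\<integral>t. \<rho> t * A n t \<partial>lborel)"
      unfolding integral_mult_right_zero inner ..
    finally show ?thesis .
  qed
  have lim: "(\<lambda>n. A n t) \<longlonglongrightarrow> pi * indicator {a..b} t" if t: "t \<noteq> a" "t \<noteq> b" for t
  proof -
    have inv: "filterlim (\<lambda>n. inverse (e n)) at_top sequentially"
      by (rule filterlim_inverse_at_top[OF e(2)]) (simp add: e)
    have up: "(\<lambda>n. arctan (c / e n)) \<longlonglongrightarrow> pi / 2" if "c > 0" for c
      unfolding divide_inverse[of c]
      by (rule filterlim_compose[OF tendsto_arctan_at_top]) (rule filterlim_tendsto_pos_mult_at_top[OF tendsto_const that inv])
    have down: "(\<lambda>n. arctan (c / e n)) \<longlonglongrightarrow> - (pi / 2)" if "c < 0" for c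
      using tendsto_minus[OF up[of "- c"]] that by (simp add: arctan_minus)
    consider "t < a" | "a < t" "t < b" | "b < t" using t by linarith
    then show ?thesis
    proof cases
      case 1
      then have "(\<lambda>n. A n t) \<longlonglongrightarrow> pi / 2 - pi / 2" unfolding A_def using ab by (intro tendsto_diff up) auto
      then show ?thesis using 1 by simp
    next
      case 2
      then have "(\<lambda>n. A n t) \<longlonglongrightarrow> pi / 2 - (- (pi / 2))" unfolding A_def by (intro tendsto_diff up down) auto
      then show ?thesis using 2 by simp
    next
      case 3
      then have "(\<lambda>n. A n t) \<longlonglongrightarrow> - (pi / 2) - (- (pi / 2))" unfolding A_def using ab by (intro tendsto_diff down) auto
      then show ?thesis using 3 by simp
    qed
  qed
  have "(\<lambda>n. \<integral>t. \<rho> t * A n t \<partial>lborel) \<longlonglongrightarrow> (\<integral>t. \<rho> t * (pi * indicator {a..b} t) \<partial>lborel)"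
  proof (rule integral_dominated_convergence)
    show "integrable lborel (\<lambda>t. norm (\<rho> t) * pi)" using rho by (intro integrable_mult_left integrable_norm)
    show "AE t in lborel. (\<lambda>n. \<rho> t * A n t) \<longlonglongrightarrow> \<rho> t * (pi * indicator {a..b} t)"
      using AE_lborel_singleton[of a] AE_lborel_singleton[of b]
      by eventually_elim (intro tendsto_intros lim)
    show "AE t in lborel. norm (\<rho> t * A n t) \<le> norm (\<rho> t) * pi" for n
      using A0 by (intro AE_I2) (auto simp: abs_mult intro!: mult_left_mono)
    show "(\<lambda>t. \<rho> t * A n t) \<in> borel_measurable lborel" for n unfolding A_def by measurable
  qed measurable
  also have "(\<integral>t. \<rho> t * (pi * indicator {a..b} t) \<partial>lborel) = (\<integral>t. pi * (indicator {a..b} t * \<rho> t) \<partial>lborel)"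
    by (simp only: ac_simps)
  also have "\<dots> = pi * (LINT t:{a..b}|lborel. \<rho> t)"
    unfolding integral_mult_right_zero set_lebesgue_integral_def by simp
  finally show ?thesis unfolding swap .
qed

section \<open>The complementary projection and the resolvent\<close>

context biharmonic
begin

lemma FF_cong: assumes "f \<in> L2" "g \<in> L2" "aeq f g" shows "aeq (FF f) (FF g)"
  unfolding FF_def by (intro VV_cong Fk assms extends_contraction_cong[OF Fk_extends])

lemma GG_FF_adjoint: "f \<in> L2 \<Longrightarrow> g \<in> L2 \<Longrightarrow> ip (GG g) f = ip g (FF f)"
  using FF_GG_adjoint[of f g] by (metis cnj_ip)

lemma FF_resolvent:
  assumes H: "H u w" and f: "f \<in> L2" "aeq (\<lambda>x. w x - z * u x) f"
  shows "AE t in hl. (of_real t - z) * FF u t = FF f t"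
proof -
  note L = H_L2[OF H]
  have e: "(\<lambda>x. w x + (- z) * u x) = (\<lambda>x. w x - z * u x)" by simp
  have d: "(\<lambda>x. w x - z * u x) \<in> L2" by (intro L2_diff L2_cmult L)
  have 1: "aeq (FF (\<lambda>x. w x - z * u x)) (\<lambda>y. FF w y + (- z) * FF u y)"
    using FF_linear[OF L(2,1), of "- z"] unfolding e .
  have 2: "aeq (FF (\<lambda>x. w x - z * u x)) (FF f)" by (rule FF_cong[OF d f])
  show ?thesis using 1 2 FF_H[OF H] unfolding aeq_iff
    by eventually_elim (simp add: algebra_simps)
qed

lemma integral_hl_density:
  fixes g :: "real \<Rightarrow> complex"
  shows "(\<integral>t. of_real ((cmod (g t))\<^sup>2) / (of_real t - z) \<partial>hl)
    = (\<integral>t. complex_of_real (indicator {0<..} t * (cmod (g t))\<^sup>2) / (complex_of_real t - z) \<partial>lborel)"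
  unfolding integral_hl[symmetric] set_lebesgue_integral_def
  by (intro Bochner_Integration.integral_cong refl) (auto simp: indicator_def)

lemma density_integrable: "g \<in> L2 \<Longrightarrow> integrable lborel (\<lambda>t. indicator {0<..} t * (cmod (g t))\<^sup>2)"
  using L2_sq[of g] by (simp add: integrable_hl_iff set_integrable_def)

lemma ip_resolvent_density:
  assumes g: "g \<in> L2" and v: "v \<in> L2" and z: "Im z \<noteq> 0" and ae: "AE t in hl. (of_real t - z) * v t = g t"
  shows "ip v g = (\<integral>t. of_real ((cmod (g t))\<^sup>2) / (of_real t - z) \<partial>hl)"
  unfolding ip_hl
proof (rule integral_cong_AE)
  show "(\<lambda>t. v t * cnj (g t)) \<in> borel_measurable hl"
    by (rule borel_measurable_integrable[OF ip_integrable[OF v g]])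
  have "(\<lambda>t. complex_of_real ((cmod (g t))\<^sup>2)) \<in> borel_measurable hl" using L2_meas[OF g] by measurable
  moreover have "(\<lambda>t. complex_of_real t - z) \<in> borel_measurable hl" by (rule borel_measurable_hl) simp
  ultimately show "(\<lambda>t. complex_of_real ((cmod (g t))\<^sup>2) / (complex_of_real t - z)) \<in> borel_measurable hl"
    by (rule borel_measurable_divide)
  show "AE t in hl. v t * cnj (g t) = complex_of_real ((cmod (g t))\<^sup>2) / (complex_of_real t - z)"
    using ae
  proof eventually_elim
    case (elim t)
    have nz: "complex_of_real t - z \<noteq> 0" using z by (auto simp: complex_eq_iff)
    then have "v t = g t / (complex_of_real t - z)" using elim by (simp add: field_simps)
    then show ?case unfolding complex_norm_square by simp
  qed
qed

lemma GG_FF_in_Hac: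
  assumes f: "f \<in> L2" shows "GG (FF f) \<in> Hac \<alpha> \<alpha>1 \<alpha>2"
proof -
  define g where "g = FF f"
  have g: "g \<in> L2" unfolding g_def by (rule FF(1)[OF f])
  have G: "GG g \<in> L2" by (rule GG[OF g])
  let ?\<rho> = "\<lambda>t. indicator {0<..} t * (cmod (g t))\<^sup>2"
  have "ip u (GG g) = (\<integral>t. complex_of_real (?\<rho> t) / (complex_of_real t - z) \<partial>lborel)"
    if z: "Im z \<noteq> 0" and H: "H u w" and ae: "aeq (\<lambda>x. w x - z * u x) (GG g)" for z u w
  proof -
    note L = H_L2[OF H]
    have "AE t in hl. (of_real t - z) * FF u t = g t"
      using FF_resolvent[OF H G ae] FF_GG[OF g] unfolding aeq_iff by eventually_elim simp
    from ip_resolvent_density[OF g FF(1)[OF L(1)] z this] show ?thesis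
      unfolding integral_hl_density FF_GG_adjoint[OF L(1) g, symmetric] .
  qed
  then show ?thesis unfolding Hac_def g_def[symmetric]
    using G density_integrable[OF g] by (intro CollectI conjI exI[of _ ?\<rho>]) auto
qed

definition Pf :: "(real \<Rightarrow> complex) \<Rightarrow> real \<Rightarrow> complex" where "Pf f x = f x - GG (FF f) x"

lemma Pf_L2: "f \<in> L2 \<Longrightarrow> Pf f \<in> L2"
  unfolding Pf_def[abs_def] by (intro L2_diff GG FF)

lemma FF_Pf: assumes f: "f \<in> L2" shows "aeq (FF (Pf f)) (\<lambda>t. 0)"
proof -
  note L = f FF(1)[OF f] GG[OF FF(1)[OF f]]
  have "Pf f = (\<lambda>x. f x + (-1) * GG (FF f) x)" by (simp add: Pf_def fun_eq_iff)
  then have "aeq (FF (Pf f)) (\<lambda>y. FF f y + (-1) * FF (GG (FF f)) y)"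
    using FF_linear[OF L(1,3), of "-1"] by simp
  then show ?thesis using FF_GG[OF L(2)] unfolding aeq_iff by eventually_elim simp
qed

text \<open>The transform turns the resolvent into division by \<open>t - z\<close>, so it
  annihilates the resolvent of whatever it annihilates.\<close>

lemma resolvent_Pf_FF_zero:
  assumes z: "Im z \<noteq> 0" and f: "f \<in> L2" and H: "H u w" and ae: "aeq (\<lambda>x. w x - z * u x) (Pf f)"
  shows "aeq (FF u) (\<lambda>t. 0)"
proof -
  have "AE t in hl. FF u t = 0"
    using FF_resolvent[OF H Pf_L2[OF f] ae] FF_Pf[OF f] unfolding aeq_iff
  proof eventually_elim
    case (elim t)
    have "complex_of_real t - z \<noteq> 0" using z by (auto simp: complex_eq_iff)
    then show ?case using elim by simp
  qed
  then show ?thesis by (simp add: aeq_iff)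
qed

lemma ip_zero_left: "f \<in> L2 \<Longrightarrow> g \<in> L2 \<Longrightarrow> aeq f (\<lambda>x. 0) \<Longrightarrow> ip f g = 0"
  using ip_cong[of f "\<lambda>x. 0" g g] by (auto simp: L2_meas ip_hl)

text \<open>The projection \<open>GG FF\<close> reduces \<open>H\<close>: in the expansion of
  \<open>ip u h\<close> along \<open>h = Pf h + q\<close> the cross terms vanish, one because
  \<open>FF u0\<close> is null, the other by passing to the resolvent at \<open>cnj z\<close>. On
  \<open>q\<close> the resolvent form is the Borel transform of \<open>|FF h|^2\<close>.\<close>

lemma resolvent_decomposition:
  assumes z: "Im z \<noteq> 0" and h: "h \<in> L2"
    and H: "H u w" "aeq (\<lambda>x. w x - z * u x) h" and H0: "H u0 w0" "aeq (\<lambda>x. w0 x - z * u0 x) (Pf h)"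
  shows "ip u h = ip u0 (Pf h) + (\<integral>t. complex_of_real (indicator {0<..} t * (cmod (FF h t))\<^sup>2) / (complex_of_real t - z) \<partial>lborel)"
proof -
  define q where "q = GG (FF h)"
  have g: "FF h \<in> L2" and q: "q \<in> L2" unfolding q_def using h by (auto intro: FF GG)
  have P: "Pf h \<in> L2" by (rule Pf_L2[OF h])
  obtain u1 w1 where H1: "H u1 w1" and w1: "w1 = (\<lambda>x. z * u1 x + q x)" using resolvent_exists[OF z q] by blast
  have z': "Im (cnj z) \<noteq> 0" using z by simp
  \<comment> \<open>The resolvent at \<open>cnj z\<close> is the adjoint of the one at
    \<open>z\<close>; through it the cross term becomes a pairing with the null function
    \<open>FF u2\<close>.\<close>
  obtain u2 w2 where H2: "H u2 w2" and w2: "w2 = (\<lambda>x. cnj z * u2 x + Pf h x)" using resolvent_exists[OF z' P] by blast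
  note L = H_L2[OF H(1)] H_L2[OF H0(1)] H_L2[OF H1] H_L2[OF H2]
  have HS: "H (\<lambda>x. u0 x + 1 * u1 x) (\<lambda>x. w0 x + 1 * w1 x)" by (rule H_add[OF H0(1) H1])
  have "aeq (\<lambda>x. (w0 x + 1 * w1 x) - z * (u0 x + 1 * u1 x)) h"
    using H0(2) unfolding aeq_iff by eventually_elim (simp add: w1 Pf_def q_def algebra_simps)
  then have uu: "aeq u (\<lambda>x. u0 x + u1 x)" using resolvent_unique[OF z H(1) HS H(2)] by simp
  have hh: "h = (\<lambda>x. Pf h x + q x)" by (simp add: Pf_def q_def fun_eq_iff)
  have "ip u h = ip (\<lambda>x. u0 x + u1 x) h"
    by (intro ip_cong L2_meas L L2_add h uu aeq_refl)
  also have "\<dots> = ip u0 h + ip u1 h" by (intro ip_add_left L h)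
  also have "ip u0 h = ip u0 (Pf h) + ip u0 q"
    by (subst hh) (intro ip_add_right L P q)
  also have "ip u1 h = ip u1 (Pf h) + ip u1 q"
    by (subst hh) (intro ip_add_right L P q)
  also have "ip u0 q = 0"
    unfolding q_def FF_GG_adjoint[OF L(3) g, symmetric]
    by (intro ip_zero_left FF L g resolvent_Pf_FF_zero[OF z h H0])
  also have "ip u1 (Pf h) = 0"
  proof -
    have "ip u1 w2 = cnj (cnj z) * ip u1 u2 + ip u1 (Pf h)"
      unfolding w2 using L P by (subst ip_add_right) (auto simp: L2_cmult ip_cmult_right)
    moreover have "ip w1 u2 = z * ip u1 u2 + ip q u2"
      unfolding w1 using L q by (subst ip_add_left) (auto simp: L2_cmult ip_cmult_left)
    moreover have "ip w1 u2 = ip u1 w2" by (rule H_symmetric[OF H1 H2])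
    ultimately have "ip u1 (Pf h) = ip q u2" by simp
    also have "\<dots> = cnj (ip (FF u2) (FF h))"
      unfolding q_def GG_FF_adjoint[OF L(7) g] by (simp add: cnj_ip)
    also have "ip (FF u2) (FF h) = 0"
      by (intro ip_zero_left FF L g resolvent_Pf_FF_zero[OF z' h H2]) (simp add: w2)
    finally show ?thesis by simp
  qed
  also have "ip u1 q = (\<integral>t. complex_of_real (indicator {0<..} t * (cmod (FF h t))\<^sup>2) / (complex_of_real t - z) \<partial>lborel)"
  proof -
    have "aeq (\<lambda>x. w1 x - z * u1 x) q" by (simp add: w1)
    from FF_resolvent[OF H1 q this] have "AE t in hl. (of_real t - z) * FF u1 t = FF h t"
      using FF_GG[OF g] unfolding aeq_iff q_def by eventually_elim simp
    from ip_resolvent_density[OF g FF(1)[OF L(5)] z this]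
    show ?thesis unfolding integral_hl_density q_def FF_GG_adjoint[OF L(5) g] .
  qed
  finally show ?thesis by simp
qed

text \<open>A representative of the resolvent is chosen; by \<open>resolvent_unique\<close> it is
  determined up to \<open>aeq\<close> for non-real \<open>z\<close>.\<close>

definition RR :: "complex \<Rightarrow> (real \<Rightarrow> complex) \<Rightarrow> real \<Rightarrow> complex" where
  "RR z f = (SOME u. \<exists>w. H u w \<and> w = (\<lambda>x. z * u x + f x))"

lemma RR:
  assumes "Im z \<noteq> 0" "f \<in> L2"
  shows "H (RR z f) (\<lambda>x. z * RR z f x + f x)" "RR z f \<in> L2" "\<bar>Im z\<bar> * nrm (RR z f) \<le> nrm f"
    "Im z * (nrm (RR z f))\<^sup>2 = Im (ip (RR z f) f)"
proof -
  have "\<exists>w. H (RR z f) w \<and> w = (\<lambda>x. z * RR z f x + f x)"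
    unfolding RR_def by (rule someI_ex[OF resolvent_exists[OF assms]])
  then show 1: "H (RR z f) (\<lambda>x. z * RR z f x + f x)" by blast
  show "RR z f \<in> L2" by (rule H_L2(1)[OF 1])
  show "\<bar>Im z\<bar> * nrm (RR z f) \<le> nrm f" by (rule resolvent_bound[OF 1 assms(2)]) simp
  show "Im z * (nrm (RR z f))\<^sup>2 = Im (ip (RR z f) f)" by (rule resolvent_im[OF 1 assms(2)]) simp
qed

lemma RR_unique:
  assumes "Im z \<noteq> 0" "f \<in> L2" "H u w" "aeq (\<lambda>x. w x - z * u x) f" shows "aeq (RR z f) u"
  by (rule resolvent_unique[OF assms(1) RR(1)[OF assms(1,2)] assms(3) _ assms(4)]) simp

lemma RR_diff:
  assumes z: "Im z \<noteq> 0" and z0: "Im z0 \<noteq> 0" and f: "f \<in> L2"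
  shows "aeq (RR z f) (\<lambda>x. RR z0 f x + (z - z0) * RR z (RR z0 f) x)"
proof (rule RR_unique[OF z f H_add[OF RR(1)[OF z0 f] RR(1)[OF z RR(2)[OF z0 f]]]])
qed (simp add: algebra_simps)

text \<open>The first resolvent identity is used twice: once for the difference quotient, and once
  more for its error, which is \<open>|z - z0|\<close> times a locally bounded quantity.\<close>

lemma RR_holomorphic:
  assumes f: "f \<in> L2" shows "(\<lambda>z. ip (RR z f) f) holomorphic_on {z. Im z > 0}"
proof -
  have op: "open {z. Im z > 0}" by (rule open_halfspace_Im_gt)
  have "((\<lambda>z. ip (RR z f) f) has_field_derivative ip (RR z0 (RR z0 f)) f) (at z0)" if z0: "Im z0 > 0" for z0
  proof -
    have z0': "Im z0 \<noteq> 0" using z0 by simp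
    note R0 = RR(2)[OF z0' f] RR(2)[OF z0' RR(2)[OF z0' f]]
    have "((\<lambda>z. (ip (RR z f) f - ip (RR z0 f) f) / (z - z0)) \<longlongrightarrow> ip (RR z0 (RR z0 f)) f) (at z0)"
    proof (rule LIM_zero_cancel, rule Lim_null_comparison)
      define K where "K z = cmod (z - z0) * (nrm (RR z0 (RR z0 f)) / Im z * nrm f)" for z
      have ev: "\<forall>\<^sub>F z in at z0. Im z > 0"
        using eventually_at_topological z0 op by (metis (mono_tags, lifting) mem_Collect_eq)
      show "\<forall>\<^sub>F z in at z0. norm ((ip (RR z f) f - ip (RR z0 f) f) / (z - z0) - ip (RR z0 (RR z0 f)) f) \<le> K z"
        using ev eventually_neq_at_within[of z0]
      proof eventually_elim
        case (elim z)
        then have z: "Im z \<noteq> 0" "z \<noteq> z0" by auto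
        note L = R0 RR(2)[OF z(1) f] RR(2)[OF z(1) R0(1)] RR(2)[OF z(1) R0(2)]
        have "ip (RR z f) f = ip (\<lambda>x. RR z0 f x + (z - z0) * RR z (RR z0 f) x) f"
          by (intro ip_cong L2_meas L2_add L2_cmult L f RR_diff[OF z(1) z0' f] aeq_refl)
        also have "\<dots> = ip (RR z0 f) f + (z - z0) * ip (RR z (RR z0 f)) f"
          using L f by (simp add: ip_add_left L2_cmult ip_cmult_left)
        finally have 1: "(ip (RR z f) f - ip (RR z0 f) f) / (z - z0) = ip (RR z (RR z0 f)) f"
          using z by simp
        have "ip (RR z (RR z0 f)) f = ip (\<lambda>x. RR z0 (RR z0 f) x + (z - z0) * RR z (RR z0 (RR z0 f)) x) f"
          by (intro ip_cong L2_meas L2_add L2_cmult L f RR_diff[OF z(1) z0' R0(1)] aeq_refl)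
        also have "\<dots> = ip (RR z0 (RR z0 f)) f + (z - z0) * ip (RR z (RR z0 (RR z0 f))) f"
          using L f by (simp add: ip_add_left L2_cmult ip_cmult_left)
        finally have 2: "ip (RR z (RR z0 f)) f - ip (RR z0 (RR z0 f)) f = (z - z0) * ip (RR z (RR z0 (RR z0 f))) f"
          by simp
        have "nrm (RR z (RR z0 (RR z0 f))) \<le> nrm (RR z0 (RR z0 f)) / Im z"
          using RR(3)[OF z(1) R0(2)] elim(1) by (simp add: field_simps)
        then have "cmod (ip (RR z (RR z0 (RR z0 f))) f) \<le> nrm (RR z0 (RR z0 f)) / Im z * nrm f"
          using Cauchy_Schwarz_ip[OF L(5) f] by (meson mult_right_mono nrm_nonneg order_trans)
        then show ?case unfolding 1 2 K_def norm_mult by (rule mult_left_mono) simp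
      qed
      have "(K \<longlongrightarrow> cmod (z0 - z0) * (nrm (RR z0 (RR z0 f)) / Im z0 * nrm f)) (at z0)"
        unfolding K_def by (intro tendsto_intros) (use z0 in auto)
      then show "(K \<longlongrightarrow> 0) (at z0)" by simp
    qed
    then show ?thesis by (simp add: has_field_derivative_iff)
  qed
  then show ?thesis
    using op by (auto simp: holomorphic_on_open)
qed

text \<open>The integrand is the imaginary part of the resolvent form, a holomorphic function
  bounded by \<open>(nrm f)^2 / Im z\<close>. Written as a squared norm it obeys a triangle
  inequality, which the later approximation exploits.\<close>

lemma RR_interval_bound:
  assumes f: "f \<in> L2" and e: "e > 0"
  shows "(LINT t:{a..b}|lborel. e * (nrm (RR (of_real t + \<i> * of_real e) f))\<^sup>2) \<le> 4 * pi * (nrm f)\<^sup>2"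
    and "continuous_on UNIV (\<lambda>t. e * (nrm (RR (of_real t + \<i> * of_real e) f))\<^sup>2)"
proof -
  let ?m = "\<lambda>z. ip (RR z f) f"
  have eq: "e * (nrm (RR (of_real t + \<i> * of_real e) f))\<^sup>2 = Im (?m (of_real t + \<i> * of_real e))" for t
    using RR(4)[of "of_real t + \<i> * of_real e" f] e f by simp
  show "(LINT t:{a..b}|lborel. e * (nrm (RR (of_real t + \<i> * of_real e) f))\<^sup>2) \<le> 4 * pi * (nrm f)\<^sup>2"
    unfolding eq
  proof (rule Nevanlinna_interval_bound[OF RR_holomorphic[OF f] _ _ e])
    fix z :: complex assume z: "Im z > 0"
    have "nrm (RR z f) \<le> nrm f / Im z" using RR(3)[of z f] z f by (simp add: field_simps)
    then have "nrm (RR z f) * nrm f \<le> nrm f / Im z * nrm f" by (rule mult_right_mono) simp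
    then show "cmod (?m z) \<le> (nrm f)\<^sup>2 / Im z"
      using Cauchy_Schwarz_ip[OF RR(2)[of z f] f] z f by (simp add: power2_eq_square)
    show "0 \<le> Im (?m z)" using RR(4)[of z f] z f by (metis less_imp_le less_irrefl mult_nonneg_nonneg zero_le_power2)
  qed
  show "continuous_on UNIV (\<lambda>t. e * (nrm (RR (of_real t + \<i> * of_real e) f))\<^sup>2)"
    unfolding eq
    by (intro continuous_on_Im continuous_on_compose2[OF holomorphic_on_imp_continuous_on[OF RR_holomorphic[OF f]]] continuous_intros)
      (use e in auto)
qed

end

section \<open>Boundary values of the resolvent on exponential sums\<close>

definition ev :: "complex \<Rightarrow> nat \<Rightarrow> real \<Rightarrow> complex" where
  "ev p k x = p ^ k * exp (p * of_real x)"

text \<open>The fourth root with argument in \<open>[0, \<pi>/4]\<close> of a nonzero number in the closed upper half-plane.\<close>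

definition zt :: "complex \<Rightarrow> complex" where
  "zt z = exp (\<i> * of_real (pi / 8) + Ln (- \<i> * z) / 4)"

lemma zt_power4: assumes "z \<noteq> 0" shows "zt z ^ 4 = z"
proof -
  have "zt z ^ 4 = exp (4 * (\<i> * of_real (pi / 8) + Ln (- \<i> * z) / 4))"
    unfolding zt_def exp_of_nat_mult[symmetric] by simp
  also have "\<dots> = exp (\<i> * of_real (pi / 2)) * exp (Ln (- \<i> * z))"
    unfolding exp_add[symmetric] by (simp add: algebra_simps)
  also have "exp (\<i> * of_real (pi / 2)) = \<i>" by (simp add: exp_eq_polar complex_eq_iff Re_exp Im_exp)
  also have "exp (Ln (- \<i> * z)) = - \<i> * z" using assms by simp
  finally show ?thesis by simp
qed

text \<open>The argument of \<open>- i z\<close> lies in \<open>[-pi/2, pi/2]\<close>; a quarter of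
  it plus \<open>pi/8\<close> is the argument of \<open>zt z\<close>. Hence
  \<open>exp (i zt x)\<close> and \<open>exp (- zt x)\<close> are the solutions that do not grow,
  and the first fails to decay only for \<open>z > 0\<close>.\<close>

lemma zt_sector:
  assumes "z \<noteq> 0" "0 \<le> Im z"
  shows "0 < Re (zt z)" "0 \<le> Im (zt z)" "\<not> (Im z = 0 \<and> 0 < Re z) \<Longrightarrow> 0 < Im (zt z)"
proof -
  have "\<bar>Im (Ln (- \<i> * z))\<bar> \<le> pi / 2"
    using assms by (subst Re_Ln_pos_le) auto
  then have "- (pi / 2) \<le> Im (Ln (- \<i> * z))" "Im (Ln (- \<i> * z)) \<le> pi / 2" by auto
  define \<theta> where "\<theta> = pi / 8 + Im (Ln (- \<i> * z)) / 4"
  have th: "0 \<le> \<theta>" "\<theta> < pi / 2" "- (pi / 2) < \<theta>" "\<theta> \<le> pi"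
    using \<open>- (pi / 2) \<le> Im (Ln (- \<i> * z))\<close> \<open>Im (Ln (- \<i> * z)) \<le> pi / 2\<close> pi_gt_zero
    unfolding \<theta>_def by linarith+
  have arg: "Im (\<i> * of_real (pi / 8) + Ln (- \<i> * z) / 4) = \<theta>"
    unfolding \<theta>_def by (simp add: Im_divide_numeral)
  show re: "0 < Re (zt z)" unfolding zt_def Re_exp arg
    by (intro mult_pos_pos cos_gt_zero_pi th exp_gt_zero)
  show im: "0 \<le> Im (zt z)" unfolding zt_def Im_exp arg
    by (intro mult_nonneg_nonneg sin_ge_zero th exp_ge_zero)
  assume n: "\<not> (Im z = 0 \<and> 0 < Re z)"
  have "Im (zt z) \<noteq> 0"
  proof
    assume "Im (zt z) = 0"
    then have "zt z = of_real (Re (zt z))" by (simp add: complex_eq_iff)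
    then have "z = of_real (Re (zt z) ^ 4)" using zt_power4[OF assms(1)] by (metis of_real_power)
    then have "Im z = 0" "Re z = Re (zt z) ^ 4" by (metis Im_complex_of_real, metis Re_complex_of_real)
    then show False using n re by simp
  qed
  then show "0 < Im (zt z)" using im by simp
qed

lemma zt_real: assumes "l > 0" shows "zt (of_real l) = of_real (kk l)"
proof -
  have e: "- \<i> * complex_of_real l = of_real l * (- \<i>)" by (rule mult.commute)
  have "Ln (- \<i> * complex_of_real l) = of_real (ln l) + Ln (- \<i>)"
    unfolding e using Ln_times_of_real[of l "- \<i>"] Ln_of_real[of l] assms by simp
  also have "Ln (- \<i>) = - (\<i> * of_real pi / 2)" by (simp add: Ln_minus_ii)
  finally have "\<i> * of_real (pi / 8) + Ln (- \<i> * complex_of_real l) / 4 = of_real (ln l / 4)"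
    by (simp add: field_simps)
  then have "zt (of_real l) = of_real (exp (ln l / 4))" unfolding zt_def by (simp only: exp_of_real)
  also have "exp (ln l / 4) = kk l" using assms by (simp add: kk_def powr_def)
  finally show ?thesis .
qed

text \<open>The cut of \<open>Ln (- i z)\<close> is the negative imaginary axis, away from the
  closed upper half-plane.\<close>

lemma zt_continuous: "continuous_on {z. 0 \<le> Im z \<and> z \<noteq> 0} zt"
proof -
  have "- \<i> * z \<notin> \<real>\<^sub>\<le>\<^sub>0" if "0 \<le> Im z" "z \<noteq> 0" for z
    using that by (auto simp: complex_nonpos_Reals_iff complex_eq_iff)
  then show ?thesis unfolding zt_def by (intro continuous_intros) auto
qed

lemma ev_tendsto_zero: assumes "Re p < 0" shows "(ev p k \<longlongrightarrow> 0) at_top"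
proof (rule tendsto_norm_zero_cancel)
  have "((\<lambda>x. cmod (p ^ k) * exp (Re p * x)) \<longlongrightarrow> cmod (p ^ k) * 0) at_top"
    by (intro tendsto_intros) (use assms in real_asymp)
  then show "((\<lambda>x. norm (ev p k x)) \<longlongrightarrow> 0) at_top" by (simp add: ev_def norm_mult)
qed

lemma tendsto_zero_mult_bounded:
  fixes f g :: "real \<Rightarrow> complex"
  assumes "(f \<longlongrightarrow> 0) at_top" "\<And>x. cmod (g x) \<le> C"
  shows "((\<lambda>x. f x * g x) \<longlongrightarrow> 0) at_top"
proof (rule Lim_null_comparison)
  show "\<forall>\<^sub>F x in at_top. norm (f x * g x) \<le> cmod (f x) * C"
    using assms(2) by (intro always_eventually allI) (auto simp: norm_mult intro!: mult_left_mono)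
  have "((\<lambda>x. cmod (f x) * C) \<longlongrightarrow> cmod 0 * C) at_top" by (intro tendsto_intros assms)
  then show "((\<lambda>x. cmod (f x) * C) \<longlongrightarrow> 0) at_top" by simp
qed

definition osc :: "real \<Rightarrow> complex \<Rightarrow> complex \<Rightarrow> nat \<Rightarrow> real \<Rightarrow> complex" where
  "osc k c d j x = c * ev (\<i> * of_real k) j x + d * ev (- \<i> * of_real k) j x"

text \<open>Agreement up to \<open>o(1)\<close> with an oscillation in the derivatives of order 0 to
  3, exactly those that occur in the bracket.\<close>

definition asym :: "real \<Rightarrow> complex \<Rightarrow> complex \<Rightarrow> (nat \<Rightarrow> real \<Rightarrow> complex) \<Rightarrow> bool" where
  "asym k c d v \<longleftrightarrow> (\<forall>j<4. ((\<lambda>x. v j x - osc k c d j x) \<longlongrightarrow> 0) at_top)"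

lemma osc_bounded: "cmod (osc k c d j x) \<le> (cmod c + cmod d) * \<bar>k\<bar> ^ j"
proof -
  have "cmod (osc k c d j x) \<le> cmod (c * ev (\<i> * of_real k) j x) + cmod (d * ev (- \<i> * of_real k) j x)"
    unfolding osc_def by (rule norm_triangle_ineq)
  also have "\<dots> = (cmod c + cmod d) * \<bar>k\<bar> ^ j" by (simp add: ev_def norm_mult norm_power algebra_simps)
  finally show ?thesis .
qed

text \<open>Products of opposite waves cancel and in products of equal waves the exponentials
  multiply to 1, so the bracket is constant in \<open>x\<close>: it is the flux, with opposite signs
  for the two directions.\<close>

lemma wronskian_osc:
  "wronskian (osc k c d) (cnjs (osc k c' d')) x = - 4 * \<i> * of_real (k ^ 3) * (c * cnj c' - d * cnj d')"
proof -
  define X where "X = exp (\<i> * of_real k * of_real x)"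
  define Y where "Y = exp (- \<i> * of_real k * of_real x)"
  have XY: "X * Y = 1" unfolding X_def Y_def exp_add[symmetric] by simp
  have cX: "cnj X = Y" "cnj Y = X" unfolding X_def Y_def exp_cnj by simp_all
  have p3: "\<i> ^ 3 = - \<i>" "(-\<i>) ^ 3 = \<i>" "\<i>\<^sup>2 = -1" "(-\<i>)\<^sup>2 = -1" by (simp_all add: power3_eq_cube)
  define K where "K = complex_of_real k"
  have cK: "cnj K = K" by (simp add: K_def)
  have evX: "ev (\<i> * of_real k) j x = (\<i> * K) ^ j * X" "ev (- \<i> * of_real k) j x = ((- \<i>) * K) ^ j * Y" for j
    by (simp_all only: ev_def X_def Y_def K_def)
  have o: "osc k c d 0 x = c * X + d * Y" "osc k c d 1 x = \<i> * K * (c * X - d * Y)"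
    "osc k c d 2 x = - K\<^sup>2 * (c * X + d * Y)" "osc k c d 3 x = - \<i> * K ^ 3 * (c * X - d * Y)" for c d
    unfolding osc_def evX by (simp_all add: power_mult_distrib p3 algebra_simps)
  have "wronskian (osc k c d) (cnjs (osc k c' d')) x
    = - 4 * \<i> * K ^ 3 * (c * cnj c' - d * cnj d') * (X * Y)"
    unfolding wronskian_def o by (simp add: cX cK power2_eq_square power3_eq_cube algebra_simps)
  then show ?thesis unfolding XY by (simp add: K_def)
qed

lemma asym_wronskian:
  assumes v: "asym k c d v" and w: "asym k c' d' w"
  shows "(wronskian v (cnjs w) \<longlongrightarrow> - 4 * \<i> * of_real (k ^ 3) * (c * cnj c' - d * cnj d')) at_top"
proof -
  let ?o = "osc k c d" and ?p = "osc k c' d'"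
  have z: "((\<lambda>x. v i x * cnj (w j x) - ?o i x * cnj (?p j x)) \<longlongrightarrow> 0) at_top" if "i < 4" "j < 4" for i j
  proof -
    have dv: "((\<lambda>x. v i x - ?o i x) \<longlongrightarrow> 0) at_top" using v that by (simp add: asym_def)
    have "((\<lambda>x. cnj (w j x - ?p j x)) \<longlongrightarrow> cnj 0) at_top"
      using w that by (intro tendsto_intros) (simp add: asym_def)
    then have dw: "((\<lambda>x. cnj (w j x - ?p j x)) \<longlongrightarrow> 0) at_top" by simp
    have "((\<lambda>x. (v i x - ?o i x) * cnj (?p j x) + cnj (w j x - ?p j x) * ?o i x + (v i x - ?o i x) * cnj (w j x - ?p j x)) \<longlongrightarrow> 0 + 0 + 0 * 0) at_top"
    proof (intro tendsto_add tendsto_mult dv dw)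
      show "((\<lambda>x. (v i x - ?o i x) * cnj (?p j x)) \<longlongrightarrow> 0) at_top"
        by (rule tendsto_zero_mult_bounded[OF dv]) (simp, rule osc_bounded)
      show "((\<lambda>x. cnj (w j x - ?p j x) * ?o i x) \<longlongrightarrow> 0) at_top"
        by (rule tendsto_zero_mult_bounded[OF dw osc_bounded])
    qed
    then show ?thesis by (simp add: algebra_simps)
  qed
  have "((\<lambda>x. (v 3 x * cnj (w 0 x) - ?o 3 x * cnj (?p 0 x)) - (v 2 x * cnj (w 1 x) - ?o 2 x * cnj (?p 1 x))
    + (v 1 x * cnj (w 2 x) - ?o 1 x * cnj (?p 2 x)) - (v 0 x * cnj (w 3 x) - ?o 0 x * cnj (?p 3 x))
    + wronskian ?o (cnjs ?p) x) \<longlongrightarrow> 0 - 0 + 0 - 0 + (- 4 * \<i> * of_real (k ^ 3) * (c * cnj c' - d * cnj d'))) at_top"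
    unfolding wronskian_osc by (intro tendsto_intros z) auto
  then show ?thesis unfolding wronskian_def[abs_def] by (simp add: algebra_simps)
qed

section \<open>The boundary determinant and the exceptional points\<close>

context biharmonic
begin

definition bb1 :: "complex \<Rightarrow> complex" where "bb1 p = p\<^sup>2 - \<alpha> - of_real \<alpha>1 * p"

definition bb2 :: "complex \<Rightarrow> complex" where "bb2 p = p ^ 3 + of_real \<alpha>2 + cnj \<alpha> * p"

definition dt :: "complex \<Rightarrow> complex" where
  "dt z = bb1 (\<i> * zt z) * bb2 (- zt z) - bb1 (- zt z) * bb2 (\<i> * zt z)"

lemma bc_ev: "bc1 (ev p) = bb1 p" "bc2 (ev p) = bb2 p"
  unfolding ev_def[abs_def] bc_exp bb1_def bb2_def by simp_all

text \<open>This is the origin of \<open>Omega\<close>: the boundary determinant of the two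
  nongrowing exponentials is antisymmetric in their exponents, so the difference
  \<open>(1 + i) zt z\<close> of the exponents splits off, and up to sign \<open>Omega\<close>
  remains.\<close>

lemma dt_Omega: "dt z = - (1 + \<i>) * zt z * Omega \<alpha> \<alpha>1 \<alpha>2 (zt z)"
proof -
  have a: "complex_of_real ((cmod \<alpha>)\<^sup>2) = \<alpha> * cnj \<alpha>" by (rule complex_norm_square)
  have r: "2 * complex_of_real (Re \<alpha>) = \<alpha> + cnj \<alpha>" by (simp add: complex_eq_iff)
  define y where "y = zt z"
  have O: "Omega \<alpha> \<alpha>1 \<alpha>2 y = of_real \<alpha>1 * of_real \<alpha>2 - \<alpha> * cnj \<alpha> + (1 - \<i>) * of_real \<alpha>2 * y
      + \<i> * (\<alpha> + cnj \<alpha>) * y\<^sup>2 - (1 + \<i>) * of_real \<alpha>1 * y^3 - y^4"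
    unfolding Omega_def alpha0_def r[symmetric] of_real_diff a by simp
  have ii: "\<i> * (\<i> * u) = - u" for u by (simp add: mult.assoc[symmetric])
  show ?thesis unfolding dt_def bb1_def bb2_def y_def[symmetric] O
    by (simp add: algebra_simps power2_eq_square power3_eq_cube power4_eq_xxxx ii)
qed

text \<open>Three obstructions on the real axis: 0, where the four roots coincide; fourth powers of
  zeros of \<open>Omega\<close>, which cover the zeros of the boundary determinant; and
  \<open>(j+1)^4\<close>, where \<open>exp (- (j+1) x)\<close> solves the homogeneous equation. All
  \<open>j\<close> are taken at once, so that one set serves every exponential sum.\<close>

definition exceptional :: "real set" where
  "exceptional = {0} \<union> {l. \<exists>y. Omega \<alpha> \<alpha>1 \<alpha>2 y = 0 \<and> of_real l = y ^ 4} \<union> range (\<lambda>j. real (Suc j) ^ 4)"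

definition adm :: "complex set" where
  "adm = {z. 0 \<le> Im z \<and> z \<notin> of_real ` exceptional}"

lemma adm_nonzero: "z \<in> adm \<Longrightarrow> z \<noteq> 0"
  by (force simp: adm_def exceptional_def)

lemma adm_upper: "Im z > 0 \<Longrightarrow> z \<in> adm"
  by (auto simp: adm_def)

text \<open>On the real axis the zeros are excluded through \<open>exceptional\<close>; above it
  both exponentials decay, and the symmetry of \<open>H\<close> excludes them.\<close>

lemma adm_dt: assumes "z \<in> adm" shows "dt z \<noteq> 0"
proof (cases "Im z = 0")
  case True
  have z0: "z \<noteq> 0" by (rule adm_nonzero[OF assms])
  have z: "z = of_real (Re z)" using True by (simp add: complex_eq_iff)
  have "zt z \<noteq> 0" using zt_power4[OF z0] z0 by auto
  moreover have "Omega \<alpha> \<alpha>1 \<alpha>2 (zt z) \<noteq> 0"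
  proof
    assume "Omega \<alpha> \<alpha>1 \<alpha>2 (zt z) = 0"
    then have "Re z \<in> exceptional" using zt_power4[OF z0] z unfolding exceptional_def by auto
    then show False using assms z unfolding adm_def by blast
  qed
  moreover have "1 + \<i> \<noteq> 0" by (simp add: complex_eq_iff)
  ultimately show ?thesis unfolding dt_Omega by (simp only: mult_eq_0_iff neg_equal_0_iff_equal) simp
next
  case False
  then have im: "Im z > 0" using assms by (simp add: adm_def)
  then have z0: "z \<noteq> 0" by auto
  have s: "0 < Re (zt z)" "0 < Im (zt z)" using zt_sector[of z] im z0 by auto
  have "bc1 (ev (\<i> * zt z)) * bc2 (ev (- zt z)) - bc1 (ev (- zt z)) * bc2 (ev (\<i> * zt z)) \<noteq> 0"
    unfolding ev_def[abs_def]
  proof (rule decaying_bc_det_nonzero)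
    show "(\<i> * zt z) ^ 4 = z" "(- zt z) ^ 4 = z"
      using zt_power4[OF z0] by (simp_all add: power_mult_distrib)
    show "\<i> * zt z \<noteq> - zt z"
    proof
      assume "\<i> * zt z = - zt z"
      from arg_cong[OF this, of Im] have "Re (zt z) = - Im (zt z)" by simp
      then show False using s by linarith
    qed
  qed (use s False in auto)
  then show ?thesis unfolding bc_ev dt_def .
qed

end

locale expsum = biharmonic +
  fixes J :: nat and c :: "nat \<Rightarrow> complex"
begin

definition aa :: "nat \<Rightarrow> complex" where "aa j = - of_real (real (Suc j))"

definition f :: "real \<Rightarrow> complex" where "f x = (\<Sum>j<J. c j * ev (aa j) 0 x)"

text \<open>Coefficients of the particular solution: on \<open>exp (aa j x)\<close> the operator
  acts as multiplication by \<open>aa j ^ 4 - z\<close>.\<close>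

definition qq :: "complex \<Rightarrow> nat \<Rightarrow> complex" where "qq z j = c j / (aa j ^ 4 - z)"

definition S1 :: "complex \<Rightarrow> complex" where "S1 z = (\<Sum>j<J. qq z j * bb1 (aa j))"

definition S2 :: "complex \<Rightarrow> complex" where "S2 z = (\<Sum>j<J. qq z j * bb2 (aa j))"

text \<open>Cramer's rule for the combination of the two nongrowing exponentials that repairs the
  boundary values of the particular solution: \<open>Pc\<close> belongs to
  \<open>exp (i zt x)\<close>, which becomes a wave on the positive axis, and \<open>Qc\<close> to
  \<open>exp (- zt x)\<close>.\<close>

definition Pc :: "complex \<Rightarrow> complex" where
  "Pc z = (S1 z * bb2 (- zt z) - S2 z * bb1 (- zt z)) / dt z"

definition Qc :: "complex \<Rightarrow> complex" where
  "Qc z = (bb1 (\<i> * zt z) * S2 z - bb2 (\<i> * zt z) * S1 z) / dt z"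

text \<open>For \<open>Im z > 0\<close> this is the resolvent applied to \<open>f\<close>, with its
  derivatives. The formula continues to the real points outside \<open>exceptional\<close>; for
  positive ones it is an outgoing solution and need not be square integrable.\<close>

definition U :: "complex \<Rightarrow> nat \<Rightarrow> real \<Rightarrow> complex" where
  "U z k x = (\<Sum>j<J. qq z j * ev (aa j) k x) - (Pc z * ev (\<i> * zt z) k x + Qc z * ev (- zt z) k x)"

text \<open>The closed form of the pairing of \<open>U z 0\<close> with \<open>f\<close>, each
  summand being the integral of an exponential. It supplies the boundary values of the resolvent
  form on the real axis.\<close>

definition M :: "complex \<Rightarrow> complex" where
  "M z = (\<Sum>l<J. cnj (c l) * ((\<Sum>j<J. qq z j * (1 / (- aa j - aa l)))
     - (Pc z * (1 / (- \<i> * zt z - aa l)) + Qc z * (1 / (zt z - aa l)))))"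

lemma chain_ev: "chain (ev p)"
  unfolding ev_def[abs_def] by (rule chain_exp)

lemma chain_U: "chain (U z)"
  unfolding U_def[abs_def] by (intro chain_diff chain_add chain_sum chain_cmult chain_ev)

lemma aa_power4: "aa j ^ 4 = of_real (real (Suc j) ^ 4)"
proof -
  have "(- x) ^ 4 = x ^ 4" for x :: complex by simp
  then show ?thesis unfolding aa_def of_real_power .
qed

lemma aa_adm: assumes "z \<in> adm" shows "aa j ^ 4 - z \<noteq> 0"
proof
  assume "aa j ^ 4 - z = 0"
  then have "z = of_real (real (Suc j) ^ 4)" unfolding aa_power4 by (simp only: right_minus_eq)
  moreover have "real (Suc j) ^ 4 \<in> exceptional" unfolding exceptional_def by blast
  ultimately show False using assms unfolding adm_def by blast
qed

lemma bc_U: assumes "z \<in> adm" shows "bc1 (U z) = 0" "bc2 (U z) = 0"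
proof -
  have d: "dt z \<noteq> 0" by (rule adm_dt[OF assms])
  have e: "bc1 (U z) = S1 z - (Pc z * bb1 (\<i> * zt z) + Qc z * bb1 (- zt z))"
    "bc2 (U z) = S2 z - (Pc z * bb2 (\<i> * zt z) + Qc z * bb2 (- zt z))"
    unfolding S1_def S2_def bc_ev[symmetric] U_def bc1_def bc2_def
    by (simp_all add: sum_subtractf sum.distrib sum_distrib_left algebra_simps)
  have p: "Pc z * dt z = S1 z * bb2 (- zt z) - S2 z * bb1 (- zt z)"
    "Qc z * dt z = bb1 (\<i> * zt z) * S2 z - bb2 (\<i> * zt z) * S1 z"
    using d by (simp_all add: Pc_def Qc_def)
  have "dt z * bc1 (U z) = dt z * S1 z - ((Pc z * dt z) * bb1 (\<i> * zt z) + (Qc z * dt z) * bb1 (- zt z))"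
    unfolding e by (simp add: algebra_simps)
  also have "\<dots> = 0" unfolding p unfolding dt_def by (simp add: algebra_simps)
  finally show "bc1 (U z) = 0" using d by simp
  have "dt z * bc2 (U z) = dt z * S2 z - ((Pc z * dt z) * bb2 (\<i> * zt z) + (Qc z * dt z) * bb2 (- zt z))"
    unfolding e by (simp add: algebra_simps)
  also have "\<dots> = 0" unfolding p unfolding dt_def by (simp add: algebra_simps)
  finally show "bc2 (U z) = 0" using d by simp
qed

lemma ev_4: "ev p 4 x = p ^ 4 * ev p 0 x"
  by (simp add: ev_def)

lemma U_4: assumes "z \<in> adm" shows "U z 4 x = z * U z 0 x + f x"
proof -
  have z0: "z \<noteq> 0" by (rule adm_nonzero[OF assms])
  have p: "(\<i> * zt z) ^ 4 = z" "(- zt z) ^ 4 = z"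
    using zt_power4[OF z0] by (simp_all add: power_mult_distrib)
  have "(\<Sum>j<J. qq z j * ev (aa j) 4 x) = (\<Sum>j<J. z * (qq z j * ev (aa j) 0 x) + c j * ev (aa j) 0 x)"
  proof (intro sum.cong refl)
    fix j
    have "qq z j * (aa j ^ 4 - z) = c j" using aa_adm[OF assms, of j] by (simp add: qq_def)
    then have "qq z j * aa j ^ 4 = z * qq z j + c j" by (simp add: algebra_simps)
    then show "qq z j * ev (aa j) 4 x = z * (qq z j * ev (aa j) 0 x) + c j * ev (aa j) 0 x"
      unfolding ev_4 by (simp only: mult.assoc[symmetric]) (simp add: algebra_simps)
  qed
  then show ?thesis
    unfolding U_def f_def ev_4 p by (simp add: sum.distrib sum_distrib_left algebra_simps)
qed

lemma Re_aa: "Re (aa j) < 0" by (simp add: aa_def)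

lemma f_L2: "f \<in> L2" and f_L1: "integrable hl f"
proof -
  have e: "ev (aa j) 0 = (\<lambda>x. exp (- ((- aa j) * of_real x)))" for j by (simp add: ev_def fun_eq_iff)
  show "f \<in> L2" unfolding f_def[abs_def] e by (intro L2_sum L2_cmult L2_exp) (simp add: Re_aa)
  show "integrable hl f" unfolding f_def[abs_def] e
    by (intro Bochner_Integration.integrable_sum integrable_mult_right integrable_exp) (simp add: Re_aa)
qed

text \<open>In the open upper half-plane both exponents decay, so \<open>U z 0\<close> lies in the
  domain of \<open>H\<close>.\<close>

lemma U_resolvent: assumes z: "Im z > 0" shows "aeq (RR z f) (U z 0)"
proof -
  have zn: "Im z \<noteq> 0" "z \<noteq> 0" using z by auto
  have a: "z \<in> adm" by (rule adm_upper[OF z])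
  have s: "0 < Re (zt z)" "0 < Im (zt z)" using zt_sector[of z] z zn by auto
  have L: "ev p k \<in> L2" if "Re p < 0" for p k
    unfolding ev_def[abs_def] by (rule exp_chain_L2[OF that])
  have "H (U z 0) (U z 4)"
    by (rule HI[OF _ chain_U bc_U[OF a]])
      (auto simp: U_def[abs_def] Re_aa s intro!: L2_diff L2_add L2_sum L2_cmult L)
  then show ?thesis
    by (rule RR_unique[OF zn(1) f_L2]) (simp add: U_4[OF a])
qed

lemma M_integral:
  assumes z: "z \<in> adm"
  shows "integrable hl (\<lambda>x. U z 0 x * cnj (f x))" "(\<integral>x. U z 0 x * cnj (f x) \<partial>hl) = M z"
proof -
  have s: "0 < Re (zt z)" "0 \<le> Im (zt z)" using zt_sector[OF adm_nonzero[OF z]] z by (auto simp: adm_def)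
  have E: "has_bochner_integral hl (\<lambda>x. ev p 0 x * cnj (ev (aa l) 0 x)) (1 / (- p - aa l))" if "Re p \<le> 0" for p l
  proof -
    have r: "0 < Re (- p - aa l)" using that Re_aa[of l] by simp
    have ca: "cnj (aa l * of_real x) = aa l * of_real x" for x unfolding aa_def by simp
    have "ev p 0 x * cnj (ev (aa l) 0 x) = exp (p * of_real x + aa l * of_real x)" for x
      unfolding ev_def power_0 mult_1 exp_cnj ca exp_add ..
    then have "ev p 0 x * cnj (ev (aa l) 0 x) = exp (- ((- p - aa l) * of_real x))" for x
      by (simp add: algebra_simps)
    then show ?thesis
      unfolding has_bochner_integral_iff using integrable_exp[OF r] integral_exp[OF r] by simp
  qed
  have eq: "U z 0 x * cnj (f x) = (\<Sum>l<J. cnj (c l) * ((\<Sum>j<J. qq z j * (ev (aa j) 0 x * cnj (ev (aa l) 0 x)))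
     - (Pc z * (ev (\<i> * zt z) 0 x * cnj (ev (aa l) 0 x)) + Qc z * (ev (- zt z) 0 x * cnj (ev (aa l) 0 x)))))" for x
    unfolding f_def U_def cnj_sum complex_cnj_mult sum_distrib_left
    by (intro sum.cong refl) (simp add: sum_distrib_left sum_distrib_right algebra_simps)
  have "has_bochner_integral hl (\<lambda>x. U z 0 x * cnj (f x)) (\<Sum>l<J. cnj (c l) * ((\<Sum>j<J. qq z j * (1 / (- aa j - aa l)))
     - (Pc z * (1 / (- (\<i> * zt z) - aa l)) + Qc z * (1 / (- (- zt z) - aa l)))))"
    unfolding eq
    by (intro has_bochner_integral_sum has_bochner_integral_mult_right has_bochner_integral_diff has_bochner_integral_add E)
      (use s Re_aa in \<open>auto intro: less_imp_le\<close>)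
  then have "has_bochner_integral hl (\<lambda>x. U z 0 x * cnj (f x)) (M z)" by (simp add: M_def)
  then show "integrable hl (\<lambda>x. U z 0 x * cnj (f x))" "(\<integral>x. U z 0 x * cnj (f x) \<partial>hl) = M z"
    by (simp_all add: has_bochner_integral_iff)
qed

lemma M_continuous: "continuous_on adm M"
proof -
  have zc: "continuous_on adm zt"
    by (rule continuous_on_subset[OF zt_continuous]) (use adm_nonzero in \<open>auto simp: adm_def\<close>)
  have b: "continuous_on S (\<lambda>z. bb1 (g z))" "continuous_on S (\<lambda>z. bb2 (g z))" if "continuous_on S g" for S and g :: "complex \<Rightarrow> complex"
    unfolding bb1_def bb2_def by (intro continuous_intros that)+
  have q: "continuous_on adm (\<lambda>z. qq z j)" for j
    unfolding qq_def by (intro continuous_intros) (use aa_adm in auto)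
  have S: "continuous_on adm S1" "continuous_on adm S2"
    unfolding S1_def[abs_def] S2_def[abs_def] by (intro continuous_intros q)+
  have dc: "continuous_on adm dt"
    unfolding dt_def[abs_def] by (intro continuous_intros b zc)
  have P: "continuous_on adm Pc" "continuous_on adm Qc"
    unfolding Pc_def[abs_def] Qc_def[abs_def] using adm_dt by (intro continuous_intros b zc S dc; auto)+
  have s: "0 < Re (zt z)" "0 \<le> Im (zt z)" if "z \<in> adm" for z
    using zt_sector[OF adm_nonzero[OF that]] that by (auto simp: adm_def)
  have n: "- \<i> * zt z - aa l \<noteq> 0" "zt z - aa l \<noteq> 0" if "z \<in> adm" for z l
    using s[OF that] by (auto simp: complex_eq_iff aa_def)
  show ?thesis unfolding M_def[abs_def]
    by (intro continuous_intros P q zc) (use n in auto)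
qed

text \<open>Two brackets at infinity. That of \<open>U\<close> with itself is
  \<open>cnj M - M\<close> and equals the flux of the outgoing wave, so
  \<open>Im M = 2 k^3 |Pc|^2\<close>. That of \<open>U\<close> with \<open>PS k\<close> is
  \<open>hat f k\<close> and equals \<open>4 i k^3 Pc cnj (co k 0)\<close>. Eliminating
  \<open>|Pc|\<close> expresses \<open>Im M\<close> by the transform.\<close>

lemma M_Im_real:
  assumes l: "l \<notin> exceptional"
  shows "Im (M (of_real l)) = pi * (indicator {0<..} l * (cmod (VV (F0 f) l))\<^sup>2)"
proof -
  let ?z = "complex_of_real l"
  have a: "?z \<in> adm" using l by (auto simp: adm_def)
  have l0: "l \<noteq> 0" using l by (auto simp: exceptional_def)
  note M = M_integral[OF a]
  have Mc: "integrable hl (\<lambda>x. f x * cnj (U ?z 0 x))" "(\<integral>x. f x * cnj (U ?z 0 x) \<partial>hl) = cnj (M ?z)"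
    using integrable_cnj[OF M(1)] arg_cong[OF M(2), of cnj]
      Bochner_Integration.integral_cnj[of hl "\<lambda>x. U ?z 0 x * cnj (f x)"] by (simp_all add: mult.commute)
  have d: "acp (wronskian (U ?z) (cnjs (U ?z))) (\<lambda>x. f x * cnj (U ?z 0 x) - U ?z 0 x * cnj (f x))"
  proof -
    have "acp (wronskian (U ?z) (cnjs (U ?z))) (\<lambda>x. U ?z 4 x * cnj (U ?z 0 x) - U ?z 0 x * cnj (U ?z 4 x))"
      by (intro acp_wronskian chain_cnjs chain_U)
    then show ?thesis by (simp add: U_4[OF a] algebra_simps)
  qed
  have "(wronskian (U ?z) (cnjs (U ?z)) \<longlongrightarrow> wronskian (U ?z) (cnjs (U ?z)) 0
     + (\<integral>x. f x * cnj (U ?z 0 x) - U ?z 0 x * cnj (f x) \<partial>hl)) at_top"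
    by (rule acp_tendsto[OF d]) (intro Bochner_Integration.integrable_diff Mc M)
  then have lim: "(wronskian (U ?z) (cnjs (U ?z)) \<longlongrightarrow> cnj (M ?z) - M ?z) at_top"
    using Mc M by (simp add: wronskian_bc bc_U[OF a])
  have decay: "((\<lambda>x. \<Sum>j<J. qq ?z j * ev (aa j) i x) \<longlongrightarrow> 0) at_top" for i
  proof -
    have "((\<lambda>x. \<Sum>j<J. qq ?z j * ev (aa j) i x) \<longlongrightarrow> (\<Sum>j<J. qq ?z j * 0)) at_top"
      by (intro tendsto_intros ev_tendsto_zero Re_aa)
    then show ?thesis by simp
  qed
  have s: "0 < Re (zt ?z)" using zt_sector[OF adm_nonzero[OF a]] by simp
  have dq: "((\<lambda>x. Qc ?z * ev (- zt ?z) i x) \<longlongrightarrow> 0) at_top" for i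
    using tendsto_mult_right_zero[OF ev_tendsto_zero[of "- zt ?z" i], of "Qc ?z"] s by simp
  show ?thesis
  proof (cases "l > 0")
    case False
    then have im: "0 < Im (zt ?z)" using zt_sector(3)[OF adm_nonzero[OF a]] l0 by simp
    \<comment> \<open>For negative \<open>l\<close> every exponential decays, so both amplitudes are
      0 and the frequency 1 is a mere placeholder.\<close>
    have "asym 1 0 0 (U ?z)" unfolding asym_def
    proof (intro allI impI)
      fix i
      have "((\<lambda>x. (\<Sum>j<J. qq ?z j * ev (aa j) i x) - (Pc ?z * ev (\<i> * zt ?z) i x + Qc ?z * ev (- zt ?z) i x)) \<longlongrightarrow> 0 - (Pc ?z * 0 + 0)) at_top"
        by (intro tendsto_intros decay dq ev_tendsto_zero) (use im in simp)
      then show "((\<lambda>x. U ?z i x - osc 1 0 0 i x) \<longlongrightarrow> 0) at_top" by (simp add: U_def osc_def)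
    qed
    from tendsto_unique[OF trivial_limit_at_top_linorder lim asym_wronskian[OF this this]]
    have "cnj (M ?z) = M ?z" by simp
    then have "Im (M ?z) = 0" by (metis Reals_cnj_iff complex_is_Real_iff)
    then show ?thesis using False by simp
  next
    case True
    define k where "k = kk l"
    have k: "k > 0" "k ^ 4 = l" unfolding k_def using True by (simp_all add: kk_pos kk_power4)
    have zk: "zt ?z = of_real k" unfolding k_def by (rule zt_real[OF True])
    have asU: "asym k (- Pc ?z) 0 (U ?z)" unfolding asym_def
    proof (intro allI impI)
      fix i
      have "((\<lambda>x. (\<Sum>j<J. qq ?z j * ev (aa j) i x) - Qc ?z * ev (- zt ?z) i x) \<longlongrightarrow> 0 - 0) at_top"
        by (intro tendsto_intros decay dq)
      then show "((\<lambda>x. U ?z i x - osc k (- Pc ?z) 0 i x) \<longlongrightarrow> 0) at_top"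
        unfolding U_def osc_def zk by (simp add: algebra_simps)
    qed
    have asP: "asym k (co k 0) (co k 1) (PS k)" unfolding asym_def
    proof (intro allI impI)
      fix i
      have "((\<lambda>x. co k 2 * ev (- of_real k) i x) \<longlongrightarrow> co k 2 * 0) at_top"
        by (intro tendsto_intros ev_tendsto_zero) (use k in simp)
      then show "((\<lambda>x. PS k i x - osc k (co k 0) (co k 1) i x) \<longlongrightarrow> 0) at_top"
        unfolding PS_def sum3 osc_def by (simp add: ex_def ev_def)
    qed
    have W1: "cnj (M ?z) - M ?z = - 4 * \<i> * of_real (k ^ 3) * (Pc ?z * cnj (Pc ?z))"
      using tendsto_unique[OF trivial_limit_at_top_linorder lim asym_wronskian[OF asU asU]] by simp
    then have "Im (cnj (M ?z) - M ?z) = Im (- 4 * \<i> * of_real (k ^ 3) * of_real ((cmod (Pc ?z))\<^sup>2))"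
      by (simp only: complex_norm_square)
    then have M2: "Im (M ?z) = 2 * k ^ 3 * (cmod (Pc ?z))\<^sup>2" by (simp del: of_real_power)
    have d2: "acp (wronskian (U ?z) (cnjs (PS k))) (\<lambda>x. cnj (PS k 0 x) * f x)"
    proof -
      have "acp (wronskian (U ?z) (cnjs (PS k))) (\<lambda>x. U ?z 4 x * cnj (PS k 0 x) - U ?z 0 x * cnj (PS k 4 x))"
        by (intro acp_wronskian chain_cnjs chain_U chain_PS)
      then show ?thesis by (simp add: U_4[OF a] PS_4 k algebra_simps del: of_real_power)
    qed
    have "(wronskian (U ?z) (cnjs (PS k)) \<longlongrightarrow> wronskian (U ?z) (cnjs (PS k)) 0 + hat f k) at_top"
      unfolding hat_def by (rule acp_tendsto[OF d2 PS_mult_integrable[OF f_L1 k(1)]])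
    then have "(wronskian (U ?z) (cnjs (PS k)) \<longlongrightarrow> hat f k) at_top"
      by (simp add: wronskian_bc bc_U[OF a] bc_PS)
    from tendsto_unique[OF trivial_limit_at_top_linorder this asym_wronskian[OF asU asP]]
    have hf: "hat f k = 4 * \<i> * of_real (k ^ 3) * (Pc ?z * cnj (co k 0))" by simp
    have Om: "Om k \<noteq> 0"
    proof
      assume "Om k = 0"
      then have "l \<in> exceptional" unfolding exceptional_def Om_def using k(2)
        by (auto intro!: exI[of _ "complex_of_real k"])
      then show False using l by simp
    qed
    have c0: "(cmod (co k 0))\<^sup>2 = (cmod (Om k))\<^sup>2 / 4"
      unfolding co_def by (simp add: norm_divide norm_mult power_divide power_mult_distrib cmod_power2[of "1 + \<i>"])
    have "(cmod (hat f k))\<^sup>2 = 16 * (k ^ 3)\<^sup>2 * ((cmod (Pc ?z))\<^sup>2 * (cmod (co k 0))\<^sup>2)"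
      unfolding hf norm_mult complex_mod_cnj norm_of_real by (simp add: power_mult_distrib)
    then have hn: "(cmod (hat f k))\<^sup>2 = 4 * (k ^ 3)\<^sup>2 * (cmod (Pc ?z))\<^sup>2 * (cmod (Om k))\<^sup>2" unfolding c0 by simp
    have "(cmod (F0 f k))\<^sup>2 = (2 / pi) * (cmod (hat f k))\<^sup>2 / (cmod (Om k))\<^sup>2"
      unfolding F0_def by (simp add: norm_divide norm_mult power_divide power_mult_distrib)
    then have Fn: "(cmod (F0 f k))\<^sup>2 = (2 / pi) * (4 * (k ^ 3)\<^sup>2 * (cmod (Pc ?z))\<^sup>2)" unfolding hn using Om by simp
    \<comment> \<open>The Jacobian of the substitution cancels one of the two factors
      \<open>k^3\<close> in \<open>|F0 f k|^2\<close>, which leaves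
      \<open>(2 / pi) k^3 |Pc|^2\<close>.\<close>
    have lk: "l powr (-3/4) * k ^ 3 = 1"
      unfolding k_def kk_def using True by (simp add: powr_power powr_add[symmetric])
    have "(cmod (VV (F0 f) l))\<^sup>2 = (l powr (-3/4) / 4) * (cmod (F0 f k))\<^sup>2"
      using VV_norm_sq[OF True, of "F0 f"] by (simp add: k_def)
    also have "\<dots> = (2 / pi) * (l powr (-3/4) * k ^ 3) * (k ^ 3 * (cmod (Pc ?z))\<^sup>2)"
      unfolding Fn by (simp add: power2_eq_square)
    finally have "(cmod (VV (F0 f) l))\<^sup>2 = (2 / pi) * (k ^ 3 * (cmod (Pc ?z))\<^sup>2)" unfolding lk by simp
    then show ?thesis unfolding M2 using True by simp
  qed
qed

text \<open>\<open>M\<close> is continuous on the compact rectangle of height 1 over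
  \<open>[a,b]\<close>, which avoids the exceptional points, so the limit passes under the integral
  with a constant bound.\<close>

lemma expsum_boundary_limit:
  assumes ab: "a < b" "{a..b} \<inter> exceptional = {}"
  shows "(\<lambda>n. LINT t:{a..b}|lborel. Im (ip (RR (of_real t + \<i> * of_real (inverse (real (Suc n)))) f) f))
    \<longlonglongrightarrow> pi * (LINT t:{a..b}|lborel. indicator {0<..} t * (cmod (FF f t))\<^sup>2)"
proof -
  let ?e = "\<lambda>n. inverse (real (Suc n))"
  have e: "?e n > 0" "?e n \<le> 1" for n by (simp_all add: divide_simps)
  have ipM: "ip (RR (of_real t + \<i> * of_real (?e n)) f) f = M (of_real t + \<i> * of_real (?e n))" for t n
  proof -
    let ?z = "of_real t + \<i> * of_real (?e n)"
    have z: "Im ?z > 0" using e(1)[of n] by simp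
    then have zn: "Im ?z \<noteq> 0" by simp
    have a: "?z \<in> adm" by (rule adm_upper[OF z])
    have UM: "U ?z 0 \<in> borel_measurable hl" by (rule acp_meas[OF chainD(1)[OF chain_U]])
    have "ip (RR ?z f) f = ip (U ?z 0) f"
      by (rule ip_cong[OF L2_meas[OF RR(2)[OF zn f_L2]] UM L2_meas[OF f_L2] L2_meas[OF f_L2] U_resolvent[OF z] aeq_refl])
    then show ?thesis unfolding ip_hl M_integral(2)[OF a] .
  qed
  define R where "R = (\<lambda>p. complex_of_real (fst p) + \<i> * of_real (snd p)) ` ({a..b} \<times> {0..1})"
  have cR: "compact R" unfolding R_def
    by (intro compact_continuous_image compact_Times continuous_intros) auto
  have RA: "R \<subseteq> adm"
  proof
    fix z assume "z \<in> R"
    then obtain t s where ts: "z = of_real t + \<i> * of_real s" "t \<in> {a..b}" "0 \<le> s" by (auto simp: R_def)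
    then show "z \<in> adm" using ab(2) by (auto simp: adm_def complex_eq_iff)
  qed
  have "compact (M ` R)"
    by (intro compact_continuous_image continuous_on_subset[OF M_continuous RA] cR)
  then obtain C where C: "\<And>z. z \<in> R \<Longrightarrow> cmod (M z) \<le> C"
    by (meson compact_imp_bounded bounded_iff imageI)
  have inR: "of_real t + \<i> * of_real (?e n) \<in> R" "complex_of_real t \<in> R" if "t \<in> {a..b}" for t n
    using that e[of n] unfolding R_def by (force intro!: image_eqI[where x="(t, ?e n)"], force intro!: image_eqI[where x="(t, 0)"])
  have cont: "continuous_on {a..b} (\<lambda>t. Im (M (of_real t + \<i> * of_real s)))" if "0 \<le> s" "s \<le> 1" for s
  proof (intro continuous_on_Im continuous_on_compose2[OF continuous_on_subset[OF M_continuous RA]] continuous_intros)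
    show "(\<lambda>t. complex_of_real t + \<i> * of_real s) ` {a..b} \<subseteq> R"
      using that unfolding R_def by (force intro!: image_eqI[where x="(_, s)"])
  qed
  have "(\<lambda>n. \<integral>t. indicator {a..b} t *\<^sub>R Im (M (of_real t + \<i> * of_real (?e n))) \<partial>lborel)
    \<longlonglongrightarrow> (\<integral>t. indicator {a..b} t *\<^sub>R Im (M (of_real t)) \<partial>lborel)"
  proof (rule integral_dominated_convergence)
    show "integrable lborel (\<lambda>t. indicator {a..b} t * C)"
      using ab by (intro integrable_mult_left integrable_real_indicator) auto
    show "AE t in lborel. (\<lambda>n. indicator {a..b} t *\<^sub>R Im (M (of_real t + \<i> * of_real (?e n)))) \<longlonglongrightarrow> indicator {a..b} t *\<^sub>R Im (M (of_real t))"
    proof (rule AE_I2)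
      fix t
      show "(\<lambda>n. indicator {a..b} t *\<^sub>R Im (M (of_real t + \<i> * of_real (?e n)))) \<longlonglongrightarrow> indicator {a..b} t *\<^sub>R Im (M (of_real t))"
      proof (cases "t \<in> {a..b}")
        case True
        have "(\<lambda>n. complex_of_real t + \<i> * of_real (?e n)) \<longlonglongrightarrow> complex_of_real t + \<i> * of_real 0"
          by (intro tendsto_intros LIMSEQ_inverse_real_of_nat)
        then have "(\<lambda>n. M (of_real t + \<i> * of_real (?e n))) \<longlonglongrightarrow> M (of_real t)"
          using continuous_on_tendsto_compose[OF continuous_on_subset[OF M_continuous RA], of "\<lambda>n. of_real t + \<i> * of_real (?e n)" "of_real t" sequentially] inR[OF True] by simp
        then show ?thesis by (intro tendsto_intros)
      qed simp
    qed
    show "AE t in lborel. norm (indicator {a..b} t *\<^sub>R Im (M (of_real t + \<i> * of_real (?e n)))) \<le> indicator {a..b} t * C" for n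
    proof (rule AE_I2)
      fix t
      show "norm (indicator {a..b} t *\<^sub>R Im (M (of_real t + \<i> * of_real (?e n)))) \<le> indicator {a..b} t * C"
        using order_trans[OF abs_Im_le_cmod C[OF inR(1)[of t n]]] by (cases "t \<in> {a..b}") auto
    qed
    show "(\<lambda>t. indicator {a..b} t *\<^sub>R Im (M (of_real t))) \<in> borel_measurable lborel"
      using borel_measurable_continuous_on_indicator[OF _ cont[of 0]] by simp
    show "(\<lambda>t. indicator {a..b} t *\<^sub>R Im (M (of_real t + \<i> * of_real (?e n)))) \<in> borel_measurable lborel" for n
      using borel_measurable_continuous_on_indicator[OF _ cont[of "?e n"]] e[of n] by simp
  qed
  then have lim: "(\<lambda>n. LINT t:{a..b}|lborel. Im (M (of_real t + \<i> * of_real (?e n)))) \<longlonglongrightarrow> (LINT t:{a..b}|lborel. Im (M (of_real t)))"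
    by (simp add: set_lebesgue_integral_def)
  have "(LINT t:{a..b}|lborel. Im (M (of_real t))) = (\<integral>t. pi * (indicator {a..b} t *\<^sub>R (indicator {0<..} t * (cmod (FF f t))\<^sup>2)) \<partial>lborel)"
    unfolding set_lebesgue_integral_def
  proof (rule integral_cong_AE)
    show "(\<lambda>t. indicator {a..b} t *\<^sub>R Im (M (of_real t))) \<in> borel_measurable lborel"
      using borel_measurable_continuous_on_indicator[OF _ cont[of 0]] by simp
    show "(\<lambda>t. pi * (indicator {a..b} t *\<^sub>R (indicator {0<..} t * (cmod (FF f t))\<^sup>2))) \<in> borel_measurable lborel"
      using borel_measurable_integrable[OF density_integrable[OF FF(1)[OF f_L2]]] by measurable
    have f12: "f \<in> L1 \<inter> L2" using f_L1 f_L2 by (simp add: L1_iff)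
    have "aeq (FF f) (VV (F0 f))" unfolding FF_def
      by (rule VV_cong[OF Fk(1)[OF f_L2] F0_contraction(1)[OF f12] Fk_F0[OF f12]])
    then show "AE t in lborel. indicator {a..b} t *\<^sub>R Im (M (of_real t)) = pi * (indicator {a..b} t *\<^sub>R (indicator {0<..} t * (cmod (FF f t))\<^sup>2))"
      unfolding aeq_def
    proof eventually_elim
      case (elim t)
      show ?case
      proof (cases "t \<in> {a..b}")
        case True
        then have "t \<notin> exceptional" using ab(2) by blast
        from M_Im_real[OF this] show ?thesis using elim True by (cases "t > 0") auto
      qed simp
    qed
  qed
  also have "\<dots> = pi * (LINT t:{a..b}|lborel. indicator {0<..} t * (cmod (FF f t))\<^sup>2)"
    unfolding integral_mult_right_zero set_lebesgue_integral_def ..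
  finally show ?thesis using lim unfolding ipM by simp
qed

end

section \<open>Density of exponential sums\<close>

lemma L2_mono:
  assumes f: "f \<in> borel_measurable hl" and g: "g \<in> L2" and le: "\<And>x. x > 0 \<Longrightarrow> cmod (f x) \<le> cmod (g x)"
  shows "f \<in> L2" "nrm f \<le> nrm g"
proof -
  show f2: "f \<in> L2"
    by (rule L2_bound[OF f L2_sq[OF g]]) (intro power_mono le norm_ge_zero)
  have "(\<integral>x. (cmod (f x))\<^sup>2 \<partial>hl) \<le> (\<integral>x. (cmod (g x))\<^sup>2 \<partial>hl)"
    by (rule integral_mono_AE[OF L2_sq[OF f2] L2_sq[OF g]]) (intro AE_I2 power_mono le norm_ge_zero, simp)
  then show "nrm f \<le> nrm g" unfolding nrm_hl by (rule real_sqrt_le_mono)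
qed

definition expsum_approximable :: "(real \<Rightarrow> complex) \<Rightarrow> bool" where
  "expsum_approximable h \<longleftrightarrow> (\<forall>\<delta>>0. \<exists>J c. nrm (\<lambda>x. h x - expsum.f J c x) < \<delta>)"

lemma expsum_f_eq: "expsum.f J c x = (\<Sum>j<J. c j * of_real (exp (- x) ^ Suc j))"
proof -
  have "ev (expsum.aa j) 0 x = of_real (exp (- x) ^ Suc j)" for j
  proof -
    have "ev (expsum.aa j) 0 x = exp (of_real (real (Suc j) * (- x)))"
      unfolding ev_def expsum.aa_def by (simp add: algebra_simps)
    also have "\<dots> = of_real (exp (real (Suc j) * (- x)))" by (rule exp_of_real)
    finally show ?thesis unfolding exp_of_nat_mult .
  qed
  then show ?thesis unfolding expsum.f_def by simp
qed

text \<open>Substituting \<open>t = exp (- x)\<close> turns exponential sums into polynomials on the unit interval.\<close>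

lemma expsum_weierstrass:
  fixes g :: "real \<Rightarrow> complex"
  assumes g: "continuous_on UNIV g" and T: "T \<ge> 0" "\<And>x. x \<ge> T \<Longrightarrow> g x = 0" and d: "\<delta> > 0"
  shows "\<exists>J c. \<forall>x>0. cmod (g x - expsum.f J c x) \<le> \<delta> * exp (- x)"
proof -
  \<comment> \<open>Dividing by \<open>t\<close> makes the approximating polynomial return as a sum
    of \<open>exp (- (j+1) x)\<close> without constant term, and leaves the factor
    \<open>exp (- x)\<close> in the error. \<open>G\<close> is continuous at 0 because
    \<open>g\<close> vanishes beyond \<open>T\<close>.\<close>
  define G where "G t = g (- ln t) / complex_of_real t" for t
  have eT: "0 < exp (- T)" "exp (- T) \<le> 1" using T by auto
  have "continuous_on ({0..exp (- T)} \<union> {exp (- T)..1}) G"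
  proof (rule continuous_on_closed_Un)
    have z: "G t = 0" if t: "t \<in> {0..exp (- T)}" for t
    proof (cases "t = 0")
      case False
      then have t0: "t > 0" using t by simp
      have "ln t \<le> ln (exp (- T))" using t t0 by (subst ln_le_cancel_iff) auto
      then have "T \<le> - ln t" by simp
      then show ?thesis unfolding G_def using T(2) by simp
    qed (simp add: G_def)
    show "continuous_on {0..exp (- T)} G"
      by (subst continuous_on_cong[OF refl z]) auto
    have p: "t > 0" if "t \<in> {exp (- T)..1}" for t using that eT by (meson atLeastAtMost_iff less_le_trans)
    show "continuous_on {exp (- T)..1} G"
      unfolding G_def[abs_def]
      by (intro continuous_on_divide continuous_on_compose2[OF g] continuous_intros) (use p in force)+
  qed auto
  also have "{0..exp (- T)} \<union> {exp (- T)..1} = {0..1}" by (rule ivl_disj_un_two_touch) (use eT in auto)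
  finally have G: "continuous_on {0..1} G" .
  obtain p q where pq: "real_polynomial_function p" "\<And>x. x \<in> {0..1} \<Longrightarrow> \<bar>Re (G x) - p x\<bar> < \<delta> / 2"
    "real_polynomial_function q" "\<And>x. x \<in> {0..1} \<Longrightarrow> \<bar>Im (G x) - q x\<bar> < \<delta> / 2"
    using Stone_Weierstrass_real_polynomial_function[of "{0..1::real}" "\<lambda>x. Re (G x)" "\<delta> / 2"]
      Stone_Weierstrass_real_polynomial_function[of "{0..1::real}" "\<lambda>x. Im (G x)" "\<delta> / 2"]
      continuous_on_Re[OF G] continuous_on_Im[OF G] d by (metis compact_Icc half_gt_zero)
  obtain a n where p: "p = (\<lambda>x. \<Sum>i\<le>n. a i * x ^ i)" using pq(1) unfolding real_polynomial_function_iff_sum by blast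
  obtain b m where q: "q = (\<lambda>x. \<Sum>i\<le>m. b i * x ^ i)" using pq(3) unfolding real_polynomial_function_iff_sum by blast
  define J where "J = Suc (max n m)"
  define a' where "a' j = (if j \<le> n then a j else 0)" for j
  define b' where "b' j = (if j \<le> m then b j else 0)" for j
  have p': "p t = (\<Sum>j<J. a' j * t ^ j)" for t
    unfolding p J_def a'_def by (rule sum.mono_neutral_cong_left) auto
  have q': "q t = (\<Sum>j<J. b' j * t ^ j)" for t
    unfolding q J_def b'_def by (rule sum.mono_neutral_cong_left) auto
  have s: "expsum.f J (\<lambda>j. Complex (a' j) (b' j)) x = of_real (exp (- x)) * Complex (p (exp (- x))) (q (exp (- x)))" for x
    unfolding expsum_f_eq p' q' by (simp add: complex_eq_iff sum_distrib_left mult_ac del: of_real_power)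
  show ?thesis
  proof (intro exI allI impI)
    fix x :: real assume "x > 0"
    define t where "t = exp (- x)"
    have t: "t \<in> {0..1}" "t > 0" using \<open>x > 0\<close> by (auto simp: t_def)
    have "g x = of_real t * G t" using t by (simp add: G_def) (simp add: t_def)
    then have "g x - expsum.f J (\<lambda>j. Complex (a' j) (b' j)) x = of_real t * (G t - Complex (p t) (q t))"
      unfolding s t_def[symmetric] by (simp add: algebra_simps)
    then have "cmod (g x - expsum.f J (\<lambda>j. Complex (a' j) (b' j)) x) = t * cmod (G t - Complex (p t) (q t))"
      using t by (simp add: norm_mult)
    also have "\<dots> \<le> t * \<delta>"
      using cmod_le[of "G t - Complex (p t) (q t)"] pq(2,4)[OF t(1)] t by (intro mult_left_mono) auto
    finally show "cmod (g x - expsum.f J (\<lambda>j. Complex (a' j) (b' j)) x) \<le> \<delta> * exp (- x)"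
      by (simp add: t_def mult.commute)
  qed
qed

text \<open>The pointwise error carries the square integrable weight \<open>exp (- x)\<close>, so it
  is small in norm.\<close>

lemma expsum_approximable_continuous:
  fixes g :: "real \<Rightarrow> complex"
  assumes g: "continuous_on UNIV g" and T: "T \<ge> 0" "\<And>x. x \<ge> T \<Longrightarrow> g x = 0"
  shows "expsum_approximable g"
  unfolding expsum_approximable_def
proof (intro allI impI)
  fix \<delta> :: real assume d: "\<delta> > 0"
  define E where "E = (\<lambda>x::real. exp (- (1 * complex_of_real x)))"
  have E2: "E \<in> L2" unfolding E_def by (rule L2_exp) simp
  have cE: "cmod (E x) = exp (- x)" for x by (simp add: E_def)
  define \<epsilon> where "\<epsilon> = \<delta> / (nrm E + 1)"
  have nE: "nrm E + 1 > 0" using nrm_nonneg[of E] by linarith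
  have e: "\<epsilon> > 0" unfolding \<epsilon>_def using d nE by simp
  obtain J c where Jc: "\<And>x. x > 0 \<Longrightarrow> cmod (g x - expsum.f J c x) \<le> \<epsilon> * exp (- x)"
    using expsum_weierstrass[OF g T e] by blast
  have m: "(\<lambda>x. g x - expsum.f J c x) \<in> borel_measurable hl"
    by (intro borel_measurable_diff L2_meas[OF expsum.f_L2] borel_measurable_hl borel_measurable_continuous_onI g)
  have "nrm (\<lambda>x. g x - expsum.f J c x) \<le> nrm (\<lambda>x. of_real \<epsilon> * E x)"
    by (rule L2_mono(2)[OF m L2_cmult[OF E2]]) (use Jc e in \<open>simp add: norm_mult cE\<close>)
  also have "\<dots> = \<epsilon> * nrm E" using e by (simp add: nrm_cmult)
  also have "\<dots> < \<epsilon> * (nrm E + 1)" using e by simp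
  also have "\<dots> = \<delta>" unfolding \<epsilon>_def using nE by simp
  finally show "\<exists>J c. nrm (\<lambda>x. g x - expsum.f J c x) < \<delta>" by blast
qed

lemma expsum_approximable_lim:
  assumes g: "\<And>n. g n \<in> L2" "\<And>n. expsum_approximable (g n)" and h: "h \<in> L2" and lim: "L2_lim g h"
  shows "expsum_approximable h"
  unfolding expsum_approximable_def
proof (intro allI impI)
  fix \<delta> :: real assume d: "\<delta> > 0"
  have "\<forall>\<^sub>F n in sequentially. nrm (\<lambda>x. g n x - h x) < \<delta> / 2"
    using lim[unfolded L2_lim_def] d by (intro order_tendstoD) auto
  then obtain n where n: "nrm (\<lambda>x. g n x - h x) < \<delta> / 2" by (auto simp: eventually_sequentially)
  obtain J c where Jc: "nrm (\<lambda>x. g n x - expsum.f J c x) < \<delta> / 2"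
    using g(2)[of n] d unfolding expsum_approximable_def by (meson half_gt_zero)
  have "nrm (\<lambda>x. (g n x - expsum.f J c x) - (g n x - h x))
      \<le> nrm (\<lambda>x. g n x - expsum.f J c x) + nrm (\<lambda>x. g n x - h x)"
    by (intro nrm_triangle_diff L2_diff g h expsum.f_L2)
  then have "nrm (\<lambda>x. h x - expsum.f J c x) < \<delta>" using n Jc by simp
  then show "\<exists>J c. nrm (\<lambda>x. h x - expsum.f J c x) < \<delta>" by blast
qed

text \<open>A measurable function is an almost everywhere limit of continuous ones. Clamping their
  values to modulus \<open>m\<close> and cutting them off past \<open>m + 1\<close> does not change
  the limit and supplies a common square integrable bound.\<close>

lemma expsum_approximable_bounded:
  assumes h: "h \<in> L2" and m: "m > 0" "\<And>x. cmod (h x) \<le> m" "\<And>x. x > m \<Longrightarrow> h x = 0"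
  shows "expsum_approximable h"
proof -
  have "(\<lambda>x. indicator {0<..} x *\<^sub>R h x) \<in> borel_measurable lborel"
    using L2_meas[OF h] by (simp add: borel_measurable_restrict_space_iff)
  then have "(\<lambda>x. indicator {0<..} x *\<^sub>R h x) \<in> borel_measurable lebesgue" by (rule measurable_completion)
  then have "h \<in> borel_measurable (lebesgue_on {0<..})" by (simp add: borel_measurable_restrict_space_iff)
  then have "h measurable_on {0<..}" by (subst measurable_on_iff_borel_measurable) auto
  then obtain N g where N: "negligible N" and g: "\<And>n. continuous_on UNIV (g n)"
    "\<And>x. x \<notin> N \<Longrightarrow> (\<lambda>n. g n x) \<longlonglongrightarrow> (if x \<in> {0<..} then h x else 0)"
    unfolding measurable_on_def by blast
  define clamp where "clamp w = w / complex_of_real (max 1 (cmod w / m))" for w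
  have clamp_pos: "max 1 (cmod w / m) > 0" for w by linarith
  have clamp_cont: "continuous_on S clamp" for S
    unfolding clamp_def[abs_def]
  proof (intro continuous_intros ballI)
    show "m \<noteq> 0" using m by simp
    show "complex_of_real (max 1 (cmod w / m)) \<noteq> 0" for w
      using clamp_pos[of w] unfolding of_real_eq_0_iff by linarith
  qed
  have clamp_le: "cmod (clamp w) \<le> m" for w
  proof -
    have "cmod w / max 1 (cmod w / m) \<le> m"
      using clamp_pos[of w] m by (simp add: pos_divide_le_eq) (simp add: field_simps max_def)
    then show ?thesis using clamp_pos[of w] by (simp add: clamp_def norm_divide)
  qed
  have clamp_id: "clamp w = w" if "cmod w \<le> m" for w
  proof -
    have "max 1 (cmod w / m) = 1" using that m by (simp add: max_def divide_le_eq)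
    then show ?thesis by (simp add: clamp_def)
  qed
  define cut where "cut x = max 0 (min 1 (m + 1 - x))" for x :: real
  have cut: "0 \<le> cut x" "cut x \<le> 1" "x \<le> m \<Longrightarrow> cut x = 1" "x \<ge> m + 1 \<Longrightarrow> cut x = 0" for x by (auto simp: cut_def)
  define G where "G n x = of_real (cut x) * clamp (g n x)" for n x
  have Gc: "continuous_on UNIV (G n)" for n
    unfolding G_def[abs_def] cut_def
    by (intro continuous_intros continuous_on_compose2[OF clamp_cont g(1)]) auto
  \<comment> \<open>Of modulus at least \<open>m\<close> wherever the cutoff is nonzero, that is for
    \<open>x < m + 1\<close>.\<close>
  define D where "D = (\<lambda>x::real. complex_of_real (m * exp (m + 1)) * exp (- (1 * complex_of_real x)))"
  have D: "D \<in> L2" unfolding D_def by (intro L2_cmult L2_exp) simp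
  have cD: "cmod (D x) = m * exp (m + 1 - x)" for x
  proof -
    have "cmod (exp (- (1 * complex_of_real x))) = exp (- x)" by simp
    then have "cmod (D x) = m * (exp (m + 1) * exp (- x))" unfolding D_def norm_mult norm_of_real using m by simp
    then show ?thesis unfolding exp_add[symmetric] by simp
  qed
  have GD: "cmod (G n x) \<le> cmod (D x)" for n x
  proof (cases "x \<ge> m + 1")
    case True
    then show ?thesis by (simp add: G_def cut)
  next
    case False
    have "cmod (G n x) = cut x * cmod (clamp (g n x))" using cut by (simp add: G_def norm_mult)
    also have "\<dots> \<le> 1 * m" using cut clamp_le m by (intro mult_mono) auto
    also have "\<dots> \<le> m * exp (m + 1 - x)" using m False by simp
    finally show ?thesis unfolding cD .
  qed
  have G2: "G n \<in> L2" for n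
    by (rule L2_mono(1)[OF _ D GD]) (intro borel_measurable_hl borel_measurable_continuous_onI Gc)
  have "AE x in lebesgue. x \<notin> N" using N by (intro AE_not_in) (simp add: negligible_iff_null_sets)
  then have "AE x in lborel. x \<notin> N" by (simp add: AE_completion_iff)
  then have AEN: "AE x in hl. x \<notin> N" by (simp add: AE_restrict_space_iff) (auto elim: eventually_mono)
  have "L2_lim G h"
  proof (rule L2_lim_dominated_AE[OF G2 h D _ GD])
    show "AE x in hl. (\<lambda>n. G n x) \<longlonglongrightarrow> h x"
      using AEN AE_space[of hl]
    proof eventually_elim
      case (elim x)
      then have "(\<lambda>n. g n x) \<longlonglongrightarrow> h x" using g(2)[of x] by simp
      then have "(\<lambda>n. clamp (g n x)) \<longlonglongrightarrow> clamp (h x)"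
        by (rule continuous_on_tendsto_compose[OF clamp_cont[of UNIV]]) auto
      then have "(\<lambda>n. G n x) \<longlonglongrightarrow> of_real (cut x) * h x"
        unfolding G_def clamp_id[OF m(2)] by (intro tendsto_intros)
      moreover have "of_real (cut x) * h x = h x" using cut(3)[of x] m(3)[of x] by (cases "x \<le> m") auto
      ultimately show ?case by simp
    qed
  qed
  show ?thesis
  proof (rule expsum_approximable_lim[OF G2 _ h \<open>L2_lim G h\<close>])
    show "expsum_approximable (G n)" for n
      by (rule expsum_approximable_continuous[OF Gc, of "m + 1"]) (use m in \<open>auto simp: G_def cut\<close>)
  qed
qed

text \<open>Truncation both in size and in position reduces to the bounded case.\<close>

lemma expsum_dense:
  assumes h: "h \<in> L2" and d: "\<delta> > 0"
  obtains J c where "nrm (\<lambda>x. h x - expsum.f J c x) < \<delta>"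
proof -
  define g where "g n x = (if cmod (h x) \<le> real (Suc n) \<and> x \<le> real (Suc n) then h x else 0)" for n x
  have [measurable]: "h \<in> borel_measurable hl" "(\<lambda>x. x) \<in> borel_measurable hl"
    using L2_meas[OF h] by (auto intro: borel_measurable_hl)
  have gm: "g n \<in> borel_measurable hl" for n unfolding g_def[abs_def] by measurable
  have gh: "cmod (g n x) \<le> cmod (h x)" for n x by (simp add: g_def)
  have g2: "g n \<in> L2" for n by (rule L2_mono(1)[OF gm h gh])
  have "L2_lim g h"
  proof (rule L2_lim_dominated[OF g2 h h _ gh])
    fix x
    obtain N where N: "max (cmod (h x)) x \<le> real N" using real_arch_simple by blast
    have "\<forall>\<^sub>F n in sequentially. g n x = h x"
      unfolding eventually_sequentially
    proof (intro exI allI impI)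
      fix n assume "N \<le> n"
      then have "real N \<le> real (Suc n)" by simp
      then have "cmod (h x) \<le> real (Suc n)" "x \<le> real (Suc n)" using N by linarith+
      then show "g n x = h x" unfolding g_def by simp
    qed
    then show "(\<lambda>n. g n x) \<longlonglongrightarrow> h x" by (rule tendsto_eventually)
  qed
  have "expsum_approximable h"
  proof (rule expsum_approximable_lim[OF g2 _ h \<open>L2_lim g h\<close>])
    show "expsum_approximable (g n)" for n
      by (rule expsum_approximable_bounded[OF g2, of "real (Suc n)"]) (auto simp: g_def)
  qed
  then show ?thesis using that d unfolding expsum_approximable_def by blast
qed

section \<open>The absolutely continuous subspace\<close>

lemma integrable_Borel_transform:
  fixes \<rho> :: "real \<Rightarrow> real"
  assumes \<rho>: "integrable lborel \<rho>" and z: "Im z > 0"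
  shows "integrable lborel (\<lambda>t. complex_of_real (\<rho> t) / (complex_of_real t - z))"
proof (rule Bochner_Integration.integrable_bound)
  have [measurable]: "\<rho> \<in> borel_measurable borel" using borel_measurable_integrable[OF \<rho>] by simp
  show "(\<lambda>t. complex_of_real (\<rho> t) / (complex_of_real t - z)) \<in> borel_measurable lborel" by measurable
  show "integrable lborel (\<lambda>t. \<rho> t / Im z)" using \<rho> by simp
  show "AE t in lborel. norm (complex_of_real (\<rho> t) / (complex_of_real t - z)) \<le> norm (\<rho> t / Im z)"
  proof (rule AE_I2)
    fix t
    have "Im z \<le> cmod (complex_of_real t - z)" using abs_Im_le_cmod[of "complex_of_real t - z"] z by simp
    then show "norm (complex_of_real (\<rho> t) / (complex_of_real t - z)) \<le> norm (\<rho> t / Im z)"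
      using z by (simp add: norm_divide frac_le)
  qed
qed

lemma Im_Borel_transform:
  fixes \<rho> :: "real \<Rightarrow> real"
  assumes \<rho>: "integrable lborel \<rho>" and e: "e > 0"
  shows "Im (\<integral>t. complex_of_real (\<rho> t) / (complex_of_real t - (of_real l + \<i> * of_real e)) \<partial>lborel)
    = (\<integral>t. \<rho> t * (e / ((l - t)\<^sup>2 + e\<^sup>2)) \<partial>lborel)"
proof -
  let ?z = "complex_of_real l + \<i> * of_real e"
  have i: "integrable lborel (\<lambda>t. complex_of_real (\<rho> t) / (complex_of_real t - ?z))"
    by (rule integrable_Borel_transform[OF \<rho>]) (simp add: e)
  have "Im (complex_of_real (\<rho> t) / (complex_of_real t - ?z)) = \<rho> t * (e / ((l - t)\<^sup>2 + e\<^sup>2))" for t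
  proof -
    have "complex_of_real (\<rho> t) / (complex_of_real t - ?z) = \<rho> t *\<^sub>R (1 / (complex_of_real t - ?z))"
      by (simp add: scaleR_conv_of_real)
    then show ?thesis by (simp only: scaleR_complex.sel Im_inverse_diff)
  qed
  then show ?thesis using integral_Im[OF i] by simp
qed

text \<open>Intervals with rational end points that miss the closed set \<open>E\<close> cover its
  complement, and on each of them all initial integrals vanish; \<open>E\<close> itself is null
  because it is countable.\<close>

lemma AE_zero_if_local_integrals_zero:
  fixes \<rho> :: "real \<Rightarrow> real"
  assumes \<rho>: "integrable lborel \<rho>" and E: "closed E" "countable E"
    and zero: "\<And>a b. a < b \<Longrightarrow> {a..b} \<inter> E = {} \<Longrightarrow> (LINT t:{a..b}|lborel. \<rho> t) = 0"
  shows "AE t in lborel. \<rho> t = 0"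
proof -
  have loc: "AE t in lborel. t \<in> {a..b} \<longrightarrow> \<rho> t = 0" if ab: "a < b" "{a..b} \<inter> E = {}" for a b
  proof -
    have "AE t in lborel. indicator {a..b} t *\<^sub>R \<rho> t = 0"
    proof (rule AE_zero_if_initial_integrals_zero)
      show "integrable lborel (\<lambda>t. indicator {a..b} t *\<^sub>R \<rho> t)"
        by (rule integrable_mult_indicator[OF _ \<rho>]) simp
      show "(\<integral>t. indicator {a..b} t *\<^sub>R \<rho> t \<partial>lborel) = 0"
        using zero[OF ab] by (simp add: set_lebesgue_integral_def)
      fix c
      have eq: "(LINT t:{..c}|lborel. indicator {a..b} t *\<^sub>R \<rho> t) = (LINT t:{a..min b c}|lborel. \<rho> t)"
        unfolding set_lebesgue_integral_def
        by (rule Bochner_Integration.integral_cong) (auto simp: indicator_def)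
      show "(LINT t:{..c}|lborel. indicator {a..b} t *\<^sub>R \<rho> t) = 0"
      proof (cases "a < c")
        case True
        then show ?thesis unfolding eq using ab by (intro zero) auto
      next
        case False
        have "{a..min b c} \<subseteq> {a}" using False by auto
        then have "AE t in lborel. t \<notin> {a..min b c}"
          by (intro AE_not_in finite_imp_null_set_lborel) (rule finite_subset, auto)
        then have "AE t in lborel. indicator {a..min b c} t *\<^sub>R \<rho> t = 0"
          by eventually_elim simp
        then have "(LINT t:{a..min b c}|lborel. \<rho> t) = 0"
          unfolding set_lebesgue_integral_def by (rule integral_eq_zero_AE)
        then show ?thesis unfolding eq .
      qed
    qed
    then show ?thesis by eventually_elim (auto simp: indicator_def)
  qed
  let ?Q = "{(a, b) \<in> \<rat> \<times> \<rat>. a < b \<and> {a..b} \<inter> E = {}} :: (real \<times> real) set"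
  have "countable ?Q"
    by (rule countable_subset[of _ "\<rat> \<times> \<rat>"]) (auto intro: countable_rat)
  then have "AE t in lborel. \<forall>p\<in>?Q. t \<in> {fst p..snd p} \<longrightarrow> \<rho> t = 0"
    by (subst AE_ball_countable) (use loc in auto)
  moreover have "AE t in lborel. t \<notin> E" by (intro AE_not_in countable_imp_null_set_lborel E)
  ultimately show ?thesis
  proof eventually_elim
    case (elim t)
    have "open (- E)" using E by auto
    then obtain r where r: "r > 0" "ball t r \<subseteq> - E" using elim(2) openE[of "- E" t] by auto
    obtain a where a: "a \<in> \<rat>" "t - r < a" "a < t" using Rats_dense_in_real[of "t - r" t] r by auto
    obtain b where b: "b \<in> \<rat>" "t < b" "b < t + r" using Rats_dense_in_real[of t "t + r"] r by auto
    have "{a..b} \<subseteq> ball t r"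
    proof
      fix s assume "s \<in> {a..b}"
      then have "t - r < s" "s < t + r" using a b by auto
      then show "s \<in> ball t r" by (simp add: dist_real_def abs_less_iff)
    qed
    then have "(a, b) \<in> ?Q" using a b r by auto
    from elim(1)[rule_format, OF this] show "\<rho> t = 0" using a b by simp
  qed
qed

context biharmonic
begin

text \<open>\<open>Omega\<close> has finitely many zeros, and the fourth powers of integers form a
  set of integers, hence a closed set.\<close>

lemma exceptional_closed: "closed exceptional" and exceptional_countable: "countable exceptional"
proof -
  let ?Z = "{l. \<exists>y. Omega \<alpha> \<alpha>1 \<alpha>2 y = 0 \<and> complex_of_real l = y ^ 4}"
  have "?Z \<subseteq> (\<lambda>y. Re (y ^ 4)) ` {z. Omega \<alpha> \<alpha>1 \<alpha>2 z = 0}"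
  proof
    fix l assume "l \<in> ?Z"
    then obtain y where y: "Omega \<alpha> \<alpha>1 \<alpha>2 y = 0" "complex_of_real l = y ^ 4" by blast
    have "l = Re (y ^ 4)" unfolding y(2)[symmetric] by simp
    then show "l \<in> (\<lambda>y. Re (y ^ 4)) ` {z. Omega \<alpha> \<alpha>1 \<alpha>2 z = 0}" using y(1) by blast
  qed
  then have Z: "finite ?Z" using Omega_zeros_finite by (meson finite_imageI finite_subset)
  have "range (\<lambda>j. real (Suc j) ^ 4) = of_nat ` range (\<lambda>j. Suc j ^ 4)" by (simp add: image_image)
  then have r: "closed (range (\<lambda>j. real (Suc j) ^ 4))" by (simp only: closed_of_nat_image)
  show "closed exceptional" unfolding exceptional_def
    by (intro closed_Un finite_imp_closed r Z) simp
  show "countable exceptional" unfolding exceptional_def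
    using Z by (auto intro: countable_finite)
qed

lemma nrm_GG: assumes g: "g \<in> L2" shows "nrm (GG g) = nrm g"
proof -
  have "complex_of_real ((nrm (GG g))\<^sup>2) = ip g (FF (GG g))"
    unfolding ip_self[symmetric] by (rule GG_FF_adjoint[OF GG[OF g] g])
  also have "\<dots> = ip g g"
    by (rule ip_cong[OF _ _ _ _ aeq_refl FF_GG[OF g]]) (intro L2_meas FF GG g)+
  also have "\<dots> = complex_of_real ((nrm g)\<^sup>2)" by (rule ip_self)
  finally have "(nrm (GG g))\<^sup>2 = (nrm g)\<^sup>2" unfolding of_real_eq_iff .
  then show ?thesis by simp
qed

lemma nrm_Pf: assumes f: "f \<in> L2" shows "nrm (Pf f) \<le> 2 * nrm f"
proof -
  have "nrm (Pf f) \<le> nrm f + nrm (GG (FF f))"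
    unfolding Pf_def[abs_def] by (intro nrm_triangle_diff f GG FF)
  then show ?thesis using nrm_GG[OF FF(1)[OF f]] FF(2)[OF f] by simp
qed

lemma ip_GG_FF: "f \<in> L2 \<Longrightarrow> k \<in> L2 \<Longrightarrow> ip (GG (FF f)) k = ip (FF f) (FF k)"
  by (intro GG_FF_adjoint FF)

text \<open>Linearity of \<open>GG FF\<close> is obtained weakly: its defect \<open>d\<close> is
  orthogonal to itself, since \<open>ip (GG (FF f)) k\<close> equals \<open>ip (FF f) (FF k)\<close>
  and \<open>FF\<close> is linear.\<close>

lemma Pf_add:
  assumes f: "f \<in> L2" and g: "g \<in> L2"
  shows "aeq (Pf (\<lambda>x. f x + c * g x)) (\<lambda>x. Pf f x + c * Pf g x)"
proof -
  have fg: "(\<lambda>x. f x + c * g x) \<in> L2" by (intro L2_add L2_cmult f g)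
  note L = fg f g FF(1)[OF fg] FF(1)[OF f] FF(1)[OF g] GG[OF FF(1)[OF fg]] GG[OF FF(1)[OF f]] GG[OF FF(1)[OF g]]
  have S: "(\<lambda>x. GG (FF f) x + c * GG (FF g) x) \<in> L2" by (intro L2_add L2_cmult L)
  define d where "d x = GG (FF (\<lambda>x. f x + c * g x)) x - (GG (FF f) x + c * GG (FF g) x)" for x
  have d: "d \<in> L2" unfolding d_def[abs_def] by (intro L2_diff S L)
  have "ip (FF (\<lambda>x. f x + c * g x)) (FF d) = ip (\<lambda>x. FF f x + c * FF g x) (FF d)"
    by (rule ip_cong[OF _ _ _ _ FF_linear[OF f g] aeq_refl]) (intro L2_meas L2_add L2_cmult L FF d)+
  also have "\<dots> = ip (FF f) (FF d) + c * ip (FF g) (FF d)"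
    by (simp add: ip_add_left ip_cmult_left L2_cmult L FF d)
  finally have "ip (GG (FF (\<lambda>x. f x + c * g x))) d = ip (GG (FF f)) d + c * ip (GG (FF g)) d"
    by (simp add: ip_GG_FF L d)
  also have "\<dots> = ip (\<lambda>x. GG (FF f) x + c * GG (FF g) x) d"
    by (simp add: ip_add_left ip_cmult_left L2_cmult L d)
  finally have "ip (\<lambda>x. GG (FF (\<lambda>x. f x + c * g x)) x - (GG (FF f) x + c * GG (FF g) x)) d = 0"
    by (simp add: ip_diff_left[OF L(7) S d])
  then have "ip d d = 0" by (simp add: d_def[abs_def])
  then have "nrm d = 0" unfolding ip_self by simp
  then have "aeq d (\<lambda>x. 0)" using nrm_eq_0_iff[OF d] by simp
  then show ?thesis unfolding aeq_iff d_def Pf_def by eventually_elim (simp add: algebra_simps)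
qed

lemma RR_density_decomposition:
  assumes z: "Im z \<noteq> 0" and f: "f \<in> L2"
  shows "ip (RR z f) f = ip (RR z (Pf f)) (Pf f)
    + (\<integral>t. complex_of_real (indicator {0<..} t * (cmod (FF f t))\<^sup>2) / (complex_of_real t - z) \<partial>lborel)"
  by (rule resolvent_decomposition[OF z f RR(1)[OF z f] _ RR(1)[OF z Pf_L2[OF f]]]) simp_all

abbreviation eps :: "nat \<Rightarrow> real" where "eps n \<equiv> inverse (real (Suc n))"

abbreviation zl :: "real \<Rightarrow> nat \<Rightarrow> complex" where "zl l n \<equiv> of_real l + \<i> * of_real (eps n)"

lemma eps: "eps n > 0" "eps \<longlonglongrightarrow> 0"
  by (simp, rule LIMSEQ_inverse_real_of_nat)

lemma Im_zl: "Im (zl l n) = eps n" "Im (zl l n) \<noteq> 0" "Im (zl l n) > 0"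
proof -
  have "Im (of_real l + \<i> * of_real e) = e" for e by simp
  then show 1: "Im (zl l n) = eps n" .
  show "Im (zl l n) \<noteq> 0" "Im (zl l n) > 0" unfolding 1 using eps(1)[of n] by simp_all
qed

lemma eps_nrm_RR: "f \<in> L2 \<Longrightarrow> eps n * (nrm (RR (zl l n) f))\<^sup>2 = Im (ip (RR (zl l n) f) f)"
  using RR(4)[OF Im_zl(2), of f l n] unfolding Im_zl(1) by simp

lemma set_integrable_RR:
  assumes f: "f \<in> L2" shows "set_integrable lborel {a..b} (\<lambda>l. eps n * (nrm (RR (zl l n) f))\<^sup>2)"
  unfolding set_integrable_def
  by (rule borel_integrable_compact[OF compact_Icc continuous_on_subset[OF RR_interval_bound(2)[OF f eps(1)]]]) simp

lemma Pf_density_limit: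
  assumes h: "h \<in> L2" and \<rho>: "integrable lborel \<rho>" and ab: "a < b"
    and B: "\<And>z. Im z > 0 \<Longrightarrow> ip (RR z (Pf h)) (Pf h) = (\<integral>t. complex_of_real (\<rho> t) / (complex_of_real t - z) \<partial>lborel)"
  shows "(\<lambda>n. LINT l:{a..b}|lborel. eps n * (nrm (RR (zl l n) (Pf h)))\<^sup>2) \<longlonglongrightarrow> pi * (LINT t:{a..b}|lborel. \<rho> t)"
  unfolding eps_nrm_RR[OF Pf_L2[OF h]] B[OF Im_zl(3)] Im_Borel_transform[OF \<rho> eps(1)]
  by (rule Stieltjes_inversion[OF \<rho> ab eps])

text \<open>The full resolvent form and the part coming from the transform have the same limit,
  \<open>pi\<close> times the integral of \<open>|FF f|^2\<close>: the former by the explicit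
  resolvent, the latter by Stieltjes inversion. Their difference is the form of
  \<open>Pf f\<close>.\<close>

lemma Pf_expsum_limit:
  assumes ab: "a < b" "{a..b} \<inter> exceptional = {}"
  shows "(\<lambda>n. LINT l:{a..b}|lborel. eps n * (nrm (RR (zl l n) (Pf (expsum.f J c))))\<^sup>2) \<longlonglongrightarrow> 0"
proof -
  interpret E: expsum \<alpha> \<alpha>1 \<alpha>2 J c .
  let ?f = "expsum.f J c"
  have f: "?f \<in> L2" by (rule expsum.f_L2)
  let ?D = "\<lambda>t. indicator {0<..} t * (cmod (FF ?f t))\<^sup>2"
  have D: "integrable lborel ?D" by (rule density_integrable[OF FF(1)[OF f]])
  let ?P = "\<lambda>n l. \<integral>t. ?D t * (eps n / ((l - t)\<^sup>2 + (eps n)\<^sup>2)) \<partial>lborel"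
  have s: "?P n l = eps n * (nrm (RR (zl l n) ?f))\<^sup>2 - eps n * (nrm (RR (zl l n) (Pf ?f)))\<^sup>2" for n l
    unfolding eps_nrm_RR[OF f] eps_nrm_RR[OF Pf_L2[OF f]] Im_Borel_transform[OF D eps(1), symmetric]
      RR_density_decomposition[OF Im_zl(2) f] by simp
  have i: "(LINT l:{a..b}|lborel. ?P n l) = (LINT l:{a..b}|lborel. Im (ip (RR (zl l n) ?f) ?f))
    - (LINT l:{a..b}|lborel. eps n * (nrm (RR (zl l n) (Pf ?f)))\<^sup>2)" for n
    unfolding s eps_nrm_RR[OF f, symmetric]
    by (rule set_integral_diff(2)[OF set_integrable_RR[OF f] set_integrable_RR[OF Pf_L2[OF f]]])
  have "(\<lambda>n. (LINT l:{a..b}|lborel. Im (ip (RR (zl l n) ?f) ?f)) - (LINT l:{a..b}|lborel. ?P n l))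
     \<longlonglongrightarrow> pi * (LINT t:{a..b}|lborel. ?D t) - pi * (LINT t:{a..b}|lborel. ?D t)"
    by (intro tendsto_diff E.expsum_boundary_limit[OF ab] Stieltjes_inversion[OF D ab(1) eps])
  then show ?thesis unfolding i by simp
qed

text \<open>The factors 2 are harmless: one summand will have limit 0 and the other will be
  arbitrarily small.\<close>

lemma RR_Pf_triangle:
  assumes f: "f \<in> L2" and g: "g \<in> L2" and z: "Im z \<noteq> 0"
  shows "(nrm (RR z (Pf (\<lambda>x. f x + g x))))\<^sup>2 \<le> 2 * (nrm (RR z (Pf f)))\<^sup>2 + 2 * (nrm (RR z (Pf g)))\<^sup>2"
proof -
  note L = RR(2)[OF z Pf_L2[OF f]] RR(2)[OF z Pf_L2[OF g]]
  have fg: "(\<lambda>x. f x + g x) \<in> L2" by (intro L2_add f g)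
  have "aeq (RR z (Pf (\<lambda>x. f x + g x))) (\<lambda>x. RR z (Pf f) x + 1 * RR z (Pf g) x)"
  proof (rule RR_unique[OF z Pf_L2[OF fg] H_add[OF RR(1)[OF z Pf_L2[OF f]] RR(1)[OF z Pf_L2[OF g]]]])
    show "aeq (\<lambda>x. (z * RR z (Pf f) x + Pf f x) + 1 * (z * RR z (Pf g) x + Pf g x) - z * (RR z (Pf f) x + 1 * RR z (Pf g) x))
      (Pf (\<lambda>x. f x + g x))"
      using Pf_add[OF f g, of 1] unfolding aeq_iff by (auto elim!: eventually_mono simp: algebra_simps)
  qed
  then have ae: "aeq (RR z (Pf (\<lambda>x. f x + g x))) (\<lambda>x. RR z (Pf f) x + RR z (Pf g) x)" by simp
  have "nrm (RR z (Pf (\<lambda>x. f x + g x))) = nrm (\<lambda>x. RR z (Pf f) x + RR z (Pf g) x)"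
    by (rule nrm_cong[OF _ _ ae]) (intro L2_meas L2_add L RR z Pf_L2 fg)+
  also have "\<dots> \<le> nrm (RR z (Pf f)) + nrm (RR z (Pf g))" by (rule nrm_triangle[OF L])
  finally have "(nrm (RR z (Pf (\<lambda>x. f x + g x))))\<^sup>2 \<le> (nrm (RR z (Pf f)) + nrm (RR z (Pf g)))\<^sup>2"
    by (intro power_mono) simp_all
  also have "\<dots> \<le> 2 * (nrm (RR z (Pf f)))\<^sup>2 + 2 * (nrm (RR z (Pf g)))\<^sup>2"
    using sum_squares_bound[of "nrm (RR z (Pf f))" "nrm (RR z (Pf g))"] by (simp add: power2_sum)
  finally show ?thesis .
qed

lemma H_aeq_zero: assumes H: "H u w" and u: "aeq u (\<lambda>x. 0)" shows "aeq w (\<lambda>x. 0)"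
proof -
  obtain v where v: "aeq (v 0) u" "aeq (v 4) w" "chain v" using H_E[OF H] by metis
  note c = chainD[OF v(3)]
  have "aeq (v 4) (\<lambda>x. 0)"
    by (rule acp_aeq_zero[OF c(4) acp_aeq_zero[OF c(3) acp_aeq_zero[OF c(2) acp_aeq_zero[OF c(1) aeq_trans[OF v(1) u]]]]])
  then show ?thesis by (rule aeq_trans[OF aeq_sym[OF v(2)]])
qed

text \<open>Away from exceptional points the integrals of the density \<open>\<rho>0\<close> of
  \<open>Pf h\<close> are limits of squared resolvent norms, which approximation by exponential sums
  makes arbitrarily small. So \<open>\<rho>0\<close> is null, its Borel transform vanishes, and with
  it the resolvent of \<open>Pf h\<close>.\<close>

lemma Pf_Hac_zero: assumes hac: "h \<in> Hac \<alpha> \<alpha>1 \<alpha>2" shows "aeq (Pf h) (\<lambda>x. 0)"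
proof -
  obtain \<rho> :: "real \<Rightarrow> real" where h: "h \<in> L2" and \<rho>: "integrable lborel \<rho>"
    and B: "\<And>z u w. Im z \<noteq> 0 \<Longrightarrow> H u w \<Longrightarrow> aeq (\<lambda>x. w x - z * u x) h \<Longrightarrow>
          ip u h = (LINT t|lborel. complex_of_real (\<rho> t) / (complex_of_real t - z))"
    using hac unfolding Hac_def by blast
  let ?D = "\<lambda>t. indicator {0<..} t * (cmod (FF h t))\<^sup>2"
  have D: "integrable lborel ?D" by (rule density_integrable[OF FF(1)[OF h]])
  \<comment> \<open>The sign of this difference is not known in advance; nonnegativity of its local
    integrals is read off from the resolvent norms.\<close>
  define \<rho>0 where "\<rho>0 t = \<rho> t - ?D t" for t
  have \<rho>0: "integrable lborel \<rho>0" unfolding \<rho>0_def[abs_def] by (rule Bochner_Integration.integrable_diff[OF \<rho> D])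
  have B0: "ip (RR z (Pf h)) (Pf h) = (\<integral>t. complex_of_real (\<rho>0 t) / (complex_of_real t - z) \<partial>lborel)" if z: "Im z > 0" for z
  proof -
    have zn: "Im z \<noteq> 0" using z by simp
    have "ip (RR z h) h = (\<integral>t. complex_of_real (\<rho> t) / (complex_of_real t - z) \<partial>lborel)"
      by (rule B[OF zn RR(1)[OF zn h]]) simp
    then have "ip (RR z (Pf h)) (Pf h) = (\<integral>t. complex_of_real (\<rho> t) / (complex_of_real t - z) \<partial>lborel)
      - (\<integral>t. complex_of_real (?D t) / (complex_of_real t - z) \<partial>lborel)"
      unfolding RR_density_decomposition[OF zn h] by (simp add: algebra_simps)
    also have "\<dots> = (\<integral>t. complex_of_real (\<rho> t) / (complex_of_real t - z) - complex_of_real (?D t) / (complex_of_real t - z) \<partial>lborel)"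
      by (rule Bochner_Integration.integral_diff[OF integrable_Borel_transform[OF \<rho> z] integrable_Borel_transform[OF D z], symmetric])
    also have "\<dots> = (\<integral>t. complex_of_real (\<rho>0 t) / (complex_of_real t - z) \<partial>lborel)"
      unfolding \<rho>0_def of_real_diff diff_divide_distrib ..
    finally show ?thesis .
  qed
  have local_zero: "(LINT t:{a..b}|lborel. \<rho>0 t) = 0" if ab: "a < b" "{a..b} \<inter> exceptional = {}" for a b
  proof -
    have lim: "(\<lambda>n. LINT l:{a..b}|lborel. eps n * (nrm (RR (zl l n) (Pf h)))\<^sup>2) \<longlonglongrightarrow> pi * (LINT t:{a..b}|lborel. \<rho>0 t)"
      by (rule Pf_density_limit[OF h \<rho>0 ab(1)]) (rule B0)
    have "0 \<le> pi * (LINT t:{a..b}|lborel. \<rho>0 t)"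
    proof (rule LIMSEQ_le_const[OF lim], intro exI allI impI)
      show "0 \<le> (LINT l:{a..b}|lborel. eps n * (nrm (RR (zl l n) (Pf h)))\<^sup>2)" for n
        unfolding set_lebesgue_integral_def by (intro integral_nonneg_AE AE_I2) simp
    qed
    moreover have "pi * (LINT t:{a..b}|lborel. \<rho>0 t) \<le> 0"
    proof (rule field_le_epsilon)
      fix \<epsilon> :: real assume e: "\<epsilon> > 0"
      \<comment> \<open>Solves \<open>32 pi \<delta>^2 = \<epsilon>\<close>: a factor 2 comes from
        the triangle inequality, \<open>4 pi\<close> from the interval bound and
        \<open>(2 \<delta>)^2\<close> from \<open>nrm_Pf\<close>.\<close>
      define \<delta> where "\<delta> = sqrt (\<epsilon> / (32 * pi))"
      have d: "\<delta> > 0" "\<delta>\<^sup>2 = \<epsilon> / (32 * pi)" using e by (simp_all add: \<delta>_def)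
      obtain J c where Jc: "nrm (\<lambda>x. h x - expsum.f J c x) < \<delta>" by (rule expsum_dense[OF h d(1)])
      let ?f = "expsum.f J c"
      define g where "g x = h x - ?f x" for x
      have f: "?f \<in> L2" by (rule expsum.f_L2)
      have g: "g \<in> L2" unfolding g_def[abs_def] by (intro L2_diff h f)
      have hfg: "h = (\<lambda>x. ?f x + g x)" by (simp add: g_def)
      have "nrm (Pf g) \<le> 2 * \<delta>" using nrm_Pf[OF g] Jc by (simp add: g_def[abs_def])
      then have "(nrm (Pf g))\<^sup>2 \<le> (2 * \<delta>)\<^sup>2" by (intro power_mono) simp_all
      also have "\<dots> = \<epsilon> / (8 * pi)" using d(2) by (simp add: power_mult_distrib)
      finally have "8 * pi * (nrm (Pf g))\<^sup>2 \<le> 8 * pi * (\<epsilon> / (8 * pi))" by (intro mult_left_mono) simp_all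
      then have gb: "8 * pi * (nrm (Pf g))\<^sup>2 \<le> \<epsilon>" by simp
      let ?I = "\<lambda>k n. LINT l:{a..b}|lborel. eps n * (nrm (RR (zl l n) (Pf k)))\<^sup>2"
      have le: "?I h n \<le> 2 * ?I ?f n + \<epsilon>" for n
      proof -
        note S = set_integrable_RR[OF Pf_L2]
        have "?I h n \<le> (LINT l:{a..b}|lborel. 2 * (eps n * (nrm (RR (zl l n) (Pf ?f)))\<^sup>2) + 2 * (eps n * (nrm (RR (zl l n) (Pf g)))\<^sup>2))"
        proof (rule set_integral_mono)
          show "set_integrable lborel {a..b} (\<lambda>l. eps n * (nrm (RR (zl l n) (Pf h)))\<^sup>2)" by (rule S[OF h])
          show "set_integrable lborel {a..b} (\<lambda>l. 2 * (eps n * (nrm (RR (zl l n) (Pf ?f)))\<^sup>2) + 2 * (eps n * (nrm (RR (zl l n) (Pf g)))\<^sup>2))"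
            by (intro set_integral_add(1) set_integrable_mult_right S f g)
          fix l
          have "eps n * (nrm (RR (zl l n) (Pf h)))\<^sup>2 \<le> eps n * (2 * (nrm (RR (zl l n) (Pf ?f)))\<^sup>2 + 2 * (nrm (RR (zl l n) (Pf g)))\<^sup>2)"
            unfolding hfg by (intro mult_left_mono RR_Pf_triangle[OF f g Im_zl(2)] less_imp_le[OF eps(1)])
          then show "eps n * (nrm (RR (zl l n) (Pf h)))\<^sup>2 \<le> 2 * (eps n * (nrm (RR (zl l n) (Pf ?f)))\<^sup>2) + 2 * (eps n * (nrm (RR (zl l n) (Pf g)))\<^sup>2)"
            by (simp only: distrib_left mult.left_commute)
        qed
        also have "\<dots> = 2 * ?I ?f n + 2 * ?I g n"
          by (subst set_integral_add(2)) (intro set_integrable_mult_right S f g, intro set_integrable_mult_right S f g, simp only: set_integral_mult_right)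
        finally show ?thesis using RR_interval_bound(1)[OF Pf_L2[OF g] eps(1), of a b n] gb by linarith
      qed
      have "pi * (LINT t:{a..b}|lborel. \<rho>0 t) \<le> 2 * 0 + \<epsilon>"
        by (rule LIMSEQ_le[OF lim tendsto_add[OF tendsto_mult[OF tendsto_const Pf_expsum_limit[OF ab]] tendsto_const]])
          (intro exI allI impI, rule le)
      then show "pi * (LINT t:{a..b}|lborel. \<rho>0 t) \<le> 0 + \<epsilon>" by simp
    qed
    ultimately have "pi * (LINT t:{a..b}|lborel. \<rho>0 t) = 0" by (rule antisym[rotated])
    then show ?thesis by simp
  qed
  have "AE t in lborel. \<rho>0 t = 0"
    by (rule AE_zero_if_local_integrals_zero[OF \<rho>0 exceptional_closed exceptional_countable local_zero])
  \<comment> \<open>One non-real point is enough: a null resolvent at \<open>i\<close> forces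
    \<open>Pf h\<close> to be null, since \<open>H u\<close> is null whenever \<open>u\<close>
    is.\<close>
  then have "AE t in lborel. complex_of_real (\<rho>0 t) / (complex_of_real t - \<i>) = 0" by eventually_elim simp
  then have "(\<integral>t. complex_of_real (\<rho>0 t) / (complex_of_real t - \<i>) \<partial>lborel) = 0" by (rule integral_eq_zero_AE)
  then have "ip (RR \<i> (Pf h)) (Pf h) = 0" using B0[of \<i>] by simp
  then have "nrm (RR \<i> (Pf h)) = 0" using RR(4)[of \<i>, OF _ Pf_L2[OF h]] by simp
  then have u: "aeq (RR \<i> (Pf h)) (\<lambda>x. 0)" using nrm_eq_0_iff[OF RR(2)[of \<i>, OF _ Pf_L2[OF h]]] by simp
  from H_aeq_zero[OF RR(1)[of \<i>, OF _ Pf_L2[OF h]] u]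
  have "aeq (\<lambda>x. \<i> * RR \<i> (Pf h) x + Pf h x) (\<lambda>x. 0)" by simp
  then show ?thesis using u unfolding aeq_iff by eventually_elim simp
qed

text \<open>\<open>GG FF\<close> is symmetric, so the inner product moves over to
  \<open>ip f (Pf h)\<close>, and \<open>Pf h\<close> is null.\<close>

lemma Pf_orthogonal_Hac:
  assumes f: "f \<in> L2" and h: "h \<in> Hac \<alpha> \<alpha>1 \<alpha>2"
  shows "ip (\<lambda>x. f x - GG (FF f) x) h = 0"
proof -
  have h2: "h \<in> L2" using h by (simp add: Hac_def)
  note L = FF(1)[OF f] FF(1)[OF h2] GG[OF FF(1)[OF f]] GG[OF FF(1)[OF h2]]
  have "ip (\<lambda>x. f x - GG (FF f) x) h = ip f h - ip (GG (FF f)) h" by (rule ip_diff_left[OF f L(3) h2])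
  also have "ip (GG (FF f)) h = ip f (GG (FF h))"
    by (simp only: ip_GG_FF[OF f h2] FF_GG_adjoint[OF f L(2)])
  also have "ip f h - ip f (GG (FF h)) = ip f (Pf h)"
    unfolding Pf_def[abs_def] by (rule ip_diff_right[symmetric]) (intro f h2 L)+
  also have "\<dots> = ip f (\<lambda>x. 0)"
    by (rule ip_cong[OF _ _ _ _ aeq_refl Pf_Hac_zero[OF h]]) (intro L2_meas f Pf_L2 h2 | simp)+
  also have "\<dots> = 0" by (simp add: ip_hl)
  finally show ?thesis .
qed

text \<open>At zeros of \<open>Om\<close> the value 1 replaces the quotient, which would be 0 there;
  this keeps \<open>ph\<close> unimodular everywhere and multiplication by it unitary.\<close>

definition ph :: "real \<Rightarrow> complex" where
  "ph x = (if Om (kk x) = 0 then 1 else sfun \<alpha> \<alpha>1 \<alpha>2 x)"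

lemma ph: "cmod (ph x) = 1" "ph x * cnj (ph x) = 1" "cnj (ph x) * ph x = 1" "ph \<in> borel_measurable hl"
proof -
  show n: "cmod (ph x) = 1" by (simp add: ph_def sfun_def Om_def norm_divide)
  show "ph x * cnj (ph x) = 1" using complex_norm_square[of "ph x"] n by simp
  then show "cnj (ph x) * ph x = 1" by (simp only: mult.commute)
  have [measurable]: "(\<lambda>x. Om (kk x)) \<in> borel_measurable borel"
    unfolding Om_def Omega_def kk_def by measurable
  have "(\<lambda>x. if Om (kk x) = 0 then 1 else cnj (Om (kk x)) / Om (kk x)) \<in> borel_measurable borel" by measurable
  then have "ph \<in> borel_measurable borel" unfolding ph_def[abs_def] sfun_def Om_def[symmetric] .
  then show "ph \<in> borel_measurable hl" by (rule borel_measurable_hl)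
qed

lemma ph_L2: assumes "f \<in> L2" shows "(\<lambda>x. ph x * f x) \<in> L2" "(\<lambda>x. cnj (ph x) * f x) \<in> L2" "nrm (\<lambda>x. ph x * f x) = nrm f"
  by (rule L2_mult_bounded[OF assms ph(4), where B=1], simp add: ph)
    (rule L2_mult_bounded[OF assms borel_measurable_cnj[OF ph(4)], where B=1], simp add: ph,
     simp add: nrm_hl norm_mult ph)

lemma Fformula_True: assumes f: "f \<in> L1 \<inter> L2" shows "aeq (\<lambda>x. ph x * FF f x) (Fformula True \<alpha> \<alpha>1 \<alpha>2 f)"
proof -
  have "Fformula True \<alpha> \<alpha>1 \<alpha>2 f x = sfun \<alpha> \<alpha>1 \<alpha>2 x * Fformula False \<alpha> \<alpha>1 \<alpha>2 f x" for x
    unfolding Fformula_def psi_pm_def integral_hl by (simp add: mult.assoc mult.left_commute)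
  then show ?thesis using FF_formula[OF f] AE_Om_kk unfolding aeq_iff
    by (auto elim!: eventually_elim2 simp: ph_def)
qed

end

theorem theorem5p12:
  fixes \<alpha> :: complex and \<alpha>1 \<alpha>2 :: real and pl :: bool
  shows "\<exists>(F :: (real \<Rightarrow> complex) \<Rightarrow> (real \<Rightarrow> complex)) (G :: (real \<Rightarrow> complex) \<Rightarrow> (real \<Rightarrow> complex)).
     \<comment> \<open>F is a bounded linear operator on L2(R+) extending the formula on L1 \<inter> L2\<close>
     (\<forall>f\<in>L1 \<inter> L2. aeq (F f) (Fformula pl \<alpha> \<alpha>1 \<alpha>2 f)) \<and>
     (\<forall>f\<in>L2. \<forall>g\<in>L2. \<forall>c::complex. aeq (F (\<lambda>x. f x + c * g x)) (\<lambda>lam. F f lam + c * F g lam)) \<and>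
     (\<exists>C. \<forall>f\<in>L2. F f \<in> L2 \<and> nrm (F f) \<le> C * nrm f) \<and>
     \<comment> \<open>G is the adjoint F*\<close>
     (\<forall>g\<in>L2. G g \<in> L2) \<and>
     (\<forall>f\<in>L2. \<forall>g\<in>L2. ip (F f) g = ip f (G g)) \<and>
     \<comment> \<open>F F* = I\<close>
     (\<forall>g\<in>L2. aeq (F (G g)) g) \<and>
     \<comment> \<open>F* F = P^(c), the orthogonal projection onto the absolutely continuous subspace\<close>
     (\<forall>f\<in>L2. G (F f) \<in> Hac \<alpha> \<alpha>1 \<alpha>2 \<and>
              (\<forall>h\<in>Hac \<alpha> \<alpha>1 \<alpha>2. ip (\<lambda>x. f x - G (F f) x) h = 0)) \<and>
     \<comment> \<open>F H = A F\<close>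
     (\<forall>u w. Hgraph \<alpha> \<alpha>1 \<alpha>2 u w \<longrightarrow> aeq (F w) (\<lambda>lam. complex_of_real lam * F u lam))"
proof -
  interpret biharmonic \<alpha> \<alpha>1 \<alpha>2 .
  show ?thesis
  proof (cases pl)
    case False
    show ?thesis
      using False FF FF_linear FF_formula GG FF_GG_adjoint FF_GG GG_FF_in_Hac Pf_orthogonal_Hac FF_H
      by (intro exI[of _ FF] exI[of _ GG] conjI exI[of _ 1] ballI allI impI) auto
  next
    case True
    \<comment> \<open>The eigenfunction for the plus sign carries the factor \<open>cnj s\<close>,
      and the conjugate under the integral turns it into \<open>s\<close>. The plus transform is
      thus the minus one times a unimodular function, and the adjoint absorbs its conjugate, so that
      the product \<open>G F\<close> is unchanged.\<close>
    define F where "F f x = ph x * FF f x" for f x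
    define G where "G g = GG (\<lambda>x. cnj (ph x) * g x)" for g
    have GF: "G (F f) = GG (FF f)" for f
      unfolding G_def F_def mult.assoc[symmetric] ph mult_1_left ..
    have "aeq (F f) (Fformula pl \<alpha> \<alpha>1 \<alpha>2 f)" if "f \<in> L1 \<inter> L2" for f
      using Fformula_True[OF that] True unfolding F_def[abs_def] by simp
    moreover have "aeq (F (\<lambda>x. f x + c * g x)) (\<lambda>x. F f x + c * F g x)" if "f \<in> L2" "g \<in> L2" for f g c
      using FF_linear[OF that, of c] unfolding aeq_iff F_def by eventually_elim (simp add: algebra_simps)
    moreover have "F f \<in> L2" "nrm (F f) \<le> 1 * nrm f" if "f \<in> L2" for f
      using FF[OF that] ph_L2[OF FF(1)[OF that]] unfolding F_def[abs_def] by simp_all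
    moreover have "G g \<in> L2" if "g \<in> L2" for g
      unfolding G_def by (intro GG ph_L2 that)
    moreover have "ip (F f) g = ip f (G g)" if "f \<in> L2" "g \<in> L2" for f g
    proof -
      have "ip (F f) g = ip (FF f) (\<lambda>x. cnj (ph x) * g x)" unfolding ip_hl F_def by (simp add: mult_ac)
      then show ?thesis unfolding G_def FF_GG_adjoint[OF that(1) ph_L2(2)[OF that(2)]] .
    qed
    moreover have "aeq (F (G g)) g" if "g \<in> L2" for g
      using FF_GG[OF ph_L2(2)[OF that]] unfolding aeq_iff F_def G_def
      by eventually_elim (simp only: mult.assoc[symmetric] ph mult_1_left)
    moreover have "aeq (F w) (\<lambda>x. of_real x * F u x)" if "H u w" for u w
      using FF_H[OF that] unfolding aeq_iff F_def by eventually_elim simp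
    ultimately show ?thesis
      using GG_FF_in_Hac Pf_orthogonal_Hac
      by (intro exI[of _ F] exI[of _ G] conjI exI[of _ 1] ballI allI impI) (auto simp: GF)
  qed
qed

end
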